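(* Let $m \le n$ be positive integers. (i) If $m+n \equiv 1 \pmod 3$ and $n \le 2m-5$, then $\tilde H_{\nu_{m,n}}(M_{m,n}) \cong \mathbb{Z}_3$. (ii) If $m+n \equiv 0 \pmod 3$ and $n \le 2m-9$, then $\tilde H_{\nu_{m,n}}(M_{m,n})$ is a nontrivial $3$-group of exponent at most $9$. (iii) If $m+n \equiv 2 \pmod 3$ and $n \le 2m-13$, then $\tilde H_{\nu_{m,n}}(M_{m,n})$ is a nontrivial $3$-group of exponent at most $9$.
   Context: For positive integers $m,n$, let $[m]=\{1,\dots,m\}$ and $[n]'=\{1',\dots,n'\}$. The chessboard complex $M_{m,n}$ is the abstract simplicial complex whose vertices are the edges $ij'$ ($i\in[m]$, $j\in[n]$) of the complete bipartite graph with parts $[m]$ and $[n]'$, and whose faces are the sets of pairwise disjoint edges (matchings). $\nu_{m,n} = \min\{m,n,\lfloor \frac{m+n+1}{3}\rfloor\}-1$. $\tilde H_*$ denotes reduced simplicial homology with integer coefficients, and $\mathbb{Z}_3=\mathbb{Z}/3\mathbb{Z}$. *)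

theory Defs
  imports "HOL-Algebra.Algebra"
begin

section \<open>Reduced simplicial homology with integer coefficients\<close>

text \<open>
  A simplicial complex \<open>K\<close> is given by its set of faces, the empty face included. A strict linear
  order \<open>r\<close> on the vertices orients the simplices. Degrees are integers: the empty face spans the
  chains of degree \<open>-1\<close>, which makes the homology reduced.
\<close>

definition abstract_simplicial_complex :: "'a set set \<Rightarrow> bool" where
  "abstract_simplicial_complex K \<longleftrightarrow>
     {} \<in> K \<and> (\<forall>\<sigma>\<in>K. finite \<sigma> \<and> (\<forall>\<tau>. \<tau> \<subseteq> \<sigma> \<longrightarrow> \<tau> \<in> K))"

definition faces :: "'a set set \<Rightarrow> int \<Rightarrow> 'a set set" where
  "faces K k = {\<sigma> \<in> K. finite \<sigma> \<and> int (card \<sigma>) = k + 1}"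

definition simplicial_chain_group :: "'a set set \<Rightarrow> int \<Rightarrow> ('a set \<Rightarrow>\<^sub>0 int) monoid" where
  "simplicial_chain_group K k = free_Abelian_group (faces K k)"

text \<open>
  For \<open>\<sigma> = {v\<^sub>0, \<dots>, v\<^sub>k}\<close> listed increasingly, the number of vertices below \<open>v\<^sub>i\<close> is \<open>i\<close>, so the
  face opposite to \<open>v\<^sub>i\<close> gets the sign \<open>(-1) ^ i\<close>.
\<close>

definition simplicial_boundary :: "('a \<times> 'a) set \<Rightarrow> ('a set \<Rightarrow>\<^sub>0 int) \<Rightarrow> ('a set \<Rightarrow>\<^sub>0 int)" where
  "simplicial_boundary r =
     frag_extend (\<lambda>\<sigma>. \<Sum>v\<in>\<sigma>. frag_cmul ((-1) ^ card {u \<in> \<sigma>. (u, v) \<in> r}) (frag_of (\<sigma> - {v})))"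

definition simplicial_cycles :: "('a \<times> 'a) set \<Rightarrow> 'a set set \<Rightarrow> int \<Rightarrow> ('a set \<Rightarrow>\<^sub>0 int) set" where
  "simplicial_cycles r K k =
     kernel (simplicial_chain_group K k) (simplicial_chain_group K (k - 1)) (simplicial_boundary r)"

definition simplicial_boundaries :: "('a \<times> 'a) set \<Rightarrow> 'a set set \<Rightarrow> int \<Rightarrow> ('a set \<Rightarrow>\<^sub>0 int) set" where
  "simplicial_boundaries r K k =
     simplicial_boundary r ` carrier (simplicial_chain_group K (k + 1))"

definition reduced_simplicial_homology ::
    "('a \<times> 'a) set \<Rightarrow> 'a set set \<Rightarrow> int \<Rightarrow> ('a set \<Rightarrow>\<^sub>0 int) set monoid" where
  "reduced_simplicial_homology r K k =
     subgroup_generated (simplicial_chain_group K k) (simplicial_cycles r K k)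
       Mod simplicial_boundaries r K k"


section \<open>Chessboard complexes\<close>

text \<open>The pair \<open>(i, j)\<close> stands for the edge \<open>ij'\<close> of the complete bipartite graph.\<close>

definition disjoint_edges :: "nat \<times> nat \<Rightarrow> nat \<times> nat \<Rightarrow> bool" where
  "disjoint_edges e f \<longleftrightarrow> fst e \<noteq> fst f \<and> snd e \<noteq> snd f"

definition chessboard_complex :: "nat \<Rightarrow> nat \<Rightarrow> (nat \<times> nat) set set" where
  "chessboard_complex m n = {\<sigma>. \<sigma> \<subseteq> {1..m} \<times> {1..n} \<and> pairwise disjoint_edges \<sigma>}"

definition chessboard_homology ::
    "nat \<Rightarrow> nat \<Rightarrow> int \<Rightarrow> ((nat \<times> nat) set \<Rightarrow>\<^sub>0 int) set monoid" where
  "chessboard_homology m n k =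
     reduced_simplicial_homology (less_than <*lex*> less_than) (chessboard_complex m n) k"

definition nu :: "nat \<Rightarrow> nat \<Rightarrow> int" where
  "nu m n = min (int m) (min (int n) ((int m + int n + 1) div 3)) - 1"


section \<open>Primary groups and exponents\<close>

text \<open>Elements of infinite order have \<open>group.ord\<close> equal to \<open>0\<close>, hence are excluded.\<close>

definition p_group :: "nat \<Rightarrow> ('a, 'b) monoid_scheme \<Rightarrow> bool" where
  "p_group p G \<longleftrightarrow> group G \<and> (\<forall>x\<in>carrier G. \<exists>k. group.ord G x = p ^ k)"

definition has_exponent :: "('a, 'b) monoid_scheme \<Rightarrow> nat \<Rightarrow> bool" where
  "has_exponent G e \<longleftrightarrow>
     0 < e \<and> (\<forall>x\<in>carrier G. x [^]\<^bsub>G\<^esub> e = \<one>\<^bsub>G\<^esub>) \<and>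
     (\<forall>d. 0 < d \<and> (\<forall>x\<in>carrier G. x [^]\<^bsub>G\<^esub> d = \<one>\<^bsub>G\<^esub>) \<longrightarrow> e \<le> d)"


section \<open>Homology groups are well defined\<close>

lemma chessboard_complex: "abstract_simplicial_complex (chessboard_complex m n)"
  unfolding abstract_simplicial_complex_def chessboard_complex_def
  by (auto intro: finite_subset pairwise_subset)

lemma simplicial_boundary_add:
  "simplicial_boundary r (a + b) = simplicial_boundary r a + simplicial_boundary r b"
  by (simp add: simplicial_boundary_def frag_extend_add)

lemma simplicial_boundary_of:
  "simplicial_boundary r (frag_of \<sigma>) =
     (\<Sum>v\<in>\<sigma>. frag_cmul ((-1) ^ card {u \<in> \<sigma>. (u, v) \<in> r}) (frag_of (\<sigma> - {v})))"
  by (simp add: simplicial_boundary_def)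

lemma simplicial_boundary_hom:
  assumes "abstract_simplicial_complex K"
  shows "simplicial_boundary r \<in> hom (simplicial_chain_group K k) (simplicial_chain_group K (k - 1))"
proof -
  have "Poly_Mapping.keys (simplicial_boundary r c) \<subseteq> faces K (k - 1)"
    if "Poly_Mapping.keys c \<subseteq> faces K k" for c
    using that
  proof (induction c rule: frag_induction)
    case (one \<sigma>)
    then have \<sigma>: "\<sigma> \<in> K" "finite \<sigma>" "int (card \<sigma>) = k + 1"
      by (auto simp: faces_def)
    have "\<sigma> - {v} \<in> faces K (k - 1)" if "v \<in> \<sigma>" for v
    proof -
      have "card \<sigma> = Suc (card (\<sigma> - {v}))"
        using card.remove[OF \<sigma>(2) that] by simp
      then show ?thesis
        using \<sigma> assms by (auto simp: faces_def abstract_simplicial_complex_def)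
    qed
    then show ?case
      unfolding simplicial_boundary_of
      by (intro order_trans[OF keys_sum] UN_least order_trans[OF keys_cmul]) auto
  next
    case (diff a b)
    then show ?case
      using keys_diff[of "simplicial_boundary r a" "simplicial_boundary r b"]
      by (auto simp: simplicial_boundary_def frag_extend_diff)
  qed (simp add: simplicial_boundary_def)
  then show ?thesis
    by (auto simp: hom_def simplicial_chain_group_def simplicial_boundary_add)
qed

lemma simplicial_boundary_boundary:
  assumes r: "trans r" "irrefl r" "total r"
  shows "simplicial_boundary r (simplicial_boundary r c) = 0"
proof -
  let ?n = "\<lambda>\<sigma> v. card {u \<in> \<sigma>. (u, v) \<in> r}"
  have swap: "((-1) ^ ?n \<sigma> w * (-1) ^ ?n (\<sigma> - {w}) v :: int)
                = - ((-1) ^ ?n \<sigma> v * (-1) ^ ?n (\<sigma> - {v}) w)"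
    if "finite \<sigma>" "v \<in> \<sigma>" "w \<in> \<sigma>" "(v, w) \<in> r" for \<sigma> v w
  proof -
    have "(w, v) \<notin> r"
      using r that by (meson irreflD transD)
    then have "{u \<in> \<sigma> - {w}. (u, v) \<in> r} = {u \<in> \<sigma>. (u, v) \<in> r}"
      by auto
    moreover have "{u \<in> \<sigma>. (u, w) \<in> r} = insert v {u \<in> \<sigma> - {v}. (u, w) \<in> r}"
      using that by auto
    then have "?n \<sigma> w = Suc (?n (\<sigma> - {v}) w)"
      using that(1) by simp
    ultimately show ?thesis
      by simp
  qed
  have gen: "simplicial_boundary r (simplicial_boundary r (frag_of \<sigma>)) = 0" for \<sigma>
  proof (cases "finite \<sigma>")
    case True
    define h where "h = (\<lambda>v w. frag_cmul ((-1) ^ ?n \<sigma> v * (-1) ^ ?n (\<sigma> - {v}) w)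
                                          (frag_of (\<sigma> - {v} - {w})))"
    define P where "P = {(v, w). v \<in> \<sigma> \<and> w \<in> \<sigma> \<and> (v, w) \<in> r}"
    define Q where "Q = {(v, w). v \<in> \<sigma> \<and> w \<in> \<sigma> \<and> (w, v) \<in> r}"
    have fin: "finite P" "finite Q"
      by (rule finite_subset[of _ "\<sigma> \<times> \<sigma>"]; use True in \<open>auto simp: P_def Q_def\<close>)+
    have "simplicial_boundary r (simplicial_boundary r (frag_of \<sigma>)) =
          (\<Sum>v\<in>\<sigma>. frag_cmul ((-1) ^ ?n \<sigma> v) (simplicial_boundary r (frag_of (\<sigma> - {v}))))"
      unfolding simplicial_boundary_of
      by (simp add: simplicial_boundary_def frag_extend_sum True frag_extend_cmul)
    also have "\<dots> = (\<Sum>v\<in>\<sigma>. \<Sum>w\<in>\<sigma> - {v}. h v w)"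
      unfolding simplicial_boundary_of h_def by (simp add: frag_cmul_sum)
    also have "\<dots> = (\<Sum>(v, w)\<in>(SIGMA v:\<sigma>. \<sigma> - {v}). h v w)"
      using True by (simp add: sum.Sigma)
    also have "(SIGMA v:\<sigma>. \<sigma> - {v}) = P \<union> Q"
      using r by (auto simp: P_def Q_def irrefl_def total_on_def)
    also have "(\<Sum>(v, w)\<in>P \<union> Q. h v w) = (\<Sum>(v, w)\<in>P. h v w) + (\<Sum>(v, w)\<in>Q. h v w)"
      by (rule sum.union_disjoint[OF fin]) (use r in \<open>auto simp: P_def Q_def; meson irreflD transD\<close>)
    also have "(\<Sum>(v, w)\<in>Q. h v w) = (\<Sum>(v, w)\<in>P. h w v)"
      by (rule sum.reindex_bij_witness[of _ prod.swap prod.swap]) (auto simp: P_def Q_def)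
    also have "(\<Sum>(v, w)\<in>P. h w v) = (\<Sum>(v, w)\<in>P. - h v w)"
    proof (intro sum.cong refl, clarify)
      fix v w assume "(v, w) \<in> P"
      then have "((-1) ^ ?n \<sigma> w * (-1) ^ ?n (\<sigma> - {w}) v :: int)
                = - ((-1) ^ ?n \<sigma> v * (-1) ^ ?n (\<sigma> - {v}) w)"
        using swap True by (auto simp: P_def)
      moreover have "\<sigma> - {w} - {v} = \<sigma> - {v} - {w}"
        by auto
      ultimately show "h w v = - h v w"
        unfolding h_def by simp
    qed
    finally show ?thesis
      by (simp add: case_prod_unfold sum_negf)
  next
    case False
    then show ?thesis
      by (simp add: simplicial_boundary_def)
  qed
  have "Poly_Mapping.keys c \<subseteq> UNIV"
    by simp
  then show ?thesis
  proof (induction c rule: frag_induction)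
    case (one \<sigma>)
    show ?case by (rule gen)
  next
    case (diff a b)
    then show ?case
      by (simp add: simplicial_boundary_def frag_extend_diff)
  qed (simp add: simplicial_boundary_def)
qed

lemma comm_group_reduced_simplicial_homology:
  assumes K: "abstract_simplicial_complex K" and r: "trans r" "irrefl r" "total r"
  shows "comm_group (reduced_simplicial_homology r K k)"
proof -
  let ?C = "simplicial_chain_group K"
  let ?d = "simplicial_boundary r"
  have comm: "comm_group (?C j)" for j
    by (simp add: simplicial_chain_group_def abelian_free_Abelian_group)
  then have grp: "group (?C j)" for j
    using comm_group.axioms(2) by blast
  have hom: "group_hom (?C j) (?C (j - 1)) ?d" for j
    using grp simplicial_boundary_hom[OF K] by (simp add: group_hom_def group_hom_axioms_def)
  interpret C: comm_group "?C k" by (rule comm)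
  have hom': "group_hom (?C (k + 1)) (?C k) ?d"
    using hom[of "k + 1"] by simp
  have B: "subgroup (simplicial_boundaries r K k) (?C k)"
    unfolding simplicial_boundaries_def by (rule group_hom.img_is_subgroup[OF hom'])
  have Z: "subgroup (simplicial_cycles r K k) (?C k)"
    unfolding simplicial_cycles_def by (rule group_hom.subgroup_kernel[OF hom])
  have "simplicial_boundaries r K k \<subseteq> simplicial_cycles r K k"
  proof
    fix c assume c: "c \<in> simplicial_boundaries r K k"
    then have "?d c = 0"
      by (auto simp: simplicial_boundaries_def simplicial_boundary_boundary[OF r])
    with c show "c \<in> simplicial_cycles r K k"
      using subgroup.mem_carrier[OF B c]
      by (simp add: simplicial_cycles_def kernel_def simplicial_chain_group_def)
  qed
  then have "subgroup (simplicial_boundaries r K k)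
               (subgroup_generated (?C k) (simplicial_cycles r K k))"
    using B Z C.subgroup_of_subgroup_generated by blast
  moreover have "comm_group (subgroup_generated (?C k) (simplicial_cycles r K k))"
    by (rule C.abelian_subgroup_generated[OF comm])
  ultimately show ?thesis
    unfolding reduced_simplicial_homology_def
    by (simp add: comm_group.abelian_FactGroup)
qed

lemma comm_group_chessboard_homology: "comm_group (chessboard_homology m n k)"
  unfolding chessboard_homology_def
  by (rule comm_group_reduced_simplicial_homology[OF chessboard_complex])
     (auto intro!: transI simp: irrefl_def total_on_def)

end

theory Submission
  imports Defs "HOL-Library.Product_Lexorder" "HOL-Combinatorics.Transposition"
begin

text \<open>
  The faces of the chessboard complex \<open>M\<^sub>m\<^sub>,\<^sub>n\<close> are the matchings of the
  complete bipartite graph on \<open>m\<close> rows and \<open>n\<close> columns. The proof computes with matchings of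
  arbitrary graphs, as elements of the exterior algebra on the edges. A triple \<open>(a, b, c)\<close> of
  vertices in which \<open>a\<close> is joined to \<open>b\<close> and \<open>c\<close> gives the cycle \<open>ab - ac\<close>, and disjoint triples
  give a product of such cycles. Write \<open>k\<close> for the number of edges of a matching in the degree
  considered; it is one third of \<open>m + n + 1\<close>, rounded down.

  The first point is generation. By \<open>decompose\<close>, a cycle is, up to boundaries, a sum of products
  of triples through a fixed edge \<open>ab\<close> with cycles on fewer vertices, provided that the links of
  disjoint pairs of edges at \<open>a\<close> and \<open>b\<close> bound. By induction (\<open>bip_triple_span\<close>), all cycles
  with \<open>k\<close> edges are generated by products of \<open>k\<close> triples as long as there are at least \<open>3 * k\<close>
  vertices, at least \<open>k\<close> of them on each side.

  Suppose \<open>m + n = 3 * k + 1\<close>, so that each product leaves one vertex free. The free vertex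
  permits local moves, which show that exchanging two vertices of the same side changes the sign
  of the class of the product (\<open>swap_all\<close>, \<open>bip_rel\<close>). Hence all products represent one class up
  to sign. The relation \<open>(ab - ac) + (ac - ad) + (ad - ab) = 0\<close> relates three products that
  differ by even permutations, so three times the class is zero (\<open>three_null\<close>). The class is not
  zero, even in the matching complex of the complete graph on the same vertices: by induction on
  \<open>k\<close> there is a cocycle modulo three whose value at each product of triples is the sign of the
  order of the vertices (\<open>alternating_exists\<close>). This gives the cyclic group of order three.

  Suppose \<open>m + n = 3 * k\<close>, so that products use all vertices. Three triples of suitable kinds
  together with one more vertex fall under the first case, so three times their product bounds
  once the extra vertex is added; therefore it is homologous to a sum of cycles that each miss a
  vertex (\<open>split_Bd\<close>). Doing this for two disjoint sets of three triples, such that one misses a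
  row and the other misses a column, yields a sum of products that miss both ends of an edge and
  bound. So nine kills every generator that contains three triples of each kind (\<open>bip_nine\<close>).
  The same cocycle shows that the homology is not zero.

  Suppose \<open>m + n = 3 * k - 1\<close>. Now the generators are products of triples with one exceptional
  cycle, on five or on eight vertices (\<open>bip_core_span\<close>). Here the double links do not bound, but
  they are spanned by products of triples, and each such product is lifted to a cycle of the
  required form. The triples in a generator are enough for \<open>bip_nine\<close>. The homology is not zero,
  because the link of an edge in the product of a hexagon with triples is a product of triples
  that does not bound.
\<close>

section \<open>Wedge and link operators on chains\<close>

type_synonym 'e chain = "'e set \<Rightarrow>\<^sub>0 int"

text \<open>
  Chains are combined linearly throughout; additivity of a map is the only linearity that is
  ever needed, since multiples by integers follow.
\<close>

abbreviation fadd :: "('a::ab_group_add \<Rightarrow> 'b::ab_group_add) \<Rightarrow> bool" where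
  "fadd \<equiv> Modules.additive"

lemma fadd_cmul:
  assumes "fadd (f :: ('a \<Rightarrow>\<^sub>0 int) \<Rightarrow> ('b \<Rightarrow>\<^sub>0 int))"
  shows "f (frag_cmul n c) = frag_cmul n (f c)"
proof -
  interpret Modules.additive f by fact
  show ?thesis
    by (induction n rule: int_induct[of _ 0])
       (simp_all add: frag_cmul_distrib frag_cmul_diff_distrib add diff zero)
qed

lemma fadd_frag_extend: "fadd (frag_extend f)"
  by unfold_locales (rule frag_extend_add)

lemma fadd_eqI:
  assumes "fadd f" "fadd g" "Poly_Mapping.keys c \<subseteq> S" "\<And>\<sigma>. \<sigma> \<in> S \<Longrightarrow> f (frag_of \<sigma>) = g (frag_of \<sigma>)"
  shows "f c = g c"
  using assms(3)
proof (induction c rule: frag_induction)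
  case zero show ?case using additive.zero[OF assms(1)] additive.zero[OF assms(2)] by simp
next
  case (one x) then show ?case using assms(4) by simp
next
  case (diff a b) then show ?case using additive.diff[OF assms(1)] additive.diff[OF assms(2)] by simp
qed

definition sg :: "'e::linorder \<Rightarrow> 'e set \<Rightarrow> int" where
  "sg e \<sigma> = (-1) ^ card {u \<in> \<sigma>. u < e}"

lemma sg_sq [simp]: "sg e \<sigma> * sg e \<sigma> = 1"
  by (simp add: sg_def flip: power_add mult_2)

lemma sg_insert:
  assumes "finite \<sigma>" "f \<notin> \<sigma>" shows "sg e (insert f \<sigma>) = (if f < e then -1 else 1) * sg e \<sigma>"
proof (cases "f < e")
  case True
  then have "{u \<in> insert f \<sigma>. u < e} = insert f {u \<in> \<sigma>. u < e}" by auto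
  then show ?thesis using assms True by (simp add: sg_def)
next
  case False
  then have "{u \<in> insert f \<sigma>. u < e} = {u \<in> \<sigma>. u < e}" by auto
  then show ?thesis using False by (simp add: sg_def)
qed

lemma sg_remove:
  assumes "finite \<sigma>" "f \<in> \<sigma>" shows "sg e (\<sigma> - {f}) = (if f < e then -1 else 1) * sg e \<sigma>"
proof -
  have "sg e \<sigma> = (if f < e then -1 else 1) * sg e (\<sigma> - {f})"
    using sg_insert[of "\<sigma> - {f}" f e] assms by (simp add: insert_absorb)
  then show ?thesis by auto
qed

text \<open>
  The chains are regarded as the exterior algebra on the edges. \<open>W e\<close> is exterior multiplication
  by the edge \<open>e\<close> from the left and \<open>Lk e\<close> is contraction with \<open>e\<close>, that is, the link of \<open>e\<close>
  with its sign. Infinite sets are sent to \<open>0\<close>, as they are by the boundary operator.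
\<close>

definition W :: "'e::linorder \<Rightarrow> 'e chain \<Rightarrow> 'e chain" where
  "W e = frag_extend (\<lambda>\<sigma>. if e \<in> \<sigma> \<or> infinite \<sigma> then 0 else frag_cmul (sg e \<sigma>) (frag_of (insert e \<sigma>)))"

definition Lk :: "'e::linorder \<Rightarrow> 'e chain \<Rightarrow> 'e chain" where
  "Lk e = frag_extend (\<lambda>\<sigma>. if e \<in> \<sigma> \<and> finite \<sigma> then frag_cmul (sg e \<sigma>) (frag_of (\<sigma> - {e})) else 0)"

definition bd :: "'e::linorder chain \<Rightarrow> 'e chain" where
  "bd = simplicial_boundary {(x, y). x < y}"

lemma fadd_W: "fadd (W e)" and fadd_Lk: "fadd (Lk e)" and fadd_bd: "fadd bd"
  unfolding W_def Lk_def bd_def simplicial_boundary_def by (rule fadd_frag_extend)+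

lemmas W_lin = additive.add[OF fadd_W] additive.diff[OF fadd_W] additive.minus[OF fadd_W]
  additive.zero[OF fadd_W] additive.sum[OF fadd_W] fadd_cmul[OF fadd_W]
lemmas Lk_lin = additive.add[OF fadd_Lk] additive.diff[OF fadd_Lk] additive.minus[OF fadd_Lk]
  additive.zero[OF fadd_Lk] additive.sum[OF fadd_Lk] fadd_cmul[OF fadd_Lk]
lemmas bd_lin = additive.add[OF fadd_bd] additive.diff[OF fadd_bd] additive.minus[OF fadd_bd]
  additive.zero[OF fadd_bd] additive.sum[OF fadd_bd] fadd_cmul[OF fadd_bd]

lemma fadd_comp: "fadd f \<Longrightarrow> fadd g \<Longrightarrow> fadd (\<lambda>x. f (g x))"
  by (simp add: additive_def)
lemma fadd_plus: "fadd f \<Longrightarrow> fadd g \<Longrightarrow> fadd (\<lambda>x. f x + g x)"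
  by (simp add: additive_def algebra_simps)
lemma fadd_minus: "fadd f \<Longrightarrow> fadd g \<Longrightarrow> fadd (\<lambda>x. f x - g x)"
  by (simp add: additive_def algebra_simps)
lemma fadd_neg: "fadd f \<Longrightarrow> fadd (\<lambda>x. - f x)"
  by (simp add: additive_def)
lemma fadd_id: "fadd (\<lambda>x. x)"
  by (simp add: additive_def)
lemma fadd_sum: "(\<And>i. i \<in> I \<Longrightarrow> fadd (f i)) \<Longrightarrow> fadd (\<lambda>x. \<Sum>i\<in>I. f i x)"
  by (simp add: additive_def sum.distrib)
lemma fadd_const_cmul: "fadd f \<Longrightarrow> fadd (\<lambda>x. frag_cmul n (f x))"
  by (simp add: additive_def frag_cmul_distrib2)

lemmas fadd_intros = fadd_W fadd_Lk fadd_bd fadd_plus fadd_minus fadd_neg fadd_id fadd_sum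
  fadd_const_cmul fadd_comp[OF fadd_W] fadd_comp[OF fadd_Lk] fadd_comp[OF fadd_bd]

lemma W_of: "W e (frag_of \<sigma>) = (if e \<in> \<sigma> \<or> infinite \<sigma> then 0 else frag_cmul (sg e \<sigma>) (frag_of (insert e \<sigma>)))"
  by (simp add: W_def)
lemma Lk_of: "Lk e (frag_of \<sigma>) = (if e \<in> \<sigma> \<and> finite \<sigma> then frag_cmul (sg e \<sigma>) (frag_of (\<sigma> - {e})) else 0)"
  by (simp add: Lk_def)
lemma bd_of:
  assumes "finite F" "\<sigma> \<subseteq> F" shows "bd (frag_of \<sigma>) = (\<Sum>v\<in>F. Lk v (frag_of \<sigma>))"
proof -
  have "bd (frag_of \<sigma>) = (\<Sum>v\<in>\<sigma>. Lk v (frag_of \<sigma>))"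
    unfolding bd_def simplicial_boundary_of Lk_of sg_def using assms
    by (intro sum.cong) (auto dest: finite_subset)
  also have "\<dots> = (\<Sum>v\<in>F. Lk v (frag_of \<sigma>))"
    using assms by (intro sum.mono_neutral_left) (auto simp: Lk_of)
  finally show ?thesis .
qed
lemma bd_inf: "infinite \<sigma> \<Longrightarrow> bd (frag_of \<sigma>) = 0"
  by (simp add: bd_def simplicial_boundary_of)

lemma bd_bd [simp]: "bd (bd c) = 0"
  unfolding bd_def by (rule simplicial_boundary_boundary) (auto intro!: transI simp: irrefl_def total_on_def)

text \<open>
  The rules \<open>W_W\<close>, \<open>Lk_Lk\<close>, \<open>Lk_W\<close>, \<open>Lk_W_same\<close> are the canonical anticommutation relations.
  Together with \<open>bd_W\<close> and \<open>bd_Lk\<close> they replace all later reasoning about signs of faces.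
\<close>

lemma W_W: "W e (W f c) = - W f (W e c)"
proof (rule fadd_eqI[of "\<lambda>c. W e (W f c)" "\<lambda>c. - W f (W e c)" c UNIV])
  fix \<sigma> :: "'a set"
  show "W e (W f (frag_of \<sigma>)) = - W f (W e (frag_of \<sigma>))"
  proof (cases "infinite \<sigma> \<or> e \<in> \<sigma> \<or> f \<in> \<sigma> \<or> e = f")
    case False
    then consider "e < f" "\<not> f < e" | "f < e" "\<not> e < f" by (cases e f rule: linorder_cases) auto
    then show ?thesis using False
      by cases (simp_all add: W_of W_lin sg_insert insert_commute[of e f] mult.commute)
  qed (auto simp: W_of W_lin)
qed (auto intro!: fadd_intros)

lemma W_same [simp]: "W e (W e c) = 0"
proof (rule fadd_eqI[of "\<lambda>c. W e (W e c)" "\<lambda>c. 0" c UNIV])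
qed (auto intro!: fadd_intros simp: W_of W_lin additive_def)

lemma Lk_Lk: "Lk e (Lk f c) = - Lk f (Lk e c)"
proof (rule fadd_eqI[of "\<lambda>c. Lk e (Lk f c)" "\<lambda>c. - Lk f (Lk e c)" c UNIV])
  fix \<sigma> :: "'a set"
  show "Lk e (Lk f (frag_of \<sigma>)) = - Lk f (Lk e (frag_of \<sigma>))"
  proof (cases "infinite \<sigma> \<or> e \<notin> \<sigma> \<or> f \<notin> \<sigma> \<or> e = f")
    case False
    then consider "e < f" "\<not> f < e" | "f < e" "\<not> e < f" by (cases e f rule: linorder_cases) auto
    moreover have *: "\<sigma> - {e} - {f} = \<sigma> - {f, e}" "\<sigma> - {f} - {e} = \<sigma> - {f, e}" by auto
    ultimately show ?thesis using False
      by cases (simp_all add: Lk_of Lk_lin sg_remove * mult.commute)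
  qed (auto simp: Lk_of Lk_lin)
qed (auto intro!: fadd_intros)

lemma Lk_W: assumes "e \<noteq> f" shows "Lk e (W f c) = - W f (Lk e c)"
proof (rule fadd_eqI[of "\<lambda>c. Lk e (W f c)" "\<lambda>c. - W f (Lk e c)" c UNIV])
  fix \<sigma> :: "'a set"
  show "Lk e (W f (frag_of \<sigma>)) = - W f (Lk e (frag_of \<sigma>))"
  proof (cases "infinite \<sigma> \<or> e \<notin> \<sigma> \<or> f \<in> \<sigma>")
    case False
    then consider "e < f" "\<not> f < e" | "f < e" "\<not> e < f" using assms by (meson linorder_neqE less_asym)
    then have "sg e (insert f \<sigma>) * sg f \<sigma> = - (sg f (\<sigma> - {e}) * sg e \<sigma>)"
      using False by cases (simp_all add: sg_remove sg_insert)
    moreover have "insert f \<sigma> - {e} = insert f (\<sigma> - {e})" using assms by auto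
    ultimately show ?thesis using False assms
      by (simp add: W_of W_lin Lk_of Lk_lin mult.commute del: insert_Diff_if)
  qed (use assms in \<open>auto simp: Lk_of Lk_lin W_of W_lin\<close>)
qed (auto intro!: fadd_intros)

definition fin_chain :: "'e chain \<Rightarrow> bool" where
  "fin_chain c \<longleftrightarrow> Poly_Mapping.keys c \<subseteq> Collect finite"

lemma Lk_W_same: assumes "fin_chain c" shows "Lk e (W e c) + W e (Lk e c) = c"
proof (rule fadd_eqI[of "\<lambda>c. Lk e (W e c) + W e (Lk e c)" "\<lambda>c. c" c "Collect finite"])
  fix \<sigma> :: "'a set" assume "\<sigma> \<in> Collect finite"
  then show "Lk e (W e (frag_of \<sigma>)) + W e (Lk e (frag_of \<sigma>)) = frag_of \<sigma>"
    by (cases "e \<in> \<sigma>") (auto simp: W_of W_lin Lk_of Lk_lin sg_remove sg_insert insert_absorb)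
qed (use assms in \<open>auto intro!: fadd_intros simp: fin_chain_def\<close>)

text \<open>
  The boundary is the sum of all contractions, and only the contraction with \<open>e\<close> itself fails to
  anticommute with \<open>W e\<close>. Hence \<open>W e\<close> is a contracting homotopy: the cone with apex \<open>e\<close>.
\<close>

lemma bd_W': assumes "fin_chain c" shows "bd (W e c) + W e (bd c) = c"
proof (rule fadd_eqI[of "\<lambda>c. bd (W e c) + W e (bd c)" "\<lambda>c. c" c "Collect finite"])
  fix \<sigma> :: "'a set" assume s: "\<sigma> \<in> Collect finite"
  define F where "F = insert e \<sigma>"
  have F: "finite F" "\<sigma> \<subseteq> F" "e \<in> F" using s by (auto simp: F_def)
  have 1: "bd (W e (frag_of \<sigma>)) = (\<Sum>v\<in>F. Lk v (W e (frag_of \<sigma>)))"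
    using F bd_of[of F "insert e \<sigma>"] s by (auto simp: W_of bd_lin Lk_lin frag_cmul_sum)
  have 2: "W e (bd (frag_of \<sigma>)) = (\<Sum>v\<in>F. W e (Lk v (frag_of \<sigma>)))"
    using F bd_of[of F "\<sigma>"] s by (auto simp: W_lin)
  have "bd (W e (frag_of \<sigma>)) + W e (bd (frag_of \<sigma>)) = (\<Sum>v\<in>F. Lk v (W e (frag_of \<sigma>)) + W e (Lk v (frag_of \<sigma>)))"
    unfolding 1 2 by (simp add: sum.distrib)
  also have "\<dots> = (\<Sum>v\<in>F. if v = e then frag_of \<sigma> else 0)"
    using s by (intro sum.cong) (auto simp: Lk_W Lk_W_same fin_chain_def)
  also have "\<dots> = frag_of \<sigma>" using F by simp
  finally show "bd (W e (frag_of \<sigma>)) + W e (bd (frag_of \<sigma>)) = frag_of \<sigma>" .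
qed (use assms in \<open>auto intro!: fadd_intros simp: fin_chain_def\<close>)

lemma bd_W: "fin_chain c \<Longrightarrow> bd (W e c) = c - W e (bd c)"
  using bd_W'[of c e] by (simp add: algebra_simps)

lemma bd_Lk: "bd (Lk e c) = - Lk e (bd c)"
proof (rule fadd_eqI[of "\<lambda>c. bd (Lk e c)" "\<lambda>c. - Lk e (bd c)" c UNIV])
  fix \<sigma> :: "'a set"
  show "bd (Lk e (frag_of \<sigma>)) = - Lk e (bd (frag_of \<sigma>))"
  proof (cases "finite \<sigma>")
    case True
    have 1: "bd (Lk e (frag_of \<sigma>)) = (\<Sum>v\<in>\<sigma>. Lk v (Lk e (frag_of \<sigma>)))"
      using True bd_of[of \<sigma> "\<sigma> - {e}"] by (auto simp: Lk_of bd_lin Lk_lin frag_cmul_sum)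
    show ?thesis
      unfolding 1 using bd_of[of \<sigma> \<sigma>] True Lk_Lk[of _ e "frag_of \<sigma>"]
      by (simp add: Lk_lin sum_negf)
  qed (simp add: Lk_of bd_inf bd_lin Lk_lin)
qed (auto intro!: fadd_intros)

section \<open>Matching complexes\<close>

text \<open>
  An undirected edge is stored as an ordered pair, so that edges inherit the lexicographic order
  of pairs.
\<close>

definition ed :: "nat \<Rightarrow> nat \<Rightarrow> nat \<times> nat" where "ed u v = (min u v, max u v)"

definition vs :: "nat \<times> nat \<Rightarrow> nat set" where "vs e = {fst e, snd e}"

lemma vs_ed [simp]: "vs (ed u v) = {u, v}" by (auto simp: vs_def ed_def min_def max_def)
lemma ed_commute: "ed u v = ed v u" by (simp add: ed_def min.commute max.commute)
lemma ed_eq_iff: "ed u v = ed u' v' \<longleftrightarrow> u = u' \<and> v = v' \<or> u = v' \<and> v = u'"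
  by (auto simp: ed_def min_def max_def split: if_splits)
lemma ed_eq_iff_right [simp]: "ed u v = ed u w \<longleftrightarrow> v = w" by (auto simp: ed_eq_iff)

definition mtch :: "(nat \<Rightarrow> nat \<Rightarrow> bool) \<Rightarrow> nat set \<Rightarrow> (nat \<times> nat) set set" where
  "mtch adj V = {\<sigma>. finite \<sigma> \<and> (\<forall>e\<in>\<sigma>. \<exists>u v. e = ed u v \<and> u \<noteq> v \<and> u \<in> V \<and> v \<in> V \<and> adj u v) \<and>
                 (\<forall>e\<in>\<sigma>. \<forall>f\<in>\<sigma>. e \<noteq> f \<longrightarrow> vs e \<inter> vs f = {})}"

text \<open>
  The index counts edges, so \<open>Ch adj V k\<close> lies in simplicial degree \<open>k - 1\<close>. Cycles and
  boundaries are always taken relative to a vertex set \<open>V\<close>: much of the argument consists in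
  recording which vertices a chain avoids.
\<close>

definition Ch :: "(nat \<Rightarrow> nat \<Rightarrow> bool) \<Rightarrow> nat set \<Rightarrow> nat \<Rightarrow> (nat \<times> nat) chain set" where
  "Ch adj V k = {c. Poly_Mapping.keys c \<subseteq> {\<sigma> \<in> mtch adj V. card \<sigma> = k}}"

definition Cy where "Cy adj V k = {c \<in> Ch adj V k. bd c = 0}"
definition Bd where "Bd adj V k = bd ` Ch adj V (Suc k)"

definition adgrp :: "'a::ab_group_add set \<Rightarrow> bool" where
  "adgrp S \<longleftrightarrow> 0 \<in> S \<and> (\<forall>x\<in>S. \<forall>y\<in>S. x - y \<in> S)"

lemma adgrp_zero: "adgrp S \<Longrightarrow> 0 \<in> S" by (simp add: adgrp_def)
lemma adgrp_diff: "adgrp S \<Longrightarrow> x \<in> S \<Longrightarrow> y \<in> S \<Longrightarrow> x - y \<in> S" by (simp add: adgrp_def)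
lemma adgrp_neg: "adgrp S \<Longrightarrow> x \<in> S \<Longrightarrow> - x \<in> S" using adgrp_diff[of S 0 x] adgrp_zero[of S] by simp
lemma adgrp_add: "adgrp S \<Longrightarrow> x \<in> S \<Longrightarrow> y \<in> S \<Longrightarrow> x + y \<in> S"
  using adgrp_diff[of S x "-y"] adgrp_neg[of S y] by simp
lemma adgrp_sum: "adgrp S \<Longrightarrow> (\<And>i. i \<in> I \<Longrightarrow> f i \<in> S) \<Longrightarrow> sum f I \<in> S"
  by (induction I rule: infinite_finite_induct) (auto simp: adgrp_zero adgrp_add)
lemma adgrp_cmul: assumes "adgrp S" "x \<in> S" shows "frag_cmul n x \<in> S"
  by (induction n rule: int_induct[of _ 0])
     (use assms in \<open>auto simp: adgrp_zero adgrp_add adgrp_diff frag_cmul_distrib frag_cmul_diff_distrib\<close>)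
lemma adgrp_image: "fadd f \<Longrightarrow> adgrp S \<Longrightarrow> adgrp (f ` S)"
  unfolding adgrp_def using additive.zero[of f] additive.diff[of f] by (auto simp: image_iff) metis+
lemma adgrp_swap: "adgrp S \<Longrightarrow> x - y \<in> S \<Longrightarrow> y - x \<in> S"
  using adgrp_neg[of S "x - y"] by simp
lemma adgrp_trans: "adgrp S \<Longrightarrow> x - y \<in> S \<Longrightarrow> y - z \<in> S \<Longrightarrow> x - z \<in> S"
  using adgrp_add[of S "x - y" "y - z"] by simp

lemma adgrp_Ch: "adgrp (Ch adj V k)"
  unfolding adgrp_def Ch_def using keys_diff by fastforce
lemma adgrp_Bd: "adgrp (Bd adj V k)"
  unfolding Bd_def by (intro adgrp_image fadd_bd adgrp_Ch)
lemma adgrp_Cy: "adgrp (Cy adj V k)"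
  using adgrp_Ch unfolding adgrp_def Cy_def by (auto simp: bd_lin)

lemmas Ch_cl = adgrp_zero[OF adgrp_Ch] adgrp_diff[OF adgrp_Ch] adgrp_neg[OF adgrp_Ch] adgrp_add[OF adgrp_Ch]
  adgrp_sum[OF adgrp_Ch] adgrp_cmul[OF adgrp_Ch]
lemmas Bd_cl = adgrp_zero[OF adgrp_Bd] adgrp_diff[OF adgrp_Bd] adgrp_neg[OF adgrp_Bd] adgrp_add[OF adgrp_Bd]
  adgrp_sum[OF adgrp_Bd] adgrp_cmul[OF adgrp_Bd]
lemmas Cy_cl = adgrp_zero[OF adgrp_Cy] adgrp_diff[OF adgrp_Cy] adgrp_neg[OF adgrp_Cy] adgrp_add[OF adgrp_Cy]
  adgrp_sum[OF adgrp_Cy] adgrp_cmul[OF adgrp_Cy]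

lemma Ch_frag_of [simp]: "frag_of \<sigma> \<in> Ch adj V k \<longleftrightarrow> \<sigma> \<in> mtch adj V \<and> card \<sigma> = k"
  by (simp add: Ch_def keys_frag_of)

lemma Ch_fin: "c \<in> Ch adj V k \<Longrightarrow> fin_chain c"
  by (auto simp: Ch_def fin_chain_def mtch_def)

lemma Ch_induct [consumes 1, case_names zero one diff]:
  assumes "c \<in> Ch adj V k" "P 0" "\<And>\<sigma>. \<sigma> \<in> mtch adj V \<Longrightarrow> card \<sigma> = k \<Longrightarrow> P (frag_of \<sigma>)"
    "\<And>x y. P x \<Longrightarrow> P y \<Longrightarrow> P (x - y)"
  shows "P c"
  using assms(1) unfolding Ch_def mem_Collect_eq
  by (induction c rule: frag_induction) (use assms(2-) in auto)

lemma Ch_map: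
  assumes "c \<in> Ch adj V k" "fadd f" "adgrp S" "\<And>\<sigma>. \<sigma> \<in> mtch adj V \<Longrightarrow> card \<sigma> = k \<Longrightarrow> f (frag_of \<sigma>) \<in> S"
  shows "f c \<in> S"
  using assms(1) by (induction c rule: Ch_induct)
    (use assms(2-) in \<open>auto simp: additive.zero additive.diff adgrp_zero adgrp_diff\<close>)

lemma mtch_mono: "V \<subseteq> V' \<Longrightarrow> mtch adj V \<subseteq> mtch adj V'"
  by (fastforce simp: mtch_def)
lemma Ch_mono: "c \<in> Ch adj V k \<Longrightarrow> V \<subseteq> V' \<Longrightarrow> c \<in> Ch adj V' k"
  using mtch_mono[of V V' adj] by (fastforce simp: Ch_def)
lemma Bd_mono: "c \<in> Bd adj V k \<Longrightarrow> V \<subseteq> V' \<Longrightarrow> c \<in> Bd adj V' k"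
  using Ch_mono by (fastforce simp: Bd_def)
lemma Cy_mono: "c \<in> Cy adj V k \<Longrightarrow> V \<subseteq> V' \<Longrightarrow> c \<in> Cy adj V' k"
  using Ch_mono by (fastforce simp: Cy_def)

lemma mtch_disj: "\<sigma> \<in> mtch adj V \<Longrightarrow> e \<in> \<sigma> \<Longrightarrow> f \<in> \<sigma> \<Longrightarrow> e \<noteq> f \<Longrightarrow> vs e \<inter> vs f = {}"
  by (simp add: mtch_def)

lemma mtch_insert:
  assumes "\<sigma> \<in> mtch adj (V - {u, v})" "u \<in> V" "v \<in> V" "adj u v" "u \<noteq> v"
  shows "insert (ed u v) \<sigma> \<in> mtch adj V" "ed u v \<notin> \<sigma>"
proof -
  have *: "vs e \<inter> {u, v} = {}" if "e \<in> \<sigma>" for e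
    using assms(1) that unfolding mtch_def by force
  show "ed u v \<notin> \<sigma>" using * by fastforce
  have "\<sigma> \<in> mtch adj V" using assms(1) mtch_mono[of "V - {u,v}" V] by auto
  then show "insert (ed u v) \<sigma> \<in> mtch adj V"
    using assms(2-) * unfolding mtch_def
    by (auto simp del: Int_insert_right Int_insert_left simp: Int_commute)
qed

lemma mtch_remove:
  assumes "\<sigma> \<in> mtch adj V" "ed u v \<in> \<sigma>"
  shows "\<sigma> - {ed u v} \<in> mtch adj (V - {u, v})"
proof -
  have *: "vs e \<inter> {u, v} = {}" if "e \<in> \<sigma>" "e \<noteq> ed u v" for e
    using mtch_disj[OF assms(1) that(1) assms(2) that(2)] by (simp only: vs_ed)
  have "\<exists>x y. e = ed x y \<and> x \<noteq> y \<and> x \<in> V - {u, v} \<and> y \<in> V - {u, v} \<and> adj x y"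
    if e: "e \<in> \<sigma>" "e \<noteq> ed u v" for e
  proof -
    obtain x y where xy: "e = ed x y" "x \<noteq> y" "x \<in> V" "y \<in> V" "adj x y"
      using assms(1) e by (auto simp: mtch_def)
    then show ?thesis using *[OF e] by (intro exI[of _ x] exI[of _ y]) auto
  qed
  then show ?thesis
    using assms(1) unfolding mtch_def by simp
qed

lemma mtch_edge: "\<sigma> \<in> mtch adj V \<Longrightarrow> ed u v \<in> \<sigma> \<Longrightarrow> u \<in> V \<and> v \<in> V \<and> (adj u v \<or> adj v u) \<and> u \<noteq> v"
  unfolding mtch_def by (auto simp: ed_eq_iff dest!: bspec)

lemma mtch_empty [simp]: "{} \<in> mtch adj V" by (simp add: mtch_def)

lemma Ch_0: assumes "c \<in> Ch adj V 0" shows "\<exists>n. c = frag_cmul n (frag_of {})"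
proof -
  have "Poly_Mapping.keys c \<subseteq> {{}}" using assms by (auto simp: Ch_def mtch_def)
  then show ?thesis
    by (induction c rule: frag_induction) (auto intro: exI[of _ 0] exI[of _ 1] simp flip: frag_cmul_diff_distrib)
qed

lemma bd_one [simp]: "bd (frag_of {}) = 0" by (simp add: bd_def simplicial_boundary_of)
lemma one_Cy [simp]: "frag_of {} \<in> Cy adj V 0" by (simp add: Cy_def)
lemma Ch_0_Cy: assumes "c \<in> Ch adj V 0" shows "bd c = 0" using Ch_0[OF assms] by (auto simp: bd_lin)
lemma Ch_0_mono: assumes "c \<in> Ch adj V 0" shows "c \<in> Ch adj V' 0"
  using Ch_0[OF assms] by (auto intro!: Ch_cl)
lemma Ch_0_Lk: assumes "c \<in> Ch adj V 0" shows "Lk e c = 0"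
  using Ch_0[OF assms] by (auto simp: Lk_lin Lk_of)

locale graph =
  fixes adj :: "nat \<Rightarrow> nat \<Rightarrow> bool"
  assumes sym: "adj u v \<Longrightarrow> adj v u" and irr: "adj u v \<Longrightarrow> u \<noteq> v"
begin

lemma Bd_Cy: "c \<in> Bd adj V k \<Longrightarrow> bd c = 0" by (auto simp: Bd_def)

lemma W_Ch:
  assumes "c \<in> Ch adj (V - {u, v}) k" "u \<in> V" "v \<in> V" "adj u v"
  shows "W (ed u v) c \<in> Ch adj V (Suc k)"
  using assms(1)
proof (rule Ch_map)
  fix \<sigma> assume s: "\<sigma> \<in> mtch adj (V - {u, v})" "card \<sigma> = k"
  have "finite \<sigma>" using s by (auto simp: mtch_def)
  then show "W (ed u v) (frag_of \<sigma>) \<in> Ch adj V (Suc k)"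
    using mtch_insert[OF s(1) assms(2-4)] irr[OF assms(4)] s(2) by (auto simp: W_of intro!: Ch_cl)
qed (auto intro: fadd_intros adgrp_Ch)

lemma Lk_Ch:
  assumes "c \<in> Ch adj V (Suc k)" shows "Lk (ed u v) c \<in> Ch adj (V - {u, v}) k"
  using assms
proof (rule Ch_map)
  fix \<sigma> assume s: "\<sigma> \<in> mtch adj V" "card \<sigma> = Suc k"
  then show "Lk (ed u v) (frag_of \<sigma>) \<in> Ch adj (V - {u, v}) k"
    using mtch_remove[OF s(1)] by (auto simp: Lk_of intro!: Ch_cl)
qed (auto intro: fadd_intros adgrp_Ch)

lemma Lk_0:
  assumes "c \<in> Ch adj V k" "u \<notin> V \<or> v \<notin> V \<or> \<not> adj u v" shows "Lk (ed u v) c = 0"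
proof -
  have "Lk (ed u v) c \<in> {0}"
    using assms(1)
  proof (rule Ch_map)
    fix \<sigma> assume s: "\<sigma> \<in> mtch adj V" "card \<sigma> = k"
    then have "ed u v \<notin> \<sigma>" using mtch_edge[OF s(1), of u v] assms(2) sym[of v u] by blast
    then show "Lk (ed u v) (frag_of \<sigma>) \<in> {0}" by (simp add: Lk_of)
  qed (auto simp: fadd_Lk adgrp_def)
  then show ?thesis by simp
qed

lemma Lk_W_id:
  assumes "c \<in> Ch adj V k" "u \<notin> V \<or> v \<notin> V \<or> \<not> adj u v" shows "Lk (ed u v) (W (ed u v) c) = c"
  using Lk_W_same[OF Ch_fin[OF assms(1)], of "ed u v"] Lk_0[OF assms] by (simp add: W_lin)

lemma bd_Ch:
  assumes "c \<in> Ch adj V (Suc k)" shows "bd c \<in> Ch adj V k"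
  using assms
proof (rule Ch_map)
  fix \<sigma> assume s: "\<sigma> \<in> mtch adj V" "card \<sigma> = Suc k"
  have f: "finite \<sigma>" using s by (auto simp: mtch_def)
  have "\<sigma> - {e} \<in> mtch adj V" for e using s by (auto simp: mtch_def)
  then show "bd (frag_of \<sigma>) \<in> Ch adj V k"
    using s f bd_of[OF f order_refl] by (auto simp: Lk_of intro!: Ch_cl)
qed (auto intro: fadd_intros adgrp_Ch)

lemma Bd_Ch: "c \<in> Bd adj V k \<Longrightarrow> c \<in> Ch adj V k" by (auto simp: Bd_def bd_Ch)
lemma Bd_sub_Cy: "c \<in> Bd adj V k \<Longrightarrow> c \<in> Cy adj V k" by (auto simp: Cy_def Bd_Ch Bd_Cy)
lemma bd_Ch_Bd: "c \<in> Ch adj V (Suc k) \<Longrightarrow> bd c \<in> Bd adj V k" by (auto simp: Bd_def)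

lemma Lk_Cy: "c \<in> Cy adj V (Suc k) \<Longrightarrow> Lk (ed u v) c \<in> Cy adj (V - {u, v}) k"
  by (auto simp: Cy_def Lk_Ch bd_Lk Lk_lin)

section \<open>Decomposing a cycle along an edge\<close>

definition nbrs where "nbrs V a = {t \<in> V. adj a t}"

text \<open>
  A matching contains at most one edge at \<open>a\<close>. Subtracting the part that uses such an edge
  leaves a chain that avoids \<open>a\<close>.
\<close>

lemma expand:
  assumes V: "finite V" "a \<in> V" and c: "c \<in> Ch adj V k"
  shows "c - (\<Sum>t\<in>nbrs V a. W (ed a t) (Lk (ed a t) c)) \<in> Ch adj (V - {a}) k"
  using c
proof (rule Ch_map)
  have fN: "finite (nbrs V a)" using V by (simp add: nbrs_def)
  fix \<sigma> assume s: "\<sigma> \<in> mtch adj V" "card \<sigma> = k"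
  show "frag_of \<sigma> - (\<Sum>t\<in>nbrs V a. W (ed a t) (Lk (ed a t) (frag_of \<sigma>))) \<in> Ch adj (V - {a}) k"
  proof (cases "\<exists>t. ed a t \<in> \<sigma>")
    case True
    then obtain t where t: "ed a t \<in> \<sigma>" by blast
    have tN: "t \<in> nbrs V a" using mtch_edge[OF s(1) t] sym by (auto simp: nbrs_def)
    have un: "ed a t' \<in> \<sigma> \<longleftrightarrow> t' = t" for t'
      using t mtch_disj[OF s(1) _ t, of "ed a t'"] by auto
    have "(\<Sum>t'\<in>nbrs V a. W (ed a t') (Lk (ed a t') (frag_of \<sigma>))) =
          (\<Sum>t'\<in>nbrs V a. if t' = t then frag_of \<sigma> else 0)"
    proof (intro sum.cong refl)
      fix t'
      have f: "finite \<sigma>" using s by (auto simp: mtch_def)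
      then have "sg (ed a t) (\<sigma> - {ed a t}) = sg (ed a t) \<sigma>" using t by (simp add: sg_remove)
      then show "W (ed a t') (Lk (ed a t') (frag_of \<sigma>)) = (if t' = t then frag_of \<sigma> else 0)"
        using t f by (auto simp: Lk_of un W_lin W_of insert_absorb)
    qed
    then show ?thesis using tN fN by (simp add: Ch_cl)
  next
    case False
    then have "(\<Sum>t\<in>nbrs V a. W (ed a t) (Lk (ed a t) (frag_of \<sigma>))) = 0"
      by (intro sum.neutral) (auto simp: Lk_of W_lin)
    moreover have "\<sigma> \<in> mtch adj (V - {a})"
    proof -
      have "u \<noteq> a \<and> v \<noteq> a" if "ed u v \<in> \<sigma>" for u v
        using False that ed_commute[of u v] by metis
      then have "\<exists>x y. e = ed x y \<and> x \<noteq> y \<and> x \<in> V - {a} \<and> y \<in> V - {a} \<and> adj x y" if "e \<in> \<sigma>" for e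
        using s(1) that unfolding mtch_def by fastforce
      then show ?thesis using s(1) unfolding mtch_def by simp
    qed
    ultimately show ?thesis using s by simp
  qed
qed (auto intro!: fadd_intros adgrp_Ch)

text \<open>
  If \<open>Lk (ed b s) c\<close> bounds some \<open>x s\<close>, then adding the boundary of \<open>W (ed b s) (x s)\<close> trades
  the edge \<open>bs\<close> for the chain \<open>x s\<close>, which avoids \<open>b\<close>.
\<close>

lemma push_off:
  assumes V: "finite V" "b \<in> V" and c: "c \<in> Cy adj V k"
    and null: "\<And>s. s \<in> nbrs V b \<Longrightarrow> Lk (ed b s) c \<in> Bd adj (V - {b, s}) (k - 1)"
  shows "\<exists>c'\<in>Cy adj (V - {b}) k. c - c' \<in> Bd adj V k"
proof (cases k)
  case 0
  then have "c \<in> Cy adj (V - {b}) k" using c by (auto simp: Cy_def intro: Ch_0_mono)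
  then show ?thesis by (intro bexI[of _ c]) (simp_all add: Bd_cl)
next
  case (Suc k')
  have "\<forall>s\<in>nbrs V b. \<exists>x\<in>Ch adj (V - {b, s}) k. Lk (ed b s) c = bd x"
    using null unfolding Bd_def Suc by (simp add: image_iff)
  then obtain x where x: "\<And>s. s \<in> nbrs V b \<Longrightarrow> x s \<in> Ch adj (V - {b, s}) k \<and> Lk (ed b s) c = bd (x s)"
    by metis
  define c0 where "c0 = c - (\<Sum>s\<in>nbrs V b. W (ed b s) (Lk (ed b s) c))"
  have c0: "c0 \<in> Ch adj (V - {b}) k" unfolding c0_def by (rule expand) (use V c in \<open>auto simp: Cy_def\<close>)
  define c' where "c' = c0 + (\<Sum>s\<in>nbrs V b. x s)"
  have "c - c' = (\<Sum>s\<in>nbrs V b. W (ed b s) (bd (x s)) - x s)"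
    using x by (simp add: c'_def c0_def sum_subtractf)
  also have "\<dots> = (\<Sum>s\<in>nbrs V b. - bd (W (ed b s) (x s)))"
  proof (intro sum.cong refl)
    fix s assume "s \<in> nbrs V b"
    then have "bd (W (ed b s) (x s)) = x s - W (ed b s) (bd (x s))"
      using x Ch_fin bd_W by blast
    then show "W (ed b s) (bd (x s)) - x s = - bd (W (ed b s) (x s))" by simp
  qed
  also have "\<dots> \<in> Bd adj V k"
  proof (intro Bd_cl bd_Ch_Bd W_Ch)
    fix s assume "s \<in> nbrs V b"
    then show "x s \<in> Ch adj (V - {b, s}) k" "s \<in> V" "adj b s" using x by (auto simp: nbrs_def)
  qed (use V in auto)
  finally have 1: "c - c' \<in> Bd adj V k" .
  have "c' \<in> Ch adj (V - {b}) k"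
    unfolding c'_def using x c0 by (intro Ch_cl) (auto intro: Ch_mono)
  moreover have "bd c' = 0" using Bd_Cy[OF 1] c by (simp add: bd_lin Cy_def)
  ultimately show ?thesis using 1 by (intro bexI[of _ c']) (auto simp: Cy_def)
qed

text \<open>
  Such a cycle lives in the star of the edge \<open>ab\<close>, and stars are contractible; the cone over \<open>c\<close>
  fills it.
\<close>

lemma star_null:
  assumes ab: "a \<in> V" "b \<in> V" "adj a b" and y: "y \<in> Ch adj (V - {a, b}) k" and c: "c \<in> Ch adj (V - {a, b}) (Suc k)"
    and z: "bd (W (ed a b) y + c) = 0"
  shows "W (ed a b) y + c \<in> Bd adj V (Suc k)"
proof -
  have 1: "y - W (ed a b) (bd y) + bd c = 0" using z by (simp add: bd_lin bd_W[OF Ch_fin[OF y]])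
  have ly: "Lk (ed a b) y = 0" "Lk (ed a b) (bd c) = 0"
    using Lk_0[OF y] Lk_0[OF c] bd_Lk[of "ed a b" c] by (auto simp: bd_lin)
  have "Lk (ed a b) (bd y) = 0" using ly bd_Lk[of "ed a b" y] by (simp add: bd_lin)
  moreover have "fin_chain (bd y)"
  proof (cases k)
    case 0
    then show ?thesis using Ch_0_Cy[of y] y by (simp add: fin_chain_def)
  next
    case (Suc k')
    then show ?thesis using bd_Ch[of y] y Ch_fin by metis
  qed
  ultimately have "Lk (ed a b) (W (ed a b) (bd y)) = bd y"
    using Lk_W_same[of "bd y" "ed a b"] by (simp add: W_lin)
  then have "bd y = 0" using arg_cong[OF 1, of "Lk (ed a b)"] ly by (simp add: Lk_lin)
  then have "y = - bd c" using 1 by (simp add: W_lin eq_neg_iff_add_eq_0)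
  then have "W (ed a b) y + c = bd (W (ed a b) c)" by (simp add: bd_W[OF Ch_fin[OF c]] W_lin)
  then show ?thesis using W_Ch[OF c ab] by (simp add: bd_Ch_Bd)
qed

end

text \<open>
  Exterior multiplication by \<open>ab - ac\<close>, the reduced \<open>0\<close>-cycle on the two edges of the path \<open>b\<close>,
  \<open>a\<close>, \<open>c\<close>. The vertex \<open>a\<close> is called the apex of the triple, \<open>b\<close> and \<open>c\<close> its leaves.
\<close>

definition Z :: "nat \<Rightarrow> nat \<Rightarrow> nat \<Rightarrow> (nat \<times> nat) chain \<Rightarrow> (nat \<times> nat) chain" where
  "Z a b c x = W (ed a b) x - W (ed a c) x"

context graph begin

lemma bd_Z: "x \<in> Cy adj V k \<Longrightarrow> bd (Z a b c x) = 0"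
  using bd_W[OF Ch_fin[of x adj V k]] by (simp add: Cy_def Z_def bd_lin W_lin)

text \<open>
  The inductive engine. Fix an edge \<open>ab\<close> and expand a cycle \<open>c\<close> at \<open>a\<close>. By \<open>hyp\<close>, each link
  \<open>Lk (ed a t) c\<close> with \<open>t\<close> other than \<open>b\<close> can be pushed off \<open>b\<close>, so it is homologous to a cycle
  \<open>y\<close> that avoids \<open>b\<close> as well; its contribution is \<open>Z a t b y\<close>, up to a boundary and up to
  chains that use no edge at \<open>a\<close> but \<open>ab\<close>. Expanding the remainder at \<open>b\<close> produces products
  \<open>Z b s a y\<close>, and what is left over is a cycle in the star of \<open>ab\<close>. Thus every cycle is a sum
  of products of a path through \<open>a\<close> and \<open>b\<close> with cycles on the other vertices, as soon as the
  double links bound.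
\<close>

lemma decompose:
  assumes V: "finite V" and ab: "a \<in> V" "b \<in> V" "adj a b" and c: "c \<in> Cy adj V (Suc k)"
    and S: "adgrp S" "Bd adj V (Suc k) \<subseteq> S"
    and hyp: "\<And>s t. s \<in> V \<Longrightarrow> t \<in> V \<Longrightarrow> distinct [a, b, s, t] \<Longrightarrow> adj b s \<Longrightarrow> adj a t \<Longrightarrow>
               Lk (ed b s) (Lk (ed a t) c) \<in> Bd adj (V - {a, b, s, t}) (k - 1)"
    and SA: "\<And>t y. t \<in> V \<Longrightarrow> t \<noteq> b \<Longrightarrow> adj a t \<Longrightarrow> y \<in> Cy adj (V - {a, t, b}) k \<Longrightarrow> Z a t b y \<in> S"
    and SB: "\<And>s y. s \<in> V \<Longrightarrow> s \<noteq> a \<Longrightarrow> adj b s \<Longrightarrow> y \<in> Cy adj (V - {b, s, a}) k \<Longrightarrow> Z b s a y \<in> S"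
  shows "c \<in> S"
proof -
  have bN: "b \<in> nbrs V a" and fN: "finite (nbrs V a)" using ab V by (auto simp: nbrs_def)
  have "\<exists>y x. y \<in> Cy adj (V - {a, t, b}) k \<and> x \<in> Ch adj (V - {a, t}) (Suc k) \<and> Lk (ed a t) c = y + bd x"
    if t: "t \<in> nbrs V a - {b}" for t
  proof -
    have tt: "t \<in> V" "adj a t" "t \<noteq> b" "a \<noteq> t" using t irr by (auto simp: nbrs_def)
    have "\<exists>c'\<in>Cy adj (V - {a, t} - {b}) k. Lk (ed a t) c - c' \<in> Bd adj (V - {a, t}) k"
    proof (rule push_off)
      fix s assume s: "s \<in> nbrs (V - {a, t}) b"
      then have "distinct [a, b, s, t]" using tt ab irr by (auto simp: nbrs_def)
      moreover have "V - {a, t} - {b, s} = V - {a, b, s, t}" by auto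
      ultimately show "Lk (ed b s) (Lk (ed a t) c) \<in> Bd adj (V - {a, t} - {b, s}) (k - 1)"
        using hyp[of s t] s tt by (auto simp: nbrs_def)
    qed (use V ab tt c irr in \<open>auto intro: Lk_Cy\<close>)
    moreover have "V - {a, t} - {b} = V - {a, t, b}" by auto
    ultimately obtain y x where "y \<in> Cy adj (V - {a, t, b}) k" "x \<in> Ch adj (V - {a, t}) (Suc k)" "Lk (ed a t) c - y = bd x"
      by (auto simp: Bd_def)
    then show ?thesis by (intro exI[of _ y] exI[of _ x]) (auto simp: algebra_simps)
  qed
  then obtain y x where yx: "\<And>t. t \<in> nbrs V a - {b} \<Longrightarrow> y t \<in> Cy adj (V - {a, t, b}) k \<and> x t \<in> Ch adj (V - {a, t}) (Suc k) \<and> Lk (ed a t) c = y t + bd (x t)"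
    by metis
  define T where "T = nbrs V a - {b}"
  have T: "t \<in> V" "adj a t" "t \<noteq> b" if "t \<in> T" for t using that by (auto simp: T_def nbrs_def)
  have fT: "finite T" using fN by (simp add: T_def)
  define c0 where "c0 = c - (\<Sum>t\<in>nbrs V a. W (ed a t) (Lk (ed a t) c))"
  have c0: "c0 \<in> Ch adj (V - {a}) (Suc k)" unfolding c0_def by (rule expand) (use V c ab in \<open>auto simp: Cy_def\<close>)
  define q where "q = Lk (ed a b) c + (\<Sum>t\<in>T. y t)"
  define r where "r = c0 + (\<Sum>t\<in>T. x t)"
  have q: "q \<in> Ch adj (V - {a, b}) k"
    unfolding q_def using c yx by (intro Ch_cl Lk_Ch) (auto simp: Cy_def T_def intro: Ch_mono)
  have r: "r \<in> Ch adj (V - {a}) (Suc k)"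
    unfolding r_def using c0 yx by (intro Ch_cl) (auto simp: T_def intro: Ch_mono)
  have "c = c0 + (\<Sum>t\<in>nbrs V a. W (ed a t) (Lk (ed a t) c))" by (simp add: c0_def)
  also have "(\<Sum>t\<in>nbrs V a. W (ed a t) (Lk (ed a t) c)) = W (ed a b) (Lk (ed a b) c) + (\<Sum>t\<in>T. W (ed a t) (Lk (ed a t) c))"
    unfolding T_def by (rule sum.remove[OF fN bN])
  also have "(\<Sum>t\<in>T. W (ed a t) (Lk (ed a t) c)) = (\<Sum>t\<in>T. Z a t b (y t) + W (ed a b) (y t) + x t - bd (W (ed a t) (x t)))"
  proof (intro sum.cong refl)
    fix t assume "t \<in> T"
    then have t: "t \<in> nbrs V a - {b}" by (simp add: T_def)
    have "bd (W (ed a t) (x t)) = x t - W (ed a t) (bd (x t))"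
      using yx[OF t] Ch_fin bd_W by blast
    then show "W (ed a t) (Lk (ed a t) c) = Z a t b (y t) + W (ed a b) (y t) + x t - bd (W (ed a t) (x t))"
      using yx[OF t] by (simp add: Z_def W_lin)
  qed
  finally have ceq: "c = (W (ed a b) q + r) + (\<Sum>t\<in>T. Z a t b (y t) - bd (W (ed a t) (x t)))"
    by (simp add: q_def r_def W_lin sum.distrib sum_subtractf algebra_simps)
  have part: "(\<Sum>t\<in>T. Z a t b (y t) - bd (W (ed a t) (x t))) \<in> S"
  proof (intro adgrp_sum adgrp_diff S(1))
    fix t assume t: "t \<in> T"
    show "Z a t b (y t) \<in> S" using SA[of t "y t"] T[OF t] yx[of t] t by (auto simp: T_def)
    show "bd (W (ed a t) (x t)) \<in> S"
      using yx[of t] t T[OF t] ab by (intro subsetD[OF S(2)] bd_Ch_Bd W_Ch) (auto simp: T_def)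
  qed
  have bdZ: "bd (Z a t b (y t)) = 0" if "t \<in> T" for t
    using yx[of t] that bd_Z[of "y t"] by (auto simp: T_def)
  have "bd (\<Sum>t\<in>T. Z a t b (y t) - bd (W (ed a t) (x t))) = 0"
    using bdZ by (simp add: bd_lin)
  then have cyc: "bd (W (ed a b) q + r) = 0"
    using arg_cong[OF ceq, of bd] c by (simp add: bd_lin Cy_def)
  define U where "U = nbrs (V - {a}) b"
  define r0 where "r0 = r - (\<Sum>s\<in>U. W (ed b s) (Lk (ed b s) r))"
  have r0: "r0 \<in> Ch adj (V - {a} - {b}) (Suc k)" unfolding r0_def U_def
    by (rule expand) (use V ab irr r in auto)
  have rs: "Lk (ed b s) r \<in> Cy adj (V - {b, s, a}) k" if "s \<in> U" for s
  proof -
    have "V - {a} - {b, s} = V - {b, s, a}" by auto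
    then have 1: "Lk (ed b s) r \<in> Ch adj (V - {b, s, a}) k" using Lk_Ch[OF r, of b s] by simp
    have ne: "ed b s \<noteq> ed a b" using that by (auto simp: U_def nbrs_def ed_eq_iff)
    have z: "Lk (ed b s) q = 0" by (rule Lk_0[OF q]) simp
    then have "Lk (ed b s) (bd q) = 0" using bd_Lk[of "ed b s" q] by (simp add: bd_lin)
    then have "Lk (ed b s) (bd (W (ed a b) q)) = 0"
      using z by (simp add: bd_W[OF Ch_fin[OF q]] Lk_lin Lk_W[OF ne] W_lin)
    moreover have "Lk (ed b s) (bd (W (ed a b) q)) + Lk (ed b s) (bd r) = 0"
      using arg_cong[OF cyc, of "Lk (ed b s)"] by (simp add: bd_lin Lk_lin)
    ultimately show ?thesis using 1 by (simp add: Cy_def bd_Lk)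
  qed
  have req: "W (ed a b) q + r = (W (ed a b) (q + (\<Sum>s\<in>U. Lk (ed b s) r)) + r0) + (\<Sum>s\<in>U. Z b s a (Lk (ed b s) r))"
    by (simp add: r0_def Z_def W_lin sum_subtractf ed_commute[of b a])
  have Zs: "(\<Sum>s\<in>U. Z b s a (Lk (ed b s) r)) \<in> S"
    using SB rs by (intro adgrp_sum S(1)) (auto simp: U_def nbrs_def)
  have stn: "W (ed a b) (q + (\<Sum>s\<in>U. Lk (ed b s) r)) + r0 \<in> Bd adj V (Suc k)"
  proof (rule star_null)
    show "q + (\<Sum>s\<in>U. Lk (ed b s) r) \<in> Ch adj (V - {a, b}) k"
      using q rs by (intro Ch_cl) (auto simp: Cy_def intro: Ch_mono)
    have "V - {a} - {b} = V - {a, b}" by auto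
    then show "r0 \<in> Ch adj (V - {a, b}) (Suc k)" using r0 by simp
    have "bd (\<Sum>s\<in>U. Z b s a (Lk (ed b s) r)) = 0"
      using bd_Z[OF rs] by (simp add: bd_lin)
    then show "bd (W (ed a b) (q + (\<Sum>s\<in>U. Lk (ed b s) r)) + r0) = 0"
      using cyc unfolding req by (simp only: additive.add[OF fadd_bd] add_0_right)
  qed (use ab in auto)
  have "W (ed a b) q + r \<in> S"
    unfolding req by (rule adgrp_add[OF S(1) subsetD[OF S(2) stn] Zs])
  then have "(W (ed a b) q + r) + (\<Sum>t\<in>T. Z a t b (y t) - bd (W (ed a t) (x t))) \<in> S"
    using part by (rule adgrp_add[OF S(1)])
  then show ?thesis by (simp only: ceq[symmetric])
qed

end

section \<open>Products of chains\<close>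

text \<open>
  \<open>mul\<close> is the exterior product; listing a face increasingly and multiplying by its edges from
  the left makes the sign of the shuffle come out automatically. It is used for chains on
  disjoint vertex sets, where it is the chain of the join.
\<close>

definition wl :: "'e::linorder list \<Rightarrow> 'e chain \<Rightarrow> 'e chain" where "wl es d = foldr W es d"

definition mul :: "'e::linorder chain \<Rightarrow> 'e chain \<Rightarrow> 'e chain" where
  "mul c d = frag_extend (\<lambda>\<sigma>. wl (sorted_list_of_set \<sigma>) d) c"

lemma frag_cmul_minus2 [simp]: "frag_cmul n (- x) = frag_cmul (- n) x"
  by (metis frag_cmul_cmul frag_cmul_minus_one mult_minus1_right)

lemma wl_simps [simp]: "wl [] d = d" "wl (e # es) d = W e (wl es d)" by (simp_all add: wl_def)
lemma fadd_wl: "fadd (wl es)"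
  by (induction es) (auto simp: additive_def W_lin)
lemma fadd_mul1: "fadd (\<lambda>c. mul c d)" unfolding mul_def by (rule fadd_frag_extend)
lemma fadd_mul2: "fadd (\<lambda>d. mul c d)"
proof -
  have "mul c (x + y) = mul c x + mul c y" for x y
    by (rule fadd_eqI[of "\<lambda>c. mul c (x + y)" "\<lambda>c. mul c x + mul c y" c UNIV])
       (auto intro!: fadd_intros fadd_frag_extend simp: mul_def additive.add[OF fadd_wl])
  then show ?thesis by (simp add: additive_def)
qed
lemmas mul_lin1 = additive.add[OF fadd_mul1] additive.diff[OF fadd_mul1] additive.minus[OF fadd_mul1]
  additive.zero[OF fadd_mul1] additive.sum[OF fadd_mul1] fadd_cmul[OF fadd_mul1]
lemmas mul_lin2 = additive.add[OF fadd_mul2] additive.diff[OF fadd_mul2] additive.minus[OF fadd_mul2]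
  additive.zero[OF fadd_mul2] additive.sum[OF fadd_mul2] fadd_cmul[OF fadd_mul2]

lemma mul_one [simp]: "mul (frag_of {}) d = d" by (simp add: mul_def)

lemma W_wl_0: "e \<in> set es \<Longrightarrow> W e (wl es d) = 0"
proof (induction es)
  case (Cons f es)
  then show ?case by (cases "e = f") (auto simp: W_W[of e f] W_lin)
qed simp

lemma wl_insort:
  assumes "sorted es" "distinct es" "e \<notin> set es"
  shows "wl (insort e es) d = frag_cmul (sg e (set es)) (W e (wl es d))"
  using assms
proof (induction es)
  case Nil then show ?case by (simp add: sg_def)
next
  case (Cons f es)
  show ?case
  proof (cases "e < f")
    case True
    then have "{u \<in> set (f # es). u < e} = {}" using Cons.prems by auto
    then have "sg e (set (f # es)) = 1" unfolding sg_def by (metis card.empty power_0)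
    then show ?thesis using True by (simp add: less_imp_le)
  next
    case False
    then have "f < e" using Cons.prems by auto
    then show ?thesis using Cons False by (simp add: sg_insert W_lin W_W[of e f])
  qed
qed

lemma mul_W: assumes "fin_chain c" shows "mul (W e c) d = W e (mul c d)"
proof (rule fadd_eqI[of "\<lambda>c. mul (W e c) d" "\<lambda>c. W e (mul c d)" c "Collect finite"])
  show "fadd (\<lambda>c. mul (W e c) d)" by (simp add: additive_def W_lin mul_lin1)
  show "fadd (\<lambda>c. W e (mul c d))" by (simp add: additive_def W_lin mul_lin1)
  fix \<sigma> :: "'a set" assume s: "\<sigma> \<in> Collect finite"
  show "mul (W e (frag_of \<sigma>)) d = W e (mul (frag_of \<sigma>) d)"
  proof (cases "e \<in> \<sigma>")
    case True
    then show ?thesis using s by (simp add: W_of mul_lin1 mul_def W_wl_0)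
  next
    case False
    then show ?thesis using s by (simp add: W_of mul_lin1) (simp add: mul_def wl_insort)
  qed
qed (use assms in \<open>simp add: fin_chain_def\<close>)

lemma fin_chain_of [simp]: "fin_chain (frag_of \<sigma>) \<longleftrightarrow> finite \<sigma>"
  by (simp add: fin_chain_def keys_frag_of)
lemma fin_chain_cmul: "fin_chain c \<Longrightarrow> fin_chain (frag_cmul n c)"
  using keys_cmul by (fastforce simp: fin_chain_def)
lemma fin_chain_sum: "(\<And>i. i \<in> I \<Longrightarrow> fin_chain (f i)) \<Longrightarrow> fin_chain (sum f I)"
  using keys_sum[of f I] by (fastforce simp: fin_chain_def)
lemma fin_chain_diff: "fin_chain c \<Longrightarrow> fin_chain d \<Longrightarrow> fin_chain (c - d)"
  using keys_diff[of c d] by (fastforce simp: fin_chain_def)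
lemma fin_chain_zero [simp]: "fin_chain 0" by (simp add: fin_chain_def)

lemma fin_chain_map:
  assumes "fin_chain c" "fadd f" "\<And>\<sigma>. finite \<sigma> \<Longrightarrow> fin_chain (f (frag_of \<sigma>))"
  shows "fin_chain (f c)"
  using assms(1) unfolding fin_chain_def[of c]
  by (induction c rule: frag_induction)
     (use assms(2-) in \<open>auto simp: additive.zero additive.diff fin_chain_diff\<close>)

lemma fin_chain_W: "fin_chain c \<Longrightarrow> fin_chain (W e c)"
  by (rule fin_chain_map[OF _ fadd_W]) (auto simp: W_of intro: fin_chain_cmul)
lemma fin_chain_bd: "fin_chain c \<Longrightarrow> fin_chain (bd c)"
  by (rule fin_chain_map[OF _ fadd_bd])
     (auto simp: bd_of[OF _ order_refl] Lk_of intro!: fin_chain_cmul fin_chain_sum)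
lemma fin_chain_Z: "fin_chain c \<Longrightarrow> fin_chain (Z a b c' c)"
  by (simp add: Z_def fin_chain_W fin_chain_diff)

text \<open>
  Inserting a new least edge into a face costs no sign, so faces can be built up by \<open>W\<close>.
\<close>

lemma fin_set_W_induct [consumes 1, case_names empty W]:
  assumes "finite (\<sigma> :: 'e::linorder set)" "P {}"
    "\<And>e \<tau>. finite \<tau> \<Longrightarrow> e \<notin> \<tau> \<Longrightarrow> frag_of (insert e \<tau>) = W e (frag_of \<tau>) \<Longrightarrow> P \<tau> \<Longrightarrow> P (insert e \<tau>)"
  shows "P \<sigma>"
  using assms(1)
proof (induction "\<sigma>" rule: finite_linorder_min_induct)
  case (insert e \<tau>)
  have no: "{u \<in> \<tau>. u < e} = {}" using insert(2) less_asym by blast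
  have "sg e \<tau> = 1" unfolding sg_def no by simp
  moreover have ni: "e \<notin> \<tau>" using insert(2) by blast
  ultimately have "frag_of (insert e \<tau>) = W e (frag_of \<tau>)" using insert(1) by (simp add: W_of)
  then show ?case using assms(3)[OF insert(1) ni] insert(3) by blast
qed (rule assms(2))

text \<open>
  The degree enters the signs of the product rules, so it has to be tracked for the left factor.
\<close>

definition homog :: "nat \<Rightarrow> 'e chain \<Rightarrow> bool" where
  "homog k c \<longleftrightarrow> Poly_Mapping.keys c \<subseteq> {\<sigma>. finite \<sigma> \<and> card \<sigma> = k}"

lemma Ch_homog: "c \<in> Ch adj V k \<Longrightarrow> homog k c" by (auto simp: homog_def Ch_def mtch_def)

abbreviation ncmul :: "nat \<Rightarrow> ('a \<Rightarrow>\<^sub>0 int) \<Rightarrow> ('a \<Rightarrow>\<^sub>0 int)" where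
  "ncmul k \<equiv> frag_cmul ((-1) ^ k)"

lemma ncmul_ncmul: "ncmul k (ncmul k x) = x"
proof -
  have "((-1) ^ k * (-1) ^ k :: int) = 1" by (simp flip: power_mult_distrib)
  then show ?thesis unfolding frag_cmul_cmul by simp
qed

lemma mul_W_right: assumes "homog k c" shows "mul c (W e d) = ncmul k (W e (mul c d))"
proof (rule fadd_eqI[of "\<lambda>c. mul c (W e d)" "\<lambda>c. ncmul k (W e (mul c d))" c "{\<sigma>. finite \<sigma> \<and> card \<sigma> = k}"])
  show "fadd (\<lambda>c. ncmul k (W e (mul c d))) "
    by (simp add: additive_def mul_lin1 W_lin frag_cmul_distrib2)
  fix \<sigma> :: "'a set" assume "\<sigma> \<in> {\<sigma>. finite \<sigma> \<and> card \<sigma> = k}"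
  then have "finite \<sigma>" "card \<sigma> = k" by auto
  then show "mul (frag_of \<sigma>) (W e d) = ncmul k (W e (mul (frag_of \<sigma>) d))"
  proof (induction \<sigma> arbitrary: k rule: fin_set_W_induct)
    case (W f \<tau>)
    then show ?case using W_W[of f e "mul (frag_of \<tau>) d"] by (auto simp: mul_W W_lin)
  qed simp
qed (use assms in \<open>auto intro: fadd_mul1 simp: homog_def\<close>)

lemma bd_mul: assumes "homog k c" "fin_chain d" shows "bd (mul c d) = mul (bd c) d + ncmul k (mul c (bd d))"
proof (rule fadd_eqI[of "\<lambda>c. bd (mul c d)" "\<lambda>c. mul (bd c) d + ncmul k (mul c (bd d))" c "{\<sigma>. finite \<sigma> \<and> card \<sigma> = k}"])
  show "fadd (\<lambda>c. bd (mul c d)) "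
    by (simp add: additive_def mul_lin1 bd_lin)
  show "fadd (\<lambda>c. mul (bd c) d + ncmul k (mul c (bd d))) "
    by (simp add: additive_def mul_lin1 bd_lin frag_cmul_distrib2)
  fix \<sigma> :: "'a set" assume "\<sigma> \<in> {\<sigma>. finite \<sigma> \<and> card \<sigma> = k}"
  then have "finite \<sigma>" "card \<sigma> = k" by auto
  then show "bd (mul (frag_of \<sigma>) d) = mul (bd (frag_of \<sigma>)) d + ncmul k (mul (frag_of \<sigma>) (bd d))"
  proof (induction \<sigma> arbitrary: k rule: fin_set_W_induct)
    case empty
    then show ?case by (simp add: mul_lin1 bd_def simplicial_boundary_of)
  next
    case (W f \<tau>)
    have fm: "fin_chain (mul (frag_of \<tau>) d)"
      using W(1) by (induction \<tau> rule: fin_set_W_induct) (simp_all add: mul_W fin_chain_W assms(2))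
    have k: "k = Suc (card \<tau>)" using W by simp
    show ?case
      unfolding k using W(1-3) W(4)[of "card \<tau>"] fm
      by (simp add: mul_W bd_W mul_lin1 fin_chain_bd W_lin)
  qed
qed (use assms in \<open>auto simp: homog_def\<close>)

context graph begin

lemma mul_Ch:
  assumes c: "c \<in> Ch adj V1 k" and d: "d \<in> Ch adj V2 l" and V: "V1 \<inter> V2 = {}" "V1 \<subseteq> V" "V2 \<subseteq> V"
  shows "mul c d \<in> Ch adj V (k + l)"
  using c
proof (rule Ch_map[of c adj V1 k "\<lambda>c. mul c d" "Ch adj V (k + l)"])
  have gen: "mul (frag_of \<sigma>) d \<in> Ch adj V (card \<sigma> + l)" if "finite \<sigma>" "\<sigma> \<in> mtch adj V1" "V1 \<inter> V2 = {}" "V1 \<subseteq> V" "V2 \<subseteq> V" for \<sigma> V1 V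
    using that
  proof (induction \<sigma> arbitrary: V V1 rule: fin_set_W_induct)
    case empty
    then show ?case using d by (auto intro: Ch_mono)
  next
    case (W e \<tau>)
    obtain u v where uv: "e = ed u v" "u \<in> V1" "v \<in> V1" "adj u v"
      using W(5) by (auto simp: mtch_def)
    have t: "\<tau> \<in> mtch adj (V1 - {u, v})"
      using mtch_remove[OF W(5), of u v] uv W(2) by simp
    have "mul (frag_of \<tau>) d \<in> Ch adj (V - {u, v}) (card \<tau> + l)"
      by (rule W(4)[OF t]) (use W uv in auto)
    then have "W e (mul (frag_of \<tau>) d) \<in> Ch adj V (Suc (card \<tau> + l))"
      unfolding uv(1) by (rule W_Ch) (use uv W in auto)
    then show ?case using W by (simp add: mul_W)
  qed
  fix \<sigma> assume "\<sigma> \<in> mtch adj V1" "card \<sigma> = k"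
  then show "mul (frag_of \<sigma>) d \<in> Ch adj V (k + l)" using gen[of \<sigma> V1 V] V by (auto simp: mtch_def)
qed (auto intro: fadd_mul1 adgrp_Ch)

lemma mul_Cy:
  assumes c: "c \<in> Cy adj V1 k" and d: "d \<in> Cy adj V2 l" and V: "V1 \<inter> V2 = {}" "V1 \<subseteq> V" "V2 \<subseteq> V"
  shows "mul c d \<in> Cy adj V (k + l)"
  using mul_Ch[of c V1 k d V2 l V] assms bd_mul[OF Ch_homog Ch_fin, of c adj V1 k d adj V2 l]
  by (auto simp: Cy_def mul_lin1 mul_lin2)

lemma mul_Bd1:
  assumes c: "c \<in> Bd adj V1 k" and d: "d \<in> Cy adj V2 l" and V: "V1 \<inter> V2 = {}" "V1 \<subseteq> V" "V2 \<subseteq> V"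
  shows "mul c d \<in> Bd adj V (k + l)"
proof -
  obtain x where x: "x \<in> Ch adj V1 (Suc k)" "c = bd x" using c by (auto simp: Bd_def)
  have "bd (mul x d) = mul c d"
    using bd_mul[OF Ch_homog[OF x(1)] Ch_fin, of d adj V2 l] d x by (simp add: Cy_def mul_lin2)
  moreover have "mul x d \<in> Ch adj V (Suc (k + l))"
    using mul_Ch[OF x(1), of d V2 l V] d V by (simp add: Cy_def)
  ultimately show ?thesis unfolding Bd_def by (metis imageI)
qed

lemma mul_Bd2:
  assumes c: "c \<in> Cy adj V1 k" and d: "d \<in> Bd adj V2 l" and V: "V1 \<inter> V2 = {}" "V1 \<subseteq> V" "V2 \<subseteq> V"
  shows "mul c d \<in> Bd adj V (k + l)"
proof -
  obtain x where x: "x \<in> Ch adj V2 (Suc l)" "d = bd x" using d by (auto simp: Bd_def)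
  have "bd (mul c x) = ncmul k (mul c d)"
    using bd_mul[OF Ch_homog Ch_fin, of c adj V1 k x adj V2 "Suc l"] c x by (simp add: Cy_def mul_lin1)
  moreover have "mul c x \<in> Ch adj V (Suc (k + l))"
    using mul_Ch[of c V1 k x V2 "Suc l" V] c x V by (simp add: Cy_def)
  ultimately have "ncmul k (mul c d) \<in> Bd adj V (k + l)" unfolding Bd_def by (metis imageI)
  then have "ncmul k (ncmul k (mul c d)) \<in> Bd adj V (k + l)" by (rule Bd_cl(6))
  then show ?thesis by (simp only: ncmul_ncmul)
qed

end

section \<open>Products of triples\<close>

type_synonym triple = "nat \<times> nat \<times> nat"

definition Zt :: "triple \<Rightarrow> (nat \<times> nat) chain \<Rightarrow> (nat \<times> nat) chain" where
  "Zt t = (case t of (a, b, c) \<Rightarrow> Z a b c)"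
lemma Zt_simp [simp]: "Zt (a, b, c) = Z a b c" by (simp add: Zt_def)

definition prodT :: "triple list \<Rightarrow> (nat \<times> nat) chain \<Rightarrow> (nat \<times> nat) chain" where
  "prodT L x = foldr Zt L x"
lemma prodT_simps [simp]: "prodT [] x = x" "prodT (t # L) x = Zt t (prodT L x)"
  "prodT (L @ L') x = prodT L (prodT L' x)"
  by (simp_all add: prodT_def)

text \<open>
  For disjoint triples, this is the fundamental cycle of a sphere, the join of one pair of
  points for each triple of the list.
\<close>

abbreviation PT :: "triple list \<Rightarrow> (nat \<times> nat) chain" where "PT L \<equiv> prodT L (frag_of {})"

definition tv :: "triple \<Rightarrow> nat set" where "tv t = (case t of (a, b, c) \<Rightarrow> {a, b, c})"
lemma tv_simp [simp]: "tv (a, b, c) = {a, b, c}" by (simp add: tv_def)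
definition Tv :: "triple list \<Rightarrow> nat set" where "Tv L = (\<Union>t\<in>set L. tv t)"
lemma Tv_simps [simp]: "Tv [] = {}" "Tv (t # L) = tv t \<union> Tv L" "Tv (L @ L') = Tv L \<union> Tv L'"
  by (auto simp: Tv_def)

definition cherry :: "(nat \<Rightarrow> nat \<Rightarrow> bool) \<Rightarrow> triple \<Rightarrow> bool" where
  "cherry adj t = (case t of (a, b, c) \<Rightarrow> adj a b \<and> adj a c \<and> b \<noteq> c)"
lemma cherry_simp [simp]: "cherry adj (a, b, c) \<longleftrightarrow> adj a b \<and> adj a c \<and> b \<noteq> c" by (simp add: cherry_def)

fun valid :: "(nat \<Rightarrow> nat \<Rightarrow> bool) \<Rightarrow> triple list \<Rightarrow> bool" where
  "valid adj [] \<longleftrightarrow> True"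
| "valid adj (t # L) \<longleftrightarrow> cherry adj t \<and> tv t \<inter> Tv L = {} \<and> valid adj L"

lemma valid_append: "valid adj (L @ L') \<longleftrightarrow> valid adj L \<and> valid adj L' \<and> Tv L \<inter> Tv L' = {}"
  by (induction L) auto

lemma fadd_Z: "fadd (Z a b c)"
  by (simp add: additive_def Z_def W_lin)
lemma fadd_Zt: "fadd (Zt t)" by (cases t) (simp add: fadd_Z)
lemmas Z_lin = additive.add[OF fadd_Z] additive.diff[OF fadd_Z] additive.minus[OF fadd_Z]
  additive.zero[OF fadd_Z] additive.sum[OF fadd_Z] fadd_cmul[OF fadd_Z]
lemmas Zt_lin = additive.add[OF fadd_Zt] additive.diff[OF fadd_Zt] additive.minus[OF fadd_Zt]
  additive.zero[OF fadd_Zt] additive.sum[OF fadd_Zt] fadd_cmul[OF fadd_Zt]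
lemma Z_W: "Z a b c (W e x) = - W e (Z a b c x)"
  by (simp add: Z_def W_lin W_W[of _ e])
lemma Z_Z: "Z a b c (Z a' b' c' x) = - Z a' b' c' (Z a b c x)"
  by (simp add: Z_def[of a' b' c'] Z_lin Z_W)
lemma Zt_Zt: "Zt t (Zt t' x) = - Zt t' (Zt t x)"
  unfolding Zt_def by (auto split: prod.splits intro: Z_Z)
lemma Zt_prodT: "Zt t (prodT L x) = ncmul (length L) (prodT L (Zt t x))"
  by (induction L) (simp_all add: Zt_Zt[of t] Zt_lin)

lemma mul_Z: "fin_chain c \<Longrightarrow> mul (Z a b c' c) d = Z a b c' (mul c d)"
  by (simp add: Z_def mul_lin1 mul_W)
lemma fin_chain_prodT: "fin_chain c \<Longrightarrow> fin_chain (prodT L c)"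
  by (induction L) (auto simp: Zt_def fin_chain_Z split: prod.splits)
lemma mul_prodT: "fin_chain c \<Longrightarrow> mul (prodT L c) d = prodT L (mul c d)"
  by (induction L) (auto simp: Zt_def mul_Z fin_chain_prodT split: prod.splits)
lemma prodT_eq_mul: "prodT L d = mul (PT L) d"
  by (simp add: mul_prodT)

lemma mul_Z_right: "homog k c \<Longrightarrow> mul c (Z a b c' d) = ncmul k (Z a b c' (mul c d))"
  by (simp add: Z_def mul_lin2 mul_W_right frag_cmul_distrib2 flip: minus_frag_cmul)
     (simp add: diff_conv_add_uminus frag_cmul_distrib2 del: add_uminus_conv_diff)

text \<open>
  Triples anticommute. The sign depends only on the permutation of the index list, and not on
  the triples, so the same sign serves two products whose triples are arranged in the same way.
\<close>

lemma prodT_perm_map: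
  assumes "mset is = mset js"
  shows "\<exists>\<epsilon>. (\<epsilon> = 1 \<or> \<epsilon> = -1) \<and> (\<forall>T x. prodT (map T is) x = frag_cmul \<epsilon> (prodT (map T js) x))"
  using assms
proof (induction "is" arbitrary: js)
  case Nil then show ?case by (auto intro: exI[of _ 1])
next
  case (Cons t "is")
  then have "t \<in> set js" by (metis list.set_intros(1) mset_eq_setD)
  then obtain A B where js: "js = A @ t # B" by (meson split_list)
  then have "mset is = mset (A @ B)" using Cons by simp
  then obtain \<epsilon> where e: "\<epsilon> = 1 \<or> \<epsilon> = -1" "\<And>T x. prodT (map T is) x = frag_cmul \<epsilon> (prodT (map T (A @ B)) x)"
    using Cons.IH by blast
  have "prodT (map T (t # is)) x = frag_cmul (\<epsilon> * (-1) ^ length A) (prodT (map T js) x)" for T x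
    by (simp add: e(2) js Zt_lin) (simp add: Zt_prodT)
  moreover have "\<epsilon> * (-1) ^ length A = 1 \<or> \<epsilon> * (-1) ^ length A = -1"
    using e(1) minus_one_power_iff[of "length A", where 'a=int] by auto
  ultimately show ?case by blast
qed

lemma prodT_perm:
  assumes "mset L = mset L'"
  shows "\<exists>\<epsilon>. (\<epsilon> = 1 \<or> \<epsilon> = -1) \<and> (\<forall>x. prodT L x = frag_cmul \<epsilon> (prodT L' x))"
  using prodT_perm_map[OF assms] by (metis list.map_ident)

context graph begin

lemma Z_Ch:
  assumes "c \<in> Ch adj (V - {x, y, z}) k" "x \<in> V" "y \<in> V" "z \<in> V" "adj x y" "adj x z"
  shows "Z x y z c \<in> Ch adj V (Suc k)"
  unfolding Z_def using assms by (intro Ch_cl W_Ch) (auto intro: Ch_mono)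

lemma Z_Cy:
  assumes "c \<in> Cy adj (V - {x, y, z}) k" "x \<in> V" "y \<in> V" "z \<in> V" "adj x y" "adj x z"
  shows "Z x y z c \<in> Cy adj V (Suc k)"
  using Z_Ch[of c V x y z k] bd_Z[OF assms(1)] assms by (simp add: Cy_def)

lemma bd_Z_Ch: "x \<in> Ch adj V k \<Longrightarrow> bd (Z a b c x) = - Z a b c (bd x)"
  using bd_W[OF Ch_fin[of x adj V k]] by (simp add: Z_def bd_lin W_lin)

lemma Z_Bd:
  assumes "c \<in> Bd adj (V - {x, y, z}) k" "x \<in> V" "y \<in> V" "z \<in> V" "adj x y" "adj x z"
  shows "Z x y z c \<in> Bd adj V (Suc k)"
proof -
  obtain e where e: "e \<in> Ch adj (V - {x, y, z}) (Suc k)" "c = bd e" using assms(1) by (auto simp: Bd_def)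
  have "Z x y z c = bd (- Z x y z e)" using bd_Z_Ch[OF e(1)] e(2) by (simp add: bd_lin)
  then show ?thesis using Z_Ch[OF e(1) assms(2-)] by (simp add: bd_Ch_Bd Ch_cl)
qed

text \<open>A cycle that avoids both ends of an edge bounds the cone over it.\<close>

lemma W_Cy_free:
  assumes "p \<in> V" "q \<in> V" "adj p q" "c \<in> Cy adj (V - {p, q}) k"
  shows "c \<in> Bd adj V k"
proof -
  have "c = bd (W (ed p q) c)" using assms bd_W[OF Ch_fin[of c adj "V - {p, q}" k]] by (auto simp: Cy_def W_lin)
  then show ?thesis using W_Ch[of c V p q k] assms bd_Ch_Bd by (metis (no_types, lifting) Cy_def mem_Collect_eq)
qed

lemma cherry_Zt_Cy: "cherry adj t \<Longrightarrow> tv t \<subseteq> V \<Longrightarrow> x \<in> Cy adj (V - tv t) k \<Longrightarrow> Zt t x \<in> Cy adj V (Suc k)"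
  by (cases t) (auto intro!: Z_Cy)
lemma prodT_Cy: "valid adj L \<Longrightarrow> Tv L \<subseteq> V \<Longrightarrow> x \<in> Cy adj (V - Tv L) k \<Longrightarrow> prodT L x \<in> Cy adj V (k + length L)"
proof (induction L arbitrary: V)
  case (Cons t L)
  have "V - tv t - Tv L = V - Tv (t # L)" by auto
  then have "prodT L x \<in> Cy adj (V - tv t) (k + length L)" using Cons by (intro Cons.IH) auto
  then show ?case using Cons.prems cherry_Zt_Cy by simp
qed simp
lemma PT_Cy: "valid adj L \<Longrightarrow> Tv L \<subseteq> V \<Longrightarrow> PT L \<in> Cy adj V (length L)"
  using prodT_Cy[of L V "frag_of {}" 0] by simp

end

section \<open>Spans of triple products\<close>

definition addspan :: "'a::ab_group_add set \<Rightarrow> 'a set" where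
  "addspan B0 = \<Inter>{S. adgrp S \<and> B0 \<subseteq> S}"

lemma addspan_base: "x \<in> B0 \<Longrightarrow> x \<in> addspan B0"
  by (auto simp: addspan_def)

lemma adgrp_addspan: "adgrp (addspan B0)"
  unfolding addspan_def by (auto simp: adgrp_def)

lemma addspan_map:
  assumes "x \<in> addspan B0" "fadd f" "adgrp S" "\<And>x. x \<in> B0 \<Longrightarrow> f x \<in> S"
  shows "f x \<in> S"
proof -
  have "adgrp {x. f x \<in> S}"
    using assms(3) additive.zero[OF assms(2)] additive.diff[OF assms(2)] by (simp add: adgrp_def)
  then show ?thesis using assms(1,4) by (auto simp: addspan_def)
qed

lemma addspan_sub: "x \<in> addspan B0 \<Longrightarrow> adgrp S \<Longrightarrow> B0 \<subseteq> S \<Longrightarrow> x \<in> S"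
  using addspan_map[of x B0 "\<lambda>x. x" S] by (auto simp: fadd_id)

definition triple_span where
  "triple_span adj V k = addspan ({PT L | L. valid adj L \<and> Tv L \<subseteq> V \<and> length L = k} \<union> Bd adj V k)"

lemma adgrp_triple_span: "adgrp (triple_span adj V k)" unfolding triple_span_def by (rule adgrp_addspan)
lemmas triple_span_cl = adgrp_zero[OF adgrp_triple_span] adgrp_diff[OF adgrp_triple_span] adgrp_neg[OF adgrp_triple_span] adgrp_add[OF adgrp_triple_span]
  adgrp_sum[OF adgrp_triple_span] adgrp_cmul[OF adgrp_triple_span]
lemma PT_triple_span: "valid adj L \<Longrightarrow> Tv L \<subseteq> V \<Longrightarrow> length L = k \<Longrightarrow> PT L \<in> triple_span adj V k"
  unfolding triple_span_def by (rule addspan_base) auto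
lemma Bd_triple_span: "x \<in> Bd adj V k \<Longrightarrow> x \<in> triple_span adj V k"
  unfolding triple_span_def by (rule addspan_base) auto
lemma triple_span_map:
  assumes "x \<in> triple_span adj V k" "fadd f" "adgrp S"
    "\<And>L. valid adj L \<Longrightarrow> Tv L \<subseteq> V \<Longrightarrow> length L = k \<Longrightarrow> f (PT L) \<in> S"
    "\<And>x. x \<in> Bd adj V k \<Longrightarrow> f x \<in> S"
  shows "f x \<in> S"
  using assms(1) unfolding triple_span_def by (rule addspan_map) (use assms in auto)

lemma Ch_0_triple_span: assumes "c \<in> Ch adj V 0" shows "c \<in> triple_span adj V 0"
proof -
  obtain n where "c = frag_cmul n (PT [])" using Ch_0[OF assms] by auto
  then show ?thesis using PT_triple_span[of adj "[]" V 0] by (auto intro: triple_span_cl)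
qed

text \<open>
  A filling of the triple \<open>(r, b, c)\<close> that uses two more neighbours: \<open>f\<close> of \<open>b\<close> and \<open>s\<close> of \<open>c\<close>.
  The edges \<open>rb\<close> and \<open>rc\<close> are joined by the path \<open>rb\<close>, \<open>sc\<close>, \<open>fb\<close>, \<open>rc\<close> in the matching complex.
\<close>

definition pathE :: "nat \<Rightarrow> nat \<Rightarrow> nat \<Rightarrow> nat \<Rightarrow> nat \<Rightarrow> (nat \<times> nat) chain \<Rightarrow> (nat \<times> nat) chain" where
  "pathE r s f b c x = W (ed r b) (W (ed s c) x) - W (ed f b) (W (ed s c) x) + W (ed f b) (W (ed r c) x)"

context graph begin

lemma cherry_tv: "cherry adj t \<Longrightarrow> card (tv t) = 3"
  by (cases t) (auto simp: card_insert_if dest: irr)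
lemma finite_tv [simp]: "finite (tv t)" by (cases t) simp
lemma finite_Tv [simp]: "finite (Tv L)" by (simp add: Tv_def)
lemma card_Tv: "valid adj L \<Longrightarrow> card (Tv L) = 3 * length L"
  by (induction L) (auto simp: card_Un_disjoint cherry_tv)

lemma triple_span_Cy: "x \<in> triple_span adj V k \<Longrightarrow> x \<in> Cy adj V k"
  unfolding triple_span_def by (erule addspan_sub) (auto simp: adgrp_Cy Bd_sub_Cy intro: PT_Cy)

lemma Z_triple_span:
  assumes "y \<in> triple_span adj (V - {p, q, r}) k" "p \<in> V" "q \<in> V" "r \<in> V" "adj p q" "adj p r" "q \<noteq> r"
  shows "Z p q r y \<in> triple_span adj V (Suc k)"
  using assms(1)
proof (rule triple_span_map)
  fix L assume L: "valid adj L" "Tv L \<subseteq> V - {p, q, r}" "length L = k"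
  have "PT ((p, q, r) # L) \<in> triple_span adj V (Suc k)"
    by (rule PT_triple_span) (use L assms in auto)
  then show "Z p q r (PT L) \<in> triple_span adj V (Suc k)" by simp
next
  fix x assume "x \<in> Bd adj (V - {p, q, r}) k"
  then show "Z p q r x \<in> triple_span adj V (Suc k)" using assms by (intro Bd_triple_span Z_Bd)
qed (auto intro: fadd_Z adgrp_triple_span)

text \<open>
  The vanishing hypothesis is stated for \<open>k = Suc j\<close>: in the lowest degree the double link is
  zero.
\<close>

lemma LkLk_null:
  assumes c: "c \<in> Cy adj V (Suc k)"
    and null: "\<And>j. k = Suc j \<Longrightarrow> Cy adj (V - {a, b, s, t}) j \<subseteq> Bd adj (V - {a, b, s, t}) j"
  shows "Lk (ed b s) (Lk (ed a t) c) \<in> Bd adj (V - {a, b, s, t}) (k - 1)"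
proof (cases k)
  case 0
  have "Lk (ed a t) c \<in> Ch adj (V - {a, t}) 0" using Lk_Cy[OF c, of a t] 0 by (simp add: Cy_def)
  from Ch_0_Lk[OF this] show ?thesis by (simp add: Bd_cl)
next
  case (Suc j)
  have "Lk (ed b s) (Lk (ed a t) c) \<in> Cy adj (V - {a, t} - {b, s}) j"
    using c Suc by (intro Lk_Cy) simp
  moreover have "V - {a, t} - {b, s} = V - {a, b, s, t}" by auto
  ultimately show ?thesis using null[OF Suc] Suc by auto
qed

text \<open>
  \<open>decompose\<close> with \<open>S\<close> the span of the triple products: the induction step of the generation
  theorems.
\<close>

lemma triple_span_step:
  assumes V: "finite V" and ab: "a \<in> V" "b \<in> V" "adj a b" and c: "c \<in> Cy adj V (Suc k)"
    and hyp: "\<And>s t j. k = Suc j \<Longrightarrow> s \<in> V \<Longrightarrow> t \<in> V \<Longrightarrow> distinct [a, b, s, t] \<Longrightarrow> adj b s \<Longrightarrow> adj a t \<Longrightarrow>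
               Cy adj (V - {a, b, s, t}) j \<subseteq> Bd adj (V - {a, b, s, t}) j"
    and SA: "\<And>t. t \<in> V \<Longrightarrow> t \<noteq> b \<Longrightarrow> adj a t \<Longrightarrow> Cy adj (V - {a, t, b}) k \<subseteq> triple_span adj (V - {a, t, b}) k"
    and SB: "\<And>s. s \<in> V \<Longrightarrow> s \<noteq> a \<Longrightarrow> adj b s \<Longrightarrow> Cy adj (V - {b, s, a}) k \<subseteq> triple_span adj (V - {b, s, a}) k"
  shows "c \<in> triple_span adj V (Suc k)"
proof (rule decompose[OF V ab c])
  show "adgrp (triple_span adj V (Suc k))" "Bd adj V (Suc k) \<subseteq> triple_span adj V (Suc k)" by (auto simp: adgrp_triple_span Bd_triple_span)
  fix s t assume "s \<in> V" "t \<in> V" "distinct [a, b, s, t]" "adj b s" "adj a t"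
  then show "Lk (ed b s) (Lk (ed a t) c) \<in> Bd adj (V - {a, b, s, t}) (k - 1)"
    by (intro LkLk_null[OF c] hyp)
next
  fix t y assume "t \<in> V" "t \<noteq> b" "adj a t" "y \<in> Cy adj (V - {a, t, b}) k"
  then show "Z a t b y \<in> triple_span adj V (Suc k)" using SA[of t] ab by (intro Z_triple_span) auto
next
  fix t y assume "t \<in> V" "t \<noteq> a" "adj b t" "y \<in> Cy adj (V - {b, t, a}) k"
  then show "Z b t a y \<in> triple_span adj V (Suc k)" using SB[of t] ab sym by (intro Z_triple_span) auto
qed

section \<open>Moves between triple products\<close>

lemma bd_WW: "x \<in> Cy adj V k \<Longrightarrow> bd (W e (W f x)) = W f x - W e x"
proof -
  assume x: "x \<in> Cy adj V k"
  then have f: "fin_chain x" and z: "bd x = 0" by (auto simp: Cy_def intro: Ch_fin)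
  show ?thesis by (simp add: bd_W[OF fin_chain_W[OF f]] bd_W[OF f] z W_lin)
qed

lemma WW_Ch:
  assumes x: "x \<in> Ch adj V' k" "V' \<subseteq> V - {p, q, r, s}" "p \<in> V" "q \<in> V" "r \<in> V" "s \<in> V" "distinct [p, q, r, s]" "adj p q" "adj r s"
  shows "W (ed p q) (W (ed r s) x) \<in> Ch adj V (Suc (Suc k))"
proof -
  have "V' \<subseteq> V - {p, q} - {r, s}" using assms(2) by auto
  then have "x \<in> Ch adj (V - {p, q} - {r, s}) k" using x Ch_mono by blast
  then show ?thesis using assms(3-) by (intro W_Ch) auto
qed

lemma pathE:
  assumes x: "x \<in> Cy adj (V - {r, s, f, b, c}) k" and V: "{r, s, f, b, c} \<subseteq> V" "distinct [r, s, f, b, c]"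
    and adj: "adj r b" "adj r c" "adj s c" "adj f b"
  shows "pathE r s f b c x \<in> Ch adj V (Suc (Suc k))" "bd (pathE r s f b c x) = - Z r b c x"
proof -
  have xc: "x \<in> Ch adj (V - {r, s, f, b, c}) k" using x by (simp add: Cy_def)
  show "pathE r s f b c x \<in> Ch adj V (Suc (Suc k))"
    unfolding pathE_def using V adj by (intro Ch_cl(2,4) WW_Ch[OF xc]) auto
  show "bd (pathE r s f b c x) = - Z r b c x"
    unfolding pathE_def by (simp add: bd_lin bd_WW[OF x] Z_def)
qed

text \<open>
  In a bipartite graph this uses two free vertices on the side of the apex and none on the other
  side, where \<open>W_Cy_free\<close> would not apply.
\<close>

lemma free_vertices_null:
  assumes "x \<in> Cy adj (V - {r, s, f, b, c}) k" "{r, s, f, b, c} \<subseteq> V" "distinct [r, s, f, b, c]"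
    and "adj r b" "adj r c" "adj s c" "adj f b"
  shows "Z r b c x \<in> Bd adj V (Suc k)"
  using adgrp_neg[OF adgrp_Bd bd_Ch_Bd[OF pathE(1)[OF assms]]] pathE(2)[OF assms] by simp

text \<open>
  The apex may be exchanged with a free vertex that is adjacent to both leaves, at the price of
  a sign: the matching complex of a four-cycle has two components, each an edge.
\<close>

lemma change_apex:
  assumes x: "x \<in> Cy adj (V - {a, b, c, d}) k" and V: "{a, b, c, d} \<subseteq> V" "distinct [a, b, c, d]"
    and adj: "adj a b" "adj a c" "adj d b" "adj d c"
  shows "Z a b c x + Z d b c x \<in> Bd adj V (Suc k)"
proof -
  define E where "E = W (ed d c) (W (ed a b) x) + W (ed a c) (W (ed d b) x)"
  have xc: "x \<in> Ch adj (V - {a, b, c, d}) k" using x by (simp add: Cy_def)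
  have "E \<in> Ch adj V (Suc (Suc k))"
    unfolding E_def using V adj by (intro Ch_cl WW_Ch[OF xc]) auto
  moreover have "Z a b c x + Z d b c x = bd E"
    unfolding E_def by (simp add: bd_lin bd_WW[OF x] Z_def)
  ultimately show ?thesis by (simp add: bd_Ch_Bd Bd_cl)
qed

text \<open>
  If \<open>d\<close> is a free neighbour of \<open>b\<close>, then the edge \<open>ab\<close> can be kept while \<open>b\<close> becomes the apex:
  \<open>ac\<close> and \<open>bd\<close> are compatible, so they are homologous. After the flip the leaf \<open>c\<close> is the free
  vertex.
\<close>

lemma flip:
  assumes x: "x \<in> Cy adj (V - {a, b, c, d}) k" and V: "{a, b, c, d} \<subseteq> V" "distinct [a, b, c, d]"
    and adj: "adj a b" "adj a c" "adj b d"
  shows "Z a b c x - Z b a d x \<in> Bd adj V (Suc k)"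
proof -
  define E where "E = W (ed a c) (W (ed b d) x)"
  have xc: "x \<in> Ch adj (V - {a, b, c, d}) k" using x by (simp add: Cy_def)
  have "E \<in> Ch adj V (Suc (Suc k))"
    unfolding E_def using V adj by (intro Ch_cl WW_Ch[OF xc]) auto
  moreover have "Z a b c x - Z b a d x = bd E"
    unfolding E_def by (simp add: bd_lin bd_WW[OF x] Z_def ed_commute[of b a])
  ultimately show ?thesis by (simp add: bd_Ch_Bd Bd_cl)
qed

end

section \<open>Generation in complete graphs\<close>

interpretation complete: graph "(\<noteq>)" by unfold_locales auto

lemma complete_PT_null:
  assumes "finite V" "3 * k + 2 \<le> card V" "valid (\<noteq>) L" "Tv L \<subseteq> V" "length L = k"
  shows "PT L \<in> Bd (\<noteq>) V k"
proof -
  have "2 \<le> card (V - Tv L)" using assms complete.card_Tv[of L] by (simp add: card_Diff_subset)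
  then obtain p q where pq: "p \<in> V - Tv L" "q \<in> V - Tv L" "p \<noteq> q"
    by (metis One_nat_def Suc_1 card_le_Suc0_iff_eq card.infinite not_less_eq_eq zero_le)
  have "PT L \<in> Cy (\<noteq>) (V - {p, q}) k"
    using complete.PT_Cy[of L "V - {p, q}"] assms pq by auto
  then show ?thesis using complete.W_Cy_free[of p V q "PT L" k] pq by auto
qed

text \<open>
  Induction on \<open>k\<close> by \<open>decompose\<close>. The double links have two edges less and live on four
  vertices less, so at least two vertices are free of each triple product there, and it bounds.
\<close>

lemma complete_triple_span:
  assumes "finite V" "3 * k \<le> card V" shows "Cy (\<noteq>) V k \<subseteq> triple_span (\<noteq>) V k"
  using assms
proof (induction k arbitrary: V rule: less_induct)
  case (less k)
  show ?case
  proof (cases k)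
    case 0
    then show ?thesis using Ch_0_triple_span by (auto simp: Cy_def)
  next
    case (Suc k')
    then have "2 \<le> card V" using less.prems by simp
    then obtain a b where ab: "a \<in> V" "b \<in> V" "a \<noteq> b"
      by (metis One_nat_def Suc_1 card_le_Suc0_iff_eq card.infinite not_less_eq_eq zero_le)
    show ?thesis unfolding Suc
    proof (rule subsetI, rule complete.triple_span_step)
      fix s t j assume st: "k' = Suc j" "s \<in> V" "t \<in> V" "distinct [a, b, s, t]"
      let ?V = "V - {a, b, s, t}"
      have "card ?V = card V - 4" using st ab by (simp add: card_Diff_subset)
      then have c: "3 * j + 2 \<le> card ?V" using less.prems Suc st by simp
      then have "Cy (\<noteq>) ?V j \<subseteq> triple_span (\<noteq>) ?V j" using Suc st less.prems by (intro less.IH) auto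
      also have "\<dots> \<subseteq> Bd (\<noteq>) ?V j" unfolding triple_span_def
      proof (intro subsetI, erule addspan_sub)
      qed (use c less.prems complete_PT_null[of ?V j] in \<open>auto simp: adgrp_Bd\<close>)
      finally show "Cy (\<noteq>) ?V j \<subseteq> Bd (\<noteq>) ?V j" .
    next
      fix t assume t: "t \<in> V" "t \<noteq> b" "a \<noteq> t"
      then have "card (V - {a, t, b}) = card V - 3" using ab by (simp add: card_Diff_subset)
      then show "Cy (\<noteq>) (V - {a, t, b}) k' \<subseteq> triple_span (\<noteq>) (V - {a, t, b}) k'"
        using less.prems Suc by (intro less.IH) auto
    next
      fix t assume t: "t \<in> V" "t \<noteq> a" "b \<noteq> t"
      then have "card (V - {b, t, a}) = card V - 3" using ab by (simp add: card_Diff_subset)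
      then show "Cy (\<noteq>) (V - {b, t, a}) k' \<subseteq> triple_span (\<noteq>) (V - {b, t, a}) k'"
        using less.prems Suc by (intro less.IH) auto
    qed (use ab less.prems in auto)
  qed
qed

lemma complete_null:
  assumes "finite V" "3 * k + 2 \<le> card V" shows "Cy (\<noteq>) V k \<subseteq> Bd (\<noteq>) V k"
proof -
  have "Cy (\<noteq>) V k \<subseteq> triple_span (\<noteq>) V k" using assms by (intro complete_triple_span) auto
  also have "\<dots> \<subseteq> Bd (\<noteq>) V k" unfolding triple_span_def
  proof (intro subsetI, erule addspan_sub)
  qed (use assms complete_PT_null[of V k] in \<open>auto simp: adgrp_Bd\<close>)
  finally show ?thesis .
qed

section \<open>Generation in complete bipartite graphs\<close>

text \<open>
  The vertices in \<open>R\<close> are the rows, all others are the columns. The description is symmetric: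
  replacing \<open>R\<close> by its complement does not change the graph, which halves the case distinctions.
\<close>

definition bip :: "nat set \<Rightarrow> nat \<Rightarrow> nat \<Rightarrow> bool" where
  "bip R u v \<longleftrightarrow> (u \<in> R) \<noteq> (v \<in> R)"

interpretation bip: graph "bip R" for R by unfold_locales (auto simp: bip_def)

lemma bip_compl: "bip (- R) = bip R" by (auto simp: bip_def fun_eq_iff)

text \<open>
  A triple with its apex in a row uses one row and two columns, any other cherry uses two rows
  and one column. The two kinds are counted by \<open>n_row\<close> and \<open>n_col\<close>.
\<close>

definition row_apex :: "nat set \<Rightarrow> triple \<Rightarrow> bool" where "row_apex R t \<longleftrightarrow> fst t \<in> R"
definition n_row where "n_row R L = length (filter (row_apex R) L)"
definition n_col where "n_col R L = length (filter (\<lambda>t. \<not> row_apex R t) L)"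

lemma n_row_simps [simp]: "n_row R [] = 0" "n_row R (t # L) = (if row_apex R t then 1 else 0) + n_row R L" "n_row R (L @ L') = n_row R L + n_row R L'"
  "n_col R [] = 0" "n_col R (t # L) = (if row_apex R t then 0 else 1) + n_col R L" "n_col R (L @ L') = n_col R L + n_col R L'"
  by (auto simp: n_row_def n_col_def)
lemma row_apex_simp [simp]: "row_apex R (a, b, c) \<longleftrightarrow> a \<in> R" by (simp add: row_apex_def)
lemma n_row_n_col: "n_row R L + n_col R L = length L" by (induction L) auto
lemma row_apex_compl: "row_apex (- R) = (\<lambda>t. \<not> row_apex R t)" by (simp add: row_apex_def fun_eq_iff)
lemma n_row_compl: "n_row (- R) L = n_col R L" "n_col (- R) L = n_row R L" by (simp_all add: n_row_def n_col_def row_apex_compl)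

lemma tv_rows: "cherry (bip R) t \<Longrightarrow> card (tv t \<inter> R) = (if row_apex R t then 1 else 2) \<and> card (tv t - R) = (if row_apex R t then 2 else 1)"
  by (cases t) (auto simp: bip_def insert_Diff_if)

lemma Tv_rows: "valid (bip R) L \<Longrightarrow> card (Tv L \<inter> R) = n_row R L + 2 * n_col R L \<and> card (Tv L - R) = 2 * n_row R L + n_col R L"
proof (induction L)
  case (Cons t L)
  have "card (Tv (t # L) \<inter> R) = card (tv t \<inter> R) + card (Tv L \<inter> R)"
    using Cons.prems by (subst card_Un_disjoint[symmetric]) (auto intro!: arg_cong[of _ _ card])
  moreover have "card (Tv (t # L) - R) = card (tv t - R) + card (Tv L - R)"
    using Cons.prems by (subst card_Un_disjoint[symmetric]) (auto intro!: arg_cong[of _ _ card])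
  ultimately show ?case using Cons tv_rows[of R t] by simp
qed simp

lemma bip_PT_free_rows_null:
  assumes V: "finite V" "valid (bip R) L" "Tv L \<subseteq> V" "length L = k"
    and r: "2 \<le> card (V \<inter> R - Tv L)" "n_row R L \<noteq> 0"
  shows "PT L \<in> Bd (bip R) V k"
proof -
  obtain s f where sf: "s \<in> V \<inter> R - Tv L" "f \<in> V \<inter> R - Tv L" "s \<noteq> f"
    using r(1) by (metis One_nat_def Suc_1 card_le_Suc0_iff_eq card.infinite not_less_eq_eq zero_le)
  have "\<exists>t\<in>set L. row_apex R t" using r(2) by (auto simp: n_row_def filter_empty_conv)
  then obtain a b c where t: "(a, b, c) \<in> set L" "a \<in> R" by auto
  then obtain A B where L: "L = A @ (a, b, c) # B" by (meson split_list)
  have "mset L = mset ((a, b, c) # A @ B)" by (simp add: L)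
  from prodT_perm[OF this] obtain \<epsilon> where e: "PT L = frag_cmul \<epsilon> (PT ((a, b, c) # A @ B))" by blast
  have "PT (A @ B) \<in> Cy (bip R) (V - {a, s, f, b, c}) (length (A @ B))"
    using V sf by (intro bip.PT_Cy) (auto simp: L valid_append)
  then have "Z a b c (PT (A @ B)) \<in> Bd (bip R) V (Suc (length (A @ B)))"
    by (rule bip.free_vertices_null) (use V sf t in \<open>auto simp: L valid_append bip_def\<close>)
  then show ?thesis unfolding e using V(4) by (auto simp: L intro: Bd_cl)
qed

lemma card_free:
  assumes "finite V" "valid (bip R) L" "Tv L \<subseteq> V"
  shows "card (V \<inter> R - Tv L) = card (V \<inter> R) - (n_row R L + 2 * n_col R L)" "card (V - R - Tv L) = card (V - R) - (2 * n_row R L + n_col R L)"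
    "n_row R L + 2 * n_col R L \<le> card (V \<inter> R)" "2 * n_row R L + n_col R L \<le> card (V - R)"
proof -
  have "V \<inter> R - Tv L = V \<inter> R - (Tv L \<inter> R)" "V - R - Tv L = V - R - (Tv L - R)" by auto
  moreover have "Tv L \<inter> R \<subseteq> V \<inter> R" "Tv L - R \<subseteq> V - R" using assms by auto
  ultimately show "card (V \<inter> R - Tv L) = card (V \<inter> R) - (n_row R L + 2 * n_col R L)" "card (V - R - Tv L) = card (V - R) - (2 * n_row R L + n_col R L)"
    using Tv_rows[OF assms(2)] by (simp_all add: card_Diff_subset)
  show "n_row R L + 2 * n_col R L \<le> card (V \<inter> R)" "2 * n_row R L + n_col R L \<le> card (V - R)"
    using Tv_rows[OF assms(2)] card_mono[of "V \<inter> R" "Tv L \<inter> R"] card_mono[of "V - R" "Tv L - R"] assms by auto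
qed

text \<open>
  At least two vertices are left over. A free row and a free column span a free edge; if all
  free vertices lie on one side, the counts force a triple with its apex on that side.
\<close>

lemma bip_PT_null:
  assumes V: "finite V" "valid (bip R) L" "Tv L \<subseteq> V" "length L = k"
    and k: "k + 1 \<le> card (V \<inter> R)" "k + 1 \<le> card (V - R)" "3 * k + 2 \<le> card (V \<inter> R) + card (V - R)"
  shows "PT L \<in> Bd (bip R) V k"
proof -
  note cf = card_free[OF V(1-3)]
  note IJ = n_row_n_col[of R L]
  consider "card (V \<inter> R - Tv L) = 0" | "card (V - R - Tv L) = 0" | "card (V \<inter> R - Tv L) \<noteq> 0" "card (V - R - Tv L) \<noteq> 0" by blast
  then show ?thesis
  proof cases
    case 1
    have e: "V \<inter> - R = V - R" by auto
    have "2 \<le> card (V \<inter> - R - Tv L)" "n_row (- R) L \<noteq> 0"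
      unfolding e n_row_compl using 1 cf IJ k V(4) by linarith+
    then show ?thesis using bip_PT_free_rows_null[of V "- R" L k] V by (simp add: bip_compl)
  next
    case 2
    then show ?thesis using cf IJ k V by (intro bip_PT_free_rows_null[OF V]) linarith+
  next
    case 3
    then obtain p q where pq: "p \<in> V \<inter> R - Tv L" "q \<in> V - R - Tv L"
      by (metis card.empty equals0I)
    have "PT L \<in> Cy (bip R) (V - {p, q}) k" using V pq bip.PT_Cy[of R L "V - {p, q}"] by auto
    then show ?thesis using bip.W_Cy_free[of p V q R "PT L" k] pq by (auto simp: bip_def)
  qed
qed

lemma mtch_bip_card: assumes "finite V" "\<sigma> \<in> mtch (bip R) V" shows "card \<sigma> \<le> card (V \<inter> R)"
proof -
  have *: "\<exists>u. u \<in> vs e \<and> u \<in> V \<inter> R" if "e \<in> \<sigma>" for e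
    using assms(2) that by (fastforce simp: mtch_def bip_def)
  define g where "g e = (SOME u. u \<in> vs e \<and> u \<in> V \<inter> R)" for e
  have g: "g e \<in> vs e \<and> g e \<in> V \<inter> R" if "e \<in> \<sigma>" for e
    unfolding g_def using someI_ex[OF *[OF that]] .
  have "inj_on g \<sigma>"
    using g mtch_disj[OF assms(2)] by (intro inj_onI) (metis IntI empty_iff)
  then show ?thesis using g assms(1) by (intro card_inj_on_le[of g]) auto
qed

text \<open>A matching cannot be larger than the number of rows.\<close>

lemma Ch_bip_0: assumes "finite V" "card (V \<inter> R) < k" "c \<in> Ch (bip R) V k" shows "c = 0"
proof -
  have "{\<sigma> \<in> mtch (bip R) V. card \<sigma> = k} = {}" using mtch_bip_card[OF assms(1)] assms(2) by fastforce
  then have "Poly_Mapping.keys c \<subseteq> {}" using assms(3) unfolding Ch_def by blast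
  then show ?thesis by simp
qed

definition sumset :: "'a::ab_group_add set \<Rightarrow> 'a set \<Rightarrow> 'a set" where
  "sumset A B = {a + b | a b. a \<in> A \<and> b \<in> B}"
lemma adgrp_sumset: assumes "adgrp A" "adgrp B" shows "adgrp (sumset A B)"
proof -
  have "0 + 0 \<in> sumset A B" unfolding sumset_def using assms adgrp_zero by blast
  moreover have "x - y \<in> sumset A B" if xy: "x \<in> sumset A B" "y \<in> sumset A B" for x y
  proof -
    obtain a b a' b' where "x = a + b" "y = a' + b'" "a \<in> A" "b \<in> B" "a' \<in> A" "b' \<in> B"
      using xy by (auto simp: sumset_def)
    moreover have "(a + b) - (a' + b') = (a - a') + (b - b')" by (simp add: algebra_simps)
    ultimately show ?thesis unfolding sumset_def using assms adgrp_diff by blast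
  qed
  ultimately show ?thesis by (simp add: adgrp_def)
qed
lemma sumsetI: "a \<in> A \<Longrightarrow> b \<in> B \<Longrightarrow> a + b \<in> sumset A B" by (auto simp: sumset_def)
lemma sumsetI1: "a \<in> A \<Longrightarrow> adgrp B \<Longrightarrow> a \<in> sumset A B" using sumsetI[of a A 0 B] adgrp_zero by auto
lemma sumsetI2: "b \<in> B \<Longrightarrow> adgrp A \<Longrightarrow> b \<in> sumset A B" using sumsetI[of 0 A b B] adgrp_zero by auto

context graph begin

text \<open>
  Since every \<open>y t\<close> is a cycle, the cone with apex \<open>at\<close> over it has boundary \<open>y t\<close>.
\<close>

lemma sum_cycles_0:
  assumes "finite T" "\<And>t. t \<in> T \<Longrightarrow> y t \<in> Cy adj (V' t) k" "bd (\<Sum>t\<in>T. W (ed a t) (y t)) = 0"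
  shows "(\<Sum>t\<in>T. y t) = 0"
proof -
  have "bd (W (ed a t) (y t)) = y t" if "t \<in> T" for t
    using bd_W[OF Ch_fin[of "y t" adj "V' t" k]] assms(2)[OF that] by (auto simp: Cy_def W_lin)
  then show ?thesis using assms(3) by (simp add: bd_lin)
qed

end

lemma rows_Diff:
  assumes "finite V" "S \<subseteq> V"
  shows "card ((V - S) \<inter> R) = card (V \<inter> R) - card (S \<inter> R)" "card ((V - S) - R) = card (V - R) - card (S - R)"
proof -
  have "(V - S) \<inter> R = (V \<inter> R) - (S \<inter> R)" "(V - S) - R = (V - R) - (S - R)" by auto
  moreover have "finite S" using assms finite_subset by auto
  ultimately show "card ((V - S) \<inter> R) = card (V \<inter> R) - card (S \<inter> R)" "card ((V - S) - R) = card (V - R) - card (S - R)"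
    using assms(2) card_Diff_subset[of "S \<inter> R" "V \<inter> R"] card_Diff_subset[of "S - R" "V - R"] by auto
qed

text \<open>
  Here \<open>k\<close> is the number of rows, so that the matchings are those that saturate the rows, and
  there are at least \<open>2 * k\<close> columns. Fix a row \<open>a\<close> and a column \<open>b\<close>. Modulo triple products a
  cycle can be made to avoid \<open>b\<close>: the links of the edges at \<open>b\<close> are spanned by triple products,
  each of which leaves a column \<open>u\<close> free, and \<open>sb = (sb - su) + su\<close>. A cycle that avoids \<open>b\<close> is
  a sum of \<open>W (ed a t) (y t)\<close>, for every matching covers \<open>a\<close>; the cycles \<open>y t\<close> sum to \<open>0\<close>, so
  every \<open>at\<close> may be replaced by \<open>at - ab\<close>.
\<close>

lemma bip_top_triple_span:
  assumes "finite V" "card (V \<inter> R) = k" "2 * k \<le> card (V - R)"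
  shows "Cy (bip R) V k \<subseteq> triple_span (bip R) V k"
  using assms
proof (induction k arbitrary: V)
  case 0
  then show ?case using Ch_0_triple_span by (auto simp: Cy_def)
next
  case (Suc k)
  let ?adj = "bip R"
  show ?case
  proof
    fix c assume c: "c \<in> Cy ?adj V (Suc k)"
    have "V - R \<noteq> {}" "V \<inter> R \<noteq> {}" using Suc.prems by (intro notI; simp)+
    then obtain a b where b: "b \<in> V - R" and a: "a \<in> V \<inter> R" by blast
    let ?H = "sumset (triple_span ?adj V (Suc k)) (Ch ?adj (V - {b}) (Suc k))"
    have H: "adgrp ?H" by (intro adgrp_sumset adgrp_triple_span adgrp_Ch)
    have "W (ed b s) (Lk (ed b s) c) \<in> ?H" if s: "s \<in> bip.nbrs R V b" for s
    proof -
      have s: "s \<in> V \<inter> R" using s b by (auto simp: bip.nbrs_def bip_def)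
      have cr: "card ((V - {b, s}) \<inter> R) = k" "2 * k < card ((V - {b, s}) - R)"
        using rows_Diff[of V "{b, s}" R] s b Suc.prems by (auto simp: insert_Diff_if)
      have "Lk (ed b s) c \<in> triple_span ?adj (V - {b, s}) k"
        using Suc.IH[of "V - {b, s}"] cr bip.Lk_Cy[OF c, of b s] Suc.prems by auto
      then show ?thesis
      proof (rule triple_span_map[OF _ fadd_W H])
        fix L assume L: "valid ?adj L" "Tv L \<subseteq> V - {b, s}" "length L = k"
        have "card ((V - {b, s}) - R - Tv L) \<noteq> 0"
          using card_free(2)[of "V - {b, s}" R L] L Suc.prems cr n_row_n_col[of R L] by simp
        then obtain u where u: "u \<in> (V - {b, s}) - R - Tv L" by (metis card.empty equals0I)
        have "Z s b u (PT L) \<in> triple_span ?adj V (Suc k)"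
          using PT_triple_span[of ?adj "(s, b, u) # L" V "Suc k"] L u b s by (auto simp: bip_def)
        moreover have "W (ed s u) (PT L) \<in> Ch ?adj (V - {b}) (Suc k)"
          using L u b s bip.PT_Cy[of R L "V - {b} - {s, u}"] by (intro bip.W_Ch) (auto simp: bip_def Cy_def)
        moreover have "W (ed b s) (PT L) = Z s b u (PT L) + W (ed s u) (PT L)"
          by (simp add: Z_def ed_commute[of b s])
        ultimately show "W (ed b s) (PT L) \<in> ?H" by (auto intro: sumsetI)
      next
        fix x assume "x \<in> Bd ?adj (V - {b, s}) k"
        then obtain e where e: "e \<in> Ch ?adj (V - {b, s}) (Suc k)" "x = bd e" by (auto simp: Bd_def)
        have "W (ed b s) x = - bd (W (ed b s) e) + e"
          using bd_W[OF Ch_fin[OF e(1)]] e(2) by simp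
        moreover have "bd (W (ed b s) e) \<in> Bd ?adj V (Suc k)"
          using e(1) s b by (intro bip.bd_Ch_Bd bip.W_Ch) (auto simp: bip_def)
        moreover have "e \<in> Ch ?adj (V - {b}) (Suc k)" using e(1) by (auto intro: Ch_mono)
        ultimately show "W (ed b s) x \<in> ?H" by (metis sumsetI Bd_triple_span Bd_cl(3))
      qed
    qed
    then have "(\<Sum>s\<in>bip.nbrs R V b. W (ed b s) (Lk (ed b s) c)) \<in> ?H" by (intro adgrp_sum H)
    moreover have "c - (\<Sum>s\<in>bip.nbrs R V b. W (ed b s) (Lk (ed b s) c)) \<in> ?H"
      using bip.expand[of V b c R "Suc k"] c b Suc.prems by (intro sumsetI2 adgrp_triple_span) (auto simp: Cy_def)
    ultimately have "c \<in> ?H" using adgrp_add[OF H] by fastforce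
    then obtain g d where gd: "c = g + d" "g \<in> triple_span ?adj V (Suc k)" "d \<in> Ch ?adj (V - {b}) (Suc k)"
      by (auto simp: sumset_def)
    have "bd d = 0" using gd(1) c bip.triple_span_Cy[OF gd(2)] by (simp add: Cy_def bd_lin)
    then have d: "d \<in> Cy ?adj (V - {b}) (Suc k)" using gd by (simp add: Cy_def)
    define T where "T = bip.nbrs R (V - {b}) a"
    have T: "t \<in> V - R \<and> t \<noteq> b" if "t \<in> T" for t using that a by (auto simp: T_def bip.nbrs_def bip_def)
    have fT: "finite T" unfolding T_def bip.nbrs_def using Suc.prems by auto
    have "d - (\<Sum>t\<in>T. W (ed a t) (Lk (ed a t) d)) \<in> Ch ?adj (V - {b} - {a}) (Suc k)"
      unfolding T_def using gd(3) Suc.prems a b by (intro bip.expand) auto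
    moreover have "card ((V - {b} - {a}) \<inter> R) < Suc k" using rows_Diff[of V "{b, a}" R] a b Suc.prems by (simp add: insert_Diff_if flip: Diff_insert2)
    ultimately have "d - (\<Sum>t\<in>T. W (ed a t) (Lk (ed a t) d)) = 0"
      using Suc.prems(1) by (intro Ch_bip_0[of "V - {b} - {a}" R "Suc k"]) auto
    then have d1: "d = (\<Sum>t\<in>T. W (ed a t) (Lk (ed a t) d))" by (simp only: right_minus_eq)
    have y: "Lk (ed a t) d \<in> Cy ?adj (V - {a, t, b}) k" if "t \<in> T" for t
    proof -
      have "V - {b} - {a, t} = V - {a, t, b}" by auto
      then show ?thesis using bip.Lk_Cy[OF d, of a t] by simp
    qed
    have "(\<Sum>t\<in>T. Lk (ed a t) d) = 0"
      by (rule bip.sum_cycles_0[where a = a, OF fT y]) (use d1 \<open>bd d = 0\<close> in auto)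
    then have "(\<Sum>t\<in>T. W (ed a b) (Lk (ed a t) d)) = 0" by (simp flip: W_lin(5) add: W_lin(4))
    then have "d = (\<Sum>t\<in>T. Z a t b (Lk (ed a t) d))" using d1 by (simp add: Z_def sum_subtractf)
    also have "\<dots> \<in> triple_span ?adj V (Suc k)"
    proof (intro triple_span_cl bip.Z_triple_span)
      fix t assume t: "t \<in> T"
      have "card ((V - {a, t, b}) \<inter> R) = k" "2 * k \<le> card ((V - {a, t, b}) - R)"
        using rows_Diff[of V "{a, t, b}" R] T[OF t] a b Suc.prems by (auto simp: insert_Diff_if)
      then show "Lk (ed a t) d \<in> triple_span ?adj (V - {a, t, b}) k"
        using Suc.IH[of "V - {a, t, b}"] y[OF t] Suc.prems by auto
    qed (use a b T in \<open>auto simp: bip_def\<close>)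
    finally show "c \<in> triple_span ?adj V (Suc k)" using gd by (auto intro: triple_span_cl)
  qed
qed

text \<open>
  Away from the extreme case of saturated rows or columns, the double links still have enough
  vertices on both sides to vanish by \<open>bip_PT_null\<close>, and \<open>decompose\<close> applies.
\<close>

lemma bip_triple_span:
  assumes "finite V" "k \<le> card (V \<inter> R)" "k \<le> card (V - R)" "3 * k \<le> card (V \<inter> R) + card (V - R)"
  shows "Cy (bip R) V k \<subseteq> triple_span (bip R) V k"
  using assms
proof (induction k arbitrary: V rule: less_induct)
  case (less k)
  consider "card (V \<inter> R) = k" | "card (V - R) = k" | "k = 0" | k' where "k < card (V \<inter> R)" "k < card (V - R)" "k = Suc k'"
    using less.prems by (cases k) fastforce+
  then show ?case
  proof cases
    case 1
    then show ?thesis using less.prems by (intro bip_top_triple_span) auto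
  next
    case 2
    have e: "V \<inter> - R = V - R" "V - - R = V \<inter> R" by auto
    show ?thesis using bip_top_triple_span[of V "- R" k] 2 less.prems unfolding e bip_compl by auto
  next
    case 3
    then show ?thesis using Ch_0_triple_span by (auto simp: Cy_def)
  next
    case 4
    note Suc = 4(3)
    have "V - R \<noteq> {}" "V \<inter> R \<noteq> {}" using 4 by (intro notI; simp)+
    then obtain a b where b: "b \<in> V - R" and a: "a \<in> V \<inter> R" by blast
    show ?thesis unfolding Suc
    proof (rule subsetI, rule bip.triple_span_step)
      fix s t j assume st: "k' = Suc j" "s \<in> V" "t \<in> V" "distinct [a, b, s, t]" "bip R b s" "bip R a t"
      let ?V = "V - {a, b, s, t}"
      have st': "s \<in> R" "t \<notin> R" using st a b by (auto simp: bip_def)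
      have c: "card (?V \<inter> R) = card (V \<inter> R) - 2" "card (?V - R) = card (V - R) - 2"
        using rows_Diff[of V "{a, b, s, t}" R] st st' a b less.prems by (auto simp: insert_Diff_if)
      have n: "j + 1 \<le> card (?V \<inter> R)" "j + 1 \<le> card (?V - R)" "3 * j + 2 \<le> card (?V \<inter> R) + card (?V - R)"
        unfolding c using 4 st(1) less.prems(4) by linarith+
      have "Cy (bip R) ?V j \<subseteq> triple_span (bip R) ?V j"
        by (rule less.IH) (use n Suc st(1) less.prems(1) in simp_all)
      also have "\<dots> \<subseteq> Bd (bip R) ?V j" unfolding triple_span_def
      proof (intro subsetI, erule addspan_sub)
        have "PT L \<in> Bd (bip R) ?V j" if "valid (bip R) L" "Tv L \<subseteq> ?V" "j = length L" for L
          by (rule bip_PT_null[OF _ that(1,2)]) (use n less.prems(1) that(3) in simp_all)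
        then show "{PT L |L. valid (bip R) L \<and> Tv L \<subseteq> ?V \<and> length L = j} \<union> Bd (bip R) ?V j \<subseteq> Bd (bip R) ?V j" by auto
      qed (rule adgrp_Bd)
      finally show "Cy (bip R) ?V j \<subseteq> Bd (bip R) ?V j" .
    next
      fix t assume t: "t \<in> V" "t \<noteq> b" "bip R a t"
      have "card ((V - {a, t, b}) \<inter> R) = card (V \<inter> R) - 1" "card ((V - {a, t, b}) - R) = card (V - R) - 2"
        using rows_Diff[of V "{a, t, b}" R] t a b less.prems by (auto simp: insert_Diff_if bip_def)
      then show "Cy (bip R) (V - {a, t, b}) k' \<subseteq> triple_span (bip R) (V - {a, t, b}) k'"
        using less.prems 4 by (intro less.IH) auto
    next
      fix t assume t: "t \<in> V" "t \<noteq> a" "bip R b t"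
      have "card ((V - {b, t, a}) \<inter> R) = card (V \<inter> R) - 2" "card ((V - {b, t, a}) - R) = card (V - R) - 1"
        using rows_Diff[of V "{b, t, a}" R] t a b less.prems by (auto simp: insert_Diff_if bip_def)
      then show "Cy (bip R) (V - {b, t, a}) k' \<subseteq> triple_span (bip R) (V - {b, t, a}) k'"
        using less.prems 4 by (intro less.IH) auto
    qed (use a b less.prems in \<open>auto simp: bip_def[of R a b]\<close>)
  qed
qed

section \<open>Signs of lists\<close>

text \<open>
  \<open>lsgn xs\<close> is the sign of the permutation that sorts \<open>xs\<close>, as a product over pairs. In this
  form it makes sense for any distinct numbers and splits at an append, with the factor \<open>cross\<close>
  between the two parts.
\<close>

definition lt_sg :: "nat \<Rightarrow> nat \<Rightarrow> int" where "lt_sg x y = (if x < y then 1 else -1)"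

definition cross :: "nat list \<Rightarrow> nat list \<Rightarrow> int" where
  "cross xs ys = prod_list (map (\<lambda>x. prod_list (map (lt_sg x) ys)) xs)"

fun lsgn :: "nat list \<Rightarrow> int" where
  "lsgn [] = 1"
| "lsgn (x # xs) = prod_list (map (lt_sg x) xs) * lsgn xs"

lemma cross_simps: "cross [] ys = 1" "cross (x # xs) ys = prod_list (map (lt_sg x) ys) * cross xs ys"
  "cross (xs @ xs') ys = cross xs ys * cross xs' ys"
  by (simp_all add: cross_def)
lemma cross_simps2: "cross xs [] = 1" "cross xs (y # ys) = cross xs [y] * cross xs ys" "cross xs (ys @ ys') = cross xs ys * cross xs ys'"
  by (induction xs) (simp_all add: cross_def mult_ac)

lemma lsgn_append: "lsgn (xs @ ys) = lsgn xs * lsgn ys * cross xs ys"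
  by (induction xs) (simp_all add: cross_simps mult_ac)

lemma lt_sg_commute: "x \<noteq> y \<Longrightarrow> lt_sg y x = - lt_sg x y" by (auto simp: lt_sg_def)

lemma prod_list_pm: "(\<And>x. x \<in> set xs \<Longrightarrow> x = 1 \<or> x = (-1::int)) \<Longrightarrow> prod_list xs = 1 \<or> prod_list xs = -1"
proof (induction xs)
  case (Cons a xs)
  have "prod_list xs = 1 \<or> prod_list xs = -1" using Cons by simp
  moreover have "a = 1 \<or> a = -1" using Cons.prems[of a] by simp
  ultimately show ?case by auto
qed simp
lemma lsgn_pm: "lsgn xs = 1 \<or> lsgn xs = -1"
proof (induction xs)
  case (Cons x xs)
  have "prod_list (map (lt_sg x) xs) = 1 \<or> prod_list (map (lt_sg x) xs) = -1"
    by (rule prod_list_pm) (auto simp: lt_sg_def)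
  then show ?case using Cons by auto
qed simp
lemma lsgn_sq [simp]: "lsgn xs * lsgn xs = 1" using lsgn_pm[of xs] by auto

lemma cross_mset: assumes "mset ys = mset ys'" shows "cross xs ys = cross xs ys'"
proof -
  have "prod_list (map f ys) = prod_list (map f ys')" for f :: "nat \<Rightarrow> int"
    using assms by (metis mset_map prod_mset_prod_list)
  then show ?thesis by (simp add: cross_def)
qed

text \<open>
  Exchanging \<open>x\<close> and \<open>y\<close> across a block \<open>B\<close> changes two signs for every entry of \<open>B\<close>.
\<close>

lemma cross_swap1: "x \<notin> set B \<Longrightarrow> y \<notin> set B \<Longrightarrow> cross [x] B * cross B [y] = cross [y] B * cross B [x]"
proof (induction B)
  case (Cons b B)
  have "lt_sg x b * lt_sg b y = lt_sg y b * lt_sg b x"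
    using Cons.prems by (simp add: lt_sg_commute[of b x] lt_sg_commute[of b y])
  moreover have "cross [x] (b # B) * cross (b # B) [y] = (lt_sg x b * lt_sg b y) * (cross [x] B * cross B [y])" for x y
    by (simp add: cross_simps mult_ac)
  ultimately show ?case using Cons by auto
qed (simp add: cross_def)

lemma lsgn_swap:
  assumes "distinct (A @ x # B @ y # C)"
  shows "lsgn (A @ y # B @ x # C) = - lsgn (A @ x # B @ y # C)"
proof -
  have one: "lsgn (x # B @ y # C) = (cross [x] B * cross B [y]) * lt_sg x y * cross [x] C * cross [y] C * (lsgn B * lsgn C * cross B C)" for x y
    by (simp add: lsgn_append cross_simps cross_simps2(2)[of B y C] mult_ac)
  have "lsgn (y # B @ x # C) = - lsgn (x # B @ y # C)"
    unfolding one using assms cross_swap1[of x B y] lt_sg_commute[of x y] by (auto simp: mult_ac)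
  moreover have "cross A (y # B @ x # C) = cross A (x # B @ y # C)" by (rule cross_mset) simp
  ultimately show ?thesis by (simp add: lsgn_append[of A])
qed

lemma lsgn_transpose:
  assumes "inj_on A {..<n}" "p < n" "q < n" "p \<noteq> q"
  shows "lsgn (map (A \<circ> transpose p q) [0..<n]) = - lsgn (map A [0..<n])"
proof -
  have *: "lsgn (map (A \<circ> transpose p q) [0..<n]) = - lsgn (map A [0..<n])" if pq: "p < q" "q < n" for p q
  proof -
    have e: "[0..<n] = [0..<p] @ p # [Suc p..<q] @ q # [Suc q..<n]"
      using pq by (metis less_imp_le less_trans upt_add_eq_append upt_conv_Cons zero_le le_add_diff_inverse Suc_leI)
    have d: "distinct (map A [0..<n])" using assms(1) by (simp add: distinct_map atLeast0LessThan)
    have "map (A \<circ> transpose p q) [0..<n] = map A [0..<p] @ A q # map A [Suc p..<q] @ A p # map A [Suc q..<n]"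
      unfolding e using pq by (auto simp: transpose_def)
    moreover have "map A [0..<n] = map A [0..<p] @ A p # map A [Suc p..<q] @ A q # map A [Suc q..<n]"
      unfolding e by simp
    ultimately show ?thesis using lsgn_swap d by metis
  qed
  show ?thesis
  proof (cases "p < q")
    case True
    then show ?thesis using *[of p q] assms by blast
  next
    case False
    then have "q < p" using assms by simp
    then show ?thesis using *[of q p] assms unfolding transpose_commute[of p q] by blast
  qed
qed

section \<open>Transposing two vertices of a triple product\<close>

text \<open>
  A list of \<open>k\<close> triples together with a free vertex is encoded as a function on the positions
  \<open>0, \<dots>, 3 * k\<close>: positions \<open>3 * i\<close>, \<open>3 * i + 1\<close>, \<open>3 * i + 2\<close> carry the apex and the leaves
  of the triple \<open>i\<close>, and position \<open>3 * k\<close> carries the free vertex. Exchanging two vertices is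
  then composition with a transposition of positions.
\<close>

definition Tr :: "(nat \<Rightarrow> nat) \<Rightarrow> nat \<Rightarrow> triple" where "Tr A i = (A (3*i), A (3*i+1), A (3*i+2))"
definition LA :: "(nat \<Rightarrow> nat) \<Rightarrow> nat \<Rightarrow> triple list" where "LA A k = map (Tr A) [0..<k]"

context graph begin

text \<open>
  The leaf \<open>c\<close> and the apex \<open>e\<close> of another triple are exchanged with a change of sign: flipping
  the first triple frees \<open>c\<close> or \<open>e\<close>, whichever is its leaf, and then \<open>c\<close> and \<open>e\<close> compete for the
  apex over \<open>f\<close> and \<open>g\<close>.
\<close>

lemma swap_leaf_apex:
  assumes x: "x \<in> Cy adj (V - {a, b, c, e, f, g, d}) k" and V: "{a, b, c, e, f, g, d} \<subseteq> V" "distinct [a, b, c, e, f, g, d]"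
    and adj: "adj a b" "adj a c" "adj a e" "adj b d" "adj e f" "adj e g" "adj c f" "adj c g"
  shows "Z a b c (Z e f g x) + Z a b e (Z c f g x) \<in> Bd adj V (Suc (Suc k))"
proof -
  have ba: "adj b a" using adj sym by blast
  have y1: "Z e f g x \<in> Cy adj (V - {a, b, c, d}) (Suc k)"
    by (rule Z_Cy) (use x V adj in \<open>auto intro: Cy_mono\<close>)
  have y2: "Z c f g x \<in> Cy adj (V - {a, b, e, d}) (Suc k)"
    by (rule Z_Cy) (use x V adj in \<open>auto intro: Cy_mono\<close>)
  have 1: "Z a b c (Z e f g x) - Z b a d (Z e f g x) \<in> Bd adj V (Suc (Suc k))"
    by (rule flip[OF y1]) (use V adj in auto)
  have 2: "Z a b e (Z c f g x) - Z b a d (Z c f g x) \<in> Bd adj V (Suc (Suc k))"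
    by (rule flip[OF y2]) (use V adj in auto)
  have "Z e f g x + Z c f g x \<in> Bd adj (V - {b, a, d}) (Suc k)"
  proof (rule change_apex)
    have "V - {b, a, d} - {e, f, g, c} = V - {a, b, c, e, f, g, d}" by auto
    then show "x \<in> Cy adj (V - {b, a, d} - {e, f, g, c}) k" using x by simp
  qed (use V adj in auto)
  then have 3: "Z b a d (Z e f g x + Z c f g x) \<in> Bd adj V (Suc (Suc k))"
    by (rule Z_Bd) (use V adj ba in auto)
  have "(Z a b c (Z e f g x) - Z b a d (Z e f g x)) + (Z a b e (Z c f g x) - Z b a d (Z c f g x)) + Z b a d (Z e f g x + Z c f g x)
     \<in> Bd adj V (Suc (Suc k))" by (rule adgrp_add[OF adgrp_Bd adgrp_add[OF adgrp_Bd 1 2] 3])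
  then show ?thesis by (simp add: Z_lin)
qed

text \<open>
  The exchange of the leaf \<open>g\<close> and the apex \<open>a2\<close> when the free vertex \<open>d\<close> is not adjacent to
  \<open>f\<close>, so that \<open>swap_leaf_apex\<close> does not apply. A third triple \<open>(a, b, c)\<close> is flipped first;
  this frees \<open>c\<close>, which is adjacent to \<open>f\<close>.
\<close>

lemma swap_leaf_apex_guarded:
  assumes x: "x \<in> Cy adj (V - {a, b, c, e, f, g, a2, b2, c2, d}) k"
    and V: "{a, b, c, e, f, g, a2, b2, c2, d} \<subseteq> V" "distinct [a, b, c, e, f, g, a2, b2, c2, d]"
    and adj: "adj a b" "adj a c" "adj b d" "adj e f" "adj e g" "adj e a2" "adj f c" "adj a2 b2" "adj a2 c2" "adj g b2" "adj g c2"
  shows "Z a b c (Z e f g (Z a2 b2 c2 x)) + Z a b c (Z e f a2 (Z g b2 c2 x)) \<in> Bd adj V (Suc (Suc (Suc k)))"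
proof -
  have ba: "adj b a" "adj f e" using adj sym by blast+
  have w1: "Z a2 b2 c2 x \<in> Cy adj (V - {a, b, d} - {e, f, g, c}) (Suc k)"
    by (rule Z_Cy) (use x V adj in \<open>auto intro: Cy_mono\<close>)
  have w2: "Z g b2 c2 x \<in> Cy adj (V - {a, b, d} - {e, f, a2, c}) (Suc k)"
    by (rule Z_Cy) (use x V adj in \<open>auto intro: Cy_mono\<close>)
  have 1: "Z e f g (Z a2 b2 c2 x) - Z f e c (Z a2 b2 c2 x) \<in> Bd adj (V - {a, b, d}) (Suc (Suc k))"
    by (rule flip[OF w1]) (use V adj in auto)
  have 2: "Z e f a2 (Z g b2 c2 x) - Z f e c (Z g b2 c2 x) \<in> Bd adj (V - {a, b, d}) (Suc (Suc k))"
    by (rule flip[OF w2]) (use V adj in auto)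
  have "Z a2 b2 c2 x + Z g b2 c2 x \<in> Bd adj (V - {a, b, d} - {f, e, c}) (Suc k)"
  proof (rule change_apex)
    have "V - {a, b, d} - {f, e, c} - {a2, b2, c2, g} = V - {a, b, c, e, f, g, a2, b2, c2, d}" by auto
    then show "x \<in> Cy adj (V - {a, b, d} - {f, e, c} - {a2, b2, c2, g}) k" using x by simp
  qed (use V adj in auto)
  then have 3: "Z f e c (Z a2 b2 c2 x + Z g b2 c2 x) \<in> Bd adj (V - {a, b, d}) (Suc (Suc k))"
    by (rule Z_Bd) (use V adj ba in auto)
  have "(Z e f g (Z a2 b2 c2 x) - Z f e c (Z a2 b2 c2 x)) + (Z e f a2 (Z g b2 c2 x) - Z f e c (Z g b2 c2 x)) + Z f e c (Z a2 b2 c2 x + Z g b2 c2 x)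
     \<in> Bd adj (V - {a, b, d}) (Suc (Suc k))" by (rule adgrp_add[OF adgrp_Bd adgrp_add[OF adgrp_Bd 1 2] 3])
  then have U: "Z e f g (Z a2 b2 c2 x) + Z e f a2 (Z g b2 c2 x) \<in> Bd adj (V - {a, b, d}) (Suc (Suc k))" by (simp add: Z_lin)
  have "V - {a, b, d} = V - {b, a, d}" by auto
  then have 4: "Z b a d (Z e f g (Z a2 b2 c2 x) + Z e f a2 (Z g b2 c2 x)) \<in> Bd adj V (Suc (Suc (Suc k)))"
    using U by (intro Z_Bd) (use V adj ba in auto)
  have y: "Z e f g (Z a2 b2 c2 x) \<in> Cy adj (V - {a, b, c, d}) (Suc (Suc k))"
    "Z e f a2 (Z g b2 c2 x) \<in> Cy adj (V - {a, b, c, d}) (Suc (Suc k))"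
    by (intro Z_Cy; use x V adj in \<open>auto intro: Cy_mono\<close>)+
  have 5: "Z a b c (Z e f g (Z a2 b2 c2 x)) - Z b a d (Z e f g (Z a2 b2 c2 x)) \<in> Bd adj V (Suc (Suc (Suc k)))"
    by (rule flip[OF y(1)]) (use V adj in auto)
  have 6: "Z a b c (Z e f a2 (Z g b2 c2 x)) - Z b a d (Z e f a2 (Z g b2 c2 x)) \<in> Bd adj V (Suc (Suc (Suc k)))"
    by (rule flip[OF y(2)]) (use V adj in auto)
  have "(Z a b c (Z e f g (Z a2 b2 c2 x)) - Z b a d (Z e f g (Z a2 b2 c2 x))) + (Z a b c (Z e f a2 (Z g b2 c2 x)) - Z b a d (Z e f a2 (Z g b2 c2 x)))
     + Z b a d (Z e f g (Z a2 b2 c2 x) + Z e f a2 (Z g b2 c2 x)) \<in> Bd adj V (Suc (Suc (Suc k)))"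
    by (rule adgrp_add[OF adgrp_Bd adgrp_add[OF adgrp_Bd 5 6] 4])
  then show ?thesis by (simp add: Z_lin)
qed

text \<open>
  The origin of the \<open>3\<close>-torsion:
  \<open>(a\<^sub>2b\<^sub>2 - a\<^sub>2c\<^sub>2) + (a\<^sub>2c\<^sub>2 - a\<^sub>2c) + (a\<^sub>2c - a\<^sub>2b\<^sub>2) = 0\<close>.
  Each of the three products is obtained by rotating \<open>c\<close>, \<open>b\<^sub>2\<close>, \<open>c\<^sub>2\<close>; the flip of
  the first triple hides which of them is its second leaf.
\<close>

lemma three_term:
  assumes x: "x \<in> Cy adj (V - {a, b, c, a2, b2, c2, d}) k" and V: "{a, b, c, a2, b2, c2, d} \<subseteq> V" "distinct [a, b, c, a2, b2, c2, d]"
    and adj: "adj a b" "adj a c" "adj a b2" "adj a c2" "adj b d" "adj a2 b2" "adj a2 c2" "adj a2 c"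
  shows "Z a b c (Z a2 b2 c2 x) + Z a b b2 (Z a2 c2 c x) + Z a b c2 (Z a2 c b2 x) \<in> Bd adj V (Suc (Suc k))"
proof -
  have y: "Z a2 b2 c2 x \<in> Cy adj (V - {a, b, c, d}) (Suc k)" "Z a2 c2 c x \<in> Cy adj (V - {a, b, b2, d}) (Suc k)"
    "Z a2 c b2 x \<in> Cy adj (V - {a, b, c2, d}) (Suc k)"
    by (intro Z_Cy; use x V adj in \<open>auto intro: Cy_mono\<close>)+
  have 1: "Z a b c (Z a2 b2 c2 x) - Z b a d (Z a2 b2 c2 x) \<in> Bd adj V (Suc (Suc k))"
    by (rule flip[OF y(1)]) (use V adj in auto)
  have 2: "Z a b b2 (Z a2 c2 c x) - Z b a d (Z a2 c2 c x) \<in> Bd adj V (Suc (Suc k))"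
    by (rule flip[OF y(2)]) (use V adj in auto)
  have 3: "Z a b c2 (Z a2 c b2 x) - Z b a d (Z a2 c b2 x) \<in> Bd adj V (Suc (Suc k))"
    by (rule flip[OF y(3)]) (use V adj in auto)
  have "Z a2 b2 c2 x + Z a2 c2 c x + Z a2 c b2 x = 0" by (simp add: Z_def)
  then have "Z b a d (Z a2 b2 c2 x) + Z b a d (Z a2 c2 c x) + Z b a d (Z a2 c b2 x) = 0"
    by (simp flip: Z_lin(1) add: Z_lin(4))
  then have "(Z a b c (Z a2 b2 c2 x) - Z b a d (Z a2 b2 c2 x)) + (Z a b b2 (Z a2 c2 c x) - Z b a d (Z a2 c2 c x)) + (Z a b c2 (Z a2 c b2 x) - Z b a d (Z a2 c b2 x))
     = Z a b c (Z a2 b2 c2 x) + Z a b b2 (Z a2 c2 c x) + Z a b c2 (Z a2 c b2 x)"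
    by (simp add: algebra_simps)
  then show ?thesis using 1 2 3 by (metis Bd_cl(4))
qed

end

lemma disj_of_sub_Diff: "S \<subseteq> B - Y \<Longrightarrow> Y \<inter> S = {}" by blast
lemma sub_DiffI: "Y \<subseteq> B \<Longrightarrow> Y \<inter> S = {} \<Longrightarrow> Y \<subseteq> B - S" by blast

text \<open>
  Vertices have colours \<open>col\<close>, positions have colours \<open>cp\<close>, and \<open>P\<close> tells which colours are
  joined by all edges. With one colour this describes complete graphs, with two colours complete
  bipartite graphs.
\<close>

locale arrangements = graph adj for adj :: "nat \<Rightarrow> nat \<Rightarrow> bool" +
  fixes V :: "nat set" and k :: nat and col :: "nat \<Rightarrow> bool" and P :: "bool \<Rightarrow> bool \<Rightarrow> bool" and cp :: "nat \<Rightarrow> bool"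
  assumes adjP: "u \<noteq> v \<Longrightarrow> P (col u) (col v) \<Longrightarrow> adj u v"
    and Pbase: "i < k \<Longrightarrow> P (cp (3*i)) (cp (3*i+1)) \<and> P (cp (3*i)) (cp (3*i+2))"
begin

definition arr :: "(nat \<Rightarrow> nat) \<Rightarrow> bool" where
  "arr A \<longleftrightarrow> inj_on A {..3*k} \<and> A ` {..3*k} \<subseteq> V \<and> (\<forall>p\<le>3*k. col (A p) = cp p)"

abbreviation F :: "(nat \<Rightarrow> nat) \<Rightarrow> (nat \<times> nat) chain" where "F A \<equiv> PT (LA A k)"

lemma arr_V: "arr A \<Longrightarrow> p \<le> 3*k \<Longrightarrow> A p \<in> V" by (auto simp: arr_def)
lemma arr_eq: "arr A \<Longrightarrow> p \<le> 3*k \<Longrightarrow> q \<le> 3*k \<Longrightarrow> A p = A q \<longleftrightarrow> p = q" by (auto simp: arr_def inj_on_def)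
lemma arr_distinct: "arr A \<Longrightarrow> distinct ps \<Longrightarrow> set ps \<subseteq> {..3*k} \<Longrightarrow> distinct (map A ps)"
  by (auto simp: arr_def distinct_map intro: inj_on_subset)
lemma arr_map: "arr A \<Longrightarrow> set ps \<subseteq> {..3*k} \<Longrightarrow> set (map A ps) \<subseteq> V"
  by (auto simp: arr_def)
lemma arr_adj: "arr A \<Longrightarrow> p \<le> 3*k \<Longrightarrow> q \<le> 3*k \<Longrightarrow> p \<noteq> q \<Longrightarrow> P (cp p) (cp q) \<Longrightarrow> adj (A p) (A q)"
  using arr_eq[of A p q] by (intro adjP) (auto simp: arr_def)

lemma arr_adj3: "arr A \<Longrightarrow> i < k \<Longrightarrow> adj (A (3*i)) (A (3*i+1)) \<and> adj (A (3*i)) (A (3*i+2))"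
  using arr_adj[of A "3*i" "3*i+1"] arr_adj[of A "3*i" "3*i+2"] Pbase[of i] by simp

lemma arr_transpose: assumes "arr A" "p \<le> 3*k" "q \<le> 3*k" "cp p = cp q" shows "arr (A \<circ> transpose p q)"
proof -
  have im: "transpose p q ` {..3*k} = {..3*k}" using assms by simp
  have "inj_on (A \<circ> transpose p q) {..3*k}"
    using assms(1) im by (intro comp_inj_on) (auto simp: arr_def)
  moreover have "(A \<circ> transpose p q) ` {..3*k} = A ` {..3*k}" using im by (metis image_comp)
  ultimately show ?thesis using assms by (auto simp: arr_def transpose_def)
qed

text \<open>
  Two positions of the same colour are related if exchanging their vertices changes the sign of
  the class of every arrangement. This is an equivalence relation; it is established for a few
  pairs of positions by the moves above, and then for all pairs of positions of equal colour.
\<close>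

definition rel :: "nat \<Rightarrow> nat \<Rightarrow> bool" where
  "rel p q \<longleftrightarrow> p \<le> 3*k \<and> q \<le> 3*k \<and> cp p = cp q \<and> (p = q \<or> (\<forall>A. arr A \<longrightarrow> F (A \<circ> transpose p q) + F A \<in> Bd adj V k))"

lemma rel_sym: "rel p q \<Longrightarrow> rel q p" by (auto simp: rel_def transpose_commute)

lemma rel_trans: assumes "rel p q" "rel q r" shows "rel p r"
proof (cases "p = q \<or> q = r \<or> p = r")
  case True then show ?thesis using assms by (auto simp: rel_def)
next
  case False
  have "F (A \<circ> transpose p r) + F A \<in> Bd adj V k" if A: "arr A" for A
  proof -
    \<comment> \<open>The transposition of \<open>p\<close> and \<open>r\<close> is a product of three transpositions, so three changes
         of sign make one.\<close>
    let ?A1 = "A \<circ> transpose p q" let ?A2 = "?A1 \<circ> transpose q r" let ?A3 = "?A2 \<circ> transpose p q"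
    have a1: "arr ?A1" using arr_transpose A assms by (auto simp: rel_def)
    have a2: "arr ?A2" using arr_transpose[OF a1, of q r] assms by (auto simp: rel_def)
    have "?A3 = A \<circ> transpose p r"
    proof -
      have "transpose p q \<circ> (transpose q r \<circ> transpose p q) = transpose p r"
        using False by (auto simp: fun_eq_iff transpose_def)
      then show ?thesis by (simp add: comp_assoc)
    qed
    moreover have b: "F ?A1 + F A \<in> Bd adj V k" "F ?A2 + F ?A1 \<in> Bd adj V k" "F ?A3 + F ?A2 \<in> Bd adj V k"
      using assms False A a1 a2 by (auto simp: rel_def)
    have "(F ?A3 + F ?A2) - (F ?A2 + F ?A1) + (F ?A1 + F A) \<in> Bd adj V k"
      by (rule adgrp_add[OF adgrp_Bd adgrp_diff[OF adgrp_Bd b(3) b(2)] b(1)])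
    ultimately show ?thesis by (simp add: algebra_simps)
  qed
  then show ?thesis using assms by (auto simp: rel_def)
qed

text \<open>
  If all positions of equal colour are related, then the class of an arrangement, multiplied by
  the sign of the arrangement, depends only on the vertex set. \<open>A\<close> is turned into \<open>B\<close> by
  transpositions that each settle one more position.
\<close>

lemma swap_all:
  assumes all: "\<And>p q. p \<le> 3*k \<Longrightarrow> q \<le> 3*k \<Longrightarrow> cp p = cp q \<Longrightarrow> rel p q"
    and A: "arr A" and B: "arr B" "A ` {..3*k} = B ` {..3*k}"
  shows "frag_cmul (lsgn (map A [0..<Suc (3*k)])) (F A) - frag_cmul (lsgn (map B [0..<Suc (3*k)])) (F B) \<in> Bd adj V k"
  using A B(2)
proof (induction "card {p. p \<le> 3*k \<and> A p \<noteq> B p}" arbitrary: A rule: less_induct)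
  case less
  let ?D = "\<lambda>A. {p. p \<le> 3*k \<and> A p \<noteq> B p}"
  let ?G = "\<lambda>A. frag_cmul (lsgn (map A [0..<Suc (3*k)])) (F A)"
  show ?case
  proof (cases "?D A = {}")
    case True
    then have e: "A p = B p" if "p \<le> 3*k" for p using that by auto
    have "map A [0..<Suc (3*k)] = map B [0..<Suc (3*k)]" using e by auto
    moreover have "LA A k = LA B k" unfolding LA_def Tr_def by (auto simp: e)
    ultimately show ?thesis by (simp only: diff_self Bd_cl)
  next
    case False
    then obtain p where p: "p \<le> 3*k" "A p \<noteq> B p" by auto
    have "B p \<in> A ` {..3*k}" using less.prems p by auto
    then obtain q where q: "q \<le> 3*k" "A q = B p" by auto
    have pq: "p \<noteq> q" using p q by auto
    have "cp p = cp q" using q p less.prems B(1) unfolding arr_def by metis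
    then have r: "rel p q" using all p q by auto
    let ?A = "A \<circ> transpose p q"
    have aA: "arr ?A" using arr_transpose less.prems p q \<open>cp p = cp q\<close> by auto
    have im: "?A ` {..3*k} = B ` {..3*k}"
    proof -
      have "transpose p q ` {..3*k} = {..3*k}" using p q by simp
      then show ?thesis using less.prems by (metis image_comp)
    qed
    have "?D ?A \<subset> ?D A"
    proof -
      have "A q \<noteq> B q" using q p pq B(1) unfolding arr_def inj_on_def by auto
      then have "?D ?A \<subseteq> ?D A" using p q by (auto simp: transpose_def)
      moreover have "p \<in> ?D A" "p \<notin> ?D ?A" using p q by auto
      ultimately have "?D ?A \<subseteq> ?D A" "p \<in> ?D A" "p \<notin> ?D ?A" by blast+
      then show ?thesis by blast
    qed
    then have "card (?D ?A) < card (?D A)" by (intro psubset_card_mono) auto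
    from less.hyps[OF this aA im] have 1: "?G ?A - ?G B \<in> Bd adj V k" .
    have ls: "lsgn (map ?A [0..<Suc (3*k)]) = - lsgn (map A [0..<Suc (3*k)])"
      using less.prems p q pq by (intro lsgn_transpose) (auto simp: arr_def lessThan_Suc_atMost)
    have "F ?A + F A \<in> Bd adj V k" using r pq less.prems by (auto simp: rel_def)
    then have "frag_cmul (lsgn (map A [0..<Suc (3*k)])) (F ?A + F A) \<in> Bd adj V k" by (rule Bd_cl(6))
    then have "?G A - ?G ?A \<in> Bd adj V k"
      unfolding ls by (simp add: frag_cmul_distrib2 add.commute flip: minus_frag_cmul)
    then show ?thesis using 1 adgrp_trans[OF adgrp_Bd] by blast
  qed
qed

lemma valid_sub:
  assumes A: "arr A" and "distinct is" "\<forall>i\<in>set is. i < k"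
  shows "valid adj (map (Tr A) is)" "Tv (map (Tr A) is) = A ` (\<Union>i\<in>set is. {3*i, 3*i+1, 3*i+2})"
proof -
  show *: "Tv (map (Tr A) is) = A ` (\<Union>i\<in>set is. {3*i, 3*i+1, 3*i+2})" for "is"
    by (auto simp: Tv_def Tr_def)
  show "valid adj (map (Tr A) is)" using assms(2,3)
  proof (induction "is")
    case (Cons i "is")
    have "cherry adj (Tr A i)"
      using Cons.prems arr_adj[OF A, of "3*i" "3*i+1"] arr_adj[OF A, of "3*i" "3*i+2"] Pbase[of i]
        arr_eq[OF A, of "3*i+1" "3*i+2"] by (simp add: Tr_def)
    moreover have "tv (Tr A i) \<inter> Tv (map (Tr A) is) = {}"
    proof -
      have "A p \<noteq> A q" if "p \<in> {3*i, 3*i+1, 3*i+2}" "j \<in> set is" "q \<in> {3*j, 3*j+1, 3*j+2}" for p q j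
      proof -
        have ij: "i \<noteq> j" "i < k" "j < k" using Cons.prems that by auto
        have "p \<noteq> q" using that ij(1) by (elim insertE emptyE; presburger)
        moreover have "p \<le> 3*k" "q \<le> 3*k" using that ij by auto
        ultimately show ?thesis using arr_eq[OF A, of p q] by simp
      qed
      then show ?thesis unfolding * by (auto simp: Tr_def simp del: insert_iff)
    qed
    ultimately show ?case using Cons by simp
  qed simp
qed

text \<open>
  The sign \<open>\<epsilon>\<close> is the same for all arrangements, so relations between arrangements can
  be checked after moving the triples concerned to the front.
\<close>

lemma front:
  assumes "distinct is" "\<forall>i\<in>set is. i < k"
  obtains js \<epsilon> where "\<And>A. F A = frag_cmul \<epsilon> (prodT (map (Tr A) is) (PT (map (Tr A) js)))"
    "set js = {..<k} - set is" "distinct js" "length is + length js = k"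
proof -
  define js where "js = filter (\<lambda>i. i \<notin> set is) [0..<k]"
  have js: "set js = {..<k} - set is" "distinct js" by (auto simp: js_def)
  have "set (is @ js) = {0..<k}" "distinct (is @ js)" using js assms by auto
  then have "mset [0..<k] = mset (is @ js)" by (metis set_eq_iff_mset_eq_distinct distinct_upt set_upt)
  from prodT_perm_map[OF this] obtain \<epsilon> where
    "\<And>T x. prodT (map T [0..<k]) x = frag_cmul \<epsilon> (prodT (map T (is @ js)) x)" by blast
  then have "\<And>A. F A = frag_cmul \<epsilon> (prodT (map (Tr A) is) (PT (map (Tr A) js)))" by (simp add: LA_def)
  moreover have "length is + length js = k"
    using \<open>mset [0..<k] = mset (is @ js)\<close> by (metis length_append length_upt diff_zero size_mset)
  ultimately show ?thesis using that js by blast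
qed

lemma rest_Cy:
  assumes A: "arr A" and js: "distinct js" "set js \<subseteq> {..<k}" and S: "S \<subseteq> A ` ({..3*k} - (\<Union>i\<in>set js. {3*i, 3*i+1, 3*i+2}))"
  shows "PT (map (Tr A) js) \<in> Cy adj (V - S) (length js)"
proof -
  have v: "valid adj (map (Tr A) js)" "Tv (map (Tr A) js) = A ` (\<Union>i\<in>set js. {3*i, 3*i+1, 3*i+2})"
    using valid_sub[OF A js(1)] subsetD[OF js(2)] by simp_all
  have J: "(\<Union>i\<in>set js. {3*i, 3*i+1, 3*i+2}) \<subseteq> {..3*k}" using js(2) by auto
  have "A ` (\<Union>i\<in>set js. {3*i, 3*i+1, 3*i+2}) \<inter> S = {}"
  proof -
    have "A ` ({..3*k} - (\<Union>i\<in>set js. {3*i, 3*i+1, 3*i+2})) = A ` {..3*k} - A ` (\<Union>i\<in>set js. {3*i, 3*i+1, 3*i+2})"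
      using A J by (intro inj_on_image_set_diff[of A "{..3*k}"]) (auto simp only: arr_def)
    then show ?thesis using S by (intro disj_of_sub_Diff[of S "A ` {..3*k}"]) simp
  qed
  moreover have "A ` (\<Union>i\<in>set js. {3*i, 3*i+1, 3*i+2}) \<subseteq> V"
    by (rule order_trans[OF image_mono[OF J, of A]]) (use A in \<open>simp add: arr_def\<close>)
  ultimately have "Tv (map (Tr A) js) \<subseteq> V - S" unfolding v(2) by (intro sub_DiffI)
  then show ?thesis using PT_Cy[OF v(1)] by simp
qed

lemma Tr_transpose:
  assumes "p \<notin> {3*i, 3*i+1, 3*i+2}" "q \<notin> {3*i, 3*i+1, 3*i+2}" shows "Tr (A \<circ> transpose p q) i = Tr A i"
  using assms by (auto simp: Tr_def transpose_def)

text \<open>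
  Only the triples that meet the positions \<open>p\<close> and \<open>q\<close>, and possibly a few auxiliary ones,
  matter; the product \<open>x\<close> of the remaining triples is a common factor.
\<close>

lemma relI:
  assumes "p \<le> 3*k" "q \<le> 3*k" "cp p = cp q" "p \<noteq> q"
    and "distinct is" "\<forall>i\<in>set is. i < k" "\<And>i. i < k \<Longrightarrow> i \<notin> set is \<Longrightarrow> {p, q} \<inter> {3*i, 3*i+1, 3*i+2} = {}"
    and "\<And>A x n. arr A \<Longrightarrow> x \<in> Cy adj (V - A ` insert (3*k) (\<Union>i\<in>set is. {3*i, 3*i+1, 3*i+2})) n \<Longrightarrow> n + length is = k \<Longrightarrow>
       prodT (map (Tr (A \<circ> transpose p q)) is) x + prodT (map (Tr A) is) x \<in> Bd adj V k"
  shows "rel p q"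
proof -
  have "F (A \<circ> transpose p q) + F A \<in> Bd adj V k" if A: "arr A" for A
  proof -
    obtain js \<epsilon> where js: "\<And>A. F A = frag_cmul \<epsilon> (prodT (map (Tr A) is) (PT (map (Tr A) js)))"
      "set js = {..<k} - set is" "distinct js" "length is + length js = k"
      using front[OF assms(5,6)] by metis
    have e: "map (Tr (A \<circ> transpose p q)) js = map (Tr A) js"
      using js(2) assms(7) by (intro map_cong refl Tr_transpose) auto
    have "insert (3*k) (\<Union>i\<in>set is. {3*i, 3*i+1, 3*i+2}) \<subseteq> {..3*k} - (\<Union>i\<in>set js. {3*i, 3*i+1, 3*i+2})"
    proof
      fix r assume "r \<in> insert (3*k) (\<Union>i\<in>set is. {3*i, 3*i+1, 3*i+2})"
      then consider "r = 3*k" | i where "i \<in> set is" "r \<in> {3*i, 3*i+1, 3*i+2}" by blast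
      then show "r \<in> {..3*k} - (\<Union>i\<in>set js. {3*i, 3*i+1, 3*i+2})"
      proof cases
        case 1
        have "r \<noteq> 3*j \<and> r \<noteq> 3*j+1 \<and> r \<noteq> 3*j+2" if "j \<in> set js" for j
        proof -
          have "j < k" using that js(2) by auto
          then show ?thesis using 1 by presburger
        qed
        then show ?thesis using 1 by auto
      next
        case 2
        then have "i < k" using assms(6) by auto
        moreover have "r \<noteq> 3*j \<and> r \<noteq> 3*j+1 \<and> r \<noteq> 3*j+2" if "j \<in> set js" for j
        proof -
          have "i \<noteq> j" using that js(2) 2 by auto
          moreover have "r = 3*i \<or> r = 3*i+1 \<or> r = 3*i+2" using 2(2) by simp
          ultimately show ?thesis by presburger
        qed
        ultimately show ?thesis using 2(2) by auto
      qed
    qed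
    then have "PT (map (Tr A) js) \<in> Cy adj (V - A ` insert (3*k) (\<Union>i\<in>set is. {3*i, 3*i+1, 3*i+2})) (length js)"
      using js by (intro rest_Cy[OF A]) auto
    from assms(8)[OF A this] have "prodT (map (Tr (A \<circ> transpose p q)) is) (PT (map (Tr A) js)) + prodT (map (Tr A) is) (PT (map (Tr A) js)) \<in> Bd adj V k"
      using js(4) by simp
    then have "frag_cmul \<epsilon> (prodT (map (Tr (A \<circ> transpose p q)) is) (PT (map (Tr A) js)) + prodT (map (Tr A) is) (PT (map (Tr A) js))) \<in> Bd adj V k"
      by (rule Bd_cl(6))
    then show ?thesis unfolding js(1) e by (simp add: frag_cmul_distrib2)
  qed
  then show ?thesis using assms(1-4) by (simp add: rel_def)
qed

lemma rel_leaves: assumes "i < k" "cp (3*i+1) = cp (3*i+2)" shows "rel (3*i+1) (3*i+2)"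
proof (rule relI[of _ _ "[i]"])
  fix A x n
  show "prodT (map (Tr (A \<circ> transpose (3*i+1) (3*i+2))) [i]) x + prodT (map (Tr A) [i]) x \<in> Bd adj V k"
    by (simp add: Tr_def transpose_def Z_def Bd_cl)
next
  fix j assume "j < k" "j \<notin> set [i]"
  then have "j \<noteq> i" by simp
  then show "{3*i+1, 3*i+2} \<inter> {3*j, 3*j+1, 3*j+2} = {}" by (simp; presburger)
qed (use assms in auto)

lemma rel_apex_free:
  assumes "i < k" "cp (3*i) = cp (3*k)" shows "rel (3*i) (3*k)"
proof (rule relI[of _ _ "[i]"])
  fix A x n assume A: "arr A" and x: "x \<in> Cy adj (V - A ` insert (3*k) (\<Union>i\<in>set [i]. {3*i, 3*i+1, 3*i+2})) n"
    and n: "n + length [i] = k"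
  let ?a = "A (3*i)" let ?b = "A (3*i+1)" let ?c = "A (3*i+2)" let ?d = "A (3*k)"
  have "Z ?a ?b ?c x + Z ?d ?b ?c x \<in> Bd adj V (Suc n)"
  proof (rule change_apex)
    have "A ` insert (3*k) (\<Union>i\<in>set [i]. {3*i, 3*i+1, 3*i+2}) = {?a, ?b, ?c, ?d}" by auto
    then show "x \<in> Cy adj (V - {?a, ?b, ?c, ?d}) n" using x by simp
    show "distinct [?a, ?b, ?c, ?d]" using assms(1) by (simp add: arr_eq[OF A])
    show "{?a, ?b, ?c, ?d} \<subseteq> V" using assms(1) arr_V[OF A] by auto
    have "3*k \<noteq> 3*i+1" "3*k \<noteq> 3*i+2" by presburger+
    then show "adj ?d ?b" "adj ?d ?c"
      using arr_adj[OF A, of "3*k" "3*i+1"] arr_adj[OF A, of "3*k" "3*i+2"] assms Pbase[of i] by simp_all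
  qed (use arr_adj3[OF A] assms in simp_all)
  moreover have "k = Suc n" using n by simp
  moreover have "prodT (map (Tr (A \<circ> transpose (3*i) (3*k))) [i]) x = Z ?d ?b ?c x" "prodT (map (Tr A) [i]) x = Z ?a ?b ?c x"
    using assms(1) by (auto simp: Tr_def transpose_def)
  ultimately show "prodT (map (Tr (A \<circ> transpose (3*i) (3*k))) [i]) x + prodT (map (Tr A) [i]) x \<in> Bd adj V k"
    by (simp add: add.commute)
next
  fix j assume "j < k" "j \<notin> set [i]"
  then have "j \<noteq> i" "j < k" by simp_all
  then show "{3*i, 3*k} \<inter> {3*j, 3*j+1, 3*j+2} = {}" by (simp; presburger)
qed (use assms in auto)

lemma rel_leaf_apex:
  assumes ij: "i < k" "j < k" "i \<noteq> j" and c: "cp (3*i+2) = cp (3*j)" and P: "P (cp (3*i+1)) (cp (3*k))"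
  shows "rel (3*i+2) (3*j)"
proof (rule relI[of _ _ "[i, j]"])
  fix A x n assume A: "arr A" and x: "x \<in> Cy adj (V - A ` insert (3*k) (\<Union>i\<in>set [i, j]. {3*i, 3*i+1, 3*i+2})) n"
    and n: "n + length [i, j] = k"
  let ?a = "A (3*i)" let ?b = "A (3*i+1)" let ?c = "A (3*i+2)" let ?d = "A (3*k)"
  let ?e = "A (3*j)" let ?f = "A (3*j+1)" let ?g = "A (3*j+2)"
  have ne: "3*i \<noteq> 3*j+1" "3*i \<noteq> 3*j+2" "3*i+1 \<noteq> 3*j" "3*i+1 \<noteq> 3*j+2" "3*i+2 \<noteq> 3*j" "3*i+2 \<noteq> 3*j+1" by presburger+
  have "Z ?a ?b ?c (Z ?e ?f ?g x) + Z ?a ?b ?e (Z ?c ?f ?g x) \<in> Bd adj V (Suc (Suc n))"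
  proof (rule swap_leaf_apex)
    have "A ` insert (3*k) (\<Union>i\<in>set [i, j]. {3*i, 3*i+1, 3*i+2}) = {?a, ?b, ?c, ?e, ?f, ?g, ?d}" by auto
    then show "x \<in> Cy adj (V - {?a, ?b, ?c, ?e, ?f, ?g, ?d}) n" using x by simp
    show "distinct [?a, ?b, ?c, ?e, ?f, ?g, ?d]" using ij ne by (simp add: arr_eq[OF A])
    show "{?a, ?b, ?c, ?e, ?f, ?g, ?d} \<subseteq> V" using ij arr_V[OF A] by auto
    show "adj ?a ?e" using ij c ne Pbase[of i] by (intro arr_adj[OF A]) simp_all
    show "adj ?b ?d" using ij P by (intro arr_adj[OF A]) simp_all
    show "adj ?c ?f" using ij c ne Pbase[of j] by (intro arr_adj[OF A]) simp_all
    show "adj ?c ?g" using ij c ne Pbase[of j] by (intro arr_adj[OF A]) simp_all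
  qed (use arr_adj3[OF A] ij in simp_all)
  moreover have "k = Suc (Suc n)" using n by simp
  moreover have "prodT (map (Tr (A \<circ> transpose (3*i+2) (3*j))) [i, j]) x = Z ?a ?b ?e (Z ?c ?f ?g x)" "prodT (map (Tr A) [i, j]) x = Z ?a ?b ?c (Z ?e ?f ?g x)"
    using ij ne by (auto simp: Tr_def transpose_def)
  ultimately show "prodT (map (Tr (A \<circ> transpose (3*i+2) (3*j))) [i, j]) x + prodT (map (Tr A) [i, j]) x \<in> Bd adj V k"
    by (simp add: add.commute)
next
  fix l assume "l < k" "l \<notin> set [i, j]"
  then have "l \<noteq> i" "l \<noteq> j" by simp_all
  then show "{3*i+2, 3*j} \<inter> {3*l, 3*l+1, 3*l+2} = {}" by (simp; presburger)
next
  show "3*i+2 \<noteq> 3*j" by presburger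
qed (use ij c in simp_all)

lemma rel_leaf_apex_guarded:
  assumes ij: "i < k" "j < k" "l < k" "distinct [i, j, l]" and c: "cp (3*j+2) = cp (3*l)"
    and P: "P (cp (3*i+1)) (cp (3*k))" "P (cp (3*j+1)) (cp (3*i+2))"
  shows "rel (3*j+2) (3*l)"
proof (rule relI[of _ _ "[i, j, l]"])
  fix A x n assume A: "arr A" and x: "x \<in> Cy adj (V - A ` insert (3*k) (\<Union>i\<in>set [i, j, l]. {3*i, 3*i+1, 3*i+2})) n"
    and n: "n + length [i, j, l] = k"
  let ?a = "A (3*i)" let ?b = "A (3*i+1)" let ?c = "A (3*i+2)" let ?d = "A (3*k)"
  let ?e = "A (3*j)" let ?f = "A (3*j+1)" let ?g = "A (3*j+2)"
  let ?p = "A (3*l)" let ?q = "A (3*l+1)" let ?r = "A (3*l+2)"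
  have ne0: "3*i \<noteq> 3*j+1" "3*i \<noteq> 3*j+2" "3*i+1 \<noteq> 3*j" "3*i+1 \<noteq> 3*j+2" "3*i+2 \<noteq> 3*j" "3*i+2 \<noteq> 3*j+1" for i j :: nat by presburger+
  note ne = ne0[of i j] ne0[of i l] ne0[of j l] ne0[of j i] ne0[of l i] ne0[of l j]
  have "Z ?a ?b ?c (Z ?e ?f ?g (Z ?p ?q ?r x)) + Z ?a ?b ?c (Z ?e ?f ?p (Z ?g ?q ?r x)) \<in> Bd adj V (Suc (Suc (Suc n)))"
  proof (rule swap_leaf_apex_guarded)
    have "A ` insert (3*k) (\<Union>i\<in>set [i, j, l]. {3*i, 3*i+1, 3*i+2}) = {?a, ?b, ?c, ?e, ?f, ?g, ?p, ?q, ?r, ?d}" by auto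
    then show "x \<in> Cy adj (V - {?a, ?b, ?c, ?e, ?f, ?g, ?p, ?q, ?r, ?d}) n" using x by simp
    let ?ps = "[3*i, 3*i+1, 3*i+2, 3*j, 3*j+1, 3*j+2, 3*l, 3*l+1, 3*l+2, 3*k]"
    have ps: "set ?ps \<subseteq> {..3*k}" using ij by simp
    have "distinct ?ps" using ij ne by simp
    from arr_distinct[OF A this ps] show "distinct [?a, ?b, ?c, ?e, ?f, ?g, ?p, ?q, ?r, ?d]"
      by (simp only: list.map)
    have "set (map A ?ps) \<subseteq> V" by (rule arr_map[OF A ps])
    then show "{?a, ?b, ?c, ?e, ?f, ?g, ?p, ?q, ?r, ?d} \<subseteq> V" by (simp only: list.map list.set)
    have le: "3*m \<le> 3*k" "3*m+1 \<le> 3*k" "3*m+2 \<le> 3*k" if "m < k" for m using that by simp_all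
    have n1: "3*j \<noteq> 3*l" "3*j+2 \<noteq> 3*l+2" using ij(4) by simp_all
    have n2: "3*j+2 \<noteq> 3*l+1" "3*i+1 \<noteq> 3*k" "3*j+1 \<noteq> 3*i+2" by presburger+
    have P1: "P (cp (3*j)) (cp (3*l))" using Pbase[OF ij(2)] unfolding c by blast
    have P2: "P (cp (3*j+2)) (cp (3*l+1))" "P (cp (3*j+2)) (cp (3*l+2))" using Pbase[OF ij(3)] unfolding c by blast+
    show "adj ?e ?p" by (rule arr_adj[OF A le(1)[OF ij(2)] le(1)[OF ij(3)] n1(1) P1])
    show "adj ?g ?q" by (rule arr_adj[OF A le(3)[OF ij(2)] le(2)[OF ij(3)] n2(1) P2(1)])
    show "adj ?g ?r" by (rule arr_adj[OF A le(3)[OF ij(2)] le(3)[OF ij(3)] n1(2) P2(2)])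
    show "adj ?b ?d" by (rule arr_adj[OF A le(2)[OF ij(1)] order_refl n2(2) P(1)])
    show "adj ?f ?c" by (rule arr_adj[OF A le(2)[OF ij(2)] le(3)[OF ij(1)] n2(3) P(2)])
  qed (use arr_adj3[OF A ij(1)] arr_adj3[OF A ij(2)] arr_adj3[OF A ij(3)] in blast)+
  moreover have "k = Suc (Suc (Suc n))" using n by simp
  moreover have "prodT (map (Tr (A \<circ> transpose (3*j+2) (3*l))) [i, j, l]) x = Z ?a ?b ?c (Z ?e ?f ?p (Z ?g ?q ?r x))"
    "prodT (map (Tr A) [i, j, l]) x = Z ?a ?b ?c (Z ?e ?f ?g (Z ?p ?q ?r x))"
  proof -
    have d: "i \<noteq> j" "i \<noteq> l" "j \<noteq> l" "j \<noteq> i" "l \<noteq> i" "l \<noteq> j" using ij(4) by auto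
    show "prodT (map (Tr (A \<circ> transpose (3*j+2) (3*l))) [i, j, l]) x = Z ?a ?b ?c (Z ?e ?f ?p (Z ?g ?q ?r x))"
      "prodT (map (Tr A) [i, j, l]) x = Z ?a ?b ?c (Z ?e ?f ?g (Z ?p ?q ?r x))"
      using d ne by (simp_all add: Tr_def transpose_def)
  qed
  ultimately show "prodT (map (Tr (A \<circ> transpose (3*j+2) (3*l))) [i, j, l]) x + prodT (map (Tr A) [i, j, l]) x \<in> Bd adj V k"
    by (simp add: add.commute)
next
  fix h assume "h < k" "h \<notin> set [i, j, l]"
  then have "h \<noteq> j" "h \<noteq> l" by simp_all
  then show "{3*j+2, 3*l} \<inter> {3*h, 3*h+1, 3*h+2} = {}" by (simp; presburger)
next
  show "3*j+2 \<noteq> 3*l" by presburger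
qed (use ij c in simp_all)

text \<open>
  The three summands of \<open>three_term\<close> are arrangements that differ by a cyclic permutation of
  three positions, hence by even permutations, so they are homologous.
\<close>

lemma three_null:
  assumes all: "\<And>p q. p \<le> 3*k \<Longrightarrow> q \<le> 3*k \<Longrightarrow> cp p = cp q \<Longrightarrow> rel p q"
    and il: "i < k" "l < k" "i \<noteq> l" "cp (3*i+2) = cp (3*l+1)" "cp (3*i+2) = cp (3*l+2)" "P (cp (3*i+1)) (cp (3*k))"
    and A: "arr A"
  shows "frag_cmul 3 (F A) \<in> Bd adj V k"
proof -
  let ?p = "3*i+2" let ?q = "3*l+1" let ?r = "3*l+2"
  \<comment> \<open>\<open>?A2\<close> and \<open>?B2\<close> are the two cyclic rotations of the positions \<open>?p\<close>, \<open>?q\<close>, \<open>?r\<close>.\<close>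
  let ?A1 = "A \<circ> transpose ?p ?q" let ?A2 = "?A1 \<circ> transpose ?q ?r"
  let ?B1 = "A \<circ> transpose ?p ?r" let ?B2 = "?B1 \<circ> transpose ?q ?r"
  have ne: "3*i \<noteq> 3*l+1" "3*i \<noteq> 3*l+2" "3*i+1 \<noteq> 3*l" "3*i+1 \<noteq> 3*l+2" "3*i+2 \<noteq> 3*l" "3*i+2 \<noteq> 3*l+1"  "3*l \<noteq> 3*i+1" "3*l \<noteq> 3*i+2"
    by presburger+
  have arrs: "arr ?A1" "arr ?B1" using il A by (auto intro!: arr_transpose)
  have r: "rel ?p ?q" "rel ?q ?r" "rel ?p ?r" using all il by auto
  have A2: "F ?A2 - F A \<in> Bd adj V k"
  proof -
    have b: "F ?A2 + F ?A1 \<in> Bd adj V k" "F ?A1 + F A \<in> Bd adj V k" using r arrs A ne unfolding rel_def by auto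
    have "(F ?A2 + F ?A1) - (F ?A1 + F A) \<in> Bd adj V k" by (rule adgrp_diff[OF adgrp_Bd b])
    then show ?thesis by simp
  qed
  have B2: "F ?B2 - F A \<in> Bd adj V k"
  proof -
    have b: "F ?B2 + F ?B1 \<in> Bd adj V k" "F ?B1 + F A \<in> Bd adj V k" using r arrs A il(3) unfolding rel_def by auto
    have "(F ?B2 + F ?B1) - (F ?B1 + F A) \<in> Bd adj V k" by (rule adgrp_diff[OF adgrp_Bd b])
    then show ?thesis by simp
  qed
  obtain js \<epsilon> where js: "\<And>A. F A = frag_cmul \<epsilon> (prodT (map (Tr A) [i, l]) (PT (map (Tr A) js)))"
    "set js = {..<k} - set [i, l]" "distinct js" "length [i, l] + length js = k"
  proof -
    have "distinct [i, l]" "\<forall>j\<in>set [i, l]. j < k" using il by simp_all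
    from front[OF this] that show thesis by metis
  qed
  let ?x = "PT (map (Tr A) js)"
  let ?a = "A (3*i)" let ?b = "A (3*i+1)" let ?c = "A (3*i+2)" let ?d = "A (3*k)"
  let ?e = "A (3*l)" let ?f = "A (3*l+1)" let ?g = "A (3*l+2)"
  have "Tr ?A2 j = Tr A j" "Tr ?B2 j = Tr A j" if "j \<in> set js" for j
  proof -
    have "j \<noteq> i" "j \<noteq> l" using that js(2) by auto
    then have "?p \<notin> {3*j, 3*j+1, 3*j+2}" "?q \<notin> {3*j, 3*j+1, 3*j+2}" "?r \<notin> {3*j, 3*j+1, 3*j+2}" by (simp; presburger)+
    note h = this
    show "Tr ?A2 j = Tr A j" using Tr_transpose[OF h(2,3), of ?A1] Tr_transpose[OF h(1,2), of A] by (rule trans)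
    show "Tr ?B2 j = Tr A j" using Tr_transpose[OF h(2,3), of ?B1] Tr_transpose[OF h(1,3), of A] by (rule trans)
  qed
  then have e: "map (Tr ?A2) js = map (Tr A) js" "map (Tr ?B2) js = map (Tr A) js" by auto
  have FA2: "F ?A2 = frag_cmul \<epsilon> (Z ?a ?b ?f (Z ?e ?g ?c ?x))"
    unfolding js(1) e using il ne by (simp add: Tr_def transpose_def)
  have FB2: "F ?B2 = frag_cmul \<epsilon> (Z ?a ?b ?g (Z ?e ?c ?f ?x))"
    unfolding js(1) e using il ne by (simp add: Tr_def transpose_def)
  have FA: "F A = frag_cmul \<epsilon> (Z ?a ?b ?c (Z ?e ?f ?g ?x))"
    unfolding js(1) by (simp add: Tr_def)
  have "Z ?a ?b ?c (Z ?e ?f ?g ?x) + Z ?a ?b ?f (Z ?e ?g ?c ?x) + Z ?a ?b ?g (Z ?e ?c ?f ?x) \<in> Bd adj V (Suc (Suc (length js)))"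
  proof (rule three_term)
    show "?x \<in> Cy adj (V - {?a, ?b, ?c, ?e, ?f, ?g, ?d}) (length js)"
    proof (rule rest_Cy[OF A js(3)])
      have "{3*i, 3*i+1, 3*i+2, 3*l, 3*l+1, 3*l+2, 3*k} \<subseteq> {..3*k} - (\<Union>j\<in>set js. {3*j, 3*j+1, 3*j+2})"
      proof -
        have "{3*i, 3*i+1, 3*i+2, 3*l, 3*l+1, 3*l+2, 3*k} \<inter> {3*j, 3*j+1, 3*j+2} = {}" if "j \<in> set js" for j
        proof -
          have "j \<noteq> i" "j \<noteq> l" "j < k" using that js(2) by auto
          then show ?thesis by (simp; presburger)
        qed
        then show ?thesis using il(1,2) by fastforce
      qed
      then have "A ` {3*i, 3*i+1, 3*i+2, 3*l, 3*l+1, 3*l+2, 3*k} \<subseteq> A ` ({..3*k} - (\<Union>j\<in>set js. {3*j, 3*j+1, 3*j+2}))" by (rule image_mono)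
      then show "{?a, ?b, ?c, ?e, ?f, ?g, ?d} \<subseteq> A ` ({..3*k} - (\<Union>j\<in>set js. {3*j, 3*j+1, 3*j+2}))" by simp
    qed (use js in auto)
    show "distinct [?a, ?b, ?c, ?e, ?f, ?g, ?d]" using il ne by (simp add: arr_eq[OF A])
    show "{?a, ?b, ?c, ?e, ?f, ?g, ?d} \<subseteq> V" using il arr_V[OF A] by auto
    show "adj ?a ?f" using il ne Pbase[of i] by (intro arr_adj[OF A]) simp_all
    show "adj ?a ?g" using il ne Pbase[of i] by (intro arr_adj[OF A]) simp_all
    show "adj ?b ?d" using il by (intro arr_adj[OF A]) simp_all
    show "adj ?e ?c" using il ne Pbase[of l] by (intro arr_adj[OF A]) simp_all
  qed (use arr_adj3[OF A] il in simp_all)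
  moreover have "k = Suc (Suc (length js))" using js(4) by simp
  ultimately have "frag_cmul \<epsilon> (Z ?a ?b ?c (Z ?e ?f ?g ?x) + Z ?a ?b ?f (Z ?e ?g ?c ?x) + Z ?a ?b ?g (Z ?e ?c ?f ?x)) \<in> Bd adj V k"
    by (metis Bd_cl(6))
  then have s3: "F A + F ?A2 + F ?B2 \<in> Bd adj V k" unfolding FA FA2 FB2 by (simp add: frag_cmul_distrib2)
  have "(F A + F ?A2 + F ?B2) - (F ?A2 - F A) - (F ?B2 - F A) \<in> Bd adj V k"
    by (rule adgrp_diff[OF adgrp_Bd adgrp_diff[OF adgrp_Bd s3 A2] B2])
  moreover have "frag_cmul 3 (F A) = F A + F A + F A"
    using frag_cmul_distrib[of 1 2 "F A"] frag_cmul_distrib[of 1 1 "F A"] by simp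
  ultimately show ?thesis by (simp add: algebra_simps)
qed

end

section \<open>Lists of triples as arrangements\<close>

text \<open>The order of the entries matches the positions of an arrangement.\<close>

fun flat :: "triple list \<Rightarrow> nat list" where
  "flat [] = []"
| "flat ((a, b, c) # L) = a # b # c # flat L"

lemma set_flat [simp]: "set (flat L) = Tv L" by (induction L rule: flat.induct) auto
lemma length_flat [simp]: "length (flat L) = 3 * length L" by (induction L rule: flat.induct) auto
lemma (in graph) distinct_flat: "valid adj L \<Longrightarrow> distinct (flat L)"
  by (induction L rule: flat.induct) (auto dest: irr)

lemma LA_flat: "LA ((!) (flat L @ ys)) (length L) = L"
proof (induction L rule: flat.induct)
  case (2 a b c L)
  let ?A = "(!) (flat ((a, b, c) # L) @ ys)"
  have "LA ?A (Suc (length L)) = Tr ?A 0 # map (Tr ?A) (map Suc [0..<length L])"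
    by (simp only: LA_def upt_conv_Cons[OF zero_less_Suc] map_Suc_upt list.map)
  also have "map (Tr ?A) (map Suc [0..<length L]) = LA ((!) (flat L @ ys)) (length L)"
    by (simp add: LA_def Tr_def numeral_3_eq_3)
  finally show ?case using 2 by (simp add: Tr_def)
qed (simp add: LA_def)

lemma map_nth_upt: "length xs = n \<Longrightarrow> map ((!) xs) [0..<n] = xs"
  using map_nth[of xs] by simp

lemma (in arrangements) arr_flat:
  assumes "valid adj L" "length L = k" "d \<notin> Tv L" "insert d (Tv L) \<subseteq> V" "\<And>p. p \<le> 3*k \<Longrightarrow> col ((flat L @ [d]) ! p) = cp p"
  shows "arr ((!) (flat L @ [d]))" "F ((!) (flat L @ [d])) = PT L"
    "map ((!) (flat L @ [d])) [0..<Suc (3*k)] = flat L @ [d]" "(!) (flat L @ [d]) ` {..3*k} = insert d (Tv L)"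
proof -
  have d: "distinct (flat L @ [d])" using assms distinct_flat by simp
  have l: "length (flat L @ [d]) = Suc (3*k)" using assms by simp
  show m: "map ((!) (flat L @ [d])) [0..<Suc (3*k)] = flat L @ [d]"
    using map_nth_upt[OF l] .
  have s: "set [0..<Suc (3*k)] = {..3*k}" by auto
  have "set (map ((!) (flat L @ [d])) [0..<Suc (3*k)]) = insert d (Tv L)" unfolding m by simp
  then show im: "(!) (flat L @ [d]) ` {..3*k} = insert d (Tv L)" by (simp only: set_map s)
  have "inj_on ((!) (flat L @ [d])) {..3*k}" using inj_on_nth[OF d, of "{..3*k}"] l by auto
  then show "arr ((!) (flat L @ [d]))" unfolding arr_def im using assms(4,5) by blast
  show "F ((!) (flat L @ [d])) = PT L" using LA_flat[of L "[d]"] assms by simp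
qed

lemma fadd_int_cmul:
  assumes "fadd (f :: ('a \<Rightarrow>\<^sub>0 int) \<Rightarrow> int)" shows "f (frag_cmul n x) = n * f x"
proof (induction n rule: int_induct[of _ 0])
qed (use assms in \<open>simp_all add: additive.zero additive.add additive.diff frag_cmul_distrib frag_cmul_diff_distrib algebra_simps\<close>)

lemma sign_transfer:
  fixes l l' x y :: int
  assumes "l * l = 1" "l' * l' = 1" "3 dvd x - l" "3 dvd l * x - l' * y"
  shows "3 dvd y - l'"
proof -
  have "3 dvd l' * (l * (x - l) - (l * x - l' * y))" by (rule dvd_mult[OF dvd_diff[OF dvd_mult[OF assms(3)] assms(4)]])
  also have "l' * (l * (x - l) - (l * x - l' * y)) = (l' * l') * y - (l * l) * l'" by (simp add: algebra_simps)
  finally show ?thesis using assms(1,2) by simp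
qed

lemma dvd3_diff: "3 dvd x - l \<Longrightarrow> 3 dvd x \<Longrightarrow> 3 dvd (l::int)" by presburger
lemma dvd3_rearrange: "3 dvd p - (a - b) \<Longrightarrow> 3 dvd b - a + (p::int)" by presburger

section \<open>All arrangements of a complete graph agree\<close>

interpretation complete_arr: arrangements "(\<noteq>)" V k "\<lambda>_. True" "\<lambda>_ _. True" "\<lambda>_. True" for V k
  by unfold_locales auto

lemma div3_cases:
  assumes "(p::nat) \<le> 3 * k" obtains "p = 3 * k" | i where "i < k" "p = 3 * i" | i where "i < k" "p = 3 * i + 1" | i where "i < k" "p = 3 * i + 2"
proof -
  have "p = 3 * (p div 3) + p mod 3" "p mod 3 < 3" by simp_all
  then consider "p = 3 * (p div 3)" | "p = 3 * (p div 3) + 1" | "p = 3 * (p div 3) + 2" by linarith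
  then show thesis
  proof cases
    case 1
    then show thesis using that(1) that(2)[of "p div 3"] assms by (cases "p = 3 * k") auto
  next
    case 2
    then show thesis using that(3)[of "p div 3"] assms by linarith
  next
    case 3
    then show thesis using that(4)[of "p div 3"] assms by linarith
  qed
qed

text \<open>
  A second triple is needed to relate a leaf to an apex, whence the bound on \<open>k\<close>.
\<close>

lemma complete_rel: assumes k: "2 \<le> k" and "p \<le> 3*k" "q \<le> 3*k" shows "complete_arr.rel V k p q"
proof -
  note r = complete_arr.rel_trans complete_arr.rel_sym
  have S2: "complete_arr.rel V k (3*i) (3*k)" if "i < k" for i using that by (intro complete_arr.rel_apex_free) auto
  have *: "complete_arr.rel V k p (3*k)" if "p \<le> 3*k" for p
    using that
  proof (cases rule: div3_cases)
    case 1 then show ?thesis by (simp add: complete_arr.rel_def)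
  next
    case (2 i) then show ?thesis using S2 by simp
  next
    case (3 i)
    have "\<exists>j. j < k \<and> i \<noteq> j" by (rule exI[of _ "if i = 0 then 1 else 0"]) (use k in simp)
    then obtain j where j: "j < k" "i \<noteq> j" by blast
    have "complete_arr.rel V k (3*i+1) (3*i+2)" "complete_arr.rel V k (3*i+2) (3*j)"
      by (rule complete_arr.rel_leaves[OF 3(1) refl], rule complete_arr.rel_leaf_apex[OF 3(1) j refl TrueI])
    then show ?thesis unfolding 3(2) using S2[OF j(1)] r(1) by metis
  next
    case (4 i)
    have "\<exists>j. j < k \<and> i \<noteq> j" by (rule exI[of _ "if i = 0 then 1 else 0"]) (use k in simp)
    then obtain j where j: "j < k" "i \<noteq> j" by blast
    have "complete_arr.rel V k (3*i+2) (3*j)"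
      by (rule complete_arr.rel_leaf_apex[OF 4(1) j refl TrueI])
    then show ?thesis unfolding 4(2) using S2[OF j(1)] r(1) by metis
  qed
  show ?thesis by (rule r(1)[OF *[OF assms(2)] r(2)[OF *[OF assms(3)]]])
qed

text \<open>
  On \<open>3 * k + 1\<close> vertices the triple product is an alternating function of the vertices, modulo
  boundaries.
\<close>

lemma complete_alt:
  assumes k: "2 \<le> k" and L: "valid (\<noteq>) L" "length L = k" "d \<notin> Tv L" "insert d (Tv L) = V"
    and L': "valid (\<noteq>) L'" "length L' = k" "d' \<notin> Tv L'" "insert d' (Tv L') = V"
  shows "frag_cmul (lsgn (flat L @ [d])) (PT L) - frag_cmul (lsgn (flat L' @ [d'])) (PT L') \<in> Bd (\<noteq>) V k"
proof -
  note a = complete_arr.arr_flat[of L k d V, OF L(1-3)] complete_arr.arr_flat[of L' k d' V, OF L'(1-3)]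
  show ?thesis
    using complete_arr.swap_all[where A = "(!) (flat L @ [d])" and B = "(!) (flat L' @ [d'])" and V = V and k = k]
      complete_rel[OF k] a L L' by simp
qed

section \<open>Contracting homotopies\<close>

text \<open>
  Since the cycles with at most \<open>j\<close> edges bound, cycles can be filled additively. The
  construction by induction on \<open>j\<close> is the usual contracting homotopy of an acyclic complex of
  free groups.
\<close>

lemma complete_contraction:
  assumes "finite Q" "3 * j + 2 \<le> card Q"
  shows "\<exists>h. fadd h \<and> (\<forall>z\<in>Cy (\<noteq>) Q j. h z \<in> Ch (\<noteq>) Q (Suc j) \<and> bd (h z) = z)"
  using assms(2)
proof (induction j)
  case 0
  have "frag_of {} \<in> Bd (\<noteq>) Q 0" using complete_null[OF assms(1), of 0] 0 one_Cy by auto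
  then obtain E where E: "E \<in> Ch (\<noteq>) Q (Suc 0)" "bd E = frag_of {}" by (auto simp: Bd_def)
  let ?h = "frag_extend (\<lambda>\<sigma>. E) :: (nat \<times> nat) chain \<Rightarrow> (nat \<times> nat) chain"
  have "?h z \<in> Ch (\<noteq>) Q (Suc 0) \<and> bd (?h z) = z" if "z \<in> Cy (\<noteq>) Q 0" for z
  proof -
    have "z \<in> Ch (\<noteq>) Q 0" using that by (simp add: Cy_def)
    then obtain n where "z = frag_cmul n (frag_of {})" using Ch_0 by blast
    then have "?h z = frag_cmul n E" "z = frag_cmul n (frag_of {})" by (simp_all add: frag_extend_cmul)
    then show ?thesis using E by (simp add: bd_lin Ch_cl)
  qed
  then show ?case using fadd_frag_extend by blast
next
  case (Suc j)
  then obtain h where h: "fadd h" "\<And>z. z \<in> Cy (\<noteq>) Q j \<Longrightarrow> h z \<in> Ch (\<noteq>) Q (Suc j) \<and> bd (h z) = z" by force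
  have "\<exists>E\<in>Ch (\<noteq>) Q (Suc (Suc j)). bd E = frag_of \<sigma> - h (bd (frag_of \<sigma>))" if s: "\<sigma> \<in> mtch (\<noteq>) Q" "card \<sigma> = Suc j" for \<sigma>
  proof -
    have c: "frag_of \<sigma> \<in> Ch (\<noteq>) Q (Suc j)" using s by simp
    then have z: "bd (frag_of \<sigma>) \<in> Cy (\<noteq>) Q j" using complete.bd_Ch by (simp add: Cy_def)
    have "frag_of \<sigma> - h (bd (frag_of \<sigma>)) \<in> Cy (\<noteq>) Q (Suc j)"
      using c h(2)[OF z] by (simp add: Cy_def bd_lin Ch_cl)
    then show ?thesis using complete_null[OF assms(1) Suc.prems] by (fastforce simp: Bd_def)
  qed
  then obtain E where E: "\<And>\<sigma>. \<sigma> \<in> mtch (\<noteq>) Q \<Longrightarrow> card \<sigma> = Suc j \<Longrightarrow> E \<sigma> \<in> Ch (\<noteq>) Q (Suc (Suc j)) \<and> bd (E \<sigma>) = frag_of \<sigma> - h (bd (frag_of \<sigma>))"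
    by metis
  let ?h = "frag_extend E"
  have fh: "fadd ?h" by (rule fadd_frag_extend)
  have "?h z \<in> Ch (\<noteq>) Q (Suc (Suc j)) \<and> bd (?h z) = z" if z: "z \<in> Cy (\<noteq>) Q (Suc j)" for z
  proof
    have zc: "z \<in> Ch (\<noteq>) Q (Suc j)" and z0: "bd z = 0" using z by (auto simp: Cy_def)
    show "?h z \<in> Ch (\<noteq>) Q (Suc (Suc j))"
      using zc fh adgrp_Ch by (rule Ch_map) (use E in simp)
    have "bd (?h z) = z - h (bd z)"
    proof (rule fadd_eqI[of "\<lambda>z. bd (?h z)" "\<lambda>z. z - h (bd z)"])
      show "Poly_Mapping.keys z \<subseteq> {\<sigma> \<in> mtch (\<noteq>) Q. card \<sigma> = Suc j}" using zc by (simp add: Ch_def)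
    qed (use fh h(1) E in \<open>auto intro!: fadd_intros fadd_comp[OF h(1)]\<close>)
    then show "bd (?h z) = z" using z0 additive.zero[OF h(1)] by simp
  qed
  then show ?case using fh by blast
qed

section \<open>An alternating functional modulo three\<close>

text \<open>
  A cocycle modulo three that takes the sign of \<open>xs\<close> followed by the vertices as its value at
  every triple product on \<open>V\<close> with one free vertex. Its existence shows that these triple
  products do not bound. The prefix \<open>xs\<close> is for the induction, where the vertices of one more
  triple precede.
\<close>

definition alternating :: "nat set \<Rightarrow> nat \<Rightarrow> nat list \<Rightarrow> ((nat \<times> nat) chain \<Rightarrow> int) \<Rightarrow> bool" where
  "alternating V k xs \<phi> \<longleftrightarrow> fadd \<phi> \<and> (\<forall>e\<in>Ch (\<noteq>) V (Suc k). 3 dvd \<phi> (bd e)) \<and>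
     (\<forall>L d. valid (\<noteq>) L \<longrightarrow> length L = k \<longrightarrow> d \<notin> Tv L \<longrightarrow> insert d (Tv L) = V \<longrightarrow> 3 dvd \<phi> (PT L) - lsgn (xs @ flat L @ [d]))"

text \<open>
  Moving the fixed prefix past the vertices of \<open>V\<close> costs a sign that does not depend on their
  order.
\<close>

lemma alternating_prefix: assumes "alternating V k [] \<phi>" shows "\<exists>\<alpha>. alternating V k xs \<alpha>"
proof -
  define s where "s = lsgn xs * cross xs (sorted_list_of_set V)"
  have "3 dvd s * \<phi> (PT L) - lsgn (xs @ flat L @ [d])"
    if L: "valid (\<noteq>) L" "length L = k" "d \<notin> Tv L" "insert d (Tv L) = V" for L d
  proof -
    have "distinct (flat L @ [d])" using L complete.distinct_flat by simp
    moreover have "finite V" using L(4) complete.finite_Tv by auto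
    ultimately have "mset (flat L @ [d]) = mset (sorted_list_of_set V)"
      using L by (intro iffD1[OF set_eq_iff_mset_eq_distinct]) auto
    then have "cross xs (flat L @ [d]) = cross xs (sorted_list_of_set V)" by (rule cross_mset)
    then have "lsgn (xs @ flat L @ [d]) = s * lsgn (flat L @ [d])"
      by (simp add: lsgn_append[of xs] s_def mult_ac)
    moreover have "3 dvd \<phi> (PT L) - lsgn (flat L @ [d])" using assms L by (auto simp: alternating_def)
    ultimately show ?thesis by (simp flip: right_diff_distrib)
  qed
  then have "alternating V k xs (\<lambda>c. s * \<phi> c)"
    using assms by (auto simp: alternating_def additive_def distrib_left)
  then show ?thesis by blast
qed

text \<open>The additive functional with prescribed values on the faces.\<close>

definition ev :: "('a \<Rightarrow> int) \<Rightarrow> ('a \<Rightarrow>\<^sub>0 int) \<Rightarrow> int" where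
  "ev g c = Poly_Mapping.lookup (frag_extend (\<lambda>\<sigma>. frag_cmul (g \<sigma>) (frag_of ())) c) ()"
lemma ev_of [simp]: "ev g (frag_of \<sigma>) = g \<sigma>" by (simp add: ev_def)
lemma fadd_ev: "fadd (ev g)" by (simp add: additive_def ev_def frag_extend_add lookup_add)

lemma alternating_0: assumes "card V = 1" shows "\<exists>\<phi>. alternating V 0 [] \<phi>"
proof -
  obtain v where v: "V = {v}" using assms by (auto simp: card_1_singleton_iff)
  have "Ch (\<noteq>) V (Suc 0) \<subseteq> {0}"
  proof -
    have e: "{\<sigma> \<in> mtch (\<noteq>) V. card \<sigma> = Suc 0} = {}"
      unfolding v mtch_def by (auto simp: card_1_singleton_iff)
    show ?thesis unfolding Ch_def e by simp
  qed
  then have "alternating V 0 [] (ev (\<lambda>_. 1))"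
    unfolding alternating_def using fadd_ev[of "\<lambda>_. 1"] by (auto simp: bd_lin additive.zero[OF fadd_ev])
  then show ?thesis by blast
qed

lemma edge_chain: "W e (frag_of {}) = frag_of {e}"
  by (simp add: W_of sg_def)

text \<open>
  The case of four vertices cannot be reached from \<open>complete_alt\<close>, which needs two triples, so a
  functional is written down. It takes the same value at the two edges of each perfect matching,
  and its values at the three perfect matchings are \<open>0\<close>, \<open>-1\<close>, \<open>1\<close>; the difference of two of
  them is the sign modulo three.
\<close>

lemma alternating_1: assumes "card V = 4" shows "\<exists>\<phi>. alternating V 1 [] \<phi>"
proof -
  have fV: "finite V" using assms by (metis card.infinite zero_neq_numeral)
  define l where "l = sorted_list_of_set V"
  have l: "length l = 4" "sorted l" "distinct l" "set l = V" using assms fV by (auto simp: l_def)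
  obtain v0 v1 v2 v3 where v: "l = [v0, v1, v2, v3]" using l(1)
    by (auto simp: length_Suc_conv numeral_eq_Suc)
  have o: "v0 < v1" "v1 < v2" "v2 < v3" "v0 < v2" "v0 < v3" "v1 < v3" using l(2,3) unfolding v by auto
  have V: "V = {v0, v1, v2, v3}" using l(4) v by simp
  \<comment> \<open>The value at an edge is the sum of the weights \<open>w\<close> of its ends, up to the sign that makes
       it equal to the value at the opposite edge; the weights add up to \<open>0\<close>.\<close>
  define w where "w u = (if u = v2 then -1 else if u = v3 then 1 else 0 :: int)" for u
  define g where "g u u' = (if u = v0 \<or> u' = v0 then w u + w u' else - (w u + w u'))" for u u'
  define \<phi> where "\<phi> = ev (\<lambda>\<sigma>. let e = the_elem \<sigma> in g (fst e) (snd e))"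
  have \<phi>e: "\<phi> (frag_of {ed u u'}) = g u u'" for u u'
    by (auto simp: \<phi>_def Let_def ed_def g_def min_def max_def)
  have f: "fadd \<phi>" unfolding \<phi>_def by (rule fadd_ev)
  have gc: "g a b = g c d" if "a \<in> V" "b \<in> V" "c \<in> V" "d \<in> V" "distinct [a, b, c, d]" for a b c d
  proof -
    have "{a, b, c, d} = V" using that assms fV by (intro card_subset_eq) auto
    moreover have "sum w V = 0" unfolding V using o by (simp add: w_def)
    ultimately have "sum w {a, b, c, d} = 0" "v0 \<in> {a, b, c, d}" using V by auto
    then have "w a + w b + w c + w d = 0" "v0 = a \<or> v0 = b \<or> v0 = c \<or> v0 = d" using that(5) by auto
    then show ?thesis using that(5) by (elim disjE) (simp_all add: g_def)
  qed
  have 1: "3 dvd \<phi> (bd e)" if "e \<in> Ch (\<noteq>) V (Suc 1)" for e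
  proof -
    have "e \<in> Ch (\<noteq>) V (Suc 1) \<Longrightarrow> bd e \<in> {c. 3 dvd \<phi> c}"
    proof (rule Ch_map[OF _ fadd_bd])
      show "adgrp {c. 3 dvd \<phi> c}" using f by (simp add: adgrp_def additive.zero additive.diff)
      fix \<sigma> assume s: "\<sigma> \<in> mtch (\<noteq>) V" "card \<sigma> = Suc 1"
      then obtain e f where ef: "\<sigma> = {e, f}" "e \<noteq> f" by (metis One_nat_def Suc_1 card_2_iff)
      obtain a b where ab: "e = ed a b" "a \<noteq> b" "a \<in> V" "b \<in> V" using s(1) ef by (auto simp: mtch_def)
      obtain c d where cd: "f = ed c d" "c \<noteq> d" "c \<in> V" "d \<in> V" using s(1) ef by (auto simp: mtch_def)
      have "vs e \<inter> vs f = {}" using mtch_disj[OF s(1)] ef by auto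
      then have "distinct [a, b, c, d]" using ab cd by auto
      then have "g a b = g c d" by (rule gc[OF ab(3,4) cd(3,4)])
      moreover obtain \<epsilon> where "frag_of \<sigma> = frag_cmul \<epsilon> (W e (W f (frag_of {})))"
      proof -
        have "W e (frag_of {f}) = frag_cmul (sg e {f}) (frag_of \<sigma>)" using ef by (simp add: W_of)
        then have "frag_cmul (sg e {f}) (W e (W f (frag_of {}))) = frag_of \<sigma>" by (simp add: edge_chain)
        then show thesis using that by metis
      qed
      ultimately have "\<phi> (bd (frag_of \<sigma>)) = \<phi> (frag_cmul \<epsilon> (frag_of {f} - frag_of {e}))"
        using complete.bd_WW[OF one_Cy, of e f] by (simp add: bd_lin edge_chain)
      also have "\<dots> = \<epsilon> * (\<phi> (frag_of {f}) - \<phi> (frag_of {e}))"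
        by (simp only: fadd_int_cmul[OF f] additive.diff[OF f])
      finally show "bd (frag_of \<sigma>) \<in> {c. 3 dvd \<phi> c}"
        using \<open>g a b = g c d\<close> by (simp add: ab(1) cd(1) \<phi>e)
    qed
    then show ?thesis using that by simp
  qed
  have 2: "3 dvd \<phi> (PT L) - lsgn ([] @ flat L @ [d])"
    if L: "valid (\<noteq>) L" "length L = 1" "d \<notin> Tv L" "insert d (Tv L) = V" for L d
  proof -
    obtain a b c where L1: "L = [(a, b, c)]" using L(2) by (metis One_nat_def length_0_conv length_Suc_conv prod_cases3)
    have ds: "distinct [a, b, c, d]" using L unfolding L1 by auto
    have m: "a \<in> {v0, v1, v2, v3}" "b \<in> {v0, v1, v2, v3}" "c \<in> {v0, v1, v2, v3}" "d \<in> {v0, v1, v2, v3}"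
      using L(4) unfolding L1 V by auto
    have e: "\<phi> (PT L) = g a b - g a c"
      unfolding L1 by (simp add: Z_def edge_chain additive.diff[OF f] \<phi>e)
    have "3 dvd (g a b - g a c) - lsgn [a, b, c, d]"
      using m(1)
    proof (elim insertE emptyE)
      assume "a = v0"
      then show ?thesis using m(2-) ds o by (elim insertE emptyE) (simp_all add: g_def w_def lt_sg_def)
    next
      assume "a = v1"
      then show ?thesis using m(2-) ds o by (elim insertE emptyE) (simp_all add: g_def w_def lt_sg_def)
    next
      assume "a = v2"
      then show ?thesis using m(2-) ds o by (elim insertE emptyE) (simp_all add: g_def w_def lt_sg_def)
    next
      assume "a = v3"
      then show ?thesis using m(2-) ds o by (elim insertE emptyE) (simp_all add: g_def w_def lt_sg_def)
    qed
    then show ?thesis unfolding e by (simp add: L1)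
  qed
  show ?thesis unfolding alternating_def using f 1 2 by blast
qed

lemma complete_list_exists: "finite V \<Longrightarrow> 3 * k \<le> card V \<Longrightarrow> \<exists>L. valid (\<noteq>) L \<and> length L = k \<and> Tv L \<subseteq> V"
proof (induction k arbitrary: V)
  case (Suc k)
  then have "3 \<le> card V" by simp
  then obtain T where T: "T \<subseteq> V" "card T = 3" by (rule obtain_subset_with_card_n)
  then obtain a b c where abc: "T = {a, b, c}" "distinct [a, b, c]" by (auto simp: card_3_iff)
  have "3 * k \<le> card (V - T)" using T Suc.prems by (simp add: card_Diff_subset finite_subset)
  then obtain L where "valid (\<noteq>) L" "length L = k" "Tv L \<subseteq> V - T" using Suc.IH[of "V - T"] Suc.prems by auto
  then show ?case using T abc by (intro exI[of _ "(a, b, c) # L"]) auto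
qed (auto intro: exI[of _ "[]"])

text \<open>Two transpositions lead from one list to the other.\<close>

lemma lsgn_exchange:
  assumes "distinct (a # t # b # ys @ [s])"
  shows "lsgn ([a, t, b] @ ys @ [s]) = lsgn ([b, s, a] @ ys @ [t])"
proof -
  have "lsgn ([a] @ s # (b # ys) @ t # []) = - lsgn ([a] @ t # (b # ys) @ s # [])"
    by (rule lsgn_swap) (use assms in auto)
  moreover have "lsgn ([] @ b # [s] @ a # (ys @ [t])) = - lsgn ([] @ a # [s] @ b # (ys @ [t]))"
    by (rule lsgn_swap) (use assms in auto)
  ultimately show ?thesis by (simp del: lsgn.simps)
qed

text \<open>
  The functional on \<open>V\<close> is assembled from functionals on smaller sets. Fix two vertices \<open>a\<close> and
  \<open>b\<close>. A chain decomposes according to the edges that its matchings use at \<open>a\<close> and at \<open>b\<close>, where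
  \<open>s\<close> and \<open>t\<close> are other vertices: \<open>\<phi>\<close> is \<open>\<alpha> t\<close> on the part with \<open>at\<close> and no edge at
  \<open>b\<close>, \<open>\<beta> s\<close> on the part with \<open>bs\<close> and no edge at \<open>a\<close>, \<open>\<psi> s t\<close> on the part with both
  \<open>at\<close> and \<open>bs\<close>, and \<open>0\<close> on the parts with \<open>ab\<close> or with neither. That \<open>\<phi>\<close> vanishes on
  boundaries requires \<open>\<alpha> t\<close> and \<open>\<beta> s\<close> to differ by the coboundary of \<open>\<psi> s t\<close>.
  Such a \<open>\<psi> s t\<close> exists because \<open>\<alpha> t\<close> and \<open>\<beta> s\<close> agree on cycles, which is
  where the alternation of signs enters.
\<close>

locale functional_step =
  fixes V :: "nat set" and k :: nat and a b :: nat
    and \<alpha> :: "nat \<Rightarrow> (nat \<times> nat) chain \<Rightarrow> int" and \<beta> :: "nat \<Rightarrow> (nat \<times> nat) chain \<Rightarrow> int"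
  assumes V: "finite V" "card V = 3 * Suc k + 1" and k: "1 \<le> k" and ab: "a \<in> V" "b \<in> V" "a \<noteq> b"
    and \<alpha>: "\<And>t. t \<in> V - {a, b} \<Longrightarrow> alternating (V - {a, b} - {t}) k [a, t, b] (\<alpha> t)"
    and \<beta>: "\<And>s. s \<in> V - {a, b} \<Longrightarrow> alternating (V - {a, b} - {s}) k [b, s, a] (\<beta> s)"
begin

abbreviation "U \<equiv> V - {a, b}"

text \<open>
  The cycles on \<open>U - {s, t}\<close> are spanned by triple products that use all of its vertices. There
  \<open>\<alpha> t\<close> has the free vertex \<open>s\<close> and \<open>\<beta> s\<close> has the free vertex \<open>t\<close>, and the two
  signs coincide by \<open>lsgn_exchange\<close>.
\<close>

lemma alpha_beta_agree:
  assumes st: "s \<in> U" "t \<in> U" "s \<noteq> t" and y: "y \<in> Cy (\<noteq>) (U - {s, t}) k"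
  shows "3 dvd \<alpha> t y - \<beta> s y"
proof -
  have fa: "fadd (\<alpha> t)" "fadd (\<beta> s)" using \<alpha> \<beta> st by (auto simp: alternating_def)
  have c: "card (U - {s, t}) = 3 * k" using V ab st by (simp add: card_Diff_subset)
  have "y \<in> triple_span (\<noteq>) (U - {s, t}) k" using complete_triple_span[of "U - {s, t}" k] V y c by auto
  then have "(\<lambda>y. y) y \<in> {y. 3 dvd \<alpha> t y - \<beta> s y}"
  proof (rule triple_span_map)
    show "adgrp {y. 3 dvd \<alpha> t y - \<beta> s y}"
    proof -
      have "\<alpha> t (x - y) - \<beta> s (x - y) = (\<alpha> t x - \<beta> s x) - (\<alpha> t y - \<beta> s y)" for x y
        using fa by (simp add: additive.diff)
      then show ?thesis using fa by (simp add: adgrp_def additive.zero)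
    qed
  next
    fix L assume L: "valid (\<noteq>) L" "Tv L \<subseteq> U - {s, t}" "length L = k"
    have "Tv L = U - {s, t}"
      using L(2) complete.card_Tv[OF L(1)] L(3) c V by (intro card_subset_eq) auto
    then have "s \<notin> Tv L" "t \<notin> Tv L" "insert s (Tv L) = U - {t}" "insert t (Tv L) = U - {s}" using st by auto
    then have "3 dvd \<alpha> t (PT L) - lsgn ([a, t, b] @ flat L @ [s])" "3 dvd \<beta> s (PT L) - lsgn ([b, s, a] @ flat L @ [t])"
      using \<alpha>[OF st(2)] \<beta>[OF st(1)] L unfolding alternating_def by blast+
    moreover have "lsgn ([a, t, b] @ flat L @ [s]) = lsgn ([b, s, a] @ flat L @ [t])"
      by (rule lsgn_exchange) (use st ab L complete.distinct_flat[OF L(1)] in auto)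
    ultimately have "3 dvd (\<alpha> t (PT L) - lsgn ([b, s, a] @ flat L @ [t])) - (\<beta> s (PT L) - lsgn ([b, s, a] @ flat L @ [t]))"
      by (metis dvd_diff)
    then show "PT L \<in> {y. 3 dvd \<alpha> t y - \<beta> s y}" by simp
  next
    fix x assume "x \<in> Bd (\<noteq>) (U - {s, t}) k"
    then obtain e where e: "e \<in> Ch (\<noteq>) (U - {s, t}) (Suc k)" "x = bd e" by (auto simp: Bd_def)
    have "e \<in> Ch (\<noteq>) (U - {t}) (Suc k)" "e \<in> Ch (\<noteq>) (U - {s}) (Suc k)" using e by (auto intro: Ch_mono)
    then have "3 dvd \<alpha> t x" "3 dvd \<beta> s x" using \<alpha>[OF st(2)] \<beta>[OF st(1)] e unfolding alternating_def by auto
    then show "x \<in> {y. 3 dvd \<alpha> t y - \<beta> s y}" by simp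
  qed (simp add: fadd_id)
  then show ?thesis by simp
qed

text \<open>
  A functional that vanishes on cycles factors through the boundary operator; the contracting
  homotopy provides the factor.
\<close>

lemma psi_exists:
  assumes st: "s \<in> U" "t \<in> U" "s \<noteq> t"
  shows "\<exists>\<psi>. fadd \<psi> \<and> (\<forall>y\<in>Ch (\<noteq>) (U - {s, t}) k. 3 dvd \<psi> (bd y) - (\<alpha> t y - \<beta> s y))"
proof -
  have fa: "fadd (\<alpha> t)" "fadd (\<beta> s)" using \<alpha> \<beta> st by (auto simp: alternating_def)
  have c: "card (U - {s, t}) = 3 * k" using V ab st by (simp add: card_Diff_subset)
  obtain j where j: "k = Suc j" using k by (cases k) auto
  obtain h where h: "fadd h" "\<And>z. z \<in> Cy (\<noteq>) (U - {s, t}) j \<Longrightarrow> h z \<in> Ch (\<noteq>) (U - {s, t}) k \<and> bd (h z) = z"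
    using complete_contraction[of "U - {s, t}" j] c j V by auto
  have "3 dvd (\<alpha> t (h (bd y)) - \<beta> s (h (bd y))) - (\<alpha> t y - \<beta> s y)" if y: "y \<in> Ch (\<noteq>) (U - {s, t}) k" for y
  proof -
    have "bd y \<in> Cy (\<noteq>) (U - {s, t}) j" using y complete.bd_Ch j by (simp add: Cy_def)
    from h(2)[OF this] have "h (bd y) - y \<in> Cy (\<noteq>) (U - {s, t}) k" using y by (simp add: Cy_def Ch_cl bd_lin)
    from alpha_beta_agree[OF st this] show ?thesis using fa by (simp add: additive.diff algebra_simps)
  qed
  moreover have "fadd (\<lambda>y. \<alpha> t (h y) - \<beta> s (h y))" using fa h(1) by (simp add: additive_def)
  ultimately show ?thesis by (intro exI[of _ "\<lambda>y. \<alpha> t (h y) - \<beta> s (h y)"]) auto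
qed

definition \<psi> where "\<psi> s t = (SOME \<psi>. fadd \<psi> \<and> (\<forall>y\<in>Ch (\<noteq>) (U - {s, t}) k. 3 dvd \<psi> (bd y) - (\<alpha> t y - \<beta> s y)))"

lemma \<psi>: assumes "s \<in> U" "t \<in> U" "s \<noteq> t"
  shows "fadd (\<psi> s t)" "y \<in> Ch (\<noteq>) (U - {s, t}) k \<Longrightarrow> 3 dvd \<psi> s t (bd y) - (\<alpha> t y - \<beta> s y)"
  using someI_ex[OF psi_exists[OF assms]] unfolding \<psi>_def[symmetric] by blast+

text \<open>
  The part of a chain that uses no edge from \<open>u\<close> to \<open>U\<close>.
\<close>

definition Dv :: "nat \<Rightarrow> (nat \<times> nat) chain \<Rightarrow> (nat \<times> nat) chain" where
  "Dv u y = y - (\<Sum>s\<in>U. W (ed u s) (Lk (ed u s) y))"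

definition \<phi> :: "(nat \<times> nat) chain \<Rightarrow> int" where
  "\<phi> x = (\<Sum>t\<in>U. \<alpha> t (Dv b (Lk (ed a t) x))) + (\<Sum>s\<in>U. \<beta> s (Dv a (Lk (ed b s) x)))
       + (\<Sum>t\<in>U. \<Sum>s\<in>U - {t}. \<psi> s t (Lk (ed b s) (Lk (ed a t) x)))"

lemma fadd_Dv: "fadd (Dv u)"
  unfolding Dv_def by (intro fadd_intros fadd_comp[OF fadd_W] fadd_Lk)
lemma fU: "finite U" using V by simp
lemma fadd_\<phi>: "fadd \<phi>"
proof -
  have "fadd (\<lambda>x. \<alpha> t (Dv b (Lk (ed a t) x)))" if "t \<in> U" for t
  proof -
    have "fadd (\<alpha> t)" using \<alpha>[OF that] by (simp add: alternating_def)
    then show ?thesis using fadd_Dv[of b] by (simp add: additive_def Lk_lin)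
  qed
  moreover have "fadd (\<lambda>x. \<beta> t (Dv a (Lk (ed b t) x)))" if "t \<in> U" for t
  proof -
    have "fadd (\<beta> t)" using \<beta>[OF that] by (simp add: alternating_def)
    then show ?thesis using fadd_Dv[of a] by (simp add: additive_def Lk_lin)
  qed
  moreover have "fadd (\<lambda>x. \<psi> s t (Lk (ed b s) (Lk (ed a t) x)))" if "t \<in> U" "s \<in> U - {t}" for s t
  proof -
    have "fadd (\<psi> s t)" using \<psi>(1)[of s t] that by blast
    then show ?thesis by (simp add: additive_def Lk_lin)
  qed
  ultimately show ?thesis unfolding \<phi>_def by (intro fadd_plus fadd_sum) auto
qed

lemmas zeros = additive.zero[OF fadd_Dv]
lemma \<alpha>0: "t \<in> U \<Longrightarrow> \<alpha> t 0 = 0" using \<alpha> by (auto simp: alternating_def additive.zero)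
lemma \<beta>0: "t \<in> U \<Longrightarrow> \<beta> t 0 = 0" using \<beta> by (auto simp: alternating_def additive.zero)
lemma \<psi>0: "t \<in> U \<Longrightarrow> s \<in> U - {t} \<Longrightarrow> \<psi> s t 0 = 0" using \<psi>(1)[of s t] by (auto simp: additive.zero)

lemma LkU: "x \<in> Ch (\<noteq>) U' n \<Longrightarrow> U' \<subseteq> U \<Longrightarrow> Lk (ed a t) x = 0 \<and> Lk (ed b t) x = 0"
  by (auto intro!: complete.Lk_0)

lemma Dv_U: "x \<in> Ch (\<noteq>) U' n \<Longrightarrow> U' \<subseteq> U \<Longrightarrow> Dv a x = x \<and> Dv b x = x"
  using LkU by (simp add: Dv_def W_lin)

lemma LkW: "x \<in> Ch (\<noteq>) U' n \<Longrightarrow> U' \<subseteq> U \<Longrightarrow> Lk (ed a t) (W (ed a t') x) = (if t = t' then x else 0)"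
  "x \<in> Ch (\<noteq>) U' n \<Longrightarrow> U' \<subseteq> U \<Longrightarrow> Lk (ed b t) (W (ed b t') x) = (if t = t' then x else 0)"
  using LkU[of x U' n t] complete.Lk_W_id[of x U' n a t] complete.Lk_W_id[of x U' n b t] by (auto simp: Lk_W W_lin)

lemma DvW: "x \<in> Ch (\<noteq>) U' n \<Longrightarrow> U' \<subseteq> U \<Longrightarrow> t \<in> U \<Longrightarrow> Dv a (W (ed a t) x) = 0 \<and> Dv b (W (ed b t) x) = 0"
  using fU by (simp add: Dv_def LkW if_distrib[of "W _"] W_lin cong: if_cong)

lemma ne_ed: "s \<in> U \<Longrightarrow> t \<in> U \<Longrightarrow> ed a t \<noteq> ed b s" "s \<in> U \<Longrightarrow> ed b s \<noteq> ed a b" "t \<in> U \<Longrightarrow> ed a t \<noteq> ed a b"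
  using ab by (auto simp: ed_eq_iff)

text \<open>
  The next four lemmas evaluate \<open>\<phi>\<close> on the parts of a chain; they determine it.
\<close>

lemma \<phi>_free: assumes "x \<in> Ch (\<noteq>) U n" shows "\<phi> x = 0" "\<phi> (W (ed a b) x) = 0"
proof -
  show "\<phi> x = 0" unfolding \<phi>_def
    using LkU[OF assms] by (simp add: zeros \<alpha>0 \<beta>0 \<psi>0 Lk_lin)
  have "Lk (ed a t) (W (ed a b) x) = 0" "Lk (ed b t) (W (ed a b) x) = 0" if "t \<in> U" for t
    using LkU[OF assms] ne_ed that by (auto simp: Lk_W W_lin)
  then show "\<phi> (W (ed a b) x) = 0" unfolding \<phi>_def
    by (simp add: zeros \<alpha>0 \<beta>0 \<psi>0 Lk_lin)
qed

lemma \<phi>_a: assumes "t \<in> U" "y \<in> Ch (\<noteq>) (U - {t}) n" shows "\<phi> (W (ed a t) y) = \<alpha> t y"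
proof -
  have s: "U - {t} \<subseteq> U" by auto
  have 1: "Lk (ed a t') (W (ed a t) y) = (if t' = t then y else 0)" for t' using LkW(1)[OF assms(2) s] .
  have 2: "Lk (ed b s) (W (ed a t) y) = 0" if "s \<in> U" for s
    using LkU[OF assms(2) s] ne_ed(1)[OF that assms(1)] by (simp add: Lk_W W_lin)
  have "(\<Sum>t'\<in>U. \<alpha> t' (Dv b (Lk (ed a t') (W (ed a t) y)))) = (\<Sum>t'\<in>U. if t' = t then \<alpha> t y else 0)"
    using Dv_U[OF assms(2) s] by (intro sum.cong) (auto simp: 1 zeros \<alpha>0)
  moreover have "(\<Sum>s\<in>U. \<beta> s (Dv a (Lk (ed b s) (W (ed a t) y)))) = 0"
    by (intro sum.neutral) (auto simp: 2 zeros \<beta>0)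
  moreover have "(\<Sum>t'\<in>U. \<Sum>s\<in>U - {t'}. \<psi> s t' (Lk (ed b s) (Lk (ed a t') (W (ed a t) y)))) = 0"
    using LkU[OF assms(2) s] by (intro sum.neutral ballI) (auto simp: 1 Lk_lin \<psi>0)
  ultimately show ?thesis unfolding \<phi>_def using fU assms(1) by simp
qed

lemma \<phi>_b: assumes "t \<in> U" "y \<in> Ch (\<noteq>) (U - {t}) n" shows "\<phi> (W (ed b t) y) = \<beta> t y"
proof -
  have s: "U - {t} \<subseteq> U" by auto
  have 1: "Lk (ed b t') (W (ed b t) y) = (if t' = t then y else 0)" for t' using LkW(2)[OF assms(2) s] .
  have 2: "Lk (ed a s) (W (ed b t) y) = 0" if "s \<in> U" for s
    using LkU[OF assms(2) s] ne_ed(1)[OF assms(1) that] by (simp add: Lk_W W_lin)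
  have "(\<Sum>t'\<in>U. \<beta> t' (Dv a (Lk (ed b t') (W (ed b t) y)))) = (\<Sum>t'\<in>U. if t' = t then \<beta> t y else 0)"
    using Dv_U[OF assms(2) s] by (intro sum.cong) (auto simp: 1 zeros \<beta>0)
  moreover have "(\<Sum>s\<in>U. \<alpha> s (Dv b (Lk (ed a s) (W (ed b t) y)))) = 0"
    by (intro sum.neutral) (auto simp: 2 zeros \<alpha>0)
  moreover have "(\<Sum>t'\<in>U. \<Sum>s\<in>U - {t'}. \<psi> s t' (Lk (ed b s) (Lk (ed a t') (W (ed b t) y)))) = 0"
    by (intro sum.neutral ballI) (auto simp: 2 Lk_lin \<psi>0)
  ultimately show ?thesis unfolding \<phi>_def using fU assms(1) by simp
qed

lemma \<phi>_ab: assumes "t \<in> U" "s \<in> U" "s \<noteq> t" "w \<in> Ch (\<noteq>) (U - {s, t}) n" shows "\<phi> (W (ed a t) (W (ed b s) w)) = \<psi> s t w"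
proof -
  have sub: "U - {s, t} \<subseteq> U" by auto
  have la: "Lk (ed a t') (W (ed b s) w) = 0" if "t' \<in> U" for t'
    using LkU[OF assms(4) sub] ne_ed(1)[OF assms(2) that] by (simp add: Lk_W W_lin)
  have W: "W (ed b s) w \<in> Ch (\<noteq>) (V - {a, t}) (Suc n)"
    using assms ab by (intro complete.W_Ch) (auto intro: Ch_mono)
  have 1: "Lk (ed a t') (W (ed a t) (W (ed b s) w)) = (if t' = t then W (ed b s) w else 0)" if "t' \<in> U" for t'
    using la[OF that] complete.Lk_W_id[OF W, of a t] by (auto simp: Lk_W W_lin)
  have 2: "Lk (ed b s') (W (ed a t) (W (ed b s) w)) = (if s' = s then - W (ed a t) w else 0)" if "s' \<in> U" for s'
    using ne_ed(1)[OF that assms(1)] LkW(2)[OF assms(4) sub, of s' s] by (auto simp: Lk_W W_lin)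
  have d: "Dv b (W (ed b s) w) = 0" "Dv a (- W (ed a t) w) = 0"
    using DvW[OF assms(4) sub] assms additive.minus[OF fadd_Dv] by auto
  have "(\<Sum>t'\<in>U. \<alpha> t' (Dv b (Lk (ed a t') (W (ed a t) (W (ed b s) w))))) = 0"
    by (intro sum.neutral) (auto simp: 1 d zeros \<alpha>0)
  moreover have "(\<Sum>s'\<in>U. \<beta> s' (Dv a (Lk (ed b s') (W (ed a t) (W (ed b s) w))))) = 0"
    by (intro sum.neutral) (auto simp: 2 d zeros \<beta>0)
  moreover have "(\<Sum>t'\<in>U. \<Sum>s'\<in>U - {t'}. \<psi> s' t' (Lk (ed b s') (Lk (ed a t') (W (ed a t) (W (ed b s) w))))) =
      (\<Sum>t'\<in>U. if t' = t then \<psi> s t w else 0)"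
  proof (intro sum.cong refl)
    fix t' assume t': "t' \<in> U"
    have "(\<Sum>s'\<in>U - {t'}. \<psi> s' t' (Lk (ed b s') (Lk (ed a t') (W (ed a t) (W (ed b s) w))))) =
        (\<Sum>s'\<in>U - {t'}. if s' = s then (if t' = t then \<psi> s t w else 0) else 0)"
      using t' LkW(2)[OF assms(4) sub] by (intro sum.cong refl) (auto simp: 1 Lk_lin \<psi>0)
    also have "\<dots> = (if t' = t then \<psi> s t w else 0)" using fU assms by simp
    finally show "(\<Sum>s'\<in>U - {t'}. \<psi> s' t' (Lk (ed b s') (Lk (ed a t') (W (ed a t) (W (ed b s) w))))) = (if t' = t then \<psi> s t w else 0)" .
  qed
  ultimately show ?thesis unfolding \<phi>_def using fU assms(1) by simp
qed

text \<open>
  By \<open>expand\<close> at \<open>a\<close> and at \<open>b\<close> it suffices to treat chains \<open>x\<close>, \<open>W (ed a b) y\<close>, \<open>W (ed a t) y\<close>,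
  \<open>W (ed b t) y\<close> and \<open>W (ed a t) (W (ed b s) g)\<close>. Only the last kind uses the relation between
  \<open>\<alpha>\<close>, \<open>\<beta>\<close> and \<open>\<psi>\<close>.
\<close>

lemma \<phi>_cocycle: assumes e: "e \<in> Ch (\<noteq>) V (Suc (Suc k))" shows "3 dvd \<phi> (bd e)"
proof -
  let ?S = "{x. 3 dvd \<phi> (bd x)}"
  have S: "adgrp ?S" using fadd_\<phi> by (simp add: adgrp_def additive.zero additive.diff bd_lin)
  have free: "x \<in> ?S" "W (ed a b) y \<in> ?S" if "x \<in> Ch (\<noteq>) U (Suc (Suc k))" "y \<in> Ch (\<noteq>) U (Suc k)" for x y
  proof -
    have "bd x \<in> Ch (\<noteq>) U (Suc k)" using that complete.bd_Ch by blast
    then show "x \<in> ?S" using \<phi>_free by simp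
    have "bd y \<in> Ch (\<noteq>) U k" using that complete.bd_Ch by blast
    then show "W (ed a b) y \<in> ?S" using that \<phi>_free additive.diff[OF fadd_\<phi>] by (simp add: bd_W[OF Ch_fin[OF that(2)]])
  qed
  have one: "W (ed a t) y \<in> ?S" "W (ed b t) y \<in> ?S" if t: "t \<in> U" and y: "y \<in> Ch (\<noteq>) (U - {t}) (Suc k)" for t y
  proof -
    have bdy: "bd y \<in> Ch (\<noteq>) (U - {t}) k" using y complete.bd_Ch by blast
    have yU: "y \<in> Ch (\<noteq>) U (Suc k)" using y by (auto intro: Ch_mono)
    have "3 dvd \<alpha> t (bd y)" "3 dvd \<beta> t (bd y)" using \<alpha>[OF t] \<beta>[OF t] y by (auto simp: alternating_def)
    then show "W (ed a t) y \<in> ?S" "W (ed b t) y \<in> ?S"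
      using \<phi>_free(1)[OF yU] \<phi>_a[OF t bdy] \<phi>_b[OF t bdy] additive.diff[OF fadd_\<phi>] by (simp_all add: bd_W[OF Ch_fin[OF y]])
  qed
  have two: "W (ed a t) (W (ed b s) g) \<in> ?S" if st: "t \<in> U" "s \<in> U" "s \<noteq> t" and g: "g \<in> Ch (\<noteq>) (U - {s, t}) k" for s t g
  proof -
    obtain j where j: "k = Suc j" using k by (cases k) auto
    have bg: "bd g \<in> Ch (\<noteq>) (U - {s, t}) j" using g complete.bd_Ch j by blast
    have gs: "g \<in> Ch (\<noteq>) (U - {s}) k" "g \<in> Ch (\<noteq>) (U - {t}) k" using g by (auto intro: Ch_mono)
    have "bd (W (ed a t) (W (ed b s) g)) = W (ed b s) g - W (ed a t) g + W (ed a t) (W (ed b s) (bd g))"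
      by (simp add: bd_W[OF fin_chain_W[OF Ch_fin[OF g]]] bd_W[OF Ch_fin[OF g]] W_lin)
    then have eq: "\<phi> (bd (W (ed a t) (W (ed b s) g))) = \<beta> s g - \<alpha> t g + \<psi> s t (bd g)"
      using additive.diff[OF fadd_\<phi>] additive.add[OF fadd_\<phi>] \<phi>_a[OF st(1) gs(2)] \<phi>_b[OF st(2) gs(1)] \<phi>_ab[OF st bg] by simp
    show ?thesis unfolding mem_Collect_eq eq by (rule dvd3_rearrange[OF \<psi>(2)[OF st(2,1,3) g]])
  qed
  have na: "complete.nbrs V a = insert b U" using ab by (auto simp: complete.nbrs_def)
  have a_part: "W (ed a t) (Lk (ed a t) e) \<in> ?S" if "t \<in> complete.nbrs V a" for t
  proof (cases "t = b")
    case True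
    show ?thesis unfolding True by (rule free(2)[OF Ch_cl(1) complete.Lk_Ch[OF e]])
  next
    case False
    then have t: "t \<in> U" using that na by auto
    let ?y = "Lk (ed a t) e"
    have y: "?y \<in> Ch (\<noteq>) (V - {a, t}) (Suc k)" using complete.Lk_Ch[OF e, of a t] .
    let ?N = "complete.nbrs (V - {a, t}) b"
    have "V - {a, t} - {b} = U - {t}" by auto
    then have 1: "?y - (\<Sum>s\<in>?N. W (ed b s) (Lk (ed b s) ?y)) \<in> Ch (\<noteq>) (U - {t}) (Suc k)"
      using complete.expand[of "V - {a, t}" b ?y "Suc k"] V ab t y by auto
    have "W (ed a t) (W (ed b s) (Lk (ed b s) ?y)) \<in> ?S" if "s \<in> ?N" for s
    proof (rule two)
      have "V - {a, t} - {b, s} = U - {s, t}" by auto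
      then show "Lk (ed b s) ?y \<in> Ch (\<noteq>) (U - {s, t}) k" using complete.Lk_Ch[OF y, of b s] by simp
    qed (use t that in \<open>auto simp: complete.nbrs_def\<close>)
    then have "(\<Sum>s\<in>?N. W (ed a t) (W (ed b s) (Lk (ed b s) ?y))) \<in> ?S" by (intro adgrp_sum[OF S])
    from adgrp_add[OF S one(1)[OF t 1] this] show ?thesis by (simp only: W_lin(2,5) diff_add_cancel)
  qed
  have e0: "e - (\<Sum>t\<in>complete.nbrs V a. W (ed a t) (Lk (ed a t) e)) \<in> Ch (\<noteq>) (V - {a}) (Suc (Suc k))"
    using complete.expand[of V a e] e V ab by auto
  define f where "f = e - (\<Sum>t\<in>complete.nbrs V a. W (ed a t) (Lk (ed a t) e))"
  have f: "f \<in> Ch (\<noteq>) (V - {a}) (Suc (Suc k))" using e0 f_def by simp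
  let ?N = "complete.nbrs (V - {a}) b"
  have VU: "V - {a} - {b} = U" by auto
  have f0: "f - (\<Sum>s\<in>?N. W (ed b s) (Lk (ed b s) f)) \<in> Ch (\<noteq>) U (Suc (Suc k))"
    using complete.expand[of "V - {a}" b f "Suc (Suc k)"] V ab f unfolding VU by auto
  have "W (ed b s) (Lk (ed b s) f) \<in> ?S" if "s \<in> ?N" for s
  proof (rule one(2))
    have "V - {a} - {b, s} = U - {s}" by auto
    then show "Lk (ed b s) f \<in> Ch (\<noteq>) (U - {s}) (Suc k)" using complete.Lk_Ch[OF f, of b s] by simp
  qed (use that in \<open>auto simp: complete.nbrs_def\<close>)
  then have "(\<Sum>s\<in>?N. W (ed b s) (Lk (ed b s) f)) \<in> ?S" by (intro adgrp_sum[OF S])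
  from adgrp_add[OF S free(1)[OF f0, of 0] this] have fS: "f \<in> ?S" by (simp add: Ch_cl)
  have "(\<Sum>t\<in>complete.nbrs V a. W (ed a t) (Lk (ed a t) e)) \<in> ?S" using a_part by (intro adgrp_sum[OF S])
  from adgrp_add[OF S fS this] have "e \<in> ?S" by (simp only: f_def diff_add_cancel)
  then show ?thesis by simp
qed

text \<open>
  The value of \<open>\<phi>\<close> at one triple product, with first triple \<open>(a, t, b)\<close>, is read off from
  \<open>\<alpha> t\<close>. All other values follow, because a cocycle is constant on homology classes and
  \<open>complete_alt\<close> compares the classes.
\<close>

lemma phi_alternating: "\<exists>\<phi>. alternating V (Suc k) [] \<phi>"
proof -
  have cU: "card U = 3 * k + 2" using V ab by (simp add: card_Diff_subset)
  then have "U \<noteq> {}" by (intro notI) simp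
  then obtain t where t: "t \<in> U" by blast
  have ct: "card (U - {t}) = 3 * k + 1" using cU t fU by simp
  obtain L where L: "valid (\<noteq>) L" "length L = k" "Tv L \<subseteq> U - {t}"
    using complete_list_exists[of "U - {t}" k] ct fU by auto
  have "card (U - {t} - Tv L) = 1"
    using L ct complete.card_Tv[OF L(1)] by (simp add: card_Diff_subset)
  then obtain d where d: "U - {t} - Tv L = {d}" by (auto simp: card_1_singleton_iff)
  then have d1: "d \<notin> Tv L" "insert d (Tv L) = U - {t}" using L(3) by auto
  let ?L = "(a, t, b) # L"
  have PL: "PT L \<in> Ch (\<noteq>) (U - {t}) k" using complete.PT_Cy[OF L(1,3)] L(2) by (simp add: Cy_def)
  then have PU: "PT L \<in> Ch (\<noteq>) U k" by (auto intro: Ch_mono)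
  have "\<phi> (PT ?L) = \<alpha> t (PT L)"
    using \<phi>_a[OF t PL] \<phi>_free(2)[OF PU] additive.diff[OF fadd_\<phi>] by (simp add: Z_def)
  moreover have "3 dvd \<alpha> t (PT L) - lsgn ([a, t, b] @ flat L @ [d])"
    using \<alpha>[OF t] L d1 by (simp add: alternating_def)
  ultimately have 1: "3 dvd \<phi> (PT ?L) - lsgn (flat ?L @ [d])" by simp
  have vL: "valid (\<noteq>) ?L" "length ?L = Suc k" "d \<notin> Tv ?L" "insert d (Tv ?L) = V"
    using L t ab d1 d by auto
  have "3 dvd \<phi> (PT L') - lsgn ([] @ flat L' @ [d'])"
    if L': "valid (\<noteq>) L'" "length L' = Suc k" "d' \<notin> Tv L'" "insert d' (Tv L') = V" for L' d'
  proof -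
    let ?l = "lsgn (flat ?L @ [d])" let ?l' = "lsgn (flat L' @ [d'])"
    have "frag_cmul ?l (PT ?L) - frag_cmul ?l' (PT L') \<in> Bd (\<noteq>) V (Suc k)"
      using complete_alt[of "Suc k" ?L d V L' d'] k vL L' by simp
    then have "3 dvd \<phi> (frag_cmul ?l (PT ?L) - frag_cmul ?l' (PT L'))"
      using \<phi>_cocycle by (auto simp: Bd_def)
    then have "3 dvd ?l * \<phi> (PT ?L) - ?l' * \<phi> (PT L')"
      by (simp only: additive.diff[OF fadd_\<phi>] fadd_int_cmul[OF fadd_\<phi>])
    then have "3 dvd \<phi> (PT L') - ?l'" by (rule sign_transfer[OF lsgn_sq lsgn_sq 1])
    then show ?thesis by simp
  qed
  then show ?thesis unfolding alternating_def using fadd_\<phi> \<phi>_cocycle by blast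
qed

end

lemma alternating_exists: "finite V \<Longrightarrow> card V = 3 * k + 1 \<Longrightarrow> \<exists>\<phi>. alternating V k [] \<phi>"
proof (induction k arbitrary: V)
  case 0
  then show ?case using alternating_0 by simp
next
  case (Suc k)
  show ?case
  proof (cases "k = 0")
    case True
    then show ?thesis using Suc alternating_1[of V] by simp
  next
    case False
    have "2 \<le> card V" using Suc.prems by simp
    then obtain a b where ab: "a \<in> V" "b \<in> V" "a \<noteq> b"
      by (metis One_nat_def Suc_1 card_le_Suc0_iff_eq card.infinite not_less_eq_eq zero_le)
    have ex: "\<exists>\<phi>. alternating (V - {a, b} - {t}) k xs \<phi>" if "t \<in> V - {a, b}" for t xs
    proof -
      have "card (V - {a, b} - {t}) = 3 * k + 1" using Suc.prems ab that by (simp add: card_Diff_subset)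
      then show ?thesis using Suc.IH[of "V - {a, b} - {t}"] Suc.prems alternating_prefix by blast
    qed
    define \<alpha> where "\<alpha> t = (SOME \<phi>. alternating (V - {a, b} - {t}) k [a, t, b] \<phi>)" for t
    define \<beta> where "\<beta> s = (SOME \<phi>. alternating (V - {a, b} - {s}) k [b, s, a] \<phi>)" for s
    interpret functional_step V k a b \<alpha> \<beta>
    proof
      show "alternating (V - {a, b} - {t}) k [a, t, b] (\<alpha> t)" if "t \<in> V - {a, b}" for t
        unfolding \<alpha>_def using someI_ex[OF ex[OF that]] .
      show "alternating (V - {a, b} - {t}) k [b, t, a] (\<beta> t)" if "t \<in> V - {a, b}" for t
        unfolding \<beta>_def using someI_ex[OF ex[OF that]] .
    qed (use Suc.prems ab False in auto)
    show ?thesis by (rule phi_alternating)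
  qed
qed

section \<open>Triple products that do not bound\<close>

lemma complete_PT_not_Bd:
  assumes "valid (\<noteq>) L" "d \<notin> Tv L" "length L = k"
  shows "PT L \<notin> Bd (\<noteq>) (insert d (Tv L)) k"
proof
  let ?V = "insert d (Tv L)"
  assume "PT L \<in> Bd (\<noteq>) ?V k"
  then obtain e where e: "e \<in> Ch (\<noteq>) ?V (Suc k)" "PT L = bd e" by (auto simp: Bd_def)
  have "card ?V = 3 * k + 1" using complete.card_Tv[OF assms(1)] assms by simp
  then obtain \<phi> where \<phi>: "alternating ?V k [] \<phi>" using alternating_exists[of ?V k] by auto
  have "3 dvd \<phi> (PT L) - lsgn (flat L @ [d])" using \<phi> assms by (auto simp: alternating_def)
  moreover have "3 dvd \<phi> (PT L)" using \<phi> e by (auto simp: alternating_def)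
  ultimately have "3 dvd lsgn (flat L @ [d])" by (rule dvd3_diff)
  then show False using lsgn_pm[of "flat L @ [d]"] by auto
qed

lemma mtch_adj_mono:
  assumes "\<sigma> \<in> mtch adj V" "\<And>u v. adj u v \<Longrightarrow> adj' u v" shows "\<sigma> \<in> mtch adj' V"
proof -
  have *: "\<forall>e\<in>\<sigma>. \<exists>u v. e = ed u v \<and> u \<noteq> v \<and> u \<in> V \<and> v \<in> V \<and> adj u v"
    using assms(1) by (simp add: mtch_def)
  have "\<exists>u v. e = ed u v \<and> u \<noteq> v \<and> u \<in> V \<and> v \<in> V \<and> adj' u v" if "e \<in> \<sigma>" for e
    using bspec[OF * that] assms(2) by (elim exE conjE) (intro exI conjI)
  then show ?thesis using assms(1) by (simp add: mtch_def)
qed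

lemma Ch_adj_mono: "c \<in> Ch adj V k \<Longrightarrow> (\<And>u v. adj u v \<Longrightarrow> adj' u v) \<Longrightarrow> c \<in> Ch adj' V k"
  using mtch_adj_mono[of _ adj V adj'] unfolding Ch_def by blast

text \<open>
  A complete bipartite graph is a subgraph of the complete graph, so a boundary in the former is
  a boundary in the latter, if need be with one more vertex.
\<close>

lemma bip_PT_not_Bd:
  assumes L: "valid (bip R) L" "length L = k" and V: "finite V" "Tv L \<subseteq> V" "card V \<le> 3 * k + 1"
  shows "PT L \<notin> Bd (bip R) V k"
proof
  assume "PT L \<in> Bd (bip R) V k"
  then have B: "PT L \<in> Bd (\<noteq>) V k" unfolding Bd_def
    using Ch_adj_mono[of _ "bip R" V "Suc k" "(\<noteq>)"] bip.irr by blast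
  have v: "valid (\<noteq>) L" using L(1)
    by (induction L) (auto simp: cherry_def bip_def split: prod.splits)
  have c: "card (Tv L) = 3 * k" using complete.card_Tv[OF v] L by simp
  obtain d where d: "d \<notin> Tv L" "V \<subseteq> insert d (Tv L)"
  proof (cases "V = Tv L")
    case True
    obtain d where "d \<notin> Tv L" using ex_new_if_finite[OF infinite_UNIV_nat complete.finite_Tv] by blast
    then show thesis using that True by blast
  next
    case False
    then have "3 * k < card V" using V(1,2) c psubset_card_mono[of V "Tv L"] by auto
    then have "card (V - Tv L) = 1" using V c by (simp add: card_Diff_subset)
    then obtain d where "V - Tv L = {d}" by (auto simp: card_1_singleton_iff)
    then show thesis using that[of d] by blast
  qed
  show False using complete_PT_not_Bd[OF v d(1) L(2)] Bd_mono[OF B d(2)] by blast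
qed

section \<open>Arrangements in complete bipartite graphs\<close>

text \<open>
  The colours of the positions for \<open>x\<close> triples with apex in a row, listed first, and \<open>k - x\<close>
  others; the free vertex is a row.
\<close>

definition row_pos :: "nat \<Rightarrow> nat \<Rightarrow> nat \<Rightarrow> bool" where
  "row_pos x k p = (if p = 3*k then True else (p mod 3 = 0) = (p div 3 < x))"

lemma row_pos_simps:
  "row_pos x k (3*k) = True" "i < k \<Longrightarrow> row_pos x k (3*i) = (i < x)"
  "i < k \<Longrightarrow> row_pos x k (3*i+1) = (\<not> i < x)" "i < k \<Longrightarrow> row_pos x k (3*i+2) = (\<not> i < x)"
proof -
  have m: "(3*i+1) mod 3 = 1" "(3*i+2) mod 3 = 2" "(3*i+1) div 3 = i" "(3*i+2) div 3 = i" by presburger+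
  have n: "3*i+1 \<noteq> 3*k" "3*i+2 \<noteq> 3*k" by presburger+
  show "row_pos x k (3*k) = True" by (simp add: row_pos_def)
  show "i < k \<Longrightarrow> row_pos x k (3*i) = (i < x)" by (simp add: row_pos_def)
  show "i < k \<Longrightarrow> row_pos x k (3*i+1) = (\<not> i < x)" unfolding row_pos_def m using n by simp
  show "i < k \<Longrightarrow> row_pos x k (3*i+2) = (\<not> i < x)" unfolding row_pos_def m using n by simp
qed

interpretation bip_arr: arrangements "bip R" V k "\<lambda>v. v \<in> R" "(\<noteq>)" "row_pos x k" for R V k x
proof
  show "bip R u v" if "(u \<in> R) \<noteq> (v \<in> R)" for u v using that by (simp add: bip_def)
  show "row_pos x k (3*i) \<noteq> row_pos x k (3*i+1) \<and> row_pos x k (3*i) \<noteq> row_pos x k (3*i+2)" if "i < k" for i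
    using row_pos_simps(2-4)[OF that, of x] by blast
qed

text \<open>
  There are two colour classes of positions. Row positions are linked to the free position
  \<open>3 * k\<close>: an apex by \<open>rel_apex_free\<close>, and a leaf of a later triple by \<open>rel_leaf_apex_guarded\<close>,
  as the free vertex is not adjacent to the other leaf. Column positions are linked to the apex
  \<open>3 * x\<close> of the first later triple by \<open>rel_leaf_apex\<close>. The guard takes a second triple with
  apex in a row, whence \<open>2 \<le> x\<close>.
\<close>

lemma bip_rel:
  assumes x: "2 \<le> x" "x < k" and pq: "p \<le> 3*k" "q \<le> 3*k" "row_pos x k p = row_pos x k q"
  shows "bip_arr.rel R V k x p q"
proof -
  note tr = bip_arr.rel_trans and sy = bip_arr.rel_sym
  have S1: "bip_arr.rel R V k x (3*i+1) (3*i+2)" if "i < k" for i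
    by (rule bip_arr.rel_leaves[OF that]) (simp only: row_pos_simps that)
  have S2: "bip_arr.rel R V k x (3*i) (3*k)" if "i < x" for i
  proof -
    have "i < k" using that x by simp
    then show ?thesis by (intro bip_arr.rel_apex_free) (use that in \<open>simp_all only: row_pos_simps\<close>)
  qed
  have S3: "bip_arr.rel R V k x (3*i+2) (3*j)" if "i < x" "x \<le> j" "j < k" for i j
  proof -
    have ik: "i < k" "i \<noteq> j" using that by simp_all
    have c: "row_pos x k (3*i+2) = row_pos x k (3*j)" "row_pos x k (3*i+1) \<noteq> row_pos x k (3*k)"
      using that unfolding row_pos_simps(2)[OF that(3)] row_pos_simps(3,4)[OF ik(1)] row_pos_simps(1) by simp_all
    show ?thesis by (rule bip_arr.rel_leaf_apex[OF ik(1) that(3) ik(2) c])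
  qed
  have S4: "bip_arr.rel R V k x (3*j+2) (3*k)" if "x \<le> j" "j < k" for j
  proof -
    have d: "1 < k" "0 < k" "distinct [1, j, 0]" using that x by simp_all
    have c: "row_pos x k (3*j+2) = row_pos x k (3*0)" "row_pos x k (3*1+1) \<noteq> row_pos x k (3*k)" "row_pos x k (3*j+1) \<noteq> row_pos x k (3*1+2)"
      using that x unfolding row_pos_simps(3,4)[OF that(2)] row_pos_simps(3,4)[OF d(1)] row_pos_simps(2)[OF d(2)] row_pos_simps(1) by simp_all
    have "bip_arr.rel R V k x (3*j+2) (3*0)"
      by (rule bip_arr.rel_leaf_apex_guarded[OF d(1) that(2) d(2) d(3) c])
    then show ?thesis using tr S2[of 0] x by auto
  qed
  have *: "bip_arr.rel R V k x p (if row_pos x k p then 3*k else 3*x)" if "p \<le> 3*k" for p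
    using that
  proof (cases rule: div3_cases)
    case 1
    then show ?thesis by (simp add: row_pos_def bip_arr.rel_def)
  next
    case (2 i)
    note c = row_pos_simps(2)[OF 2(1), of x]
    show ?thesis
    proof (cases "i < x")
      case True
      then show ?thesis unfolding 2(2) c using S2 by simp
    next
      case False
      have "bip_arr.rel R V k x (3*i) (3*x)"
        by (rule tr[OF sy[OF S3[of 0 i]] S3[of 0 x]]) (use False 2 x in auto)
      then show ?thesis unfolding 2(2) c using False by simp
    qed
  next
    case (3 i)
    note c = row_pos_simps(3)[OF 3(1), of x]
    show ?thesis
    proof (cases "i < x")
      case True
      then show ?thesis unfolding 3(2) c using tr[OF S1[OF 3(1)] S3[of i x]] x by simp
    next
      case False
      then show ?thesis unfolding 3(2) c using tr[OF S1[OF 3(1)] S4[of i]] 3 by simp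
    qed
  next
    case (4 i)
    note c = row_pos_simps(4)[OF 4(1), of x]
    show ?thesis
    proof (cases "i < x")
      case True
      then show ?thesis unfolding 4(2) c using S3[of i x] x by simp
    next
      case False
      then show ?thesis unfolding 4(2) c using S4[of i] 4 by simp
    qed
  qed
  show ?thesis using tr[OF *[OF pq(1)]] sy[OF *[OF pq(2)]] pq(3) by simp
qed

lemma flat_concat: "flat L = concat (map (\<lambda>(a, b, c). [a, b, c]) L)"
  by (induction L rule: flat.induct) auto

lemma (in graph) valid_iff: "valid adj L \<longleftrightarrow> (\<forall>t\<in>set L. cherry adj t) \<and> distinct (flat L)"
proof (induction L rule: flat.induct)
  case (2 a b c L)
  then show ?case by (auto dest: irr)
qed simp

lemma (in graph) valid_perm: assumes "mset L = mset L'" "valid adj L" shows "valid adj L'"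
proof -
  have "sum_list (map f L) = sum_list (map f L')" for f :: "triple \<Rightarrow> nat multiset"
    using assms(1) by (metis mset_map sum_mset_sum_list)
  then have "mset (flat L) = mset (flat L')" unfolding flat_concat mset_concat by simp
  then have "distinct (flat L) \<longleftrightarrow> distinct (flat L')" by (rule mset_eq_imp_distinct_iff)
  moreover have "set L = set L'" using assms(1) by (rule mset_eq_setD)
  ultimately show ?thesis using assms(2) unfolding valid_iff by simp
qed

lemma Tv_perm: "mset L = mset L' \<Longrightarrow> Tv L = Tv L'"
  using mset_eq_setD[of L L'] unfolding Tv_def by simp

text \<open>Lists in the order that \<open>row_pos\<close> prescribes.\<close>

definition std_list :: "nat set \<Rightarrow> nat set \<Rightarrow> nat \<Rightarrow> nat \<Rightarrow> triple list \<Rightarrow> nat \<Rightarrow> bool" where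
  "std_list R V x k L d \<longleftrightarrow> valid (bip R) L \<and> length L = k \<and> d \<in> R \<and> d \<notin> Tv L \<and> insert d (Tv L) = V \<and>
     (\<forall>i<k. row_apex R (L ! i) \<longleftrightarrow> i < x)"

lemma std_list_arr:
  assumes s: "std_list R V x k L d"
  shows "bip_arr.arr V k R x ((!) (flat L @ [d]))" "PT (LA ((!) (flat L @ [d])) k) = PT L" "(!) (flat L @ [d]) ` {..3*k} = V"
proof -
  have L: "valid (bip R) L" "length L = k" "d \<notin> Tv L" "insert d (Tv L) = V" "d \<in> R"
    "\<And>i. i < k \<Longrightarrow> row_apex R (L ! i) \<longleftrightarrow> i < x" using s by (auto simp: std_list_def)
  have Vs: "insert d (Tv L) \<subseteq> V" using L(4) by simp
  let ?A = "(!) (flat L @ [d])"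
  have tr: "Tr ?A i = L ! i" if "i < k" for i
    using LA_flat[of L "[d]"] L(2) that by (metis LA_def add.left_neutral diff_zero length_upt nth_map nth_upt)
  have col: "?A p \<in> R \<longleftrightarrow> row_pos x k p" if "p \<le> 3*k" for p
  proof -
    have g: "(?A (3*i) \<in> R) = (i < x) \<and> (?A (3*i+1) \<in> R) = (\<not> i < x) \<and> (?A (3*i+2) \<in> R) = (\<not> i < x)" if "i < k" for i
    proof -
      have "cherry (bip R) (L ! i)" using L(1,2) that bip.valid_iff by auto
      moreover have "row_apex R (L ! i) \<longleftrightarrow> i < x" using L(6) that .
      ultimately show ?thesis unfolding tr[OF that, symmetric] by (auto simp: Tr_def bip_def)
    qed
    show ?thesis using \<open>p \<le> 3*k\<close>
    proof (cases rule: div3_cases)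
      case 1
      then show ?thesis using L(2,5) by (simp add: row_pos_def nth_append)
    next
      case (2 i) then show ?thesis using g[OF 2(1)] row_pos_simps(2)[OF 2(1)] by simp
    next
      case (3 i) then show ?thesis using g[OF 3(1)] row_pos_simps(3)[OF 3(1)] by simp
    next
      case (4 i) then show ?thesis using g[OF 4(1)] row_pos_simps(4)[OF 4(1)] by simp
    qed
  qed
  note a = bip_arr.arr_flat[OF L(1-3) Vs col]
  show "bip_arr.arr V k R x ?A" "PT (LA ?A k) = PT L" "?A ` {..3*k} = V"
    using a(1,2,4) L(4) by simp_all
qed

lemma pm_trans:
  assumes "adgrp S" "x - frag_cmul e y \<in> S" "y - frag_cmul e' z \<in> S"
  shows "x - frag_cmul (e * e') z \<in> S"
proof -
  have "frag_cmul e (y - frag_cmul e' z) \<in> S" using assms(1,3) by (rule adgrp_cmul)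
  moreover have "frag_cmul e (y - frag_cmul e' z) = frag_cmul e y - frag_cmul (e * e') z"
    using fadd_cmul by (simp add: diff_conv_add_uminus frag_cmul_distrib2 del: add_uminus_conv_diff)
  ultimately show ?thesis using assms(1,2) adgrp_trans by metis
qed

lemma pm_of_eq:
  assumes "adgrp S" "frag_cmul l x - frag_cmul l' y \<in> S" "l * l = 1"
  shows "x - frag_cmul (l * l') y \<in> S"
proof -
  have "frag_cmul l (frag_cmul l x - frag_cmul l' y) \<in> S" using assms(1,2) by (rule adgrp_cmul)
  moreover have "frag_cmul l (frag_cmul l x - frag_cmul l' y) = frag_cmul (l*l) x - frag_cmul (l * l') y"
    by (simp add: diff_conv_add_uminus frag_cmul_distrib2 del: add_uminus_conv_diff)
  ultimately show ?thesis using assms(3) by simp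
qed

lemma std_eq:
  assumes x: "2 \<le> x" "x < k" and s: "std_list R V x k L d" "std_list R V x k L' d'"
  shows "\<exists>\<epsilon>. (\<epsilon> = 1 \<or> \<epsilon> = -1) \<and> PT L - frag_cmul \<epsilon> (PT L') \<in> Bd (bip R) V k"
proof -
  let ?A = "(!) (flat L @ [d])" let ?B = "(!) (flat L' @ [d'])"
  let ?l = "lsgn (map ?A [0..<Suc (3*k)])" let ?l' = "lsgn (map ?B [0..<Suc (3*k)])"
  note a = std_list_arr[OF s(1)] and b = std_list_arr[OF s(2)]
  have "?A ` {..3*k} = ?B ` {..3*k}" using a(3) b(3) by (rule trans[OF _ sym])
  from bip_arr.swap_all[OF bip_rel[OF x] a(1) b(1) this]
  have "frag_cmul ?l (PT L) - frag_cmul ?l' (PT L') \<in> Bd (bip R) V k" unfolding a(2) b(2) .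
  then have "PT L - frag_cmul (?l * ?l') (PT L') \<in> Bd (bip R) V k" by (rule pm_of_eq[OF adgrp_Bd _ lsgn_sq])
  moreover have "?l * ?l' = 1 \<or> ?l * ?l' = -1"
    using lsgn_pm[of "map ?A [0..<Suc (3*k)]"] lsgn_pm[of "map ?B [0..<Suc (3*k)]"] by (elim disjE) (simp_all del: upt_Suc)
  ultimately show ?thesis by blast
qed

lemma std_three:
  assumes x: "2 \<le> x" "x < k" and s: "std_list R V x k L d"
  shows "frag_cmul 3 (PT L) \<in> Bd (bip R) V k"
proof -
  note a = std_list_arr[OF s]
  have k: "0 < k" "1 < k" using x by simp_all
  have "frag_cmul 3 (PT (LA ((!) (flat L @ [d])) k)) \<in> Bd (bip R) V k"
  proof (rule bip_arr.three_null[where i = 0 and l = 1, OF bip_rel[OF x] k(1) k(2) _ _ _ _ a(1)])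
    show "0 \<noteq> (1::nat)" by simp
    show "row_pos x k (3*0+2) = row_pos x k (3*1+1)" "row_pos x k (3*0+2) = row_pos x k (3*1+2)" "row_pos x k (3*0+1) \<noteq> row_pos x k (3*k)"
      unfolding row_pos_simps(3,4)[OF k(1)] row_pos_simps(3,4)[OF k(2)] row_pos_simps(1) using x by simp_all
  qed
  then show ?thesis unfolding a(2) .
qed

text \<open>
  Every triple product with one free vertex is, up to sign and boundaries, in the prescribed
  form. If the free vertex is a column, then flipping a triple with its apex in a column frees a
  row instead.
\<close>

lemma to_std:
  assumes V: "finite V" "card (V \<inter> R) = x + 2*y + 1" "card (V - R) = 2*x + y" and k: "k = x + y"
    and L: "valid (bip R) L" "length L = k" "Tv L \<subseteq> V"
  shows "\<exists>L' d \<epsilon>. std_list R V x k L' d \<and> (\<epsilon> = 1 \<or> \<epsilon> = -1) \<and> PT L - frag_cmul \<epsilon> (PT L') \<in> Bd (bip R) V k"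
proof -
  have cV: "card V = 3*k + 1" using V k card_Int_Diff[of V R] by simp
  have row: "\<exists>L' \<epsilon>. std_list R V x k L' d \<and> (\<epsilon> = 1 \<or> \<epsilon> = -1) \<and> PT L - frag_cmul \<epsilon> (PT L') \<in> Bd (bip R) V k"
    if L: "valid (bip R) L" "length L = k" "Tv L \<subseteq> V" and d: "V - Tv L = {d}" "d \<in> R" for L d
  proof -
    note cf = card_free[OF V(1) L(1,3)]
    have "V \<inter> R - Tv L = {d}" "V - R - Tv L = {}" using d by auto
    then have "n_row R L = x" using cf V k n_row_n_col[of R L] L(2) by simp
    then have lx: "length (filter (row_apex R) L) = x" by (simp add: n_row_def)
    let ?L = "filter (row_apex R) L @ filter (\<lambda>t. \<not> row_apex R t) L"
    have m: "mset L = mset ?L" by simp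
    from prodT_perm[OF m] obtain \<epsilon> where e: "\<epsilon> = 1 \<or> \<epsilon> = -1" "PT L = frag_cmul \<epsilon> (PT ?L)" by blast
    have "row_apex R (?L ! i) \<longleftrightarrow> i < x" if "i < k" for i
    proof (cases "i < x")
      case True
      then have "?L ! i = filter (row_apex R) L ! i" using lx by (simp add: nth_append)
      then have "?L ! i \<in> set (filter (row_apex R) L)" using True lx nth_mem[of i "filter (row_apex R) L"] by (simp only:)
      then show ?thesis using True by simp
    next
      case False
      have "length ?L = k" using m L(2) by (metis size_mset)
      then have "i - x < length (filter (\<lambda>t. \<not> row_apex R t) L)" using False that lx by simp
      moreover have "?L ! i = filter (\<lambda>t. \<not> row_apex R t) L ! (i - x)" using False lx by (simp add: nth_append)
      ultimately have "?L ! i \<in> set (filter (\<lambda>t. \<not> row_apex R t) L)"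
        using nth_mem[of "i - x" "filter (\<lambda>t. \<not> row_apex R t) L"] by (simp only:)
      then show ?thesis using False by simp
    qed
    moreover have "length ?L = k" using m L(2) by (metis size_mset)
    moreover have "valid (bip R) ?L" by (rule bip.valid_perm[OF m L(1)])
    moreover have "Tv ?L = Tv L" by (rule Tv_perm[OF m, symmetric])
    moreover have "insert d (Tv L) = V" "d \<notin> Tv L" using d L(3) by auto
    ultimately have "std_list R V x k ?L d" unfolding std_list_def using d(2) by simp
    moreover have "PT L - frag_cmul \<epsilon> (PT ?L) \<in> Bd (bip R) V k" unfolding e(2) by (simp add: Bd_cl(1))
    ultimately show ?thesis using e(1) by blast
  qed
  have "card (V - Tv L) = 1" using L V cV bip.card_Tv[OF L(1)] by (simp add: card_Diff_subset)
  then obtain d where d: "V - Tv L = {d}" by (auto simp: card_1_singleton_iff)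
  show ?thesis
  proof (cases "d \<in> R")
    case True
    then show ?thesis using row[OF L d] by blast
  next
    case False
    note cf = card_free[OF V(1) L(1,3)]
    have "V \<inter> R - Tv L = {}" "V - R - Tv L = {d}" using d False by auto
    then have "n_col R L \<noteq> 0" using cf V k n_row_n_col[of R L] L(2) by simp
    then have "\<exists>t\<in>set L. \<not> row_apex R t" by (auto simp: n_col_def filter_empty_conv)
    then obtain e f g where t: "(e, f, g) \<in> set L" "e \<notin> R" by auto
    then obtain A B where Leq: "L = A @ (e, f, g) # B" by (meson split_list)
    have m: "mset L = mset ((e, f, g) # A @ B)" by (simp add: Leq)
    from prodT_perm[OF m] obtain \<epsilon> where ee: "\<epsilon> = 1 \<or> \<epsilon> = -1" "PT L = frag_cmul \<epsilon> (PT ((e, f, g) # A @ B))" by blast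
    have v: "valid (bip R) ((e, f, g) # A @ B)" by (rule bip.valid_perm[OF m L(1)])
    have tv: "Tv L = {e, f, g} \<union> Tv (A @ B)" using Tv_perm[OF m] by simp
    have fg: "f \<in> R" "g \<in> R" "f \<noteq> g" "e \<noteq> f" "e \<noteq> g" using v t(2) by (auto simp: bip_def)
    have dn: "d \<notin> Tv L" "d \<in> V" using d by auto
    have disj: "{e, f, g} \<inter> Tv (A @ B) = {}" using v by simp
    let ?L = "(f, e, d) # A @ B"
    have vL: "valid (bip R) ?L"
      using v t(2) fg False dn disj unfolding tv by (auto simp: bip_def)
    have tvL: "Tv ?L \<subseteq> V" using L(3) dn unfolding tv by auto
    have "V - Tv ?L = {g}" using d dn L(3) disj fg unfolding tv by auto
    moreover have lL: "length ?L = k" using L(2) by (simp add: Leq)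
    ultimately obtain L' \<epsilon>' where L': "std_list R V x k L' g" "\<epsilon>' = 1 \<or> \<epsilon>' = -1" "PT ?L - frag_cmul \<epsilon>' (PT L') \<in> Bd (bip R) V k"
      using row[OF vL _ tvL] fg by blast
    have "Z e f g (PT (A @ B)) - Z f e d (PT (A @ B)) \<in> Bd (bip R) V (Suc (length (A @ B)))"
    proof (rule bip.flip)
      show "PT (A @ B) \<in> Cy (bip R) (V - {e, f, g, d}) (length (A @ B))"
        by (rule bip.PT_Cy) (use v L(3) disj dn tv in auto)
    qed (use L(3) dn fg t(2) False tv in \<open>auto simp: bip_def\<close>)
    then have "PT ((e, f, g) # A @ B) - PT ?L \<in> Bd (bip R) V k" using lL by simp
    then have "PT L - frag_cmul \<epsilon> (PT ?L) \<in> Bd (bip R) V k"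
      using Bd_cl(6)[of "PT ((e, f, g) # A @ B) - PT ?L" "bip R" V k \<epsilon>] unfolding ee(2)
      by (simp add: diff_conv_add_uminus frag_cmul_distrib2 del: add_uminus_conv_diff)
    from pm_trans[OF adgrp_Bd this L'(3)] have "PT L - frag_cmul (\<epsilon> * \<epsilon>') (PT L') \<in> Bd (bip R) V k" .
    moreover have "\<epsilon> * \<epsilon>' = 1 \<or> \<epsilon> * \<epsilon>' = -1" using ee(1) L'(2) by auto
    ultimately show ?thesis using L'(1) by blast
  qed
qed

text \<open>
  With one vertex free, \<open>three_null\<close> applies to a leaf of one triple and the two leaves of
  another with the same kind of apex.
\<close>

lemma bip_three:
  assumes V: "finite V" "card (V \<inter> R) = x + 2*y + 1" "card (V - R) = 2*x + y" and k: "k = x + y" and xy: "2 \<le> x" "1 \<le> y"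
    and L: "valid (bip R) L" "length L = k" "Tv L \<subseteq> V"
  shows "frag_cmul 3 (PT L) \<in> Bd (bip R) V k"
proof -
  obtain L' d \<epsilon> where L': "std_list R V x k L' d" "PT L - frag_cmul \<epsilon> (PT L') \<in> Bd (bip R) V k"
    using to_std[OF V k L] by blast
  have "x < k" using k xy by simp
  from std_three[OF xy(1) this L'(1)] have 3: "frag_cmul 3 (PT L') \<in> Bd (bip R) V k" .
  have "frag_cmul 3 (PT L - frag_cmul \<epsilon> (PT L')) + frag_cmul \<epsilon> (frag_cmul 3 (PT L')) \<in> Bd (bip R) V k"
    by (rule adgrp_add[OF adgrp_Bd Bd_cl(6)[OF L'(2)] Bd_cl(6)[OF 3]])
  moreover have "frag_cmul 3 (PT L - frag_cmul \<epsilon> (PT L')) + frag_cmul \<epsilon> (frag_cmul 3 (PT L')) = frag_cmul 3 (PT L)"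
    by (simp add: diff_conv_add_uminus frag_cmul_distrib2 mult.commute del: add_uminus_conv_diff)
       (simp flip: frag_cmul_distrib)
  ultimately show ?thesis by simp
qed

lemma bip_list_exists:
  "finite V \<Longrightarrow> x + 2*y \<le> card (V \<inter> R) \<Longrightarrow> 2*x + y \<le> card (V - R) \<Longrightarrow>
     \<exists>L. valid (bip R) L \<and> length L = x + y \<and> Tv L \<subseteq> V"
proof (induction x arbitrary: V)
  case 0
  then show ?case
  proof (induction y arbitrary: V)
    case (Suc y)
    have "2 \<le> card (V \<inter> R)" "1 \<le> card (V - R)" using Suc.prems by simp_all
    then obtain T1 T2 where T: "T1 \<subseteq> V \<inter> R" "card T1 = 2" "T2 \<subseteq> V - R" "card T2 = 1" by (metis obtain_subset_with_card_n)
    then obtain a b c where abc: "T1 = {b, c}" "b \<noteq> c" "T2 = {a}" by (auto simp: card_2_iff card_1_singleton_iff)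
    have abc': "a \<in> V" "a \<notin> R" "b \<in> V" "b \<in> R" "c \<in> V" "c \<in> R" using abc T by auto
    have "0 + 2*y \<le> card ((V - {a, b, c}) \<inter> R)" "2*0 + y \<le> card (V - {a, b, c} - R)"
      using rows_Diff[of V "{a, b, c}" R] abc' abc(2) Suc.prems by (auto simp: insert_Diff_if)
    then obtain L where "valid (bip R) L" "length L = y" "Tv L \<subseteq> V - {a, b, c}"
      using Suc.IH[of "V - {a, b, c}"] Suc.prems by auto
    then show ?case using abc abc' by (intro exI[of _ "(a, b, c) # L"]) (auto simp: bip_def[of R a])
  qed (auto intro: exI[of _ "[]"])
next
  case (Suc x)
  have "2 \<le> card (V - R)" "1 \<le> card (V \<inter> R)" using Suc.prems by simp_all
  then obtain T1 T2 where T: "T1 \<subseteq> V - R" "card T1 = 2" "T2 \<subseteq> V \<inter> R" "card T2 = 1" by (metis obtain_subset_with_card_n)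
  then obtain a b c where abc: "T1 = {b, c}" "b \<noteq> c" "T2 = {a}" by (auto simp: card_2_iff card_1_singleton_iff)
  have abc': "a \<in> V" "a \<in> R" "b \<in> V" "b \<notin> R" "c \<in> V" "c \<notin> R" using abc T by auto
  have "x + 2*y \<le> card ((V - {a, b, c}) \<inter> R)" "2*x + y \<le> card (V - {a, b, c} - R)"
    using rows_Diff[of V "{a, b, c}" R] abc' abc(2) Suc.prems by (auto simp: insert_Diff_if)
  then obtain L where "valid (bip R) L" "length L = x + y" "Tv L \<subseteq> V - {a, b, c}"
    using Suc.IH[of "V - {a, b, c}"] Suc.prems by auto
  then show ?case using abc abc' by (intro exI[of _ "(a, b, c) # L"]) (auto simp: bip_def[of R a])
qed

text \<open>
  All triple products are plus or minus one and the same class, which generates by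
  \<open>bip_triple_span\<close>, is killed by three by \<open>bip_three\<close>, and is not zero by \<open>bip_PT_not_Bd\<close>.
\<close>

lemma bip_homology_Z3:
  assumes V: "finite V" "card (V \<inter> R) = x + 2*y + 1" "card (V - R) = 2*x + y" and k: "k = x + y" and xy: "2 \<le> x" "1 \<le> y"
  shows "\<exists>P\<in>Cy (bip R) V k. P \<notin> Bd (bip R) V k \<and> frag_cmul 3 P \<in> Bd (bip R) V k \<and>
           (\<forall>c\<in>Cy (bip R) V k. \<exists>n. c - frag_cmul n P \<in> Bd (bip R) V k)"
proof -
  obtain L where L: "valid (bip R) L" "length L = k" "Tv L \<subseteq> V"
    using bip_list_exists[of V x y R] V k by auto
  have cV: "card V = 3*k + 1" using V k card_Int_Diff[of V R] by simp
  have xk: "x < k" using k xy by simp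
  have eq: "\<exists>n. PT L' - frag_cmul n (PT L) \<in> Bd (bip R) V k" if L': "valid (bip R) L'" "length L' = k" "Tv L' \<subseteq> V" for L'
  proof -
    obtain M d \<epsilon> where M: "std_list R V x k M d" "\<epsilon> = 1 \<or> \<epsilon> = -1" "PT L - frag_cmul \<epsilon> (PT M) \<in> Bd (bip R) V k"
      using to_std[OF V k L] by blast
    obtain M' d' \<epsilon>' where M': "std_list R V x k M' d'" "PT L' - frag_cmul \<epsilon>' (PT M') \<in> Bd (bip R) V k"
      using to_std[OF V k L'] by blast
    obtain \<epsilon>'' where M'': "PT M' - frag_cmul \<epsilon>'' (PT M) \<in> Bd (bip R) V k" using std_eq[OF xy(1) xk M'(1) M(1)] by blast
    have ee: "\<epsilon> * \<epsilon> = 1" using M(2) by auto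
    have "frag_cmul \<epsilon> (PT M) - frag_cmul 1 (PT L) \<in> Bd (bip R) V k"
      using adgrp_swap[OF adgrp_Bd M(3)] by simp
    from pm_of_eq[OF adgrp_Bd this ee] have "PT M - frag_cmul (\<epsilon> * 1) (PT L) \<in> Bd (bip R) V k" .
    from pm_trans[OF adgrp_Bd pm_trans[OF adgrp_Bd M'(2) M''] this] show ?thesis by blast
  qed
  have "\<exists>n. c - frag_cmul n (PT L) \<in> Bd (bip R) V k" if c: "c \<in> Cy (bip R) V k" for c
  proof -
    let ?S = "{c. \<exists>n. c - frag_cmul n (PT L) \<in> Bd (bip R) V k}"
    have S: "adgrp ?S" unfolding adgrp_def
    proof (intro conjI ballI)
      have "0 - frag_cmul 0 (PT L) \<in> Bd (bip R) V k" by (simp add: Bd_cl(1))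
      then show "0 \<in> ?S" by blast
      fix a b assume "a \<in> ?S" "b \<in> ?S"
      then obtain n m where nm: "a - frag_cmul n (PT L) \<in> Bd (bip R) V k" "b - frag_cmul m (PT L) \<in> Bd (bip R) V k" by auto
      have "(a - b) - frag_cmul (n - m) (PT L) = (a - frag_cmul n (PT L)) - (b - frag_cmul m (PT L))"
        by (simp add: frag_cmul_diff_distrib algebra_simps)
      then have "(a - b) - frag_cmul (n - m) (PT L) \<in> Bd (bip R) V k" using adgrp_diff[OF adgrp_Bd nm] by (simp only:)
      then show "a - b \<in> ?S" by blast
    qed
    have "k \<le> card (V \<inter> R)" "k \<le> card (V - R)" "3 * k \<le> card (V \<inter> R) + card (V - R)" using V k by simp_all
    from bip_triple_span[OF V(1) this] c have "c \<in> triple_span (bip R) V k" by blast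
    then have "(\<lambda>c. c) c \<in> ?S"
    proof (rule triple_span_map[OF _ fadd_id S])
      fix y assume "y \<in> Bd (bip R) V k"
      then have "y - frag_cmul 0 (PT L) \<in> Bd (bip R) V k" by simp
      then show "y \<in> ?S" by blast
    qed (use eq in blast)
    then show ?thesis by simp
  qed
  moreover have "PT L \<notin> Bd (bip R) V k" using bip_PT_not_Bd[OF L(1,2) V(1) L(3)] cV by simp
  moreover have "PT L \<in> Cy (bip R) V k" using bip.PT_Cy[OF L(1,3)] L(2) by simp
  ultimately show ?thesis using bip_three[OF V k xy L] by blast
qed

section \<open>Exponent nine\<close>

text \<open>
  If adding one vertex \<open>v\<close> makes \<open>c\<close> a boundary, then \<open>c\<close> is homologous to a sum of cycles that
  each avoid a neighbour of \<open>v\<close>: the links of the edges at \<open>v\<close> in a filling of \<open>c\<close>.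
\<close>

lemma (in graph) split_Bd:
  assumes V: "finite V1" "v \<notin> V1" and c: "c \<in> Ch adj V1 k" "c \<in> Bd adj (insert v V1) k"
  shows "\<exists>f Y. c = (\<Sum>s\<in>nbrs V1 v. f s) + bd Y \<and> (\<forall>s\<in>nbrs V1 v. f s \<in> Cy adj (V1 - {s}) k) \<and> Y \<in> Ch adj V1 (Suc k)"
proof -
  obtain E where E: "E \<in> Ch adj (insert v V1) (Suc k)" "c = bd E" using c(2) by (auto simp: Bd_def)
  have Ne: "nbrs (insert v V1) v = nbrs V1 v" using irr by (auto simp: nbrs_def)
  define f where "f s = Lk (ed v s) E" for s
  define Y where "Y = E - (\<Sum>s\<in>nbrs V1 v. W (ed v s) (f s))"
  have V1: "insert v V1 - {v} = V1" using V by auto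
  have Y: "Y \<in> Ch adj V1 (Suc k)"
    using expand[of "insert v V1" v E "Suc k"] V E unfolding Ne V1 f_def Y_def by simp
  have f: "f s \<in> Cy adj (V1 - {s}) k" for s
  proof -
    have "insert v V1 - {v, s} = V1 - {s}" using V by auto
    then have "f s \<in> Ch adj (V1 - {s}) k" using Lk_Ch[OF E(1), of v s] by (simp add: f_def)
    moreover have "Lk (ed v s) c = 0" by (rule Lk_0[OF c(1)]) (use V in simp)
    then have "bd (f s) = 0" by (simp add: f_def bd_Lk E(2))
    ultimately show ?thesis by (simp add: Cy_def)
  qed
  have "c = bd Y + (\<Sum>s\<in>nbrs V1 v. bd (W (ed v s) (f s)))" by (simp add: E(2) Y_def bd_lin)
  also have "(\<Sum>s\<in>nbrs V1 v. bd (W (ed v s) (f s))) = (\<Sum>s\<in>nbrs V1 v. f s)"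
  proof (intro sum.cong refl)
    fix s show "bd (W (ed v s) (f s)) = f s"
      using f[of s] bd_W[OF Ch_fin[of "f s" adj "V1 - {s}" k], of "ed v s"] by (simp add: Cy_def W_lin)
  qed
  finally show ?thesis using f Y by (intro exI[of _ f] exI[of _ Y]) (simp add: add.commute)
qed

text \<open>
  One triple with its apex in a row and two with their apexes in columns cover five rows and
  four columns. With one more column there is a free vertex, and \<open>bip_three\<close> kills three times
  their product. So by \<open>split_Bd\<close> three times the product of \<open>L1\<close> is homologous to a sum of
  cycles that each avoid a row of \<open>Tv L1\<close>. Likewise for \<open>L2\<close>, with a column of \<open>Tv L2\<close>. The
  products of these cycles avoid a row and a column, so they bound.
\<close>

lemma bip_nine_pair:
  assumes L: "valid (bip R) (L1 @ L2)" "length L1 = 3" "length L2 = 3"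
    and n: "n_row R L1 = 1" "n_col R L1 = 2" "n_row R L2 = 2" "n_col R L2 = 1"
  shows "frag_cmul 9 (PT (L1 @ L2)) \<in> Bd (bip R) (Tv (L1 @ L2)) 6"
proof -
  let ?V1 = "Tv L1" let ?V2 = "Tv L2" let ?V = "Tv (L1 @ L2)"
  have v: "valid (bip R) L1" "valid (bip R) L2" "?V1 \<inter> ?V2 = {}" using L(1) by (auto simp: valid_append)
  have c: "card (?V1 \<inter> R) = 5" "card (?V1 - R) = 4" "card (?V2 \<inter> R) = 4" "card (?V2 - R) = 5"
    using Tv_rows[OF v(1)] Tv_rows[OF v(2)] n by simp_all
  have "?V2 - R \<noteq> {}" "?V1 \<inter> R \<noteq> {}" using c by (intro notI; simp)+
  then obtain u r where u: "u \<in> ?V2" "u \<notin> R" and r: "r \<in> ?V1" "r \<in> R" by blast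
  have u1: "u \<notin> ?V1" and r2: "r \<notin> ?V2" using u r v(3) by blast+
  have three: "frag_cmul 3 (PT L) \<in> Bd (bip R) (insert w (Tv L)) 3"
    if "valid (bip R) L" "length L = 3" "card (insert w (Tv L) \<inter> R) = 5" "card (insert w (Tv L) - R) = 5" for L w
    by (rule bip_three[of "insert w (Tv L)" R 2 1]) (use that in auto)
  have e1: "insert u ?V1 \<inter> R = ?V1 \<inter> R" "insert u ?V1 - R = insert u (?V1 - R)" using u by auto
  have e2: "insert r ?V2 \<inter> R = insert r (?V2 \<inter> R)" "insert r ?V2 - R = ?V2 - R" using r by auto
  have B1: "frag_cmul 3 (PT L1) \<in> Bd (bip R) (insert u ?V1) 3"
    by (rule three[OF v(1) L(2)]) (use c u1 in \<open>simp_all add: e1\<close>)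
  have B2: "frag_cmul 3 (PT L2) \<in> Bd (bip R) (insert r ?V2) 3"
    by (rule three[OF v(2) L(3)]) (use c r2 in \<open>simp_all add: e2\<close>)
  have C1: "PT L1 \<in> Cy (bip R) ?V1 3" and C2: "PT L2 \<in> Cy (bip R) ?V2 3"
    using bip.PT_Cy[OF v(1) order_refl] bip.PT_Cy[OF v(2) order_refl] L by simp_all
  have C1': "frag_cmul 3 (PT L1) \<in> Cy (bip R) ?V1 3" and C2': "frag_cmul 3 (PT L2) \<in> Cy (bip R) ?V2 3"
    using C1 C2 by (auto intro: Cy_cl)
  obtain f Y where f: "frag_cmul 3 (PT L1) = (\<Sum>s\<in>bip.nbrs R ?V1 u. f s) + bd Y" "\<And>s. s \<in> bip.nbrs R ?V1 u \<Longrightarrow> f s \<in> Cy (bip R) (?V1 - {s}) 3"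
    "Y \<in> Ch (bip R) ?V1 (Suc 3)"
    using bip.split_Bd[OF bip.finite_Tv u1 _ B1] C1' unfolding Cy_def by blast
  obtain g Y' where g: "frag_cmul 3 (PT L2) = (\<Sum>s\<in>bip.nbrs R ?V2 r. g s) + bd Y'" "\<And>s. s \<in> bip.nbrs R ?V2 r \<Longrightarrow> g s \<in> Cy (bip R) (?V2 - {s}) 3"
    "Y' \<in> Ch (bip R) ?V2 (Suc 3)"
    using bip.split_Bd[OF bip.finite_Tv r2 _ B2] C2' unfolding Cy_def by blast
  define A where "A = (\<Sum>s\<in>bip.nbrs R ?V1 u. f s)"
  define A' where "A' = (\<Sum>s\<in>bip.nbrs R ?V2 r. g s)"
  have sub: "?V1 \<subseteq> ?V" "?V2 \<subseteq> ?V" by auto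
  have AC: "A \<in> Cy (bip R) ?V1 3" unfolding A_def using f(2) by (intro Cy_cl) (auto intro: Cy_mono)
  have "mul A A' = (\<Sum>s\<in>bip.nbrs R ?V1 u. \<Sum>t\<in>bip.nbrs R ?V2 r. mul (f s) (g t))"
    by (simp add: A_def A'_def mul_lin1 mul_lin2) (rule sum.swap)
  also have "\<dots> \<in> Bd (bip R) ?V (3 + 3)"
  proof (intro Bd_cl(5))
    fix s t assume s: "s \<in> bip.nbrs R ?V1 u" and t: "t \<in> bip.nbrs R ?V2 r"
    have s': "s \<in> ?V1" "s \<in> R" using s u by (auto simp: bip.nbrs_def bip_def)
    have t': "t \<in> ?V2" "t \<notin> R" using t r by (auto simp: bip.nbrs_def bip_def)
    show "mul (f s) (g t) \<in> Bd (bip R) ?V (3 + 3)"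
    proof (rule bip.W_Cy_free[of s _ t])
      show "mul (f s) (g t) \<in> Cy (bip R) (?V - {s, t}) (3 + 3)"
        by (rule bip.mul_Cy[OF f(2)[OF s] g(2)[OF t]]) (use s' t' v(3) in auto)
    qed (use s' t' in \<open>auto simp: bip_def\<close>)
  qed
  finally have 1: "mul A A' \<in> Bd (bip R) ?V (3 + 3)" .
  have 2: "mul A (bd Y') \<in> Bd (bip R) ?V (3 + 3)"
    by (rule bip.mul_Bd2[OF AC bip.bd_Ch_Bd[OF g(3)] v(3) sub])
  have 3: "mul (bd Y) (frag_cmul 3 (PT L2)) \<in> Bd (bip R) ?V (3 + 3)"
    by (rule bip.mul_Bd1[OF bip.bd_Ch_Bd[OF f(3)] C2' v(3) sub])
  have "mul (frag_cmul 3 (PT L1)) (frag_cmul 3 (PT L2)) = mul A (frag_cmul 3 (PT L2)) + mul (bd Y) (frag_cmul 3 (PT L2))"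
    by (simp only: f(1) A_def mul_lin1)
  also have "mul A (frag_cmul 3 (PT L2)) = mul A A' + mul A (bd Y')"
    by (simp only: g(1) A'_def mul_lin2)
  finally have "mul (frag_cmul 3 (PT L1)) (frag_cmul 3 (PT L2)) \<in> Bd (bip R) ?V (3 + 3)"
    using adgrp_add[OF adgrp_Bd adgrp_add[OF adgrp_Bd 1 2] 3] by (simp only:)
  moreover have "mul (frag_cmul 3 (PT L1)) (frag_cmul 3 (PT L2)) = frag_cmul 9 (PT (L1 @ L2))"
    by (simp add: mul_lin1 mul_lin2 prodT_eq_mul[of L1 "PT L2"])
  ultimately show ?thesis by simp
qed

lemma three_of: assumes "3 \<le> length M" obtains a b c M' where "M = a # b # c # M'"
  using assms by (cases M; cases "tl M"; cases "tl (tl M)") auto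

text \<open>
  The two groups of \<open>bip_nine_pair\<close> use three triples of each kind between them; all other
  triples form a common factor.
\<close>

lemma bip_nine:
  assumes L: "valid (bip R) L" "3 \<le> n_row R L" "3 \<le> n_col R L"
  shows "frag_cmul 9 (PT L) \<in> Bd (bip R) (Tv L) (length L)"
proof -
  obtain i1 i2 i3 Is where I: "filter (row_apex R) L = i1 # i2 # i3 # Is"
    using three_of[OF L(2)[unfolded n_row_def]] by blast
  obtain j1 j2 j3 Js where J: "filter (\<lambda>t. \<not> row_apex R t) L = j1 # j2 # j3 # Js"
    using three_of[OF L(3)[unfolded n_col_def]] by blast
  have "\<forall>t\<in>set (filter (row_apex R) L). row_apex R t" "\<forall>t\<in>set (filter (\<lambda>t. \<not> row_apex R t) L). \<not> row_apex R t" by simp_all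
  then have ti: "row_apex R i1" "row_apex R i2" "row_apex R i3" and tj: "\<not> row_apex R j1" "\<not> row_apex R j2" "\<not> row_apex R j3"
    unfolding I J by simp_all
  let ?L1 = "[i1, j1, j2]" let ?L2 = "[i2, i3, j3]" let ?L3 = "Is @ Js"
  have "mset L = mset (filter (row_apex R) L @ filter (\<lambda>t. \<not> row_apex R t) L)" by simp
  then have m: "mset L = mset ((?L1 @ ?L2) @ ?L3)" unfolding I J by simp
  from prodT_perm[OF m] obtain \<epsilon> where e: "PT L = frag_cmul \<epsilon> (PT ((?L1 @ ?L2) @ ?L3))" by blast
  have v: "valid (bip R) (?L1 @ ?L2)" "valid (bip R) ?L3" "Tv (?L1 @ ?L2) \<inter> Tv ?L3 = {}"
    using bip.valid_perm[OF m L(1)] unfolding valid_append[of _ "?L1 @ ?L2"] by blast+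
  have tv: "Tv L = Tv (?L1 @ ?L2) \<union> Tv ?L3" using Tv_perm[OF m] by (simp only: Tv_simps)
  have len: "length L = 6 + length ?L3" using arg_cong[OF m, of size] by simp
  have "frag_cmul 9 (PT (?L1 @ ?L2)) \<in> Bd (bip R) (Tv (?L1 @ ?L2)) 6"
    by (rule bip_nine_pair[OF v(1)]) (use ti tj in simp_all)
  moreover have "PT ?L3 \<in> Cy (bip R) (Tv ?L3) (length ?L3)" by (rule bip.PT_Cy[OF v(2) order_refl])
  ultimately have "mul (frag_cmul 9 (PT (?L1 @ ?L2))) (PT ?L3) \<in> Bd (bip R) (Tv L) (6 + length ?L3)"
    by (rule bip.mul_Bd1[OF _ _ v(3)]) (use tv in blast)+
  moreover have "mul (frag_cmul 9 (PT (?L1 @ ?L2))) (PT ?L3) = frag_cmul 9 (PT ((?L1 @ ?L2) @ ?L3))"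
    by (simp only: mul_lin1 prodT_eq_mul[of "?L1 @ ?L2" "PT ?L3", symmetric] prodT_simps(3)[of "?L1 @ ?L2" ?L3, symmetric])
  ultimately have "frag_cmul \<epsilon> (frag_cmul 9 (PT ((?L1 @ ?L2) @ ?L3))) \<in> Bd (bip R) (Tv L) (length L)"
    unfolding len by (metis Bd_cl(6))
  then show ?thesis unfolding e frag_cmul_cmul by (simp only: mult.commute)
qed

lemma bip_exponent_nine:
  assumes V: "finite V" "card (V \<inter> R) = x + 2*y" "card (V - R) = 2*x + y" and k: "k = x + y" and xy: "3 \<le> x" "3 \<le> y"
  shows "(\<exists>P\<in>Cy (bip R) V k. P \<notin> Bd (bip R) V k) \<and> (\<forall>c\<in>Cy (bip R) V k. frag_cmul 9 c \<in> Bd (bip R) V k)"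
proof
  obtain L where L: "valid (bip R) L" "length L = k" "Tv L \<subseteq> V"
    using bip_list_exists[of V x y R] V k by auto
  have cV: "card V = 3*k" using V k card_Int_Diff[of V R] by simp
  have "PT L \<notin> Bd (bip R) V k" using bip_PT_not_Bd[OF L(1,2) V(1) L(3)] cV by simp
  moreover have "PT L \<in> Cy (bip R) V k" using bip.PT_Cy[OF L(1,3)] L(2) by simp
  ultimately show "\<exists>P\<in>Cy (bip R) V k. P \<notin> Bd (bip R) V k" by blast
  show "\<forall>c\<in>Cy (bip R) V k. frag_cmul 9 c \<in> Bd (bip R) V k"
  proof
    fix c assume c: "c \<in> Cy (bip R) V k"
    have "k \<le> card (V \<inter> R)" "k \<le> card (V - R)" "3 * k \<le> card (V \<inter> R) + card (V - R)" using V k by simp_all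
    from bip_triple_span[OF V(1) this] c have "c \<in> triple_span (bip R) V k" by blast
    then show "frag_cmul 9 c \<in> Bd (bip R) V k"
    proof (rule triple_span_map[OF _ fadd_const_cmul[OF fadd_id] adgrp_Bd])
      fix L assume L: "valid (bip R) L" "Tv L \<subseteq> V" "length L = k"
      have "n_row R L + 2 * n_col R L \<le> card (V \<inter> R)" "2 * n_row R L + n_col R L \<le> card (V - R)" by (rule card_free[OF V(1) L(1,2)])+
      then have "n_row R L = x" "n_col R L = y" using V k n_row_n_col[of R L] L(3) by simp_all
      then have "frag_cmul 9 (PT L) \<in> Bd (bip R) (Tv L) (length L)" using xy by (intro bip_nine L(1)) simp_all
      then show "frag_cmul 9 (PT L) \<in> Bd (bip R) V k" using L(2,3) Bd_mono by blast
    qed (rule Bd_cl(6))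
  qed
qed

section \<open>Generation when one vertex is missing\<close>

text \<open>
  When \<open>3 * k\<close> exceeds the number of vertices by one, there is no room for \<open>k\<close> disjoint triples.
  The cycles are then generated by products of triples with one exceptional cycle on a small
  vertex set. Five vertices and two edges occur for hexagons, eight vertices and three edges for
  the lifts constructed below; both have one vertex less than three times the number of edges.
\<close>

definition core :: "nat set \<Rightarrow> nat set \<Rightarrow> nat \<Rightarrow> bool" where
  "core R V0 j \<longleftrightarrow> finite V0 \<and> (card (V0 \<inter> R), card (V0 - R), j) \<in> {(2, 3, 2), (3, 2, 2), (4, 4, 3)}"

definition core_span where
  "core_span R V k = addspan ({mul w (PT L) | w V0 j L. core R V0 j \<and> V0 \<subseteq> V \<and> w \<in> Cy (bip R) V0 j \<and>
       valid (bip R) L \<and> Tv L \<subseteq> V - V0 \<and> j + length L = k} \<union> Bd (bip R) V k)"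

lemma adgrp_core_span: "adgrp (core_span R V k)" unfolding core_span_def by (rule adgrp_addspan)
lemma mul_core_span: "core R V0 j \<Longrightarrow> V0 \<subseteq> V \<Longrightarrow> w \<in> Cy (bip R) V0 j \<Longrightarrow> valid (bip R) L \<Longrightarrow> Tv L \<subseteq> V - V0 \<Longrightarrow> j + length L = k
    \<Longrightarrow> mul w (PT L) \<in> core_span R V k"
  unfolding core_span_def by (rule addspan_base) blast
lemma Bd_core_span: "x \<in> Bd (bip R) V k \<Longrightarrow> x \<in> core_span R V k"
  unfolding core_span_def by (rule addspan_base) blast
lemma core_span_map:
  assumes "x \<in> core_span R V k" "fadd f" "adgrp S"
    "\<And>w V0 j L. core R V0 j \<Longrightarrow> V0 \<subseteq> V \<Longrightarrow> w \<in> Cy (bip R) V0 j \<Longrightarrow> valid (bip R) L \<Longrightarrow> Tv L \<subseteq> V - V0 \<Longrightarrow> j + length L = k \<Longrightarrow> f (mul w (PT L)) \<in> S"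
    "\<And>x. x \<in> Bd (bip R) V k \<Longrightarrow> f x \<in> S"
  shows "f x \<in> S"
  using assms(1) unfolding core_span_def by (rule addspan_map) (use assms in blast)+

lemma core_span_Cy: assumes "x \<in> core_span R V k" shows "x \<in> Cy (bip R) V k"
proof -
  have "(\<lambda>x. x) x \<in> Cy (bip R) V k"
    using assms
  proof (rule core_span_map[OF _ fadd_id adgrp_Cy])
    fix w V0 j L assume a: "core R V0 j" "V0 \<subseteq> V" "w \<in> Cy (bip R) V0 j" "valid (bip R) L" "Tv L \<subseteq> V - V0" "j + length L = k"
    have "mul w (PT L) \<in> Cy (bip R) V (j + length L)"
      by (rule bip.mul_Cy[OF a(3) bip.PT_Cy[OF a(4) a(5)]]) (use a(2) in auto)
    then show "mul w (PT L) \<in> Cy (bip R) V k" using a(6) by simp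
  qed (rule bip.Bd_sub_Cy)
  then show ?thesis .
qed

lemma core_compl: "core (- R) V0 j = core R V0 j"
proof -
  have "V0 \<inter> - R = V0 - R" "V0 - - R = V0 \<inter> R" by auto
  then show ?thesis unfolding core_def by auto
qed
lemma core_span_compl: "core_span (- R) V k = core_span R V k"
  unfolding core_span_def core_compl bip_compl ..

text \<open>
  The triple is moved past the exceptional factor, which costs the sign \<open>(-1)\<close> to the power \<open>j\<close>.
\<close>

lemma Z_core_span:
  assumes "y \<in> core_span R (V - {p, q, r}) k" "p \<in> V" "q \<in> V" "r \<in> V" "bip R p q" "bip R p r" "q \<noteq> r"
  shows "Z p q r y \<in> core_span R V (Suc k)"
  using assms(1)
proof (rule core_span_map[OF _ fadd_Z adgrp_core_span])
  fix w V0 j L assume a: "core R V0 j" "V0 \<subseteq> V - {p, q, r}" "w \<in> Cy (bip R) V0 j" "valid (bip R) L" "Tv L \<subseteq> V - {p, q, r} - V0" "j + length L = k"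
  have "mul w (PT ((p, q, r) # L)) \<in> core_span R V (Suc k)"
    by (rule mul_core_span[OF a(1) _ a(3)]) (use a(2,4-) assms in auto)
  then have "ncmul j (mul w (PT ((p, q, r) # L))) \<in> core_span R V (Suc k)" by (rule adgrp_cmul[OF adgrp_core_span])
  moreover have "homog j w" using a(3) Ch_homog by (auto simp: Cy_def)
  then have "mul w (PT ((p, q, r) # L)) = ncmul j (Z p q r (mul w (PT L)))"
    by (simp add: mul_Z_right)
  ultimately show "Z p q r (mul w (PT L)) \<in> core_span R V (Suc k)" by (simp only: ncmul_ncmul)
next
  fix x assume "x \<in> Bd (bip R) (V - {p, q, r}) k"
  then show "Z p q r x \<in> core_span R V (Suc k)" using assms by (intro Bd_core_span bip.Z_Bd) auto
qed

text \<open>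
  The product with the hexagon of the six matchings of the rows \<open>s\<close> and \<open>a\<close> into the columns
  \<open>b\<close>, \<open>t\<close>, \<open>u\<close>.
\<close>

definition hex :: "nat \<Rightarrow> nat \<Rightarrow> nat \<Rightarrow> nat \<Rightarrow> nat \<Rightarrow> (nat \<times> nat) chain \<Rightarrow> (nat \<times> nat) chain" where
  "hex s a b t u x = W (ed s b) (Z a t u x) + W (ed s t) (Z a u b x) + W (ed s u) (Z a b t x)"

context graph begin

lemma hex_Cy:
  assumes x: "x \<in> Cy adj (V - {s, a, b, t, u}) k" and V: "{s, a, b, t, u} \<subseteq> V" "distinct [s, a, b, t, u]"
    and adj: "adj s b" "adj s t" "adj s u" "adj a b" "adj a t" "adj a u"
  shows "hex s a b t u x \<in> Cy adj V (Suc (Suc k))"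
proof -
  have zc: "Z a t u x \<in> Cy adj (V - {s, b}) (Suc k)" "Z a u b x \<in> Cy adj (V - {s, t}) (Suc k)" "Z a b t x \<in> Cy adj (V - {s, u}) (Suc k)"
    by (rule Z_Cy; use x V adj in \<open>auto intro: Cy_mono\<close>)+
  have b: "bd (W e z) = z" if "z \<in> Cy adj V' n" for e z V' n
    using that bd_W[OF Ch_fin[of z adj V' n]] by (simp add: Cy_def W_lin)
  have "bd (hex s a b t u x) = Z a t u x + Z a u b x + Z a b t x"
    unfolding hex_def by (simp add: bd_lin b[OF zc(1)] b[OF zc(2)] b[OF zc(3)])
  then have "bd (hex s a b t u x) = 0" by (simp add: Z_def)
  moreover have "hex s a b t u x \<in> Ch adj V (Suc (Suc k))"
    unfolding hex_def using zc V adj by (intro Ch_cl(4) W_Ch) (auto simp: Cy_def)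
  ultimately show ?thesis by (simp add: Cy_def)
qed

lemma hex_Lk:
  assumes x: "x \<in> Ch adj (V - {s, a, b, t, u}) k" and V: "distinct [s, a, b, t, u]"
  shows "Lk (ed s b) (hex s a b t u x) = Z a t u x"
proof -
  have n: "ed s b \<noteq> ed s t" "ed s b \<noteq> ed s u" "ed s b \<noteq> ed a t" "ed s b \<noteq> ed a u" "ed s b \<noteq> ed a b"
    using V by (auto simp: ed_eq_iff)
  have x0: "Lk (ed s b) x = 0" by (rule Lk_0[OF x]) simp
  then have z0: "Lk (ed s b) (Z a p q x) = 0" if "p \<in> {b, t, u}" "q \<in> {b, t, u}" for p q
    using that n by (auto simp: Z_def Lk_lin Lk_W W_lin)
  have f: "fin_chain (Z a t u x)" by (rule fin_chain_Z[OF Ch_fin[OF x]])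
  have "Lk (ed s b) (W (ed s b) (Z a t u x)) = Z a t u x"
    using Lk_W_same[OF f, of "ed s b"] z0[of t u] by (simp add: W_lin)
  then show ?thesis unfolding hex_def using n z0 by (simp add: Lk_lin Lk_W W_lin)
qed

end

lemma mul_hex: "fin_chain c \<Longrightarrow> mul (hex s a b t u c) d = hex s a b t u (mul c d)"
  unfolding hex_def by (simp add: mul_lin1 mul_W mul_Z fin_chain_Z)

text \<open>
  The analogue of \<open>bip_top_triple_span\<close> with one column less. The links of the edges \<open>sb\<close> with
  \<open>s\<close> other than \<open>a\<close> are still spanned by triple products, but these may leave no column free.
  They do contain a triple \<open>(a, t, u)\<close>, since all rows are used; subtracting a hexagon on \<open>s\<close>,
  \<open>a\<close> and \<open>b\<close>, \<open>t\<close>, \<open>u\<close> turns the edge \<open>sb\<close> into \<open>ab\<close>. So, modulo the span, a cycle has no edge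
  at \<open>b\<close> other than \<open>ab\<close>, and expanding at \<open>a\<close> finishes as before.
\<close>

lemma bip_top_core_span:
  assumes "finite V" "card (V \<inter> R) = k" "card (V - R) + 1 = 2 * k"
  shows "Cy (bip R) V k \<subseteq> core_span R V k"
  using assms
proof (induction k arbitrary: V)
  case 0
  from 0(3) show ?case by simp
next
  case (Suc k)
  let ?adj = "bip R"
  have "V - R \<noteq> {}" "V \<inter> R \<noteq> {}" using Suc.prems by (intro notI; simp)+
  then obtain a b where b: "b \<in> V - R" and a: "a \<in> V \<inter> R" by blast
  show ?case
  proof
    fix c assume c: "c \<in> Cy ?adj V (Suc k)"
    let ?M = "W (ed a b) ` Ch ?adj (V - {a, b}) k"
    let ?N = "sumset ?M (Ch ?adj (V - {b}) (Suc k))"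
    let ?H = "sumset (core_span R V (Suc k)) ?N"
    have M: "adgrp ?M" by (intro adgrp_image fadd_W adgrp_Ch)
    have nH: "adgrp ?N" by (intro adgrp_sumset M adgrp_Ch)
    have H: "adgrp ?H" by (intro adgrp_sumset adgrp_core_span nH)
    have part: "W (ed b s) (Lk (ed b s) c) \<in> ?H" if s: "s \<in> bip.nbrs R V b" for s
    proof (cases "s = a")
      case True
      have "V - {b, a} = V - {a, b}" by auto
      then have "Lk (ed b a) c \<in> Ch ?adj (V - {a, b}) k" using bip.Lk_Ch[of c R V k b a] c by (simp add: Cy_def)
      then have "W (ed a b) (Lk (ed b a) c) \<in> ?M" by (rule imageI)
      from sumsetI2[OF sumsetI1[OF this adgrp_Ch] adgrp_core_span] show ?thesis unfolding True by (simp add: ed_commute[of b a])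
    next
      case False
      have s: "s \<in> V \<inter> R" using s b by (auto simp: bip.nbrs_def bip_def)
      have cr: "card ((V - {b, s}) \<inter> R) = k" "2 * k \<le> card ((V - {b, s}) - R)"
        using rows_Diff[of V "{b, s}" R] s b Suc.prems by (auto simp: insert_Diff_if)
      have "Lk (ed b s) c \<in> triple_span ?adj (V - {b, s}) k"
        using bip_top_triple_span[OF _ cr] bip.Lk_Cy[OF c, of b s] Suc.prems by auto
      then show ?thesis
      proof (rule triple_span_map[OF _ fadd_W H])
        fix L assume L: "valid ?adj L" "Tv L \<subseteq> V - {b, s}" "length L = k"
        have fV: "finite (V - {b, s})" using Suc.prems by simp
        note cf = card_free[OF fV L(1,2)]
        have n_row: "n_row R L = k" "n_col R L = 0" using cf(3) cr(1) n_row_n_col[of R L] L(3) by simp_all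
        have "card ((V - {b, s}) \<inter> R - Tv L) = 0" using cf(1) cr(1) n_row by simp
        then have "(V - {b, s}) \<inter> R - Tv L = {}" using fV by simp
        then have "a \<in> Tv L" using a b False by auto
        then obtain T where T: "T \<in> set L" "a \<in> tv T" by (auto simp: Tv_def)
        have "row_apex R T" using n_row(2) T(1) by (auto simp: n_col_def filter_empty_conv)
        moreover have "cherry ?adj T" using L(1) T(1) bip.valid_iff by blast
        ultimately obtain t u where Teq: "T = (a, t, u)" using T(2) a by (cases T) (auto simp: bip_def)
        then obtain A B where Leq: "L = A @ (a, t, u) # B" using T(1) by (meson split_list)
        have m: "mset L = mset ((a, t, u) # A @ B)" by (simp add: Leq)
        from prodT_perm[OF m] obtain \<epsilon> where ee: "PT L = frag_cmul \<epsilon> (PT ((a, t, u) # A @ B))" by blast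
        have v: "valid ?adj ((a, t, u) # A @ B)" by (rule bip.valid_perm[OF m L(1)])
        have tvL: "Tv L = {a, t, u} \<union> Tv (A @ B)" using Tv_perm[OF m] by simp
        let ?P = "PT (A @ B)"
        have tu: "t \<in> V" "u \<in> V" "t \<notin> R" "u \<notin> R" "t \<noteq> u" "t \<noteq> b" "u \<noteq> b"
          using v L(2) a unfolding tvL by (auto simp: bip_def)
        have len: "length (A @ B) + 1 = k" using L(3) by (simp add: Leq)
        have AB: "Tv (A @ B) \<subseteq> V - {s, a, b, t, u}" using v L(2) unfolding tvL by auto
        have P: "?P \<in> Cy ?adj (V - {s, a, b, t, u}) (length (A @ B))" by (rule bip.PT_Cy) (use v AB in auto)
        have ab: "a \<noteq> b" "a \<noteq> s" "s \<noteq> b" using a b s False by auto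
        have "mul (hex s a b t u (frag_of {})) ?P \<in> core_span R V (Suc k)"
        proof (rule mul_core_span)
          have "{s, a, b, t, u} \<inter> R = {s, a}" "{s, a, b, t, u} - R = {b, t, u}" using a b s tu by auto
          then show "core R {s, a, b, t, u} 2" using ab tu a b s by (auto simp: core_def)
          have one: "frag_of {} \<in> Cy ?adj ({s, a, b, t, u} - {s, a, b, t, u}) 0" by simp
          show "hex s a b t u (frag_of {}) \<in> Cy ?adj {s, a, b, t, u} 2"
            using bip.hex_Cy[OF one] ab tu a b s by (auto simp: bip_def numeral_2_eq_2)
          show "2 + length (A @ B) = Suc k" using len by simp
        qed (use v AB tu a b s in auto)
        moreover have "mul (hex s a b t u (frag_of {})) ?P = hex s a b t u ?P" by (simp add: mul_hex)
        ultimately have h: "hex s a b t u ?P \<in> core_span R V (Suc k)" by simp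
        have Pc: "?P \<in> Ch ?adj (V - {s, a, b, t, u}) (length (A @ B))" using P by (simp add: Cy_def)
        define z1 where "z1 = W (ed s t) ?P - W (ed s u) ?P"
        define z2 where "z2 = W (ed s u) (W (ed a t) ?P) - W (ed s t) (W (ed a u) ?P)"
        have sub: "V - {s, a, b, t, u} \<subseteq> V - {a, b} - {s, t}" "V - {s, a, b, t, u} \<subseteq> V - {a, b} - {s, u}" by auto
        have "z1 \<in> Ch ?adj (V - {a, b}) (Suc (length (A @ B)))"
          unfolding z1_def
          by (intro Ch_cl(2) bip.W_Ch Ch_mono[OF Pc sub(1)] Ch_mono[OF Pc sub(2)]) (use tu a b s ab in \<open>auto simp: bip_def\<close>)
        then have z1: "z1 \<in> Ch ?adj (V - {a, b}) k" using len by simp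
        have sub2: "V - {s, a, b, t, u} \<subseteq> V - {b} - {s, u, a, t}" "V - {s, a, b, t, u} \<subseteq> V - {b} - {s, t, a, u}" by auto
        have "z2 \<in> Ch ?adj (V - {b}) (Suc (Suc (length (A @ B))))"
          unfolding z2_def
          by (intro Ch_cl(2) bip.WW_Ch[OF Pc sub2(1)] bip.WW_Ch[OF Pc sub2(2)]) (use tu a b s ab in \<open>auto simp: bip_def\<close>)
        then have z2: "z2 \<in> Ch ?adj (V - {b}) (Suc k)" using len by simp
        \<comment> \<open>In the hexagon, the terms that do not contain \<open>sb\<close> contain \<open>ab\<close> or avoid \<open>b\<close>.\<close>
        have "W (ed s b) (Z a t u ?P) = hex s a b t u ?P + (- W (ed a b) z1 + z2)"
          unfolding hex_def z1_def z2_def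
          by (simp add: Z_def W_lin W_W[of "ed s t" "ed a b"] W_W[of "ed s u" "ed a b"])
        moreover have "- W (ed a b) z1 + z2 \<in> ?N"
          using z1 z2 by (intro sumsetI adgrp_neg[OF M] imageI)
        ultimately have "W (ed b s) (Z a t u ?P) \<in> ?H" using h by (simp add: sumsetI ed_commute[of b s])
        then have "frag_cmul \<epsilon> (W (ed b s) (Z a t u ?P)) \<in> ?H" by (rule adgrp_cmul[OF H])
        then show "W (ed b s) (PT L) \<in> ?H" unfolding ee by (simp add: W_lin)
      next
        fix x assume "x \<in> Bd ?adj (V - {b, s}) k"
        then obtain e where e: "e \<in> Ch ?adj (V - {b, s}) (Suc k)" "x = bd e" by (auto simp: Bd_def)
        have xe: "W (ed b s) x = - bd (W (ed b s) e) + e"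
          using bd_W[OF Ch_fin[OF e(1)]] e(2) by simp
        have "bd (W (ed b s) e) \<in> Bd ?adj V (Suc k)"
          using e(1) s b by (intro bip.bd_Ch_Bd bip.W_Ch) (auto simp: bip_def)
        then have g: "- bd (W (ed b s) e) \<in> core_span R V (Suc k)" by (intro adgrp_neg[OF adgrp_core_span] Bd_core_span)
        have "e \<in> Ch ?adj (V - {b}) (Suc k)" by (rule Ch_mono[OF e(1)]) auto
        from sumsetI[OF g sumsetI2[OF this M]] show "W (ed b s) x \<in> ?H" unfolding xe .
      qed
    qed
    then have "(\<Sum>s\<in>bip.nbrs R V b. W (ed b s) (Lk (ed b s) c)) \<in> ?H" by (intro adgrp_sum H)
    moreover have "c - (\<Sum>s\<in>bip.nbrs R V b. W (ed b s) (Lk (ed b s) c)) \<in> Ch ?adj (V - {b}) (Suc k)"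
      using bip.expand[of V b c R "Suc k"] c b Suc.prems by (auto simp: Cy_def)
    from sumsetI2[OF sumsetI2[OF this M] adgrp_core_span] have "c - (\<Sum>s\<in>bip.nbrs R V b. W (ed b s) (Lk (ed b s) c)) \<in> ?H" .
    ultimately have "c \<in> ?H" using adgrp_add[OF H] by fastforce
    then obtain g d where gd: "c = g + d" "g \<in> core_span R V (Suc k)" "d \<in> ?N"
      unfolding sumset_def[of "core_span R V (Suc k)"] by blast
    obtain x y where xy: "d = W (ed a b) x + y" "x \<in> Ch ?adj (V - {a, b}) k" "y \<in> Ch ?adj (V - {b}) (Suc k)"
      using gd(3) unfolding sumset_def by blast
    have dz: "bd d = 0" using gd(1) c core_span_Cy[OF gd(2)] by (simp add: Cy_def bd_lin)
    define T where "T = bip.nbrs R (V - {b}) a"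
    have T: "t \<in> V - R \<and> t \<noteq> b" if "t \<in> T" for t using that a by (auto simp: T_def bip.nbrs_def bip_def)
    have fT: "finite T" unfolding T_def bip.nbrs_def using Suc.prems by auto
    have "y - (\<Sum>t\<in>T. W (ed a t) (Lk (ed a t) y)) \<in> Ch ?adj (V - {b} - {a}) (Suc k)"
      unfolding T_def using xy(3) Suc.prems a b by (intro bip.expand) auto
    moreover have "V - {b} - {a} = V - {b, a}" by auto
    ultimately have y0: "y - (\<Sum>t\<in>T. W (ed a t) (Lk (ed a t) y)) \<in> Ch ?adj (V - {b, a}) (Suc k)" by (simp only:)
    have lt: "card ((V - {b, a}) \<inter> R) < Suc k"
      using rows_Diff[of V "{b, a}" R] a b Suc.prems by (simp add: insert_Diff_if)
    have "finite (V - {b, a})" using Suc.prems(1) by simp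
    from Ch_bip_0[OF this lt y0] have "y - (\<Sum>t\<in>T. W (ed a t) (Lk (ed a t) y)) = 0" .
    then have y1: "y = (\<Sum>t\<in>T. W (ed a t) (Lk (ed a t) y))" by (simp only: right_minus_eq)
    have xl: "Lk (ed a t) x = 0" for t by (rule bip.Lk_0[OF xy(2)]) simp
    have eqd: "x - W (ed a b) (bd x) + bd y = 0"
      using dz by (simp add: xy(1) bd_lin bd_W[OF Ch_fin[OF xy(2)]])
    have ly: "Lk (ed a t) y \<in> Cy ?adj (V - {a, t, b}) k" if t: "t \<in> T" for t
    proof -
      have "V - {b} - {a, t} = V - {a, t, b}" by auto
      then have 1: "Lk (ed a t) y \<in> Ch ?adj (V - {a, t, b}) k" using bip.Lk_Ch[OF xy(3), of a t] by simp
      have ne: "ed a t \<noteq> ed a b" using T[OF t] by auto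
      have "Lk (ed a t) (bd x) = 0" using xl[of t] bd_Lk[of "ed a t" x] by (simp add: bd_lin)
      then have "Lk (ed a t) (bd y) = 0"
        using arg_cong[OF eqd, of "Lk (ed a t)"] xl[of t] by (simp add: Lk_lin Lk_W[OF ne] W_lin)
      then show ?thesis using 1 by (simp add: Cy_def bd_Lk)
    qed
    have bdy: "bd y = (\<Sum>t\<in>T. Lk (ed a t) y)"
    proof -
      have "bd (W (ed a t) (Lk (ed a t) y)) = Lk (ed a t) y" if "t \<in> T" for t
        using ly[OF that] bd_W[OF Ch_fin[of "Lk (ed a t) y" ?adj "V - {a, t, b}" k]] by (simp add: Cy_def W_lin)
      then have "bd (\<Sum>t\<in>T. W (ed a t) (Lk (ed a t) y)) = (\<Sum>t\<in>T. Lk (ed a t) y)" by (simp add: bd_lin)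
      then show ?thesis using y1 by simp
    qed
    have lab: "Lk (ed a b) y = 0" by (rule bip.Lk_0[OF xy(3)]) simp
    have lab2: "Lk (ed a b) (bd y) = 0" using lab bd_Lk[of "ed a b" y] by (simp add: bd_lin)
    have lab3: "Lk (ed a b) (bd x) = 0" using xl[of b] bd_Lk[of "ed a b" x] by (simp add: bd_lin)
    have "Lk (ed a b) (W (ed a b) (bd x)) = bd x"
      using Lk_W_same[OF fin_chain_bd[OF Ch_fin[OF xy(2)]], of "ed a b"] lab3 by (simp add: W_lin)
    then have "bd x = 0" using arg_cong[OF eqd, of "Lk (ed a b)"] xl[of b] lab2 by (simp add: Lk_lin)
    then have "x = - (\<Sum>t\<in>T. Lk (ed a t) y)" using eqd bdy by (simp add: W_lin eq_neg_iff_add_eq_0)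
    then have "d = - W (ed a b) (\<Sum>t\<in>T. Lk (ed a t) y) + (\<Sum>t\<in>T. W (ed a t) (Lk (ed a t) y))"
      using xy(1) y1 by (simp add: W_lin)
    also have "\<dots> = (\<Sum>t\<in>T. Z a t b (Lk (ed a t) y))" by (simp add: Z_def sum_subtractf W_lin)
    also have "\<dots> \<in> core_span R V (Suc k)"
    proof (intro adgrp_sum[OF adgrp_core_span] Z_core_span)
      fix t assume t: "t \<in> T"
      have at: "a \<noteq> t" using T[OF t] a by auto
      have tb: "t \<in> V - R" "t \<noteq> b" using T[OF t] by auto
      have "card {t, b} \<le> card (V - R)" using tb b Suc.prems(1) by (intro card_mono) auto
      then have "2 \<le> card (V - R)" using tb by simp
      then have "card ((V - {a, t, b}) \<inter> R) = k" "card ((V - {a, t, b}) - R) + 1 = 2 * k"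
        using rows_Diff[of V "{a, t, b}" R] tb a b Suc.prems by (auto simp: insert_Diff_if)
      then show "Lk (ed a t) y \<in> core_span R (V - {a, t, b}) k"
        using Suc.IH[of "V - {a, t, b}"] ly[OF t] Suc.prems by auto
    qed (use a b T in \<open>auto simp: bip_def\<close>)
    finally show "c \<in> core_span R V (Suc k)" using gd(1,2) adgrp_add[OF adgrp_core_span] by blast
  qed
qed

section \<open>Lifting double links to cycles\<close>

text \<open>
  A cycle with prescribed double link \<open>x\<close> at the edges \<open>at\<close> and \<open>bs\<close>. The boundary of \<open>at bs x\<close>
  is \<open>bs x - at x\<close>; the fillings \<open>E\<close>, which may use \<open>s\<close>, and \<open>E'\<close>, which may use \<open>t\<close>, close it
  up without creating other double links.
\<close>

definition lift :: "nat \<Rightarrow> nat \<Rightarrow> nat \<Rightarrow> nat \<Rightarrow> (nat \<times> nat) chain \<Rightarrow> (nat \<times> nat) chain \<Rightarrow> (nat \<times> nat) chain \<Rightarrow> (nat \<times> nat) chain" where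
  "lift a b s t x E E' = W (ed a t) (W (ed b s) x) + Z a t b E + Z b s a E'"

context graph begin

lemma lift_Cy:
  assumes x: "x \<in> Cy adj (V - {a, b, s, t}) j" and E: "E \<in> Ch adj (V - {a, b, t}) (Suc j)" "bd E = - x"
    and E': "E' \<in> Ch adj (V - {a, b, s}) (Suc j)" "bd E' = x"
    and V: "{a, b, s, t} \<subseteq> V" "distinct [a, b, s, t]" and adj: "adj a b" "adj a t" "adj b s"
  shows "lift a b s t x E E' \<in> Cy adj V (Suc (Suc j))"
proof -
  have ba: "adj b a" using adj sym by blast
  have e: "V - {a, t, b} = V - {a, b, t}" "V - {b, s, a} = V - {a, b, s}" by auto
  have "lift a b s t x E E' \<in> Ch adj V (Suc (Suc j))"
    unfolding lift_def
  proof (intro Ch_cl(4))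
    show "W (ed a t) (W (ed b s) x) \<in> Ch adj V (Suc (Suc j))"
      by (rule WW_Ch[of x "V - {a, b, s, t}"]) (use x V adj in \<open>auto simp: Cy_def\<close>)
    show "Z a t b E \<in> Ch adj V (Suc (Suc j))" by (rule Z_Ch) (use E V adj e in auto)
    show "Z b s a E' \<in> Ch adj V (Suc (Suc j))" by (rule Z_Ch) (use E' V adj e ba in auto)
  qed
  moreover have "bd (lift a b s t x E E') = 0"
    unfolding lift_def using bd_Z_Ch[OF E(1)] bd_Z_Ch[OF E'(1)] E(2) E'(2)
    by (simp add: bd_lin bd_WW[OF x] Z_lin) (simp add: Z_def ed_commute[of b a])
  ultimately show ?thesis by (simp add: Cy_def)
qed

lemma lift_Lk:
  assumes x: "x \<in> Ch adj (V - {a, b, s, t}) j" and E: "E \<in> Ch adj (V - {a, b, t}) (Suc j)"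
    and E': "E' \<in> Ch adj (V - {a, b, s}) (Suc j)" and V: "distinct [a, b, s, t]" "distinct [a, b, s', t']"
  shows "Lk (ed b s') (Lk (ed a t') (lift a b s t x E E')) = (if s' = s \<and> t' = t then x else 0)"
proof -
  have z: "Lk (ed a t') x = 0" "Lk (ed b s') x = 0" "Lk (ed a t') E = 0" "Lk (ed b s') E = 0" "Lk (ed a t') E' = 0" "Lk (ed b s') E' = 0"
    using Lk_0[OF x] Lk_0[OF E] Lk_0[OF E'] by auto
  have n: "ed a t' \<noteq> ed b s" "ed a t' \<noteq> ed a b" "ed a t' \<noteq> ed b a" "ed b s' \<noteq> ed b a"
    using V by (auto simp: ed_eq_iff)
  have 1: "Lk (ed a t') (W (ed b s) x) = 0" using n z by (simp add: Lk_W W_lin)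
  have 2: "Lk (ed a t') (Z b s a E') = 0" using n z by (simp add: Z_def Lk_lin Lk_W W_lin)
  have 3: "Lk (ed a t') (Z a t b E) = (if t' = t then E else 0)"
    using n z Lk_W_same[OF Ch_fin[OF E], of "ed a t"] by (auto simp: Z_def Lk_lin Lk_W W_lin)
  have 4: "Lk (ed a t') (W (ed a t) (W (ed b s) x)) = (if t' = t then W (ed b s) x else 0)"
    using 1 Lk_W_same[OF fin_chain_W[OF Ch_fin[OF x]], of "ed a t" "ed b s"] by (auto simp: Lk_W W_lin)
  have 5: "Lk (ed b s') (W (ed b s) x) = (if s' = s then x else 0)"
  proof (cases "s' = s")
    case True
    then show ?thesis using z(2) Lk_W_same[OF Ch_fin[OF x], of "ed b s"] by (simp add: W_lin)
  next
    case False
    then show ?thesis using z(2) by (simp add: Lk_W W_lin)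
  qed
  have 6: "Lk (ed a t') (lift a b s t x E E') = (if t' = t then W (ed b s) x + E else 0)"
    unfolding lift_def Lk_lin(1) 2 3 4 by simp
  show ?thesis
  proof (cases "t' = t")
    case True
    then have "Lk (ed b s') (Lk (ed a t') (lift a b s t x E E')) = Lk (ed b s') (W (ed b s) x) + Lk (ed b s') E"
      unfolding 6 by (simp add: Lk_lin)
    also have "\<dots> = (if s' = s then x else 0)" unfolding 5 z(4) by simp
    finally show ?thesis using True by simp
  next
    case False
    then show ?thesis unfolding 6 by (simp add: Lk_lin)
  qed
qed

end

lemma mul_lift: "fin_chain c \<Longrightarrow> fin_chain E \<Longrightarrow> fin_chain E' \<Longrightarrow>
    mul (lift a b s t c E E') d = lift a b s t (mul c d) (mul E d) (mul E' d)"
  unfolding lift_def by (simp add: mul_lin1 mul_W mul_Z fin_chain_W)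

lemma mul_pathE: "fin_chain c' \<Longrightarrow> mul (pathE r s f b c c') d = pathE r s f b c (mul c' d)"
  unfolding pathE_def by (simp add: mul_lin1 mul_W fin_chain_W)
lemma fin_chain_add: "fin_chain c \<Longrightarrow> fin_chain d \<Longrightarrow> fin_chain (c + d)"
  using keys_add[of c d] by (fastforce simp: fin_chain_def)
lemma fin_chain_pathE: "fin_chain x \<Longrightarrow> fin_chain (pathE r s f b c x)"
  unfolding pathE_def by (intro fin_chain_diff fin_chain_add fin_chain_W)
text \<open>
  Four vertices \<open>a\<close>, \<open>b\<close>, \<open>s\<close>, \<open>t\<close> are removed and a row \<open>f\<close> is free. The triple \<open>(r, p, q)\<close>
  bounds once \<open>s\<close> is released, by \<open>pathE\<close> with the free rows \<open>s\<close> and \<open>f\<close>, and it bounds once \<open>t\<close>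
  is released, by the cone with the free edge \<open>ft\<close>. The resulting lift lives on four rows and
  four columns and has three edges, times the remaining triples.
\<close>

lemma lift_row:
  assumes ab: "a \<in> V" "a \<in> R" "b \<in> V" "b \<notin> R" and st: "s \<in> V" "s \<in> R" "t \<in> V" "t \<notin> R" "s \<noteq> a" "t \<noteq> b"
    and f: "f \<in> V" "f \<in> R" "f \<notin> {a, s}" and L: "valid (bip R) ((r, p, q) # L)" "r \<in> R"
    and sub: "Tv ((r, p, q) # L) \<subseteq> V - {a, b, s, t, f}"
  shows "\<exists>w\<in>core_span R V (length L + 3). \<forall>s' t'. distinct [a, b, s', t'] \<longrightarrow>
     Lk (ed b s') (Lk (ed a t') w) = (if s' = s \<and> t' = t then PT ((r, p, q) # L) else 0)"
proof -
  let ?V0 = "{a, s, f, r, b, t, p, q}"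
  have rpq: "r \<in> V" "p \<in> V" "q \<in> V" "p \<notin> R" "q \<notin> R" "p \<noteq> q" "r \<notin> {a, s, f}" "p \<notin> {b, t}" "q \<notin> {b, t}"
    using L sub by (auto simp: bip_def)
  have vL: "valid (bip R) L" "Tv L \<subseteq> V - ?V0" using L sub by auto
  have d: "distinct [a, s, f, r, b, t, p, q]" using ab st f rpq L(2) by auto
  \<comment> \<open>The construction is carried out for a variable factor \<open>c\<close>: it is applied to the empty
       matching, to get the exceptional cycle, and to \<open>PT L\<close>, to get its product with the other
       triples.\<close>
  define xx where "xx c = Z r p q c" for c
  define E where "E c = pathE r s f p q c" for c
  define E' where "E' c = W (ed f t) (Z r p q c)" for c
  have gen: "lift a b s t (xx c) (E c) (E' c) \<in> Cy (bip R) V' (Suc (Suc (Suc k)))"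
    "xx c \<in> Ch (bip R) (V' - {a, b, s, t}) (Suc k)" "E c \<in> Ch (bip R) (V' - {a, b, t}) (Suc (Suc k))" "E' c \<in> Ch (bip R) (V' - {a, b, s}) (Suc (Suc k))"
    if c: "c \<in> Cy (bip R) (V' - ?V0) k" and V': "?V0 \<subseteq> V'" for c V' k
  proof -
    have x: "xx c \<in> Cy (bip R) (V' - {a, b, s, t}) (Suc k)"
      unfolding xx_def by (rule bip.Z_Cy) (use c V' d L(2) rpq in \<open>auto intro: Cy_mono simp: bip_def\<close>)
    have cc: "c \<in> Cy (bip R) (V' - {a, b, t} - {r, s, f, p, q}) k" by (rule Cy_mono[OF c]) auto
    have q1: "{r, s, f, p, q} \<subseteq> V' - {a, b, t}" using V' d by auto
    have q2: "distinct [r, s, f, p, q]" using d by auto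
    have q3: "bip R r p" "bip R r q" "bip R s q" "bip R f p" using L(2) rpq(4,5) st(2) f(2) by (simp_all add: bip_def)
    have E: "E c \<in> Ch (bip R) (V' - {a, b, t}) (Suc (Suc k))" "bd (E c) = - xx c"
      unfolding E_def xx_def by (rule bip.pathE[OF cc q1 q2 q3])+
    have x': "Z r p q c \<in> Cy (bip R) (V' - {a, b, s} - {f, t}) (Suc k)"
      by (rule bip.Z_Cy) (use c V' d L(2) rpq in \<open>auto intro: Cy_mono simp: bip_def\<close>)
    have E': "E' c \<in> Ch (bip R) (V' - {a, b, s}) (Suc (Suc k))"
      unfolding E'_def by (rule bip.W_Ch) (use x' V' d st f in \<open>auto simp: bip_def Cy_def\<close>)
    have bE': "bd (E' c) = xx c"
      unfolding E'_def xx_def using x' bd_W[OF Ch_fin[of "Z r p q c" "bip R" "V' - {a, b, s} - {f, t}" "Suc k"]] by (auto simp: Cy_def W_lin)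
    show "lift a b s t (xx c) (E c) (E' c) \<in> Cy (bip R) V' (Suc (Suc (Suc k)))"
      by (rule bip.lift_Cy[OF x E E' bE']) (use V' d ab st in \<open>auto simp: bip_def\<close>)
    show "xx c \<in> Ch (bip R) (V' - {a, b, s, t}) (Suc k)" "E c \<in> Ch (bip R) (V' - {a, b, t}) (Suc (Suc k))" "E' c \<in> Ch (bip R) (V' - {a, b, s}) (Suc (Suc k))"
      using x E E' by (auto simp: Cy_def)
  qed
  let ?o = "frag_of {} :: (nat \<times> nat) chain"
  have one: "?o \<in> Cy (bip R) (?V0 - ?V0) 0" by simp
  let ?wz = "lift a b s t (xx ?o) (E ?o) (E' ?o)"
  have w0: "?wz \<in> Cy (bip R) ?V0 3" using gen(1)[OF one order_refl] by (simp add: numeral_3_eq_3)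
  let ?lw = "lift a b s t (xx (PT L)) (E (PT L)) (E' (PT L))"
  have P: "PT L \<in> Cy (bip R) (V - ?V0) (length L)" by (rule bip.PT_Cy[OF vL])
  have V0: "?V0 \<subseteq> V" using ab st f rpq by auto
  have "mul ?wz (PT L) = lift a b s t (mul (xx ?o) (PT L)) (mul (E ?o) (PT L)) (mul (E' ?o) (PT L))"
    by (rule mul_lift) (auto simp: xx_def E_def E'_def intro!: fin_chain_Z fin_chain_pathE fin_chain_W)
  also have "\<dots> = ?lw" by (simp add: xx_def E_def E'_def mul_Z mul_pathE mul_W fin_chain_Z)
  finally have wm: "mul ?wz (PT L) = ?lw" .
  have "mul ?wz (PT L) \<in> core_span R V (length L + 3)"
  proof (rule mul_core_span[OF _ V0 w0 vL])
    have "?V0 \<inter> R = {a, s, f, r}" "?V0 - R = {b, t, p, q}" using ab st f rpq L(2) by auto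
    then show "core R ?V0 3" using d by (auto simp: core_def)
  qed simp
  then have "?lw \<in> core_span R V (length L + 3)" unfolding wm .
  moreover have "Lk (ed b s') (Lk (ed a t') ?lw) = (if s' = s \<and> t' = t then PT ((r, p, q) # L) else 0)"
    if "distinct [a, b, s', t']" for s' t'
  proof -
    have "distinct [a, b, s, t]" using d by auto
    from bip.lift_Lk[OF gen(2-4)[OF P V0] this that] show ?thesis by (simp add: xx_def)
  qed
  ultimately show ?thesis by blast
qed

text \<open>By symmetry; exchanging the order of the two links changes the sign.\<close>

lemma lift_col:
  assumes ab: "a \<in> V" "a \<in> R" "b \<in> V" "b \<notin> R" and st: "s \<in> V" "s \<in> R" "t \<in> V" "t \<notin> R" "s \<noteq> a" "t \<noteq> b"
    and f: "f \<in> V" "f \<notin> R" "f \<notin> {b, t}" and L: "valid (bip R) ((r, p, q) # L)" "r \<notin> R"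
    and sub: "Tv ((r, p, q) # L) \<subseteq> V - {a, b, s, t, f}"
  shows "\<exists>w\<in>core_span R V (length L + 3). \<forall>s' t'. distinct [a, b, s', t'] \<longrightarrow>
     Lk (ed b s') (Lk (ed a t') w) = (if s' = s \<and> t' = t then PT ((r, p, q) # L) else 0)"
proof -
  have "\<exists>w\<in>core_span (- R) V (length L + 3). \<forall>s' t'. distinct [b, a, s', t'] \<longrightarrow>
     Lk (ed a s') (Lk (ed b t') w) = (if s' = t \<and> t' = s then PT ((r, p, q) # L) else 0)"
    by (rule lift_row[where f = f]) (use assms in \<open>auto simp: bip_compl\<close>)
  then obtain w where w: "w \<in> core_span R V (length L + 3)" "\<And>s' t'. distinct [b, a, s', t'] \<Longrightarrow>
     Lk (ed a s') (Lk (ed b t') w) = (if s' = t \<and> t' = s then PT ((r, p, q) # L) else 0)"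
    unfolding core_span_compl by blast
  have "Lk (ed b s') (Lk (ed a t') (- w)) = (if s' = s \<and> t' = t then PT ((r, p, q) # L) else 0)"
    if "distinct [a, b, s', t']" for s' t'
  proof -
    have "distinct [b, a, t', s']" using that by auto
    from w(2)[OF this] have "Lk (ed a t') (Lk (ed b s') w) = (if t' = t \<and> s' = s then PT ((r, p, q) # L) else 0)" .
    then show ?thesis using Lk_Lk[of "ed b s'" "ed a t'" w] by (auto simp: Lk_lin)
  qed
  then show ?thesis using adgrp_neg[OF adgrp_core_span w(1)] by blast
qed

text \<open>
  The number of vertices leaves exactly one of them free, and the bounds on both sides provide a
  triple with its apex on the side of the free vertex.
\<close>

lemma lift_PT:
  assumes V: "finite V" "Suc (Suc j) < card (V \<inter> R)" "Suc (Suc j) < card (V - R)" "card (V \<inter> R) + card (V - R) + 1 = 3 * Suc (Suc j)"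
    and ab: "a \<in> V" "a \<in> R" "b \<in> V" "b \<notin> R" and st: "s \<in> V" "s \<in> R" "t \<in> V" "t \<notin> R" "s \<noteq> a" "t \<noteq> b"
    and L: "valid (bip R) L" "Tv L \<subseteq> V - {a, b, s, t}" "length L = j"
  shows "\<exists>w\<in>core_span R V (Suc (Suc j)). \<forall>s' t'. distinct [a, b, s', t'] \<longrightarrow>
     Lk (ed b s') (Lk (ed a t') w) = (if s' = s \<and> t' = t then PT L else 0)"
proof -
  let ?V = "V - {a, b, s, t}"
  have c: "card (?V \<inter> R) = card (V \<inter> R) - 2" "card (?V - R) = card (V - R) - 2"
    using rows_Diff[of V "{a, b, s, t}" R] ab st V(1) by (auto simp: insert_Diff_if)
  have fV: "finite ?V" using V by simp
  note cf = card_free[OF fV L(1,2)]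
  have split: "\<exists>\<epsilon> r p q L'. (r, p, q) \<in> set L \<and> valid (bip R) ((r, p, q) # L') \<and> Tv ((r, p, q) # L') = Tv L \<and> (r \<in> R \<longleftrightarrow> B) \<and>
      length L' + 3 = Suc (Suc j) \<and> PT L = frag_cmul \<epsilon> (PT ((r, p, q) # L'))" if exT: "\<exists>t\<in>set L. row_apex R t \<longleftrightarrow> B" for B
  proof -
    obtain T where T: "T \<in> set L" "row_apex R T \<longleftrightarrow> B" using exT by blast
    obtain r p q where "T = (r, p, q)" by (cases T)
    then have rpq: "(r, p, q) \<in> set L" "r \<in> R \<longleftrightarrow> B" using T by simp_all
    then obtain A C where Leq: "L = A @ (r, p, q) # C" by (meson split_list)
    have m: "mset L = mset ((r, p, q) # A @ C)" by (simp add: Leq)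
    from prodT_perm[OF m] obtain \<epsilon> where "PT L = frag_cmul \<epsilon> (PT ((r, p, q) # A @ C))" by blast
    moreover have "length (A @ C) + 3 = Suc (Suc j)" using L(3) by (simp add: Leq)
    ultimately show ?thesis using rpq bip.valid_perm[OF m L(1)] Tv_perm[OF m] by metis
  qed
  have fin: "\<exists>w\<in>core_span R V (Suc (Suc j)). \<forall>s' t'. distinct [a, b, s', t'] \<longrightarrow>
     Lk (ed b s') (Lk (ed a t') w) = (if s' = s \<and> t' = t then PT L else 0)"
    if "w \<in> core_span R V (Suc (Suc j))" "\<forall>s' t'. distinct [a, b, s', t'] \<longrightarrow>
     Lk (ed b s') (Lk (ed a t') w) = (if s' = s \<and> t' = t then M else 0)" "PT L = frag_cmul \<epsilon> M" for w M \<epsilon>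
    using that adgrp_cmul[OF adgrp_core_span that(1), of \<epsilon>] by (intro bexI[of _ "frag_cmul \<epsilon> w"]) (auto simp: Lk_lin)
  have V4: "card (V \<inter> R) + card (V - R) = 3 * j + 5" using V(4) by simp
  have "0 < card (?V \<inter> R - Tv L) + card (?V - R - Tv L)"
    using cf V(2,3) V4 c n_row_n_col[of R L] L(3) by linarith
  then have "card (?V \<inter> R - Tv L) \<noteq> 0 \<or> card (?V - R - Tv L) \<noteq> 0" by linarith
  then consider "card (?V \<inter> R - Tv L) \<noteq> 0" | "card (?V \<inter> R - Tv L) = 0" "card (?V - R - Tv L) \<noteq> 0"
    by blast
  then show ?thesis
  proof cases
    case 1
    then obtain f where f: "f \<in> ?V \<inter> R - Tv L" by (metis card.empty equals0I)
    have "0 < n_row R L" using 1 cf V(2,3) V4 c n_row_n_col[of R L] L(3) by linarith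
    then have "\<exists>t\<in>set L. row_apex R t \<longleftrightarrow> True" by (auto simp: n_row_def filter_empty_conv)
    from split[OF this] obtain \<epsilon> r p q L' where L': "valid (bip R) ((r, p, q) # L')" "Tv ((r, p, q) # L') = Tv L" "r \<in> R"
      "length L' + 3 = Suc (Suc j)" "PT L = frag_cmul \<epsilon> (PT ((r, p, q) # L'))" by blast
    have "Tv ((r, p, q) # L') \<subseteq> V - {a, b, s, t, f}" unfolding L'(2) using L(2) f by auto
    from lift_row[OF ab st _ _ _ L'(1,3) this] f show ?thesis unfolding L'(4) using fin[OF _ _ L'(5)] by blast
  next
    case 2
    then obtain f where f: "f \<in> ?V - R - Tv L" by (metis card.empty equals0I)
    have "0 < n_col R L" using 2 cf V(2,3) V4 c n_row_n_col[of R L] L(3) by linarith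
    then have "\<exists>t\<in>set L. row_apex R t \<longleftrightarrow> False" by (auto simp: n_col_def filter_empty_conv)
    from split[OF this] obtain \<epsilon> r p q L' where L': "valid (bip R) ((r, p, q) # L')" "Tv ((r, p, q) # L') = Tv L" "r \<notin> R"
      "length L' + 3 = Suc (Suc j)" "PT L = frag_cmul \<epsilon> (PT ((r, p, q) # L'))" by blast
    have "Tv ((r, p, q) # L') \<subseteq> V - {a, b, s, t, f}" unfolding L'(2) using L(2) f by auto
    from lift_col[OF ab st _ _ _ L'(1,3) this] f show ?thesis unfolding L'(4) using fin[OF _ _ L'(5)] by blast
  qed
qed

lemma lift_triple_span:
  assumes V: "finite V" "Suc (Suc j) < card (V \<inter> R)" "Suc (Suc j) < card (V - R)" "card (V \<inter> R) + card (V - R) + 1 = 3 * Suc (Suc j)"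
    and ab: "a \<in> V" "a \<in> R" "b \<in> V" "b \<notin> R" and st: "s \<in> V" "s \<in> R" "t \<in> V" "t \<notin> R" "s \<noteq> a" "t \<noteq> b"
    and y: "y \<in> triple_span (bip R) (V - {a, b, s, t}) j"
  shows "\<exists>w\<in>core_span R V (Suc (Suc j)). Lk (ed b s) (Lk (ed a t) w) - y \<in> Bd (bip R) (V - {a, b, s, t}) j \<and>
    (\<forall>s' t'. distinct [a, b, s', t'] \<longrightarrow> (s', t') \<noteq> (s, t) \<longrightarrow> Lk (ed b s') (Lk (ed a t') w) = 0)"
proof -
  let ?B = "Bd (bip R) (V - {a, b, s, t}) j"
  let ?Q = "\<lambda>y w. Lk (ed b s) (Lk (ed a t) w) - y \<in> ?B \<and>
    (\<forall>s' t'. distinct [a, b, s', t'] \<longrightarrow> (s', t') \<noteq> (s, t) \<longrightarrow> Lk (ed b s') (Lk (ed a t') w) = 0)"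
  let ?S = "{y. \<exists>w\<in>core_span R V (Suc (Suc j)). ?Q y w}"
  have S: "adgrp ?S" unfolding adgrp_def
  proof (intro conjI ballI)
    have "?Q 0 0" by (simp add: Lk_lin Bd_cl(1))
    then show "0 \<in> ?S" using adgrp_zero[OF adgrp_core_span] by blast
    fix x y assume "x \<in> ?S" "y \<in> ?S"
    then obtain u v where u: "u \<in> core_span R V (Suc (Suc j))" "?Q x u" and v: "v \<in> core_span R V (Suc (Suc j))" "?Q y v" by blast
    have "Lk (ed b s) (Lk (ed a t) (u - v)) - (x - y) = (Lk (ed b s) (Lk (ed a t) u) - x) - (Lk (ed b s) (Lk (ed a t) v) - y)"
      by (simp add: Lk_lin)
    then have "Lk (ed b s) (Lk (ed a t) (u - v)) - (x - y) \<in> ?B"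
      using adgrp_diff[OF adgrp_Bd conjunct1[OF u(2)] conjunct1[OF v(2)]] by (simp only:)
    moreover have "Lk (ed b s') (Lk (ed a t') (u - v)) = 0" if "distinct [a, b, s', t']" "(s', t') \<noteq> (s, t)" for s' t'
      using conjunct2[OF u(2)] conjunct2[OF v(2)] that by (simp add: Lk_lin)
    ultimately have "?Q (x - y) (u - v)" by blast
    then show "x - y \<in> ?S" using adgrp_diff[OF adgrp_core_span u(1) v(1)] by blast
  qed
  have "(\<lambda>y. y) y \<in> ?S"
  proof (rule triple_span_map[OF y fadd_id S])
    fix L assume L: "valid (bip R) L" "Tv L \<subseteq> V - {a, b, s, t}" "length L = j"
    obtain w where w: "w \<in> core_span R V (Suc (Suc j))" "\<And>s' t'. distinct [a, b, s', t'] \<Longrightarrow>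
     Lk (ed b s') (Lk (ed a t') w) = (if s' = s \<and> t' = t then PT L else 0)"
      using lift_PT[OF V ab st L] by blast
    have "distinct [a, b, s, t]" using ab st by auto
    from w(2)[OF this] have "Lk (ed b s) (Lk (ed a t) w) - PT L \<in> ?B" by (simp add: Bd_cl(1))
    moreover have "Lk (ed b s') (Lk (ed a t') w) = 0" if "distinct [a, b, s', t']" "(s', t') \<noteq> (s, t)" for s' t'
      using w(2)[OF that(1)] that(2) by auto
    ultimately show "PT L \<in> ?S" using w(1) by blast
  next
    fix x assume "x \<in> ?B"
    then have "?Q x 0" by (simp add: Lk_lin Bd_cl(3))
    then show "x \<in> ?S" using adgrp_zero[OF adgrp_core_span] by blast
  qed
  then show ?thesis by simp
qed

text \<open>
  The double links of a cycle need not bound, so \<open>decompose\<close> does not apply directly. They are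
  spanned by triple products, and \<open>lift_triple_span\<close> realises each of them as the only double
  link of a cycle in the span. After subtracting these lifts all double links bound. The cases
  with saturated rows or columns are \<open>bip_top_core_span\<close>.
\<close>

lemma bip_core_span:
  assumes "finite V" "k \<le> card (V \<inter> R)" "k \<le> card (V - R)" "card (V \<inter> R) + card (V - R) + 1 = 3 * k"
  shows "Cy (bip R) V k \<subseteq> core_span R V k"
  using assms
proof (induction k arbitrary: V)
  case 0
  from 0(4) show ?case by simp
next
  case (Suc k)
  let ?adj = "bip R"
  consider "card (V \<inter> R) = Suc k" | "card (V - R) = Suc k" | j where "Suc k < card (V \<inter> R)" "Suc k < card (V - R)" "k = Suc j"
  proof -
    have "0 < k" if "Suc k < card (V \<inter> R)" "Suc k < card (V - R)"
    proof (rule ccontr)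
      assume "\<not> 0 < k"
      then show False using that Suc.prems(4) by simp
    qed
    then have "k = Suc (k - 1)" if "Suc k < card (V \<inter> R)" "Suc k < card (V - R)"
      using that by simp
    moreover have "card (V \<inter> R) = Suc k \<or> card (V - R) = Suc k \<or> (Suc k < card (V \<inter> R) \<and> Suc k < card (V - R))"
      using Suc.prems(2,3) by linarith
    ultimately show thesis using that by blast
  qed
  then show ?case
  proof cases
    case 1
    then show ?thesis using Suc.prems by (intro bip_top_core_span) auto
  next
    case 2
    have e: "V \<inter> - R = V - R" "V - - R = V \<inter> R" by auto
    show ?thesis using bip_top_core_span[of V "- R" "Suc k"] 2 Suc.prems unfolding e bip_compl core_span_compl by auto
  next
    case 3
    have "V - R \<noteq> {}" "V \<inter> R \<noteq> {}" using 3 by (intro notI; simp)+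
    then obtain a b where b: "b \<in> V" "b \<notin> R" and a: "a \<in> V" "a \<in> R" by blast
    have c4: "card (V \<inter> R) + card (V - R) + 1 = 3 * Suc (Suc j)" using Suc.prems 3 by simp
    have c5: "card (V \<inter> R) + card (V - R) = 3 * j + 5" using c4 by simp
    have lt: "Suc (Suc j) < card (V \<inter> R)" "Suc (Suc j) < card (V - R)" using 3 by simp_all
    define I where "I = {(s, t). s \<in> V \<and> s \<in> R \<and> t \<in> V \<and> t \<notin> R \<and> s \<noteq> a \<and> t \<noteq> b}"
    have fI: "finite I" by (rule finite_subset[of _ "V \<times> V"]) (use Suc.prems(1) in \<open>auto simp: I_def\<close>)
    show ?thesis
    proof
      fix c assume c: "c \<in> Cy ?adj V (Suc k)"
      have ex: "\<exists>w. w \<in> core_span R V (Suc k) \<and> Lk (ed b s) (Lk (ed a t) w) - Lk (ed b s) (Lk (ed a t) c) \<in> Bd ?adj (V - {a, b, s, t}) j \<and>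
         (\<forall>s' t'. distinct [a, b, s', t'] \<longrightarrow> (s', t') \<noteq> (s, t) \<longrightarrow> Lk (ed b s') (Lk (ed a t') w) = 0)"
        if I: "(s, t) \<in> I" for s t
      proof -
        have st: "s \<in> V" "s \<in> R" "t \<in> V" "t \<notin> R" "s \<noteq> a" "t \<noteq> b" using I by (auto simp: I_def)
        let ?V = "V - {a, b, s, t}"
        have e: "V - {a, t} - {b, s} = ?V" by auto
        have 1: "Lk (ed b s) (Lk (ed a t) c) \<in> Cy ?adj ?V j"
          using bip.Lk_Cy[OF bip.Lk_Cy[OF c[unfolded 3(3)], of a t], of b s] unfolding e by simp
        have cd: "card (?V \<inter> R) = card (V \<inter> R) - 2" "card (?V - R) = card (V - R) - 2"
          using rows_Diff[of V "{a, b, s, t}" R] a b st Suc.prems(1) by (auto simp: insert_Diff_if)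
        have "j \<le> card (?V \<inter> R)" "j \<le> card (?V - R)" "3 * j \<le> card (?V \<inter> R) + card (?V - R)"
          unfolding cd using lt c5 by linarith+
        then have "Lk (ed b s) (Lk (ed a t) c) \<in> triple_span ?adj ?V j"
          using bip_triple_span[of ?V j R] 1 Suc.prems(1) by auto
        from lift_triple_span[OF Suc.prems(1) lt c4 a b st this] show ?thesis unfolding 3(3) by blast
      qed
      have "\<exists>w. \<forall>i\<in>I. w i \<in> core_span R V (Suc k) \<and> Lk (ed b (fst i)) (Lk (ed a (snd i)) (w i)) - Lk (ed b (fst i)) (Lk (ed a (snd i)) c) \<in> Bd ?adj (V - {a, b, fst i, snd i}) j \<and>
         (\<forall>s' t'. distinct [a, b, s', t'] \<longrightarrow> (s', t') \<noteq> i \<longrightarrow> Lk (ed b s') (Lk (ed a t') (w i)) = 0)"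
        by (rule bchoice) (use ex in auto)
      then obtain w where w: "\<And>i. i \<in> I \<Longrightarrow> w i \<in> core_span R V (Suc k)"
        "\<And>i. i \<in> I \<Longrightarrow> Lk (ed b (fst i)) (Lk (ed a (snd i)) (w i)) - Lk (ed b (fst i)) (Lk (ed a (snd i)) c) \<in> Bd ?adj (V - {a, b, fst i, snd i}) j"
        "\<And>i s' t'. i \<in> I \<Longrightarrow> distinct [a, b, s', t'] \<Longrightarrow> (s', t') \<noteq> i \<Longrightarrow> Lk (ed b s') (Lk (ed a t') (w i)) = 0"
        by blast
      define g where "g = (\<Sum>i\<in>I. w i)"
      have g: "g \<in> core_span R V (Suc k)" unfolding g_def using w(1) by (intro adgrp_sum[OF adgrp_core_span])
      have c': "c - g \<in> Cy ?adj V (Suc k)" using c core_span_Cy[OF g] by (rule Cy_cl(2))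
      have "c - g \<in> core_span R V (Suc k)"
      proof (rule bip.decompose[OF Suc.prems(1) a(1) b(1) _ c' adgrp_core_span])
        show "bip R a b" using a b by (simp add: bip_def)
        show "Bd ?adj V (Suc k) \<subseteq> core_span R V (Suc k)" using Bd_core_span by blast
        fix s t assume st: "s \<in> V" "t \<in> V" "distinct [a, b, s, t]" "bip R b s" "bip R a t"
        then have iI: "(s, t) \<in> I" using a b by (auto simp: I_def bip_def)
        have "Lk (ed b s) (Lk (ed a t) g) = (\<Sum>i\<in>I. Lk (ed b s) (Lk (ed a t) (w i)))" by (simp add: g_def Lk_lin)
        also have "\<dots> = (\<Sum>i\<in>I. if i = (s, t) then Lk (ed b s) (Lk (ed a t) (w (s, t))) else 0)"
          using w(3)[OF _ st(3)] by (intro sum.cong) auto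
        also have "\<dots> = Lk (ed b s) (Lk (ed a t) (w (s, t)))" using fI iI by simp
        finally have "Lk (ed b s) (Lk (ed a t) (c - g)) = - (Lk (ed b s) (Lk (ed a t) (w (s, t))) - Lk (ed b s) (Lk (ed a t) c))"
          by (simp add: Lk_lin)
        moreover have "- (Lk (ed b s) (Lk (ed a t) (w (s, t))) - Lk (ed b s) (Lk (ed a t) c)) \<in> Bd ?adj (V - {a, b, s, t}) j"
          using w(2)[OF iI] by (intro adgrp_neg[OF adgrp_Bd]) simp
        ultimately show "Lk (ed b s) (Lk (ed a t) (c - g)) \<in> Bd ?adj (V - {a, b, s, t}) (k - 1)" using 3(3) by simp
      next
        fix t y assume t: "t \<in> V" "t \<noteq> b" "bip R a t" and y: "y \<in> Cy ?adj (V - {a, t, b}) k"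
        have tR: "t \<notin> R" using t a by (simp add: bip_def)
        have "card ((V - {a, t, b}) \<inter> R) = card (V \<inter> R) - 1" "card ((V - {a, t, b}) - R) = card (V - R) - 2"
          using rows_Diff[of V "{a, t, b}" R] t tR a b Suc.prems(1) by (auto simp: insert_Diff_if)
        then have "Cy ?adj (V - {a, t, b}) k \<subseteq> core_span R (V - {a, t, b}) k"
          using 3 Suc.prems by (intro Suc.IH) auto
        then have "y \<in> core_span R (V - {a, t, b}) k" using y by blast
        then show "Z a t b y \<in> core_span R V (Suc k)" by (rule Z_core_span) (use t tR a b in \<open>auto simp: bip_def\<close>)
      next
        fix s y assume s: "s \<in> V" "s \<noteq> a" "bip R b s" and y: "y \<in> Cy ?adj (V - {b, s, a}) k"
        have sR: "s \<in> R" using s b by (simp add: bip_def)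
        have "card ((V - {b, s, a}) \<inter> R) = card (V \<inter> R) - 2" "card ((V - {b, s, a}) - R) = card (V - R) - 1"
          using rows_Diff[of V "{b, s, a}" R] s sR a b Suc.prems(1) by (auto simp: insert_Diff_if)
        then have "Cy ?adj (V - {b, s, a}) k \<subseteq> core_span R (V - {b, s, a}) k"
          using 3 Suc.prems by (intro Suc.IH) auto
        then have "y \<in> core_span R (V - {b, s, a}) k" using y by blast
        then show "Z b s a y \<in> core_span R V (Suc k)" by (rule Z_core_span) (use s sR a b in \<open>auto simp: bip_def\<close>)
      qed
      from adgrp_add[OF adgrp_core_span this g] show "c \<in> core_span R V (Suc k)" by simp
    qed
  qed
qed

text \<open>
  Every generator contains at least three triples of each kind besides the exceptional factor,
  so \<open>bip_nine\<close> applies to it. For nonvanishing, a product of a hexagon with triples has a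
  triple product on all the remaining vertices as the link of \<open>sb\<close>; taking links anticommutes
  with the boundary operator, and this triple product does not bound.
\<close>

lemma bip_exponent_nine_core:
  assumes V: "finite V" "card (V \<inter> R) = x + 2*y + 1" "card (V - R) = 2*x + y + 1" and k: "k = x + y + 1" and xy: "4 \<le> x" "4 \<le> y"
  shows "(\<exists>P\<in>Cy (bip R) V k. P \<notin> Bd (bip R) V k) \<and> (\<forall>c\<in>Cy (bip R) V k. frag_cmul 9 c \<in> Bd (bip R) V k)"
proof
  have "k \<le> card (V \<inter> R)" "k \<le> card (V - R)" "card (V \<inter> R) + card (V - R) + 1 = 3 * k" using V k by simp_all
  note gen = bip_core_span[OF V(1) this]
  show "\<forall>c\<in>Cy (bip R) V k. frag_cmul 9 c \<in> Bd (bip R) V k"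
  proof
    fix c assume "c \<in> Cy (bip R) V k"
    then have "c \<in> core_span R V k" using gen by blast
    then show "frag_cmul 9 c \<in> Bd (bip R) V k"
    proof (rule core_span_map[OF _ fadd_const_cmul[OF fadd_id] adgrp_Bd])
      fix w V0 j L assume a: "core R V0 j" "V0 \<subseteq> V" "w \<in> Cy (bip R) V0 j" "valid (bip R) L" "Tv L \<subseteq> V - V0" "j + length L = k"
      have fV: "finite (V - V0)" using V(1) by simp
      note cf = card_free(3,4)[OF fV a(4,5)]
      note rd = rows_Diff[OF V(1) a(2), of R]
      have c: "(card (V0 \<inter> R) = 2 \<and> card (V0 - R) = 3 \<and> j = 2) \<or> (card (V0 \<inter> R) = 3 \<and> card (V0 - R) = 2 \<and> j = 2) \<or> (card (V0 \<inter> R) = 4 \<and> card (V0 - R) = 4 \<and> j = 3)"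
        using a(1) by (auto simp: core_def)
      have n: "3 \<le> n_row R L" "3 \<le> n_col R L"
        using c cf rd V(2,3) a(6) k xy n_row_n_col[of R L] by linarith+
      have "frag_cmul 9 (PT L) \<in> Bd (bip R) (Tv L) (length L)" by (rule bip_nine[OF a(4) n])
      then have "frag_cmul 9 (PT L) \<in> Bd (bip R) (V - V0) (length L)" using a(5) by (rule Bd_mono)
      then have "mul w (frag_cmul 9 (PT L)) \<in> Bd (bip R) V (j + length L)"
        by (rule bip.mul_Bd2[OF a(3)]) (use a(2) in auto)
      then show "frag_cmul 9 (mul w (PT L)) \<in> Bd (bip R) V k" using a(6) by (simp add: mul_lin2)
    qed (rule Bd_cl(6))
  qed
  obtain s b where s: "s \<in> V" "s \<in> R" and b: "b \<in> V" "b \<notin> R"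
  proof -
    have "V - R \<noteq> {}" "V \<inter> R \<noteq> {}" using V by (intro notI; simp)+
    then show thesis using that by blast
  qed
  let ?V = "V - {s, b}"
  have cV: "card (?V \<inter> R) = x + 2*y" "card (?V - R) = 2*x + y"
    using rows_Diff[of V "{s, b}" R] s b V by (auto simp: insert_Diff_if)
  obtain L where L: "valid (bip R) L" "length L = x + y" "Tv L \<subseteq> ?V"
    using bip_list_exists[of ?V x y R] cV V by auto
  have fV: "finite ?V" using V(1) by simp
  have "0 < n_row R L" using card_free(3,4)[OF fV L(1,3)] cV n_row_n_col[of R L] L(2) xy by linarith
  then have "\<exists>t\<in>set L. row_apex R t" by (auto simp: n_row_def filter_empty_conv)
  then obtain a t u where atu: "(a, t, u) \<in> set L" "a \<in> R" by auto
  then obtain A B where Leq: "L = A @ (a, t, u) # B" by (meson split_list)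
  have m: "mset L = mset ((a, t, u) # A @ B)" by (simp add: Leq)
  have v: "valid (bip R) ((a, t, u) # A @ B)" by (rule bip.valid_perm[OF m L(1)])
  have tv: "Tv L = {a, t, u} \<union> Tv (A @ B)" using Tv_perm[OF m] by simp
  have tu: "a \<in> V" "t \<in> V" "u \<in> V" "t \<notin> R" "u \<notin> R" "t \<noteq> u" "t \<noteq> b" "u \<noteq> b" "a \<noteq> s"
    using v L(3) atu(2) unfolding tv by (auto simp: bip_def)
  have AB: "Tv (A @ B) \<subseteq> V - {s, a, b, t, u}" using v L(3) unfolding tv by auto
  let ?P = "PT (A @ B)"
  have len: "length (A @ B) + 2 = k" using L(2) k by (simp add: Leq)
  have P: "?P \<in> Cy (bip R) (V - {s, a, b, t, u}) (length (A @ B))" by (rule bip.PT_Cy) (use v AB in auto)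
  have d: "distinct [s, a, b, t, u]" using tu s b atu(2) by auto
  have h: "hex s a b t u ?P \<in> Cy (bip R) V (Suc (Suc (length (A @ B))))"
    by (rule bip.hex_Cy[OF P]) (use d s b tu atu(2) in \<open>auto simp: bip_def\<close>)
  have lk: "Lk (ed s b) (hex s a b t u ?P) = PT ((a, t, u) # A @ B)"
    using bip.hex_Lk[OF _ d, of ?P R V "length (A @ B)"] P by (simp add: Cy_def)
  have "hex s a b t u ?P \<notin> Bd (bip R) V k"
  proof
    assume "hex s a b t u ?P \<in> Bd (bip R) V k"
    then obtain e where e: "e \<in> Ch (bip R) V (Suc k)" "hex s a b t u ?P = bd e" by (auto simp: Bd_def)
    have "PT ((a, t, u) # A @ B) = bd (- Lk (ed s b) e)" using lk e(2) by (simp add: bd_lin bd_Lk)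
    moreover have "- Lk (ed s b) e \<in> Ch (bip R) ?V k" using bip.Lk_Ch[OF e(1), of s b] by (rule Ch_cl(3))
    moreover have "k = Suc (x + y)" using k by simp
    ultimately have 1: "PT ((a, t, u) # A @ B) \<in> Bd (bip R) ?V (x + y)" using bip.bd_Ch_Bd by metis
    have 2: "length ((a, t, u) # A @ B) = x + y" using L(2) by (simp add: Leq)
    have 3: "Tv ((a, t, u) # A @ B) \<subseteq> ?V" using L(3) unfolding Tv_perm[OF m] .
    have 4: "card ?V \<le> 3 * (x + y) + 1" using cV card_Int_Diff[OF fV, of R] by simp
    show False using bip_PT_not_Bd[OF v 2 fV 3 4] 1 by contradiction
  qed
  moreover have "hex s a b t u ?P \<in> Cy (bip R) V k" using h len by (simp add: len[symmetric])
  ultimately show "\<exists>P\<in>Cy (bip R) V k. P \<notin> Bd (bip R) V k" by blast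
qed

section \<open>Chessboard complexes as matching complexes\<close>

abbreviation lexr :: "((nat \<times> nat) \<times> (nat \<times> nat)) set" where "lexr \<equiv> less_than <*lex*> less_than"

lemma lexr_less: "lexr = {(x, y). x < y}"
  by (auto simp: less_prod_def')

lemma boundary_bd: "simplicial_boundary lexr = bd"
  unfolding bd_def lexr_less ..

text \<open>
  The rows \<open>1, \<dots>, m\<close> keep their names and the column \<open>j\<close> becomes the vertex \<open>m + j\<close>. This
  preserves the lexicographic order of the edges, so no signs appear.
\<close>

definition shift :: "nat \<Rightarrow> nat \<times> nat \<Rightarrow> nat \<times> nat" where "shift m = (\<lambda>(i, j). (i, m + j))"
definition unshift :: "nat \<Rightarrow> nat \<times> nat \<Rightarrow> nat \<times> nat" where "unshift m = (\<lambda>(i, j). (i, j - m))"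

lemma shift_less [simp]: "shift m e < shift m f \<longleftrightarrow> e < f"
  by (cases e; cases f) (auto simp: shift_def)
lemma inj_shift: "inj (shift m)" by (auto simp: inj_def shift_def)
lemma unshift_shift [simp]: "unshift m (shift m e) = e" by (cases e) (simp add: shift_def unshift_def)

definition push :: "nat \<Rightarrow> (nat \<times> nat) chain \<Rightarrow> (nat \<times> nat) chain" where
  "push m = frag_extend (\<lambda>\<sigma>. frag_of (shift m ` \<sigma>))"
definition pull :: "nat \<Rightarrow> (nat \<times> nat) chain \<Rightarrow> (nat \<times> nat) chain" where
  "pull m = frag_extend (\<lambda>\<sigma>. frag_of (unshift m ` \<sigma>))"

lemma fadd_push: "fadd (push m)" and fadd_pull: "fadd (pull m)"
  unfolding push_def pull_def by (rule fadd_frag_extend)+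
lemma push_of [simp]: "push m (frag_of \<sigma>) = frag_of (shift m ` \<sigma>)" by (simp add: push_def)
lemma pull_of [simp]: "pull m (frag_of \<sigma>) = frag_of (unshift m ` \<sigma>)" by (simp add: pull_def)

lemma pull_push [simp]: "pull m (push m c) = c"
proof (rule fadd_eqI[of "\<lambda>c. pull m (push m c)" "\<lambda>c. c" c UNIV])
  show "fadd (\<lambda>c. pull m (push m c))" by (simp add: additive_def additive.add[OF fadd_push] additive.add[OF fadd_pull])
qed (auto simp: fadd_id image_image)

lemma bd_push: "bd (push m c) = push m (bd c)"
proof (rule fadd_eqI[of "\<lambda>c. bd (push m c)" "\<lambda>c. push m (bd c)" c UNIV])
  show "fadd (\<lambda>c. bd (push m c))" by (simp add: additive_def additive.add[OF fadd_push] additive.add[OF fadd_bd])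
  show "fadd (\<lambda>c. push m (bd c))" by (simp add: additive_def additive.add[OF fadd_push] additive.add[OF fadd_bd])
  fix \<sigma> :: "(nat \<times> nat) set"
  have inj: "inj_on (shift m) \<sigma>" using inj_shift inj_on_subset by blast
  show "bd (push m (frag_of \<sigma>)) = push m (bd (frag_of \<sigma>))"
  proof (cases "finite \<sigma>")
    case True
    have "Lk (shift m e) (frag_of (shift m ` \<sigma>)) = push m (Lk e (frag_of \<sigma>))" if e: "e \<in> \<sigma>" for e
    proof -
      have "{u \<in> shift m ` \<sigma>. u < shift m e} = shift m ` {u \<in> \<sigma>. u < e}" by auto
      moreover have "inj_on (shift m) {u \<in> \<sigma>. u < e}" using inj_shift inj_on_subset by blast
      ultimately have "sg (shift m e) (shift m ` \<sigma>) = sg e \<sigma>" by (simp add: sg_def card_image)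
      moreover have "shift m ` \<sigma> - {shift m e} = shift m ` (\<sigma> - {e})" using image_set_diff[OF inj_shift[of m], of \<sigma> "{e}"] by simp
      ultimately show ?thesis using True e fadd_cmul[OF fadd_push] by (simp add: Lk_of)
    qed
    then show ?thesis using True
      by (simp add: bd_of[OF _ order_refl] sum.reindex[OF inj] additive.sum[OF fadd_push])
  next
    case False
    then have "infinite (shift m ` \<sigma>)" using inj finite_imageD by blast
    then show ?thesis using False additive.zero[OF fadd_push] by (simp add: bd_inf)
  qed
qed simp

context
  fixes m n :: nat
begin

abbreviation (input) "VV \<equiv> {1..m + n}"
abbreviation (input) "RR \<equiv> {1..m}"
abbreviation (input) "KK \<equiv> chessboard_complex m n"

lemma chess_shift: assumes "\<sigma> \<in> KK" shows "shift m ` \<sigma> \<in> mtch (bip RR) VV"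
proof -
  have s: "\<sigma> \<subseteq> {1..m} \<times> {1..n}" "pairwise disjoint_edges \<sigma>" using assms by (auto simp: chessboard_complex_def)
  have "finite \<sigma>" using s(1) finite_subset by blast
  moreover have "\<exists>u v. shift m e = ed u v \<and> u \<noteq> v \<and> u \<in> VV \<and> v \<in> VV \<and> bip RR u v" if e: "e \<in> \<sigma>" for e
  proof -
    obtain i j where e: "e = (i, j)" "i \<in> {1..m}" "j \<in> {1..n}" using subsetD[OF s(1) e] by (cases e) simp
    show ?thesis using e by (intro exI[of _ i] exI[of _ "m + j"]) (auto simp: shift_def ed_def bip_def)
  qed
  moreover have "vs (shift m e) \<inter> vs (shift m f) = {}" if "e \<in> \<sigma>" "f \<in> \<sigma>" "shift m e \<noteq> shift m f" for e f
  proof -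
    have "disjoint_edges e f" using s(2) that by (auto simp: pairwise_def)
    moreover have "e \<in> {1..m} \<times> {1..n}" "f \<in> {1..m} \<times> {1..n}" using that s(1) by auto
    ultimately show ?thesis by (auto simp: disjoint_edges_def shift_def vs_def)
  qed
  ultimately show ?thesis by (auto simp: mtch_def)
qed

lemma mtch_bip_edge: assumes t: "\<tau> \<in> mtch (bip RR) VV" and "e \<in> \<tau>"
  shows "\<exists>i j. e = (i, m + j) \<and> i \<in> {1..m} \<and> j \<in> {1..n}"
proof -
  have "\<exists>u v. e = ed u v \<and> u \<noteq> v \<and> u \<in> VV \<and> v \<in> VV \<and> bip RR u v" using assms by (simp add: mtch_def)
  then obtain u v where uv: "e = ed u v" "u \<in> VV" "v \<in> VV" "bip RR u v" by blast
  then consider "u \<le> m" "m < v" | "v \<le> m" "m < u" by (auto simp: bip_def)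
  then show ?thesis
  proof cases
    case 1
    then show ?thesis using uv by (intro exI[of _ u] exI[of _ "v - m"]) (auto simp: ed_def)
  next
    case 2
    then show ?thesis using uv by (intro exI[of _ v] exI[of _ "u - m"]) (auto simp: ed_def)
  qed
qed

lemma mtch_shift_unshift: assumes "\<tau> \<in> mtch (bip RR) VV" "e \<in> \<tau>" shows "shift m (unshift m e) = e"
  using mtch_bip_edge[OF assms] by (auto simp: shift_def unshift_def)

lemma mtch_unshift: assumes t: "\<tau> \<in> mtch (bip RR) VV" shows "unshift m ` \<tau> \<in> KK" "shift m ` unshift m ` \<tau> = \<tau>"
proof -
  note e = mtch_bip_edge[OF t] and su = mtch_shift_unshift[OF t]
  show "shift m ` unshift m ` \<tau> = \<tau>" using su by (simp add: image_image)
  have "unshift m ` \<tau> \<subseteq> {1..m} \<times> {1..n}" using e by (force simp: unshift_def)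
  moreover have "disjoint_edges (unshift m e) (unshift m f)" if ef: "e \<in> \<tau>" "f \<in> \<tau>" "unshift m e \<noteq> unshift m f" for e f
  proof -
    obtain i j i' j' where ij: "e = (i, m + j)" "f = (i', m + j')" using e ef by meson
    have "vs e \<inter> vs f = {}" using mtch_disj[OF t ef(1,2)] ef(3) by auto
    then show ?thesis using ij by (auto simp: vs_def disjoint_edges_def unshift_def)
  qed
  ultimately show "unshift m ` \<tau> \<in> KK" unfolding chessboard_complex_def by (auto simp: pairwise_def)
qed

lemma push_Ch: assumes "Poly_Mapping.keys c \<subseteq> faces KK (int k - 1)" shows "push m c \<in> Ch (bip RR) VV k"
  using assms
proof (induction c rule: frag_induction)
  case (one \<sigma>)
  then have "card (shift m ` \<sigma>) = k" using card_image[OF inj_on_subset[OF inj_shift subset_UNIV]] by (simp add: faces_def)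
  then show ?case using chess_shift one by (simp add: faces_def)
qed (use additive.zero[OF fadd_push] additive.diff[OF fadd_push] in \<open>simp_all add: Ch_cl\<close>)

lemma pull_Ch:
  assumes "w \<in> Ch (bip RR) VV k"
  shows "Poly_Mapping.keys (pull m w) \<subseteq> faces KK (int k - 1) \<and> push m (pull m w) = w"
  using assms
proof (induction w rule: Ch_induct)
  case (one \<sigma>)
  have "finite (unshift m ` \<sigma>)" using one by (simp add: mtch_def)
  moreover have "inj_on (unshift m) \<sigma>"
    by (rule inj_on_inverseI[of _ "shift m"]) (rule mtch_shift_unshift[OF one(1)])
  then have "card (unshift m ` \<sigma>) = k" using one by (simp add: card_image)
  ultimately show ?case using mtch_unshift[OF one(1)] by (simp add: faces_def keys_frag_of)
next
  case (diff x y)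
  then show ?case using keys_diff[of "pull m x" "pull m y"]
    by (auto simp: additive.diff[OF fadd_push] additive.diff[OF fadd_pull])
qed (simp add: additive.zero[OF fadd_push] additive.zero[OF fadd_pull])

abbreviation (input) "ZZ k \<equiv> simplicial_cycles lexr KK (int k - 1)"
abbreviation (input) "BB k \<equiv> simplicial_boundaries lexr KK (int k - 1)"

lemma ZZ_iff: "c \<in> ZZ k \<longleftrightarrow> Poly_Mapping.keys c \<subseteq> faces KK (int k - 1) \<and> bd c = 0"
  by (simp add: simplicial_cycles_def kernel_def simplicial_chain_group_def boundary_bd)
lemma BB_eq: "BB k = bd ` {c. Poly_Mapping.keys c \<subseteq> faces KK (int (Suc k) - 1)}"
  by (simp add: simplicial_boundaries_def simplicial_chain_group_def boundary_bd free_Abelian_group_def)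

lemma push_ZZ: "c \<in> ZZ k \<Longrightarrow> push m c \<in> Cy (bip RR) VV k"
  unfolding ZZ_iff Cy_def using push_Ch by (simp add: bd_push additive.zero[OF fadd_push])
lemma pull_Cy: assumes "w \<in> Cy (bip RR) VV k" shows "pull m w \<in> ZZ k" "push m (pull m w) = w"
proof -
  have w: "w \<in> Ch (bip RR) VV k" "bd w = 0" using assms by (auto simp: Cy_def)
  note p = pull_Ch[OF w(1)]
  show "push m (pull m w) = w" using p by simp
  have "push m (bd (pull m w)) = 0" using p w(2) by (simp flip: bd_push)
  then have "bd (pull m w) = 0" using pull_push[of m "bd (pull m w)"] additive.zero[OF fadd_pull] by simp
  then show "pull m w \<in> ZZ k" using p by (simp add: ZZ_iff)
qed

lemma push_BB: assumes "c \<in> ZZ k" shows "push m c \<in> Bd (bip RR) VV k \<longleftrightarrow> c \<in> BB k"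
proof
  assume "c \<in> BB k"
  then obtain e where "Poly_Mapping.keys e \<subseteq> faces KK (int (Suc k) - 1)" "c = bd e" unfolding BB_eq by blast
  then show "push m c \<in> Bd (bip RR) VV k" using push_Ch[of e "Suc k"] unfolding Bd_def by (metis bd_push imageI)
next
  assume "push m c \<in> Bd (bip RR) VV k"
  then obtain w where w: "w \<in> Ch (bip RR) VV (Suc k)" "push m c = bd w" unfolding Bd_def by blast
  note p = pull_Ch[OF w(1)]
  have "push m c = push m (bd (pull m w))" using p w(2) by (simp flip: bd_push)
  then have "c = bd (pull m w)" by (metis pull_push)
  then show "c \<in> BB k" unfolding BB_eq using p by blast
qed

end

section \<open>Reduced homology as cosets of cycles\<close>

locale ordered_complex =
  fixes K :: "'a set set" and r :: "('a \<times> 'a) set" and k :: int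
  assumes K: "abstract_simplicial_complex K" and r: "trans r" "irrefl r" "total r"
begin

abbreviation "Z0 \<equiv> simplicial_cycles r K k"
abbreviation "B0 \<equiv> simplicial_boundaries r K k"
abbreviation "H0 \<equiv> reduced_simplicial_homology r K k"

text \<open>The coset of \<open>z\<close>, written as it occurs in the quotient group.\<close>

definition cl :: "('a set \<Rightarrow>\<^sub>0 int) \<Rightarrow> ('a set \<Rightarrow>\<^sub>0 int) set" where "cl z = (\<lambda>b. b + z) ` B0"

lemma comm_H0: "comm_group H0" by (rule comm_group_reduced_simplicial_homology[OF K r])
lemma group_H0: "group H0" using comm_H0 by (rule comm_group.axioms(2))

lemma bd_lin0: "fadd (simplicial_boundary r)"
  unfolding simplicial_boundary_def by (rule fadd_frag_extend)

lemma adgrp_keys: "adgrp {c :: 'a set \<Rightarrow>\<^sub>0 int. Poly_Mapping.keys c \<subseteq> S}"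
  unfolding adgrp_def using keys_diff by fastforce

lemma adgrp_B0: "adgrp B0"
proof -
  have "B0 = simplicial_boundary r ` {c. Poly_Mapping.keys c \<subseteq> faces K (k + 1)}"
    by (simp add: simplicial_boundaries_def simplicial_chain_group_def free_Abelian_group_def)
  then show ?thesis using adgrp_image[OF bd_lin0 adgrp_keys] by simp
qed
lemma Z0_iff: "c \<in> Z0 \<longleftrightarrow> Poly_Mapping.keys c \<subseteq> faces K k \<and> simplicial_boundary r c = 0"
  by (simp add: simplicial_cycles_def kernel_def simplicial_chain_group_def)
lemma adgrp_Z0: "adgrp Z0"
  using adgrp_keys[of "faces K k"]
  unfolding adgrp_def by (simp add: Z0_iff additive.zero[OF bd_lin0] additive.diff[OF bd_lin0])

lemma Z0_subgroup: "subgroup Z0 (simplicial_chain_group K k)"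
proof -
  have grp: "group (simplicial_chain_group K j)" for j by (simp add: simplicial_chain_group_def)
  have "group_hom (simplicial_chain_group K k) (simplicial_chain_group K (k - 1)) (simplicial_boundary r)"
    using grp simplicial_boundary_hom[OF K] by (simp add: group_hom_def group_hom_axioms_def)
  then show ?thesis unfolding simplicial_cycles_def by (rule group_hom.subgroup_kernel)
qed

lemma H0_carrier: "carrier H0 = cl ` Z0"
proof -
  have "r_coset (subgroup_generated (simplicial_chain_group K k) Z0) B0 z = cl z" for z
    by (auto simp: r_coset_def cl_def simplicial_chain_group_def)
  then show ?thesis
    unfolding reduced_simplicial_homology_def carrier_FactGroup
    using subgroup.carrier_subgroup_generated_subgroup[OF Z0_subgroup] by simp
qed
lemma H0_one: "\<one>\<^bsub>H0\<^esub> = B0" by (simp add: reduced_simplicial_homology_def)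

lemma cl_eq: "cl x = cl y \<longleftrightarrow> x - y \<in> B0"
proof
  assume "cl x = cl y"
  moreover have "x \<in> cl x" using adgrp_zero[OF adgrp_B0] by (auto simp: cl_def image_iff intro: bexI[of _ 0])
  ultimately obtain b where "b \<in> B0" "x = b + y" by (auto simp: cl_def)
  then show "x - y \<in> B0" by simp
next
  have *: "cl x \<subseteq> cl y" if xy: "x - y \<in> B0" for x y
  proof
    fix u assume "u \<in> cl x"
    then obtain b where b: "b \<in> B0" "u = b + x" by (auto simp: cl_def)
    then have "u = (b + (x - y)) + y" by simp
    moreover have "b + (x - y) \<in> B0" using adgrp_add[OF adgrp_B0 b(1) xy] .
    ultimately show "u \<in> cl y" unfolding cl_def by blast
  qed
  assume "x - y \<in> B0"
  then show "cl x = cl y" using *[of x y] *[of y x] adgrp_swap[OF adgrp_B0] by blast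
qed

lemma cl_zero: "cl 0 = B0" by (simp add: cl_def)
lemma cl_one: "cl x = \<one>\<^bsub>H0\<^esub> \<longleftrightarrow> x \<in> B0"
  unfolding H0_one cl_zero[symmetric] cl_eq by simp

lemma cl_mult: "cl x \<otimes>\<^bsub>H0\<^esub> cl y = cl (x + y)"
proof -
  have "cl x \<otimes>\<^bsub>H0\<^esub> cl y = {u + v | u v. u \<in> cl x \<and> v \<in> cl y}"
    by (auto simp: reduced_simplicial_homology_def set_mult_def simplicial_chain_group_def)
  also have "{u + v | u v. u \<in> cl x \<and> v \<in> cl y} = cl (x + y)"
  proof (rule Set.set_eqI, rule iffI)
    fix w assume "w \<in> {u + v | u v. u \<in> cl x \<and> v \<in> cl y}"
    then obtain b b' where b: "b \<in> B0" "b' \<in> B0" "w = (b + x) + (b' + y)" by (auto simp: cl_def)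
    then have "w = (b + b') + (x + y)" by (simp add: algebra_simps)
    then show "w \<in> cl (x + y)" unfolding cl_def using adgrp_add[OF adgrp_B0 b(1,2)] by blast
  next
    fix w assume "w \<in> cl (x + y)"
    then obtain b where b: "b \<in> B0" "w = b + (x + y)" by (auto simp: cl_def)
    then have "w = (b + x) + (0 + y)" by (simp add: algebra_simps)
    moreover have "b + x \<in> cl x" "0 + y \<in> cl y" using b adgrp_zero[OF adgrp_B0] unfolding cl_def by blast+
    ultimately show "w \<in> {u + v | u v. u \<in> cl x \<and> v \<in> cl y}" by blast
  qed
  finally show ?thesis .
qed

lemma cl_pow: "cl x [^]\<^bsub>H0\<^esub> (j::nat) = cl (frag_cmul (int j) x)"
proof (induction j)
  case 0
  then show ?case using cl_one[of 0] adgrp_zero[OF adgrp_B0] by simp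
next
  case (Suc j)
  then show ?case by (simp add: cl_mult frag_cmul_distrib add.commute)
qed

lemma H0_nontrivial: assumes "P \<in> Z0" "P \<notin> B0" shows "\<not> trivial_group H0"
  using assms cl_one[of P] by (auto simp: trivial_group_def H0_carrier)

lemma H0_nine:
  assumes nine: "\<And>c. c \<in> Z0 \<Longrightarrow> frag_cmul 9 c \<in> B0"
  shows "p_group 3 H0" "\<exists>e\<le>9. has_exponent H0 e"
proof -
  have p: "x [^]\<^bsub>H0\<^esub> (9::nat) = \<one>\<^bsub>H0\<^esub>" if x: "x \<in> carrier H0" for x
  proof -
    obtain z where "z \<in> Z0" "x = cl z" using x by (auto simp: H0_carrier)
    then show ?thesis using cl_pow[of z 9] cl_one[of "frag_cmul 9 z"] nine by simp
  qed
  have "\<exists>j. group.ord H0 x = 3 ^ j" if "x \<in> carrier H0" for x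
  proof -
    have "group.ord H0 x dvd 3 ^ 2" using group.pow_eq_id[OF group_H0 that, of 9] p[OF that] by simp
    then show ?thesis using divides_primepow_nat[of 3 "group.ord H0 x" 2] by auto
  qed
  then show "p_group 3 H0" using group_H0 by (simp add: p_group_def)
  let ?E = "\<lambda>e. 0 < e \<and> (\<forall>x\<in>carrier H0. x [^]\<^bsub>H0\<^esub> (e::nat) = \<one>\<^bsub>H0\<^esub>)"
  have 9: "?E 9" using p by simp
  have "?E (LEAST e. ?E e)" using 9 by (rule LeastI)
  moreover have "(LEAST e. ?E e) \<le> d" if "?E d" for d using that by (rule Least_le)
  ultimately show "\<exists>e\<le>9. has_exponent H0 e" using 9 unfolding has_exponent_def by blast
qed

text \<open>
  The powers of the class of \<open>P\<close> give the isomorphism; \<open>2 P\<close> does not bound since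
  \<open>P = 3 P - 2 P\<close> does not.
\<close>

lemma H0_three:
  assumes P: "P \<in> Z0" "P \<notin> B0" "frag_cmul 3 P \<in> B0" and gen: "\<And>c. c \<in> Z0 \<Longrightarrow> \<exists>n. c - frag_cmul n P \<in> B0"
  shows "H0 \<cong> integer_mod_group 3"
proof -
  let ?G = "integer_mod_group 3"
  define h where "h i = cl (frag_cmul i P)" for i
  have red: "h (i mod 3) = h i" for i
  proof -
    have "i mod 3 - i = - (i div 3) * 3" using div_mult_mod_eq[of i 3] by linarith
    then have "frag_cmul (i mod 3) P - frag_cmul i P = frag_cmul (- (i div 3)) (frag_cmul 3 P)"
      by (simp flip: frag_cmul_diff_distrib)
    moreover have "frag_cmul (- (i div 3)) (frag_cmul 3 P) \<in> B0" using P(3) by (rule adgrp_cmul[OF adgrp_B0])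
    ultimately show ?thesis unfolding h_def cl_eq by simp
  qed
  have hom: "h \<in> hom ?G H0"
  proof (rule homI)
    fix i show "h i \<in> carrier H0" unfolding h_def H0_carrier using adgrp_cmul[OF adgrp_Z0 P(1)] by blast
  next
    fix i j show "h (i \<otimes>\<^bsub>?G\<^esub> j) = h i \<otimes>\<^bsub>H0\<^esub> h j"
      using red[of "i + j"] by (simp add: h_def cl_mult frag_cmul_distrib)
  qed
  have two: "frag_cmul 2 P \<notin> B0"
  proof
    assume "frag_cmul 2 P \<in> B0"
    from adgrp_diff[OF adgrp_B0 P(3) this] have "P \<in> B0" by (simp flip: frag_cmul_diff_distrib)
    then show False using P(2) by simp
  qed
  have small: "i = j" if "i \<in> {0..<3}" "j \<in> {0..<3}" "h i = h j" for i j :: int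
  proof (rule ccontr)
    assume "i \<noteq> j"
    have B: "frag_cmul (i - j) P \<in> B0" using that(3) unfolding h_def cl_eq by (simp add: frag_cmul_diff_distrib)
    then have B': "frag_cmul (j - i) P \<in> B0" using adgrp_neg[OF adgrp_B0 B] by (simp add: frag_cmul_diff_distrib)
    have "i - j = 1 \<or> i - j = 2 \<or> j - i = 1 \<or> j - i = 2" using that(1,2) \<open>i \<noteq> j\<close> by auto
    then show False
    proof (elim disjE)
      assume "i - j = 1" then show False using B P(2) by (simp only: frag_cmul_one)
    next
      assume "i - j = 2" then show False using B two by (simp only:)
    next
      assume "j - i = 1" then show False using B' P(2) by (simp only: frag_cmul_one)
    next
      assume "j - i = 2" then show False using B' two by (simp only:)
    qed
  qed
  have "bij_betw h (carrier ?G) (carrier H0)"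
    unfolding bij_betw_def
  proof
    have G: "carrier ?G = {0..<3}" by (simp add: carrier_integer_mod_group)
    show "inj_on h (carrier ?G)" unfolding G by (rule inj_onI) (rule small)
    show "h ` carrier ?G = carrier H0"
    proof
      show "h ` carrier ?G \<subseteq> carrier H0" using hom by (auto simp: hom_def)
      show "carrier H0 \<subseteq> h ` carrier ?G"
      proof
        fix x assume "x \<in> carrier H0"
        then obtain z where z: "z \<in> Z0" "x = cl z" by (auto simp: H0_carrier)
        obtain n where "z - frag_cmul n P \<in> B0" using gen[OF z(1)] by blast
        then have "x = h n" unfolding z(2) h_def cl_eq .
        then have "x = h (n mod 3)" using red[of n] by simp
        moreover have "n mod 3 \<in> carrier ?G" by (simp add: carrier_integer_mod_group)
        ultimately show "x \<in> h ` carrier ?G" by blast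
      qed
    qed
  qed
  then have "h \<in> iso ?G H0" using hom by (simp add: iso_def)
  then have "?G \<cong> H0" by (auto simp: is_iso_def)
  then show ?thesis by (rule group.iso_sym[OF group_integer_mod_group])
qed

end

section \<open>Homology of chessboard complexes\<close>

interpretation chess: ordered_complex "chessboard_complex m n" lexr k for m n k
  by unfold_locales (auto simp: chessboard_complex irrefl_def total_on_def intro!: transI)

lemma chess_parts:
  fixes m n :: nat
  shows "finite {1..m + n}" "card ({1..m + n} \<inter> {1..m}) = m" "card ({1..m + n} - {1..m}) = n"
proof -
  have "{1..m + n} \<inter> {1..m} = {1..m}" "{1..m + n} - {1..m} = {m + 1..m + n}" by auto
  then show "card ({1..m + n} \<inter> {1..m}) = m" "card ({1..m + n} - {1..m}) = n" by simp_all
qed simp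

lemma push_cmul: "push m (frag_cmul j c) = frag_cmul j (push m c)" by (rule fadd_cmul[OF fadd_push])

lemma chess_nine:
  assumes "(\<exists>P\<in>Cy (bip {1..m}) {1..m + n} k. P \<notin> Bd (bip {1..m}) {1..m + n} k) \<and>
     (\<forall>c\<in>Cy (bip {1..m}) {1..m + n} k. frag_cmul 9 c \<in> Bd (bip {1..m}) {1..m + n} k)"
  shows "\<not> trivial_group (chessboard_homology m n (int k - 1)) \<and> p_group 3 (chessboard_homology m n (int k - 1)) \<and>
     (\<exists>e\<le>9. has_exponent (chessboard_homology m n (int k - 1)) e)"
proof -
  obtain P where P: "P \<in> Cy (bip {1..m}) {1..m + n} k" "P \<notin> Bd (bip {1..m}) {1..m + n} k" using assms by blast
  note p = pull_Cy[OF P(1)]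
  have "pull m P \<notin> simplicial_boundaries lexr (chessboard_complex m n) (int k - 1)"
    using push_BB[OF p(1)] p(2) P(2) by simp
  note 1 = chess.H0_nontrivial[OF p(1) this]
  have nine: "frag_cmul 9 c \<in> simplicial_boundaries lexr (chessboard_complex m n) (int k - 1)"
    if c: "c \<in> simplicial_cycles lexr (chessboard_complex m n) (int k - 1)" for c
  proof -
    have "push m (frag_cmul 9 c) \<in> Bd (bip {1..m}) {1..m + n} k" using assms push_ZZ[OF c] by (simp add: push_cmul)
    then show ?thesis using push_BB[OF adgrp_cmul[OF chess.adgrp_Z0 c]] by simp
  qed
  show ?thesis unfolding chessboard_homology_def using 1 chess.H0_nine[OF nine] by blast
qed

theorem theorem1p7:
  fixes m n :: nat
  assumes "1 \<le> m" and "m \<le> n"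
  shows "((m + n) mod 3 = 1 \<and> int n \<le> 2 * int m - 5 \<longrightarrow>
           chessboard_homology m n (nu m n) \<cong> integer_mod_group 3) \<and>
         ((m + n) mod 3 = 0 \<and> int n \<le> 2 * int m - 9 \<longrightarrow>
           \<not> trivial_group (chessboard_homology m n (nu m n)) \<and>
           p_group 3 (chessboard_homology m n (nu m n)) \<and>
           (\<exists>e\<le>9. has_exponent (chessboard_homology m n (nu m n)) e)) \<and>
         ((m + n) mod 3 = 2 \<and> int n \<le> 2 * int m - 13 \<longrightarrow>
           \<not> trivial_group (chessboard_homology m n (nu m n)) \<and>
           p_group 3 (chessboard_homology m n (nu m n)) \<and>
           (\<exists>e\<le>9. has_exponent (chessboard_homology m n (nu m n)) e))"
proof (intro conjI impI)
  let ?A = "bip {1..m}" let ?V = "{1..m + n}"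
  note V = chess_parts[of m n]
  define q where "q = (m + n) div 3"
  {
    assume a: "(m + n) mod 3 = 1 \<and> int n \<le> 2 * int m - 5"
    have mn: "m + n = 3 * q + 1" using a unfolding q_def by presburger
    \<comment> \<open>The numbers of triples with apex in a row and in a column when the one free vertex is a
         row; in all, \<open>m = x + 2 * y + 1\<close> and \<open>n = 2 * x + y\<close>.\<close>
    define x where "x = 2 * q + 1 - m" define y where "y = m - 1 - q"
    have "q + 2 \<le> m" using a mn by linarith
    moreover have "2 * m \<le> 3 * q + 1" using assms(2) mn by linarith
    ultimately have xy: "m = x + 2*y + 1" "n = 2*x + y" "q = x + y" "2 \<le> x" "1 \<le> y"
      using mn unfolding x_def y_def by linarith+
    have nu: "nu m n = int q - 1"
    proof -
      have "(int m + int n + 1) div 3 = int q" using mn by linarith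
      then show ?thesis unfolding nu_def using xy by simp
    qed
    obtain P where P: "P \<in> Cy ?A ?V q" "P \<notin> Bd ?A ?V q" "frag_cmul 3 P \<in> Bd ?A ?V q"
      "\<And>c. c \<in> Cy ?A ?V q \<Longrightarrow> \<exists>j. c - frag_cmul j P \<in> Bd ?A ?V q"
      using bip_homology_Z3[of ?V "{1..m}" x y q] V xy by (metis (no_types, lifting))
    note p = pull_Cy[OF P(1)]
    show "chessboard_homology m n (nu m n) \<cong> integer_mod_group 3"
      unfolding nu chessboard_homology_def
    proof (rule chess.H0_three[OF p(1)])
      show "pull m P \<notin> simplicial_boundaries lexr (chessboard_complex m n) (int q - 1)"
        using push_BB[OF p(1)] p(2) P(2) by simp
      show "frag_cmul 3 (pull m P) \<in> simplicial_boundaries lexr (chessboard_complex m n) (int q - 1)"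
        using push_BB[OF adgrp_cmul[OF chess.adgrp_Z0 p(1), of 3]] p(2) P(3) by (simp add: push_cmul)
      fix c assume c: "c \<in> simplicial_cycles lexr (chessboard_complex m n) (int q - 1)"
      obtain j where j: "push m c - frag_cmul j P \<in> Bd ?A ?V q" using P(4)[OF push_ZZ[OF c]] by blast
      have "push m (c - frag_cmul j (pull m P)) = push m c - frag_cmul j P"
        using p(2) by (simp add: additive.diff[OF fadd_push] push_cmul)
      then show "\<exists>j. c - frag_cmul j (pull m P) \<in> simplicial_boundaries lexr (chessboard_complex m n) (int q - 1)"
        using push_BB[OF adgrp_diff[OF chess.adgrp_Z0 c adgrp_cmul[OF chess.adgrp_Z0 p(1), of j]]] j by auto
    qed
  }
  {
    assume a: "(m + n) mod 3 = 0 \<and> int n \<le> 2 * int m - 9"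
    have mn: "m + n = 3 * q" using a unfolding q_def by presburger
    \<comment> \<open>All vertices are used: \<open>m = x + 2 * y\<close> and \<open>n = 2 * x + y\<close>.\<close>
    define x where "x = 2 * q - m" define y where "y = m - q"
    have "q + 3 \<le> m" using a mn by linarith
    moreover have "2 * m \<le> 3 * q" using assms(2) mn by linarith
    ultimately have xy: "m = x + 2*y" "n = 2*x + y" "q = x + y" "3 \<le> x" "3 \<le> y"
      using mn unfolding x_def y_def by linarith+
    have nu: "nu m n = int q - 1"
    proof -
      have "(int m + int n + 1) div 3 = int q" using mn by linarith
      then show ?thesis unfolding nu_def using xy by simp
    qed
    have "\<not> trivial_group (chessboard_homology m n (nu m n)) \<and> p_group 3 (chessboard_homology m n (nu m n)) \<and>
       (\<exists>e\<le>9. has_exponent (chessboard_homology m n (nu m n)) e)"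
      unfolding nu by (rule chess_nine, rule bip_exponent_nine[of _ _ x y]) (use V xy in simp_all)
    then show "\<not> trivial_group (chessboard_homology m n (nu m n))" "p_group 3 (chessboard_homology m n (nu m n))"
       "\<exists>e\<le>9. has_exponent (chessboard_homology m n (nu m n)) e" by blast+
  }
  {
    assume a: "(m + n) mod 3 = 2 \<and> int n \<le> 2 * int m - 13"
    have mn: "m + n = 3 * q + 2" using a unfolding q_def by presburger
    \<comment> \<open>A row and a column exceed what \<open>q\<close> triples use, but the matchings have \<open>q + 1\<close> edges.\<close>
    define x where "x = 2 * q + 1 - m" define y where "y = m - 1 - q"
    have "q + 5 \<le> m" using a mn by linarith
    moreover have "2 * m \<le> 3 * q + 2" using assms(2) mn by linarith
    ultimately have xy: "m = x + 2*y + 1" "n = 2*x + y + 1" "q = x + y" "4 \<le> x" "4 \<le> y"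
      using mn unfolding x_def y_def by linarith+
    have nu: "nu m n = int (q + 1) - 1"
    proof -
      have "(int m + int n + 1) div 3 = int q + 1" using mn by linarith
      then show ?thesis unfolding nu_def using xy by simp
    qed
    have "\<not> trivial_group (chessboard_homology m n (nu m n)) \<and> p_group 3 (chessboard_homology m n (nu m n)) \<and>
       (\<exists>e\<le>9. has_exponent (chessboard_homology m n (nu m n)) e)"
      unfolding nu by (rule chess_nine, rule bip_exponent_nine_core[of _ _ x y]) (use V xy in simp_all)
    then show "\<not> trivial_group (chessboard_homology m n (nu m n))" "p_group 3 (chessboard_homology m n (nu m n))"
       "\<exists>e\<le>9. has_exponent (chessboard_homology m n (nu m n)) e" by blast+
  }
qed

end
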